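(* Let $n>1$ be an even integer and $q>0$ an odd integer. Let $(\mathbb{R}^n,\|\cdot\|)$ be a normed (quasi-normed) space such that $\Delta^{(n+q-1)/2}\|x\|^q$ (in the sense of distributions) is a function in $\mathbb{R}^n\setminus\{0\}$ with $(\Delta^{(n+q-1)/2}\|x\|^q)|_\Omega\in L_1(\Omega)$. Then: (i) $(\mathbb{R}^n,\|\cdot\|)$ is isometric to a subspace of $L_q$ if and only if $$\xi\mapsto\frac{(-1)^{(n+q-1)/2}}{C_q}\int_{\Omega\cap\{(\theta,\xi)=0\}}\big(\Delta^{(n+q-1)/2}\|\cdot\|^q\big)(\theta)\,d\theta$$ is a non-negative function on $\Omega$. (ii) The related sufficient condition: if the function $\frac{(-1)^{(n+q-1)/2}}{C_q}\,\Delta^{(n+q-1)/2}\|x\|^q$ is a non-negative $L_1$-function on $\Omega$, then $(\mathbb{R}^n,\|\cdot\|)$ is isometric to a subspace of $L_q$.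
   Context: The functional $\|\cdot\|$ is a norm or a quasi-norm on $\mathbb{R}^n$ which is a continuous, non-negative, even homogeneous function of degree $1$ (i.e. $\|\alpha x\|=|\alpha|\,\|x\|$ for real $\alpha$); the triangle inequality is not required. $\Delta$ is the Laplace operator. $\Omega$ is the Euclidean unit sphere in $\mathbb{R}^n$; $(\theta,\xi)$ is the standard scalar product; the integral over $\Omega\cap\{(\theta,\xi)=0\}$ is with respect to the $(n-2)$-dimensional surface measure on this great subsphere (counting measure on two points if $n=2$). $L_q=L_q([0,1])$, and "isometric to a subspace of $L_q$" means that there is a linear map $T:\mathbb{R}^n\to L_q$ with $\|Tx\|_{L_q}=\|x\|$ for all $x$. For $q>-1$ not an even integer, $$C_q=\frac{2^{q+1}\sqrt{\pi}\,\Gamma((q+1)/2)}{\Gamma(-q/2)}.$$ *)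

theory Defs
  imports "HOL-Analysis.Analysis"
begin

text \<open>In finite dimension a continuous, definite, absolutely homogeneous function satisfies
  the quasi-triangle inequality \<open>N (x + y) \<le> K * (N x + N y)\<close> for some \<open>K\<close>, by compactness of the
  unit sphere, so it is not listed.\<close>

definition continuous_quasi_norm :: "(real^'n \<Rightarrow> real) \<Rightarrow> bool" where
  "continuous_quasi_norm N \<longleftrightarrow>
     continuous_on UNIV N \<and>
     (\<forall>x. 0 \<le> N x) \<and>
     (\<forall>x. N x = 0 \<longleftrightarrow> x = 0) \<and>
     (\<forall>c x. N (c *\<^sub>R x) = \<bar>c\<bar> * N x)"

text \<open>The space \<open>L\<^sub>q([0,1])\<close>. Its elements are given by representatives; a linear map into the
  quotient by almost everywhere equality is then a choice of representatives that is linear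
  almost everywhere.\<close>

definition Lq_functions :: "real \<Rightarrow> (real \<Rightarrow> real) set" where
  "Lq_functions q = {f \<in> borel_measurable (lebesgue_on {0..1}).
     integrable (lebesgue_on {0..1}) (\<lambda>t. \<bar>f t\<bar> powr q)}"

definition Lq_norm :: "real \<Rightarrow> (real \<Rightarrow> real) \<Rightarrow> real" where
  "Lq_norm q f = (\<integral>t. \<bar>f t\<bar> powr q \<partial>lebesgue_on {0..1}) powr (1 / q)"

definition isometric_to_subspace_of_Lq :: "real \<Rightarrow> (real^'n \<Rightarrow> real) \<Rightarrow> bool" where
  "isometric_to_subspace_of_Lq q N \<longleftrightarrow>
     (\<exists>T :: real^'n \<Rightarrow> real \<Rightarrow> real.
        (\<forall>x. T x \<in> Lq_functions q) \<and>
        (\<forall>x y. AE t in lebesgue_on {0..1}. T (x + y) t = T x t + T y t) \<and>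
        (\<forall>c x. AE t in lebesgue_on {0..1}. T (c *\<^sub>R x) t = c * T x t) \<and>
        (\<forall>x. Lq_norm q (T x) = N x))"

definition partial_deriv :: "'n \<Rightarrow> (real^'n \<Rightarrow> real) \<Rightarrow> real^'n \<Rightarrow> real" where
  "partial_deriv i f x = frechet_derivative f (at x) (axis i 1)"

primrec C_k :: "nat \<Rightarrow> (real^'n \<Rightarrow> real) \<Rightarrow> bool" where
  "C_k 0 f \<longleftrightarrow> continuous_on UNIV f"
| "C_k (Suc k) f \<longleftrightarrow> (\<forall>x. f differentiable (at x)) \<and> (\<forall>i. C_k k (partial_deriv i f))"

definition laplacian :: "(real^'n \<Rightarrow> real) \<Rightarrow> real^'n \<Rightarrow> real" where
  "laplacian f x = (\<Sum>i\<in>UNIV. partial_deriv i (partial_deriv i f) x)"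

definition test_functions :: "(real^'n) set \<Rightarrow> (real^'n \<Rightarrow> real) set" where
  "test_functions S = {\<phi>. (\<forall>k. C_k k \<phi>) \<and>
     compact (closure {x. \<phi> x \<noteq> 0}) \<and> closure {x. \<phi> x \<noteq> 0} \<subseteq> S}"

text \<open>Only the values on test functions are meaningful.\<close>

type_synonym 'n distribution = "(real^'n \<Rightarrow> real) \<Rightarrow> real"

definition regular_distribution :: "(real^'n \<Rightarrow> real) \<Rightarrow> 'n distribution" where
  "regular_distribution u \<phi> = (\<integral>x. u x * \<phi> x \<partial>lebesgue)"

definition distr_laplacian :: "'n::finite distribution \<Rightarrow> 'n distribution" where
  "distr_laplacian F \<phi> = F (laplacian \<phi>)"

definition locally_integrable_on :: "(real^'n \<Rightarrow> real) \<Rightarrow> (real^'n) set \<Rightarrow> bool" where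
  "locally_integrable_on g S \<longleftrightarrow>
     (\<forall>K. compact K \<and> K \<subseteq> S \<longrightarrow> g absolutely_integrable_on K)"

definition is_function_on :: "'n::finite distribution \<Rightarrow> (real^'n) set \<Rightarrow> (real^'n \<Rightarrow> real) \<Rightarrow> bool" where
  "is_function_on F S g \<longleftrightarrow>
     locally_integrable_on g S \<and> (\<forall>\<phi>\<in>test_functions S. F \<phi> = regular_distribution g \<phi>)"

text \<open>Surface measure on the unit sphere of a \<open>d\<close>-dimensional subspace with Lebesgue measure \<open>M\<close>,
  normalised as in polar coordinates: the measure of \<open>A\<close> is \<open>d\<close> times the volume of
  \<open>{x. 0 < norm x \<le> 1 \<and> x / norm x \<in> A}\<close>. For \<open>d = 1\<close> it is the counting measure on two points.
  It is a measure on the whole space that is concentrated on the sphere.\<close>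

definition cone_measure :: "nat \<Rightarrow> (real^'n) measure \<Rightarrow> (real^'n) measure" where
  "cone_measure d M = completion (scale_measure (of_nat d)
     (distr (restrict_space M (cball 0 1 - {0})) borel sgn))"

definition sphere_measure :: "(real^'n) measure" where
  "sphere_measure = cone_measure CARD('n) lborel"

text \<open>For a unit vector \<open>\<xi>\<close>, the \<open>(n - 1)\<close>-dimensional Lebesgue measure of a subset of the
  hyperplane orthogonal to \<open>\<xi>\<close> is the \<open>n\<close>-dimensional volume of the right cylinder of height 1
  over it.\<close>

definition hyperplane_measure :: "real^'n \<Rightarrow> (real^'n) measure" where
  "hyperplane_measure \<xi> = distr (restrict_space lborel {x. 0 \<le> x \<bullet> \<xi> \<and> x \<bullet> \<xi> \<le> 1}) borel
     (\<lambda>x. x - (x \<bullet> \<xi>) *\<^sub>R \<xi>)"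

definition great_subsphere_measure :: "real^'n \<Rightarrow> (real^'n) measure" where
  "great_subsphere_measure \<xi> = cone_measure (CARD('n) - 1) (hyperplane_measure \<xi>)"

text \<open>Meant for \<open>q > -1\<close> not an even integer; at even \<open>q \<ge> 0\<close> the denominator is the totalised
  value \<open>0\<close> of \<open>Gamma\<close> at a pole.\<close>

definition C_const :: "real \<Rightarrow> real" where
  "C_const q = 2 powr (q + 1) * sqrt pi * Gamma ((q + 1) / 2) / Gamma (- q / 2)"

end

(* Write S for the sphere, R g for the integral of g over great subspheres, and m for the power of the
   Laplacian, and let g be the function Delta^m N^q.  Testing the hypothesis with a radial function
   times (x . a)^(2k) gives a triangular linear system for the moments of N^q against (x . a)^(2k);
   it is invertible because q is odd and n is even.  The superposition x |-> c * int_S |x . xi|^q R g(xi) dxi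
   satisfies the same system: tested with Hermite polynomials in x . a times a Gaussian, a ridge
   function |x . xi|^q integrates to a one-dimensional expression proportional to (xi . a)^(2k)
   (this is where 2m = n + q - 1 enters), and R is self-adjoint on the sphere, since the measures
   d theta d xi on the incidence set theta . xi = 0 are the limit of thin slabs 0 <= x . y <= eps,
   which are symmetric in x and y.  Even moments determine even functions on S by
   Stone-Weierstrass, so N^q equals the superposition, and the sign of c is that of (-1)^m / C_q.

   If R g has the right sign, the density c * R g is realised as the law of a map from [0,1] to S,
   which gives the embedding.  Conversely an embedding T yields a second representation of N^q by a
   positive measure on S; the even measure in such a representation is unique, again by moments, so c * R g >= 0. *)
theory Submission
  imports Defs "HOL-Probability.Probability" "HOL-Computational_Algebra.Polynomial"
begin

text \<open>The hypothesis on \<open>N ^ q\<close> speaks only of test functions vanishing near the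
  origin, whereas ridge functions are computable against polynomials times a Gaussian, which do not
  vanish there. Homogeneity bridges the gap. For a profile \<open>D\<close> of
  \<open>x \<bullet> x\<close>, polar coordinates split off a scalar
  \<open>rint D 0 (2 * k)\<close>, and the remaining coefficients \<open>kap\<close> do not depend
  on \<open>D\<close>; since 2m = n + q - 1, the side of \<open>g\<close>, homogeneous of degree 1 -
  n, carries the same scalar. It cancels, so an annular bump and the Gaussian produce the same
  equations for the moments. This route avoids the Fourier transform: the constant of the
  representation comes out of Gaussian moments as \<open>ridge_const\<close>, and
  \<open>C_const\<close> is compared with it in sign only. A second obstacle is that
  \<open>g\<close> is known on the sphere only up to null sets, while a single great subsphere is
  itself a null set. The symmetry of the incidence measure therefore serves twice: besides
  self-adjointness it shows that a null set of the sphere is null on almost every great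
  subsphere.\<close>

section \<open>Cone measures, slicing by hyperplanes and polar coordinates\<close>

text \<open>The Borel measure underlying \<open>cone_measure\<close>. Before completion it fits into
  Borel products and Tonelli; the completion is restored only when the theorem is assembled.\<close>

definition cone0 :: "nat \<Rightarrow> (real^'n) measure \<Rightarrow> (real^'n) measure" where
  "cone0 d M = scale_measure (of_nat d) (distr (restrict_space M (cball 0 1 - {0})) borel sgn)"

lemma cone_measure_eq: "cone_measure d M = completion (cone0 d M)"
  by (simp add: cone_measure_def cone0_def)

lemma sets_cone0 [simp, measurable_cong]: "sets (cone0 d M) = sets borel"
  and space_cone0 [simp]: "space (cone0 d M) = UNIV"
  by (simp_all add: cone0_def space_scale_measure)

lemma sets_hyperplane_measure [simp, measurable_cong]: "sets (hyperplane_measure \<xi>) = sets borel"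
  and space_hyperplane_measure [simp]: "space (hyperplane_measure \<xi>) = UNIV"
  by (simp_all add: hyperplane_measure_def)

lemma cball_diff_zero_borel [measurable]:
  "cball a r - {b} \<in> sets (borel :: 'a::euclidean_space measure)"
  by simp

lemma nn_integral_cone0:
  fixes f :: "real^'n \<Rightarrow> ennreal"
  assumes M: "sets M = sets borel" and [measurable]: "f \<in> borel_measurable borel"
  shows "(\<integral>\<^sup>+\<theta>. f \<theta> \<partial>cone0 d M) = of_nat d * (\<integral>\<^sup>+x. f (sgn x) * indicator (cball 0 1 - {0}) x \<partial>M)"
proof -
  note [measurable_cong] = M
  have sp: "space M = UNIV" using M by (metis sets_eq_imp_space_eq space_borel)
  have [measurable]: "sgn \<in> restrict_space M (cball 0 1 - {0::real^'n}) \<rightarrow>\<^sub>M borel"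
    by (intro measurable_restrict_space1) measurable
  show ?thesis
    unfolding cone0_def
    by (simp add: nn_integral_scale_measure nn_integral_distr nn_integral_restrict_space M sp)
qed

lemma nn_integral_hyperplane_measure:
  fixes f :: "real^'n \<Rightarrow> ennreal"
  assumes [measurable]: "f \<in> borel_measurable borel"
  shows "(\<integral>\<^sup>+y. f y \<partial>hyperplane_measure \<xi>)
    = (\<integral>\<^sup>+x. f (x - (x \<bullet> \<xi>) *\<^sub>R \<xi>) * indicator {x. 0 \<le> x \<bullet> \<xi> \<and> x \<bullet> \<xi> \<le> 1} x \<partial>lborel)"
proof -
  have [measurable]: "(\<lambda>x. x - (x \<bullet> \<xi>) *\<^sub>R \<xi>) \<in> restrict_space lborel {x. 0 \<le> x \<bullet> \<xi> \<and> x \<bullet> \<xi> \<le> 1} \<rightarrow>\<^sub>M borel"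
    by (intro measurable_restrict_space1) measurable
  show ?thesis
    unfolding hyperplane_measure_def
    by (simp add: nn_integral_distr nn_integral_restrict_space)
qed

lemma nn_integral_lborel_translate:
  fixes f :: "'a::euclidean_space \<Rightarrow> ennreal"
  assumes [measurable]: "f \<in> borel_measurable borel"
  shows "(\<integral>\<^sup>+x. f (t + x) \<partial>lborel) = (\<integral>\<^sup>+x. f x \<partial>lborel)"
  by (subst lborel_distr_plus[of t, symmetric]) (simp add: nn_integral_distr)

lemma nn_integral_lborel_scale:
  fixes f :: "'a::euclidean_space \<Rightarrow> ennreal"
  assumes [measurable]: "f \<in> borel_measurable borel" and c: "c > 0"
  shows "(\<integral>\<^sup>+x. f x \<partial>lborel) = ennreal (c ^ DIM('a)) * (\<integral>\<^sup>+x. f (c *\<^sub>R x) \<partial>lborel)"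
  using c by (subst lborel_affine[of c 0])
    (simp_all add: nn_integral_density nn_integral_distr nn_integral_cmult)

lemma nn_integral_real_flip:
  assumes [measurable]: "f \<in> borel_measurable borel"
  shows "(\<integral>\<^sup>+s. f (a - s :: real) \<partial>lborel) = (\<integral>\<^sup>+s. f s \<partial>lborel)"
  by (subst nn_integral_real_affine[where c = "-1" and t = a]) (auto simp: )

text \<open>Every line parallel to \<open>\<xi>\<close> meets the slab \<open>{x. 0 \<le> x
  \<bullet> \<xi> \<and> x \<bullet> \<xi> \<le> 1}\<close> in length 1, so that length can be
  inserted as a factor 1. Tonelli and a translation along \<open>\<xi>\<close> then move the
  indicator of the slab from the shifted point to the point itself. This is Fubini for the splitting
  into \<open>\<xi>\<close> and its orthogonal hyperplane, obtained without a basis of the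
  hyperplane.\<close>

lemma nn_slice:
  fixes \<xi> :: "real^'n" and F :: "real^'n \<Rightarrow> ennreal"
  assumes \<xi>: "norm \<xi> = 1" and [measurable]: "F \<in> borel_measurable borel"
  shows "(\<integral>\<^sup>+x. F x \<partial>lborel) = (\<integral>\<^sup>+y. (\<integral>\<^sup>+s. F (y + s *\<^sub>R \<xi>) \<partial>lborel) \<partial>hyperplane_measure \<xi>)"
proof -
  have xx: "\<xi> \<bullet> \<xi> = 1" using \<xi> by (simp add: norm_eq_1)
  let ?S = "{x. 0 \<le> x \<bullet> \<xi> \<and> x \<bullet> \<xi> \<le> 1}"
  have one: "(\<integral>\<^sup>+s. indicator ?S (s *\<^sub>R \<xi> + x) \<partial>lborel) = 1" for x
  proof -
    have "indicator ?S (s *\<^sub>R \<xi> + x) = (indicator {- (x \<bullet> \<xi>) .. 1 - x \<bullet> \<xi>} s :: ennreal)" for s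
      by (auto simp: indicator_def inner_simps xx)
    then have "(\<integral>\<^sup>+s. indicator ?S (s *\<^sub>R \<xi> + x) \<partial>lborel)
      = (\<integral>\<^sup>+s. indicator {- (x \<bullet> \<xi>) .. 1 - x \<bullet> \<xi>} s \<partial>lborel)" by simp
    then show ?thesis by simp
  qed
  have "(\<integral>\<^sup>+x. F x \<partial>lborel) = (\<integral>\<^sup>+x. F x * (\<integral>\<^sup>+s. indicator ?S (s *\<^sub>R \<xi> + x) \<partial>lborel) \<partial>lborel)"
    by (simp only: one mult_1_right)
  also have "\<dots> = (\<integral>\<^sup>+x. (\<integral>\<^sup>+s. F x * indicator ?S (s *\<^sub>R \<xi> + x) \<partial>lborel) \<partial>lborel)"
    by (subst nn_integral_cmult) simp_all
  also have "\<dots> = (\<integral>\<^sup>+s. (\<integral>\<^sup>+x. F x * indicator ?S (s *\<^sub>R \<xi> + x) \<partial>lborel) \<partial>lborel)"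
    by (rule lborel_pair.Fubini') simp
  also have "\<dots> = (\<integral>\<^sup>+s. (\<integral>\<^sup>+x. F (- (s *\<^sub>R \<xi>) + x) * indicator ?S x \<partial>lborel) \<partial>lborel)"
  proof (rule nn_integral_cong)
    fix s :: real
    show "(\<integral>\<^sup>+x. F x * indicator ?S (s *\<^sub>R \<xi> + x) \<partial>lborel) = (\<integral>\<^sup>+x. F (- (s *\<^sub>R \<xi>) + x) * indicator ?S x \<partial>lborel)"
      by (subst nn_integral_lborel_translate[of _ "- (s *\<^sub>R \<xi>)", symmetric]) (simp_all add: algebra_simps)
  qed
  also have "\<dots> = (\<integral>\<^sup>+x. (\<integral>\<^sup>+s. F (- (s *\<^sub>R \<xi>) + x) * indicator ?S x \<partial>lborel) \<partial>lborel)"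
    by (rule lborel_pair.Fubini') simp
  also have "\<dots> = (\<integral>\<^sup>+x. (\<integral>\<^sup>+s. F (- (s *\<^sub>R \<xi>) + x) \<partial>lborel) * indicator ?S x \<partial>lborel)"
    by (subst nn_integral_multc) simp_all
  also have "\<dots> = (\<integral>\<^sup>+x. (\<integral>\<^sup>+s. F ((x - (x \<bullet> \<xi>) *\<^sub>R \<xi>) + s *\<^sub>R \<xi>) \<partial>lborel) * indicator ?S x \<partial>lborel)"
  proof (rule nn_integral_cong)
    fix x
    have "(\<integral>\<^sup>+s. F (- (s *\<^sub>R \<xi>) + x) \<partial>lborel) = (\<integral>\<^sup>+s. F (- ((x \<bullet> \<xi> - s) *\<^sub>R \<xi>) + x) \<partial>lborel)"
      by (subst nn_integral_real_flip[of _ "x \<bullet> \<xi>", symmetric]) simp_all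
    then show "(\<integral>\<^sup>+s. F (- (s *\<^sub>R \<xi>) + x) \<partial>lborel) * indicator ?S x
      = (\<integral>\<^sup>+s. F ((x - (x \<bullet> \<xi>) *\<^sub>R \<xi>) + s *\<^sub>R \<xi>) \<partial>lborel) * indicator ?S x"
      by (simp add: algebra_simps)
  qed
  also have "\<dots> = (\<integral>\<^sup>+y. (\<integral>\<^sup>+s. F (y + s *\<^sub>R \<xi>) \<partial>lborel) \<partial>hyperplane_measure \<xi>)"
    by (subst nn_integral_hyperplane_measure) simp_all
  finally show ?thesis .
qed

text \<open>Scaling the space by c changes the height of the cylinder from 1 to 1/c. A cylinder of
  height a carries a times the hyperplane measure (\<open>cyl\<close>), which lowers the exponent
  from n to n - 1.\<close>

lemma nn_integral_hyperplane_scale: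
  fixes \<xi> :: "real^'n" and F :: "real^'n \<Rightarrow> ennreal"
  assumes \<xi>: "norm \<xi> = 1" and [measurable]: "F \<in> borel_measurable borel" and c: "c > 0"
  shows "(\<integral>\<^sup>+y. F y \<partial>hyperplane_measure \<xi>)
    = ennreal (c ^ (CARD('n) - 1)) * (\<integral>\<^sup>+y. F (c *\<^sub>R y) \<partial>hyperplane_measure \<xi>)"
proof -
  have xx: "\<xi> \<bullet> \<xi> = 1" using \<xi> by (simp add: norm_eq_1)
  have Pp: "(y - (y \<bullet> \<xi>) *\<^sub>R \<xi>) \<bullet> \<xi> = 0" for y by (simp add: inner_simps xx)
  have cyl: "(\<integral>\<^sup>+x. f (x - (x \<bullet> \<xi>) *\<^sub>R \<xi>) * indicator {x. 0 \<le> x \<bullet> \<xi> \<and> x \<bullet> \<xi> \<le> a} x \<partial>lborel)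
     = ennreal a * (\<integral>\<^sup>+y. f y \<partial>hyperplane_measure \<xi>)"
    if [measurable]: "f \<in> borel_measurable borel" and a: "a \<ge> 0" for f and a :: real
  proof -
    have eq: "f (y - (y \<bullet> \<xi>) *\<^sub>R \<xi> + s *\<^sub>R \<xi> - ((y - (y \<bullet> \<xi>) *\<^sub>R \<xi> + s *\<^sub>R \<xi>) \<bullet> \<xi>) *\<^sub>R \<xi>)
        * indicator {x. 0 \<le> x \<bullet> \<xi> \<and> x \<bullet> \<xi> \<le> a} (y - (y \<bullet> \<xi>) *\<^sub>R \<xi> + s *\<^sub>R \<xi>)
      = f (y - (y \<bullet> \<xi>) *\<^sub>R \<xi>) * indicator {0..a} s" for y s
      by (simp only: inner_add_left Pp) (simp add: inner_simps xx indicator_def)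
    show ?thesis
      using a
      by (subst nn_slice[OF \<xi>], simp, subst (1 2) nn_integral_hyperplane_measure, simp, simp)
        (simp only: eq, simp add: nn_integral_cmult nn_integral_multc mult_ac flip: nn_integral_cmult)
  qed
  have *: "F (c *\<^sub>R x - (c *\<^sub>R x \<bullet> \<xi>) *\<^sub>R \<xi>) * indicator {x. 0 \<le> x \<bullet> \<xi> \<and> x \<bullet> \<xi> \<le> 1} (c *\<^sub>R x)
      = F (c *\<^sub>R (x - (x \<bullet> \<xi>) *\<^sub>R \<xi>)) * indicator {x. 0 \<le> x \<bullet> \<xi> \<and> x \<bullet> \<xi> \<le> 1/c} x" for x
    using c by (auto simp: indicator_def algebra_simps zero_le_mult_iff field_simps)
  have "(\<integral>\<^sup>+y. F y \<partial>hyperplane_measure \<xi>)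
     = ennreal (c ^ CARD('n)) * (\<integral>\<^sup>+x. F (c *\<^sub>R (x - (x \<bullet> \<xi>) *\<^sub>R \<xi>)) * indicator {x. 0 \<le> x \<bullet> \<xi> \<and> x \<bullet> \<xi> \<le> 1/c} x \<partial>lborel)"
    by (subst nn_integral_hyperplane_measure, simp, subst nn_integral_lborel_scale[of _ c]) (simp_all only: *, simp_all add: c)
  also have "\<dots> = ennreal (c ^ CARD('n)) * (ennreal (1/c) * (\<integral>\<^sup>+y. F (c *\<^sub>R y) \<partial>hyperplane_measure \<xi>))"
    using c by (subst cyl[where f = "\<lambda>y. F (c *\<^sub>R y)"]) simp_all
  also have "ennreal (c ^ CARD('n)) * (ennreal (1/c) * X) = ennreal (c ^ (CARD('n) - 1)) * X" for X
  proof -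
    have "c ^ CARD('n) = c * c ^ (CARD('n) - 1)"
      by (metis Suc_pred' power_Suc zero_less_card_finite)
    then show ?thesis using c by (simp add: mult.assoc[symmetric] ennreal_mult[symmetric])
  qed
  finally show ?thesis .
qed

lemma emeasure_hyperplane_cball:
  fixes \<xi> :: "real^'n"
  assumes \<xi>: "norm \<xi> = 1"
  shows "emeasure (hyperplane_measure \<xi>) (cball 0 r) \<le> emeasure lborel (cball (0::real^'n) (r + 1))"
    and "emeasure (hyperplane_measure \<xi>) (cball 0 r) < \<infinity>"
proof -
  have "emeasure (hyperplane_measure \<xi>) (cball 0 r) = (\<integral>\<^sup>+y. indicator (cball 0 r) y \<partial>hyperplane_measure \<xi>)"
    by simp
  also have "\<dots> = (\<integral>\<^sup>+x. indicator (cball 0 r) (x - (x \<bullet> \<xi>) *\<^sub>R \<xi>) * indicator {x. 0 \<le> x \<bullet> \<xi> \<and> x \<bullet> \<xi> \<le> 1} x \<partial>lborel)"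
    by (rule nn_integral_hyperplane_measure) (simp add: borel_measurable_indicator)
  also have "\<dots> \<le> (\<integral>\<^sup>+x. indicator (cball 0 (r + 1)) x \<partial>(lborel :: (real^'n) measure))"
  proof (rule nn_integral_mono)
    fix x :: "real^'n"
    have "norm x \<le> norm (x - (x \<bullet> \<xi>) *\<^sub>R \<xi>) + \<bar>x \<bullet> \<xi>\<bar>"
      using norm_triangle_ineq[of "x - (x \<bullet> \<xi>) *\<^sub>R \<xi>" "(x \<bullet> \<xi>) *\<^sub>R \<xi>"] \<xi> by simp
    then show "indicator (cball 0 r) (x - (x \<bullet> \<xi>) *\<^sub>R \<xi>) * indicator {x. 0 \<le> x \<bullet> \<xi> \<and> x \<bullet> \<xi> \<le> 1} x
      \<le> (indicator (cball 0 (r + 1)) x :: ennreal)"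
      by (auto simp: indicator_def)
  qed
  also have "\<dots> = emeasure lborel (cball (0::real^'n) (r + 1))" by simp
  finally show le: "emeasure (hyperplane_measure \<xi>) (cball 0 r) \<le> emeasure lborel (cball (0::real^'n) (r + 1))" .
  show "emeasure (hyperplane_measure \<xi>) (cball 0 r) < \<infinity>"
    using le emeasure_lborel_cball_finite[of "0::real^'n" "r + 1"] by (simp add: order.strict_trans1)
qed

text \<open>For \<open>x \<noteq> 0\<close> the kernel \<open>K x\<close> is a probability density
  in s, equal to d |x|^d / s^(d+1) for s at least |x|. Inserting it as a factor 1, exchanging the
  integrals and substituting x = s z confines z to the unit ball and leaves the direction of z with
  radius s |z|. Only the scaling law of \<open>M\<close> is used, so the same argument serves
  Lebesgue measure and the hyperplane measures.\<close>

lemma polar_nn: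
  fixes M :: "(real^'n) measure" and F :: "real^'n \<Rightarrow> ennreal"
  assumes sM: "sets M = sets borel" and d: "d \<ge> 1"
    and fin: "\<And>r. emeasure M (cball 0 r) < \<infinity>"
    and hom: "\<And>f s. f \<in> borel_measurable borel \<Longrightarrow> s > 0 \<Longrightarrow>
       (\<integral>\<^sup>+x. f x \<partial>M) = ennreal (s ^ d) * (\<integral>\<^sup>+x. f (s *\<^sub>R x) \<partial>M)"
    and F[measurable]: "F \<in> borel_measurable borel"
  shows "(\<integral>\<^sup>+x. F x \<partial>M)
     = (\<integral>\<^sup>+\<theta>. (\<integral>\<^sup>+r. F (r *\<^sub>R \<theta>) * ennreal (r ^ (d - 1)) * indicator {0<..} r \<partial>lborel) \<partial>cone0 d M)"
proof -
  note [measurable_cong] = sM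
  have sp: "space M = UNIV" using sM by (metis sets_eq_imp_space_eq space_borel)
  interpret M: sigma_finite_measure M
  proof
    show "\<exists>A. countable A \<and> A \<subseteq> sets M \<and> \<Union> A = space M \<and> (\<forall>a\<in>A. emeasure M a \<noteq> \<infinity>)"
    proof (intro exI conjI ballI)
      show "countable (range (\<lambda>i::nat. cball (0::real^'n) (real i)))" by simp
      show "\<Union> (range (\<lambda>i::nat. cball (0::real^'n) (real i))) = space M"
        by (auto simp: sp real_arch_simple)
      show "range (\<lambda>i::nat. cball (0::real^'n) (real i)) \<subseteq> sets M" by (auto simp: sM)
    qed (use fin in \<open>auto simp: less_top\<close>)
  qed
  interpret P: pair_sigma_finite M "lborel :: real measure" ..
  \<comment> \<open>Scaling by 2 fixes the origin but multiplies its finite mass by 2^d, and 2^d >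
    1.\<close>
  have zero: "emeasure M {0} = 0"
  proof -
    have "emeasure M {0} \<le> emeasure M (cball 0 1)" by (rule emeasure_mono) (auto simp: sM)
    then have f: "emeasure M {0} < \<infinity>" using fin[of 1] by (rule order.strict_trans1)
    have "emeasure M {0} = ennreal (2 ^ d) * (\<integral>\<^sup>+x. indicator {0} (2 *\<^sub>R x) \<partial>M)"
      using hom[of "indicator {0}" 2] by (simp add: sM)
    also have "(\<lambda>x. indicator {0} (2 *\<^sub>R x)) = (indicator {0::real^'n} :: _ \<Rightarrow> ennreal)" by (auto simp: indicator_def)
    finally have e: "emeasure M {0} = ennreal (2^d) * emeasure M {0}" by (simp add: sM)
    obtain z where z: "emeasure M {0} = ennreal z" "z \<ge> 0" using f by (cases "emeasure M {0}") auto
    have "z = 2^d * z" using e z by (simp add: ennreal_mult[symmetric])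
    moreover have "(2::real)^d > 1" using d by (simp add: one_less_power)
    ultimately have "z = 0" by auto
    then show ?thesis using z by simp
  qed
  then have ae: "AE x in M. x \<noteq> 0" by (intro AE_I[where N = "{0}"]) (auto simp: sM)
  define K where "K x s = (ennreal (real d * norm x ^ d / s ^ (d + 1)) * indicator {s. 0 < s \<and> norm x \<le> s} s)" for x :: "real^'n" and s :: real
  have Km[measurable]: "case_prod K \<in> borel_measurable (borel \<Otimes>\<^sub>M borel)"
    unfolding K_def by measurable
  have one: "(\<integral>\<^sup>+s. K x s \<partial>lborel) = 1" if "x \<noteq> 0" for x
  proof -
    let ?a = "norm x"
    have a: "?a > 0" using that by simp
    have 1: "K x s = ennreal (real d * norm x ^ d / s ^ (d + 1)) * indicator {?a..} s" for s
      using order.strict_trans2[OF a, of s] unfolding K_def by (auto simp: indicator_def)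
    have "(\<integral>\<^sup>+s. ennreal (real d * ?a ^ d / s ^ (d + 1)) * indicator {?a..} s \<partial>lborel)
       = ennreal (0 - - ((?a / ?a) ^ d))"
    proof (rule nn_integral_FTC_atLeast[where F = "\<lambda>s. - ((?a / s) ^ d)"])
      fix s assume s: "?a \<le> s"
      show "((\<lambda>s. - ((?a / s) ^ d)) has_field_derivative real d * ?a ^ d / s ^ (d + 1)) (at s)"
      proof -
        have "s > 0" by (rule order.strict_trans2[OF a s])
        obtain e where e: "d = Suc e" using d by (cases d) auto
        have D: "((\<lambda>s. ?a / s) has_field_derivative - ?a / s\<^sup>2) (at s)"
          using \<open>s > 0\<close> by (auto intro!: derivative_eq_intros simp: power2_eq_square)
        show ?thesis unfolding e
          by (rule DERIV_cong[OF DERIV_minus[OF DERIV_power_Suc[OF D]]])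
            (use \<open>s > 0\<close> in \<open>auto simp: field_simps power2_eq_square power_divide\<close>)
      qed
      show "0 \<le> real d * ?a ^ d / s ^ (d + 1)" using order.strict_trans2[OF a s] by simp
    next
      have "((\<lambda>s. - ((?a / s) ^ d)) \<longlongrightarrow> - (0 ^ d)) at_top"
        by (intro tendsto_intros tendsto_divide_0[OF tendsto_const] filterlim_at_top_imp_at_infinity filterlim_ident)
      then show "((\<lambda>s. - ((?a / s) ^ d)) \<longlongrightarrow> 0) at_top" using d by (simp add: power_0_left)
    qed simp
    then show ?thesis using a by (simp add: 1)
  qed
  \<comment> \<open>With r = |z| s the powers of s collapse to r^(d-1); what is left over, the
    factor d and the indicator of the punctured ball, is exactly the weight in
    \<open>cone0\<close>.\<close>
  have sub: "(\<integral>\<^sup>+s. ennreal (s^d) * (F (s *\<^sub>R z) * K (s *\<^sub>R z) s) \<partial>lborel)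
      = (of_nat d * indicator (cball 0 1 - {0}) z) * (\<integral>\<^sup>+r. F (r *\<^sub>R sgn z) * ennreal (r ^ (d - 1)) * indicator {0<..} r \<partial>lborel)" (is "?L = ?R") for z
  proof (cases "z = 0")
    case True
    have "K 0 s = 0" for s using d by (simp add: K_def zero_power)
    then show ?thesis using True by simp
  next
    case False
    let ?b = "norm z"
    have b: "?b > 0" using False by simp
    obtain e where e: "d = Suc e" using d by (cases d) auto
    have I: "ennreal (s^d) * (F (s *\<^sub>R z) * K (s *\<^sub>R z) s)
      = (of_nat d * indicator (cball 0 1 - {0}) z) * (ennreal ?b * (F ((?b * s) *\<^sub>R sgn z) * ennreal ((?b * s)^(d-1)) * indicator {0<..} (?b * s)))" for s
    proof (cases "s > 0 \<and> ?b \<le> 1")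
      case True
      then have s: "s > 0" "?b \<le> 1" by auto
      have K: "K (s *\<^sub>R z) s = ennreal (real d * ?b ^ d / s)"
        using s b by (simp add: K_def power_mult_distrib field_simps)
      have p: "s *\<^sub>R z = (?b * s) *\<^sub>R sgn z" using False by (simp add: sgn_div_norm)
      have "ennreal (s^d) * (F (s *\<^sub>R z) * K (s *\<^sub>R z) s) = F (s *\<^sub>R z) * (ennreal (s^d) * ennreal (real d * ?b ^ d / s))"
        by (simp add: K mult_ac)
      also have "ennreal (s^d) * ennreal (real d * ?b ^ d / s) = ennreal (real d * (?b * (?b * s) ^ (d-1)))"
      proof -
        have "s ^ d * (real d * ?b ^ d / s) = real d * (?b * (?b * s) ^ (d-1))"
          using s by (simp add: e power_mult_distrib)
        then show ?thesis using s by (subst ennreal_mult[symmetric]) simp_all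
      qed
      also have "\<dots> = of_nat d * (ennreal ?b * ennreal ((?b * s) ^ (d-1)))"
        using s b by (subst ennreal_mult, simp, simp, subst ennreal_mult) (auto simp: ennreal_of_nat_eq_real_of_nat)
      finally show ?thesis using s b False by (simp add: p[symmetric, unfolded mult.commute[of "norm z" s]] mult_ac)
    next
      case False2: False
      show ?thesis
      proof (cases "s > 0")
        case True
        then have "\<not> ?b \<le> 1" using False2 by simp
        then show ?thesis using True b by (simp add: K_def indicator_def)
      next
        case F3: False
        then have "\<not> ?b * s > 0" using b by (simp add: zero_less_mult_iff)
        then show ?thesis using F3 by (simp add: K_def indicator_def)
      qed
    qed
    have "?L = (of_nat d * indicator (cball 0 1 - {0}) z) * (ennreal ?b * (\<integral>\<^sup>+s. (F ((?b * s) *\<^sub>R sgn z) * ennreal ((?b * s)^(d-1)) * indicator {0<..} (?b * s)) \<partial>lborel))"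
      unfolding I by (simp add: nn_integral_cmult)
    also have "\<dots> = ?R"
      using b by (subst (2) nn_integral_real_affine[where c = "?b" and t = 0]) simp_all
    finally show ?thesis .
  qed
  have "(\<integral>\<^sup>+x. F x \<partial>M) = (\<integral>\<^sup>+x. F x * (\<integral>\<^sup>+s. K x s \<partial>lborel) \<partial>M)"
    by (rule nn_integral_cong_AE, use ae in eventually_elim) (simp add: one)
  also have "\<dots> = (\<integral>\<^sup>+x. (\<integral>\<^sup>+s. F x * K x s \<partial>lborel) \<partial>M)"
    by (subst nn_integral_cmult) simp_all
  also have "\<dots> = (\<integral>\<^sup>+s. (\<integral>\<^sup>+x. F x * K x s \<partial>M) \<partial>lborel)"
    by (rule P.Fubini'[symmetric]) simp
  also have "\<dots> = (\<integral>\<^sup>+s. (\<integral>\<^sup>+z. ennreal (s^d) * (F (s *\<^sub>R z) * K (s *\<^sub>R z) s) \<partial>M) \<partial>lborel)"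
  proof (rule nn_integral_cong)
    fix s :: real
    show "(\<integral>\<^sup>+x. F x * K x s \<partial>M) = (\<integral>\<^sup>+z. ennreal (s^d) * (F (s *\<^sub>R z) * K (s *\<^sub>R z) s) \<partial>M)"
    proof (cases "s > 0")
      case True
      then show ?thesis
        by (subst hom[where s = s]) (simp_all add: nn_integral_cmult)
    qed (simp add: K_def)
  qed
  also have "\<dots> = (\<integral>\<^sup>+z. (\<integral>\<^sup>+s. ennreal (s^d) * (F (s *\<^sub>R z) * K (s *\<^sub>R z) s) \<partial>lborel) \<partial>M)"
    by (rule P.Fubini') simp
  also have "\<dots> = (\<integral>\<^sup>+z. (of_nat d * indicator (cball 0 1 - {0}) z) * (\<integral>\<^sup>+r. F (r *\<^sub>R sgn z) * ennreal (r ^ (d - 1)) * indicator {0<..} r \<partial>lborel) \<partial>M)"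
    by (simp only: sub)
  also have "\<dots> = (\<integral>\<^sup>+\<theta>. (\<integral>\<^sup>+r. F (r *\<^sub>R \<theta>) * ennreal (r ^ (d - 1)) * indicator {0<..} r \<partial>lborel) \<partial>cone0 d M)"
  proof (subst nn_integral_cone0[OF sM])
    show "(\<lambda>\<theta>. \<integral>\<^sup>+r. F (r *\<^sub>R \<theta>) * ennreal (r ^ (d - 1)) * indicator {0<..} r \<partial>lborel) \<in> borel_measurable borel"
      by measurable
    show "(\<integral>\<^sup>+z. (of_nat d * indicator (cball 0 1 - {0}) z) * (\<integral>\<^sup>+r. F (r *\<^sub>R sgn z) * ennreal (r ^ (d - 1)) * indicator {0<..} r \<partial>lborel) \<partial>M)
      = of_nat d * (\<integral>\<^sup>+x. (\<integral>\<^sup>+r. F (r *\<^sub>R sgn x) * ennreal (r ^ (d - 1)) * indicator {0<..} r \<partial>lborel) * indicator (cball 0 1 - {0}) x \<partial>M)"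
    proof -
      have "(\<lambda>x. (\<integral>\<^sup>+r. F (r *\<^sub>R sgn x) * ennreal (r ^ (d - 1)) * indicator {0<..} r \<partial>lborel) * indicator (cball 0 1 - {0}) x) \<in> borel_measurable borel"
        by measurable
      then have "(\<lambda>x. (\<integral>\<^sup>+r. F (r *\<^sub>R sgn x) * ennreal (r ^ (d - 1)) * indicator {0<..} r \<partial>lborel) * indicator (cball 0 1 - {0}) x) \<in> borel_measurable M"
        by (simp add: measurable_cong_sets[OF sM refl])
      then show ?thesis
        by (subst nn_integral_cmult[symmetric]) (assumption, intro nn_integral_cong, simp add: mult_ac)
    qed
  qed
  finally show ?thesis .
qed

section \<open>The measures on the sphere and on its great subspheres\<close>

abbreviation proj :: "real^'n \<Rightarrow> real^'n \<Rightarrow> real^'n" where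
  "proj \<xi> x \<equiv> x - (x \<bullet> \<xi>) *\<^sub>R \<xi>"

definition sph :: "(real^'n) measure" where "sph = cone0 CARD('n) lborel"

definition subsph :: "real^'n \<Rightarrow> (real^'n) measure" where
  "subsph \<xi> = cone0 (CARD('n) - 1) (hyperplane_measure \<xi>)"

lemma sphere_measure_eq: "sphere_measure = completion sph"
  by (simp add: sphere_measure_def sph_def cone_measure_eq)

lemma great_subsphere_measure_eq: "great_subsphere_measure \<xi> = completion (subsph \<xi>)"
  by (simp add: great_subsphere_measure_def subsph_def cone_measure_eq)

lemma sets_sph [simp, measurable_cong]: "sets sph = sets borel"
  and space_sph [simp]: "space sph = UNIV"
  and sets_subsph [simp, measurable_cong]: "sets (subsph \<xi>) = sets borel"
  and space_subsph [simp]: "space (subsph \<xi>) = UNIV"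
  by (simp_all add: sph_def subsph_def)

lemma proj_orth: "norm \<xi> = 1 \<Longrightarrow> proj \<xi> x \<bullet> \<xi> = 0"
  by (simp add: inner_simps norm_eq_1)

lemma nn_integral_sph:
  assumes "f \<in> borel_measurable borel"
  shows "(\<integral>\<^sup>+\<theta>. f \<theta> \<partial>(sph :: (real^'n) measure))
    = of_nat CARD('n) * (\<integral>\<^sup>+x. f (sgn x) * indicator (cball 0 1 - {0}) x \<partial>lborel)"
  unfolding sph_def by (rule nn_integral_cone0) (use assms in simp_all)

lemma nn_integral_subsph:
  assumes [measurable]: "f \<in> borel_measurable borel"
  shows "(\<integral>\<^sup>+\<theta>. f \<theta> \<partial>subsph (\<xi> :: real^'n))
    = of_nat (CARD('n) - 1) * (\<integral>\<^sup>+x. f (sgn (proj \<xi> x)) * indicator (cball 0 1 - {0}) (proj \<xi> x)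
        * indicator {x. 0 \<le> x \<bullet> \<xi> \<and> x \<bullet> \<xi> \<le> 1} x \<partial>lborel)"
  unfolding subsph_def
  by (subst nn_integral_cone0, simp, simp, subst nn_integral_hyperplane_measure) (simp_all add: mult.assoc)

lemma polar_lborel:
  fixes F :: "real^'n \<Rightarrow> ennreal"
  assumes "F \<in> borel_measurable borel"
  shows "(\<integral>\<^sup>+x. F x \<partial>lborel)
     = (\<integral>\<^sup>+\<theta>. (\<integral>\<^sup>+r. F (r *\<^sub>R \<theta>) * ennreal (r ^ (CARD('n) - 1)) * indicator {0<..} r \<partial>lborel) \<partial>sph)"
  unfolding sph_def
proof (rule polar_nn)
  show "CARD('n) \<ge> 1" by (simp add: Suc_leI)
  show "emeasure lborel (cball (0::real^'n) r) < \<infinity>" for r using emeasure_lborel_cball_finite[of 0 r] by simp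
  show "(\<integral>\<^sup>+x. f x \<partial>lborel) = ennreal (s ^ CARD('n)) * (\<integral>\<^sup>+x. f (s *\<^sub>R x) \<partial>lborel)"
    if "f \<in> borel_measurable borel" "s > 0" for f :: "real^'n \<Rightarrow> ennreal" and s
    using nn_integral_lborel_scale[OF that] by simp
qed (use assms in simp_all)

lemma polar_hyperplane:
  fixes F :: "real^'n \<Rightarrow> ennreal"
  assumes n: "CARD('n) > 1" and \<xi>: "norm \<xi> = 1" and "F \<in> borel_measurable borel"
  shows "(\<integral>\<^sup>+x. F x \<partial>hyperplane_measure \<xi>)
     = (\<integral>\<^sup>+\<theta>. (\<integral>\<^sup>+r. F (r *\<^sub>R \<theta>) * ennreal (r ^ (CARD('n) - 2)) * indicator {0<..} r \<partial>lborel) \<partial>subsph \<xi>)"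
proof -
  have e: "CARD('n) - 2 = CARD('n) - 1 - 1" by simp
  show ?thesis
    unfolding subsph_def e
  proof (rule polar_nn)
    show "(\<integral>\<^sup>+x. f x \<partial>hyperplane_measure \<xi>) = ennreal (s ^ (CARD('n) - 1)) * (\<integral>\<^sup>+x. f (s *\<^sub>R x) \<partial>hyperplane_measure \<xi>)"
      if "f \<in> borel_measurable borel" "s > 0" for f :: "real^'n \<Rightarrow> ennreal" and s
      using \<xi> that by (rule nn_integral_hyperplane_scale)
  qed (use assms emeasure_hyperplane_cball(2)[OF \<xi>] in simp_all)
qed

lemma AE_borel_iff_nn_integral:
  assumes "sets M = sets borel" and [measurable]: "Measurable.pred borel P"
  shows "(AE x in M. P x) \<longleftrightarrow> (\<integral>\<^sup>+x. indicator {x. \<not> P x} x \<partial>M) = 0"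
proof -
  note [measurable_cong] = assms(1)
  have sp: "space M = UNIV" using assms(1) by (metis sets_eq_imp_space_eq space_borel)
  show ?thesis
    by (subst AE_iff_measurable[where N = "{x. \<not> P x}"]) (auto simp: sp)
qed

lemma AE_sph_norm: "AE \<theta> in (sph :: (real^'n) measure). norm \<theta> = 1"
proof (subst AE_borel_iff_nn_integral)
  have "(\<integral>\<^sup>+\<theta>. indicator {x. norm x \<noteq> 1} \<theta> \<partial>(sph :: (real^'n) measure))
    = of_nat CARD('n) * (\<integral>\<^sup>+x. indicator {x. norm x \<noteq> 1} (sgn x) * indicator (cball 0 1 - {0}) x \<partial>(lborel :: (real^'n) measure))"
    by (rule nn_integral_sph) measurable
  also have "(\<lambda>x :: real^'n. indicator {x. norm x \<noteq> 1} (sgn x) * indicator (cball 0 1 - {0}) x) = (\<lambda>x. 0 :: ennreal)"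
    by (auto simp: indicator_def norm_sgn)
  finally show "(\<integral>\<^sup>+\<theta>. indicator {x. norm x \<noteq> 1} \<theta> \<partial>(sph :: (real^'n) measure)) = 0" by simp
qed simp_all

lemma AE_subsph:
  assumes "norm \<xi> = 1"
  shows "AE \<theta> in subsph \<xi>. norm \<theta> = 1 \<and> \<theta> \<bullet> \<xi> = 0"
proof (subst AE_borel_iff_nn_integral)
  have "(\<integral>\<^sup>+\<theta>. indicator {x. \<not> (norm x = 1 \<and> x \<bullet> \<xi> = 0)} \<theta> \<partial>subsph \<xi>)
    = of_nat (CARD('a) - 1) * (\<integral>\<^sup>+x. indicator {x. \<not> (norm x = 1 \<and> x \<bullet> \<xi> = 0)} (sgn (proj \<xi> x)) * indicator (cball 0 1 - {0}) (proj \<xi> x)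
        * indicator {x. 0 \<le> x \<bullet> \<xi> \<and> x \<bullet> \<xi> \<le> 1} x \<partial>lborel)"
    by (rule nn_integral_subsph) measurable
  also have "(\<lambda>x. indicator {x. \<not> (norm x = 1 \<and> x \<bullet> \<xi> = 0)} (sgn (proj \<xi> x)) * indicator (cball 0 1 - {0}) (proj \<xi> x)
        * indicator {x. 0 \<le> x \<bullet> \<xi> \<and> x \<bullet> \<xi> \<le> 1} x) = (\<lambda>x. 0 :: ennreal)"
  proof
    fix x
    have "proj \<xi> x \<bullet> \<xi> = 0" using assms by (rule proj_orth)
    then have "sgn (proj \<xi> x) \<bullet> \<xi> = 0" by (simp add: sgn_div_norm)
    then show "indicator {x. \<not> (norm x = 1 \<and> x \<bullet> \<xi> = 0)} (sgn (proj \<xi> x)) * indicator (cball 0 1 - {0}) (proj \<xi> x)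
        * indicator {x. 0 \<le> x \<bullet> \<xi> \<and> x \<bullet> \<xi> \<le> 1} x = (0::ennreal)"
      by (auto simp: indicator_def norm_sgn)
  qed
  finally show "(\<integral>\<^sup>+\<theta>. indicator {x. \<not> (norm x = 1 \<and> x \<bullet> \<xi> = 0)} \<theta> \<partial>subsph \<xi>) = 0" by simp
qed simp_all

lemma AE_hyperplane_orth:
  assumes "norm \<xi> = 1"
  shows "AE y in hyperplane_measure \<xi>. y \<bullet> \<xi> = 0"
proof (subst AE_borel_iff_nn_integral)
  have "(\<integral>\<^sup>+\<theta>. indicator {x. x \<bullet> \<xi> \<noteq> 0} \<theta> \<partial>hyperplane_measure \<xi>)
    = (\<integral>\<^sup>+x. indicator {x. x \<bullet> \<xi> \<noteq> 0} (proj \<xi> x) * indicator {x. 0 \<le> x \<bullet> \<xi> \<and> x \<bullet> \<xi> \<le> 1} x \<partial>lborel)"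
    by (rule nn_integral_hyperplane_measure) measurable
  then show "(\<integral>\<^sup>+\<theta>. indicator {x. x \<bullet> \<xi> \<noteq> 0} \<theta> \<partial>hyperplane_measure \<xi>) = 0"
    by (simp add: indicator_def proj_orth[OF assms])
qed simp_all

lemma finite_sph: "finite_measure (sph :: (real^'n) measure)"
proof
  have "emeasure sph (UNIV :: (real^'n) set) = of_nat CARD('n) * emeasure lborel (cball (0::real^'n) 1 - {0})"
    using nn_integral_sph[of "\<lambda>_::real^'n. 1"] by simp
  also have "\<dots> \<le> of_nat CARD('n) * emeasure lborel (cball (0::real^'n) 1)"
    by (intro mult_left_mono emeasure_mono) auto
  also have "\<dots> < \<infinity>" using emeasure_lborel_cball_finite[of "0::real^'n" 1] by (simp add: ennreal_mult_less_top of_nat_less_top)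
  finally show "emeasure sph (space (sph :: (real^'n) measure)) \<noteq> \<infinity>" by (simp add: less_top)
qed

lemma emeasure_subsph_le:
  assumes "norm \<xi> = 1"
  shows "emeasure (subsph (\<xi> :: real^'n)) UNIV \<le> of_nat (CARD('n) - 1) * emeasure lborel (cball (0::real^'n) 2)"
proof -
  have "emeasure (subsph \<xi>) UNIV = (\<integral>\<^sup>+\<theta>. 1 \<partial>subsph \<xi>)" by simp
  also have "\<dots> = of_nat (CARD('n) - 1) * emeasure (hyperplane_measure \<xi>) (cball 0 1 - {0})"
    unfolding subsph_def by (subst nn_integral_cone0) simp_all
  also have "\<dots> \<le> of_nat (CARD('n) - 1) * emeasure (hyperplane_measure \<xi>) (cball 0 1)"
    by (intro mult_left_mono emeasure_mono) auto
  also have "\<dots> \<le> of_nat (CARD('n) - 1) * emeasure lborel (cball (0::real^'n) 2)"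
    using emeasure_hyperplane_cball(1)[OF assms, of 1] by (intro mult_left_mono) simp_all
  finally show ?thesis .
qed

lemma finite_subsph:
  assumes "norm \<xi> = 1" shows "finite_measure (subsph (\<xi> :: real^'n))"
proof
  have "emeasure (subsph \<xi>) UNIV < \<infinity>"
    using emeasure_subsph_le[OF assms] emeasure_lborel_cball_finite[of "0::real^'n" 2]
    by (auto simp: ennreal_mult_less_top of_nat_less_top intro: order.strict_trans1)
  then show "emeasure (subsph \<xi>) (space (subsph \<xi>)) \<noteq> \<infinity>" by (simp add: less_top)
qed

text \<open>The measure itself varies with \<open>z\<close>; rewriting the integral over the fixed
  measure \<open>lborel\<close> moves that dependence into the integrand, where measurability is
  visible.\<close>

lemma borel_measurable_nn_integral_subsph [measurable]:
  fixes \<Phi> :: "'a \<times> (real^'n) \<Rightarrow> ennreal"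
  assumes [measurable]: "\<Phi> \<in> borel_measurable (M \<Otimes>\<^sub>M borel)" "h \<in> borel_measurable M"
  shows "(\<lambda>z. \<integral>\<^sup>+\<theta>. \<Phi> (z, \<theta>) \<partial>subsph (h z)) \<in> borel_measurable M"
proof -
  have "(\<integral>\<^sup>+\<theta>. \<Phi> (z, \<theta>) \<partial>subsph (h z)) = of_nat (CARD('n) - 1) * (\<integral>\<^sup>+x. \<Phi> (z, sgn (proj (h z) x)) * indicator (cball 0 1 - {0}) (proj (h z) x)
        * indicator {x. 0 \<le> x \<bullet> h z \<and> x \<bullet> h z \<le> 1} x \<partial>lborel)" if "z \<in> space M" for z
    using that by (subst nn_integral_subsph) simp_all
  then show ?thesis
    by (simp cong: measurable_cong)
qed

subsection \<open>Symmetry of the incidence measure\<close>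

text \<open>The standard Gaussian without its normalising factor, which would depend on the
  dimension. In this form it is exactly multiplicative on orthogonal sums, and on rays it is the
  one-dimensional function of the same name.\<close>

definition gw :: "'a::real_inner \<Rightarrow> real" where "gw x = exp (- (x \<bullet> x) / 2)"

lemma gw_pos: "gw x > 0" and gw_le: "gw x \<le> 1" and gw_nonneg [simp]: "gw x \<ge> 0"
  by (simp_all add: gw_def)

lemma gw_add_orth: "x \<bullet> y = 0 \<Longrightarrow> gw (x + y) = gw x * gw y"
  by (simp add: gw_def inner_simps inner_commute exp_add[symmetric] add_divide_distrib)

lemma gw_scale: "norm \<theta> = 1 \<Longrightarrow> gw (r *\<^sub>R \<theta>) = gw r"
  by (simp add: gw_def norm_eq_1)

lemma continuous_on_gw [continuous_intros]:
  "continuous_on S f \<Longrightarrow> continuous_on S (\<lambda>x. gw (f x))"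
  unfolding gw_def by (intro continuous_intros) auto

lemma borel_measurable_gw [measurable]: "(gw :: 'a::euclidean_space \<Rightarrow> real) \<in> borel_measurable borel"
  unfolding gw_def by measurable

lemma gw_real: "gw (s::real) = sqrt (2 * pi) * std_normal_density s"
  by (simp add: gw_def std_normal_density_def power2_eq_square)

lemma integrable_gw_moment: "integrable lborel (\<lambda>s::real. gw s * s ^ k)"
  using integrable_mult_right[OF integrable_std_normal_moment[of k], of "sqrt (2*pi)"]
  by (simp add: gw_real mult.assoc)

lemma integrable_gw_moment_abs: "integrable lborel (\<lambda>s::real. gw s * \<bar>s\<bar> ^ k)"
  using integrable_mult_right[OF integrable_std_normal_moment_abs[of k], of "sqrt (2*pi)"]
  by (simp add: gw_real mult.assoc)

lemma nn_gw_moment_finite: "(\<integral>\<^sup>+r. ennreal (gw r) * ennreal (r ^ k) * indicator {0<..} r \<partial>lborel) < \<infinity>"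
proof -
  have "(\<integral>\<^sup>+r. ennreal (gw r) * ennreal (r ^ k) * indicator {0<..} r \<partial>lborel) \<le> (\<integral>\<^sup>+r. ennreal (gw r * \<bar>r\<bar> ^ k) \<partial>lborel)"
    by (intro nn_integral_mono) (auto simp: indicator_def ennreal_mult[symmetric])
  also have "\<dots> < \<infinity>" using integrable_gw_moment_abs[of k] unfolding integrable_iff_bounded by simp
  finally show ?thesis .
qed

lemma nn_gw_moment_pos: "(\<integral>\<^sup>+r. ennreal (gw r) * ennreal (r ^ k) * indicator {0<..} r \<partial>lborel) > 0"
proof -
  have "(\<integral>\<^sup>+r. ennreal (exp (-2)) * indicator {1..2::real} r \<partial>lborel) \<le> (\<integral>\<^sup>+r. ennreal (gw r) * ennreal (r ^ k) * indicator {0<..} r \<partial>lborel)"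
  proof (rule nn_integral_mono)
    fix r :: real
    show "ennreal (exp (-2)) * indicator {1..2} r \<le> ennreal (gw r) * ennreal (r ^ k) * indicator {0<..} r"
    proof (cases "r \<in> {1..2}")
      case True
      then have "r * r \<le> 2 * 2" by (intro mult_mono) auto
      then have "exp (-2) \<le> gw r" by (simp add: gw_def)
      moreover have "1 \<le> r ^ k" using True by simp
      ultimately have "exp (-2) * 1 \<le> gw r * r ^ k" by (intro mult_mono) auto
      then show ?thesis using True by (simp add: ennreal_mult[symmetric])
    qed simp
  qed
  moreover have "(\<integral>\<^sup>+r. ennreal (exp (-2)) * indicator {1..2::real} r \<partial>lborel) = ennreal (exp (-2))"
    by (simp add: nn_integral_cmult)
  ultimately show ?thesis by (metis ennreal_less_zero_iff exp_gt_zero order.strict_trans2)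
qed

text \<open>The weight \<open>1 / norm x\<close> is the density with which slabs around the
  hyperplane orthogonal to \<open>x\<close> converge, their thickness being proportional to it. It
  also lowers the radial exponent of \<open>x\<close> from n - 1 to n - 2, so both radial integrals
  are the same finite positive constant.\<close>

lemma frame_weighted:
  fixes f :: "(real^'n) \<times> (real^'n) \<Rightarrow> ennreal"
  assumes n: "CARD('n) > 1" and [measurable]: "f \<in> borel_measurable borel"
  shows "(\<integral>\<^sup>+x. ennreal (gw x / norm x) * (\<integral>\<^sup>+y. ennreal (gw y) * f (sgn x, sgn y) \<partial>hyperplane_measure (sgn x)) \<partial>lborel)
    = (\<integral>\<^sup>+r. ennreal (gw r) * ennreal (r ^ (CARD('n) - 2)) * indicator {0<..} r \<partial>lborel)
      * (\<integral>\<^sup>+r. ennreal (gw r) * ennreal (r ^ (CARD('n) - 2)) * indicator {0<..} r \<partial>lborel)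
      * (\<integral>\<^sup>+\<xi>. (\<integral>\<^sup>+\<theta>. f (\<xi>, \<theta>) \<partial>subsph \<xi>) \<partial>sph)" (is "_ = ?C * ?C * _")
proof -
  have [measurable]: "f \<in> borel_measurable (borel \<Otimes>\<^sub>M borel)" by (simp add: borel_prod)
  have inner: "(\<integral>\<^sup>+y. ennreal (gw y) * f (\<xi>, sgn y) \<partial>hyperplane_measure \<xi>) = ?C * (\<integral>\<^sup>+\<theta>. f (\<xi>, \<theta>) \<partial>subsph \<xi>)"
    if "norm \<xi> = 1" for \<xi>
  proof -
    have "(\<integral>\<^sup>+y. ennreal (gw y) * f (\<xi>, sgn y) \<partial>hyperplane_measure \<xi>)
       = (\<integral>\<^sup>+\<theta>. (\<integral>\<^sup>+r. ennreal (gw (r *\<^sub>R \<theta>)) * f (\<xi>, sgn (r *\<^sub>R \<theta>)) * ennreal (r ^ (CARD('n) - 2)) * indicator {0<..} r \<partial>lborel) \<partial>subsph \<xi>)"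
      using that n by (intro polar_hyperplane) measurable
    also have "\<dots> = (\<integral>\<^sup>+\<theta>. ?C * f (\<xi>, \<theta>) \<partial>subsph \<xi>)"
    proof (rule nn_integral_cong_AE, use AE_subsph[OF that] in eventually_elim)
      fix \<theta> assume t: "norm \<theta> = 1 \<and> \<theta> \<bullet> \<xi> = 0"
      then have "sgn \<theta> = \<theta>" by (simp add: sgn_div_norm)
      then have "ennreal (gw (r *\<^sub>R \<theta>)) * f (\<xi>, sgn (r *\<^sub>R \<theta>)) * ennreal (r ^ (CARD('n) - 2)) * indicator {0<..} r
        = (ennreal (gw r) * ennreal (r ^ (CARD('n) - 2)) * indicator {0<..} r) * f (\<xi>, \<theta>)" for r
        using t by (cases "r > 0") (auto simp: gw_scale sgn_scaleR mult_ac)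
      then show "(\<integral>\<^sup>+r. ennreal (gw (r *\<^sub>R \<theta>)) * f (\<xi>, sgn (r *\<^sub>R \<theta>)) * ennreal (r ^ (CARD('n) - 2)) * indicator {0<..} r \<partial>lborel) = ?C * f (\<xi>, \<theta>)"
        by (simp add: nn_integral_multc)
    qed
    also have "\<dots> = ?C * (\<integral>\<^sup>+\<theta>. f (\<xi>, \<theta>) \<partial>subsph \<xi>)"
      by (rule nn_integral_cmult) measurable
    finally show ?thesis .
  qed
  have "(\<integral>\<^sup>+x. ennreal (gw x / norm x) * (\<integral>\<^sup>+y. ennreal (gw y) * f (sgn x, sgn y) \<partial>hyperplane_measure (sgn x)) \<partial>lborel)
    = (\<integral>\<^sup>+x. ennreal (gw x / norm x) * (?C * (\<integral>\<^sup>+\<theta>. f (sgn x, \<theta>) \<partial>subsph (sgn x))) \<partial>lborel)"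
  proof (rule nn_integral_cong)
    fix x :: "real^'n"
    show "ennreal (gw x / norm x) * (\<integral>\<^sup>+y. ennreal (gw y) * f (sgn x, sgn y) \<partial>hyperplane_measure (sgn x))
      = ennreal (gw x / norm x) * (?C * (\<integral>\<^sup>+\<theta>. f (sgn x, \<theta>) \<partial>subsph (sgn x)))"
    proof (cases "x = 0")
      case False
      then have "norm (sgn x) = 1" by (simp add: norm_sgn)
      then show ?thesis by (simp only: inner)
    qed simp
  qed
  also have "\<dots> = (\<integral>\<^sup>+\<theta>. (\<integral>\<^sup>+r. ennreal (gw (r *\<^sub>R \<theta>) / norm (r *\<^sub>R \<theta>)) * (?C * (\<integral>\<^sup>+\<theta>'. f (sgn (r *\<^sub>R \<theta>), \<theta>') \<partial>subsph (sgn (r *\<^sub>R \<theta>))))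
      * ennreal (r ^ (CARD('n) - 1)) * indicator {0<..} r \<partial>lborel) \<partial>sph)"
    by (rule polar_lborel) measurable
  also have "\<dots> = (\<integral>\<^sup>+\<xi>. ?C * (?C * (\<integral>\<^sup>+\<theta>. f (\<xi>, \<theta>) \<partial>subsph \<xi>)) \<partial>sph)"
  proof (rule nn_integral_cong_AE, use AE_sph_norm in eventually_elim)
    fix \<theta> :: "real^'n" assume t: "norm \<theta> = 1"
    then have s: "sgn \<theta> = \<theta>" by (simp add: sgn_div_norm)
    have e: "CARD('n) - 1 = Suc (CARD('n) - 2)" using n by simp
    have "ennreal (gw (r *\<^sub>R \<theta>) / norm (r *\<^sub>R \<theta>)) * (?C * (\<integral>\<^sup>+\<theta>'. f (sgn (r *\<^sub>R \<theta>), \<theta>') \<partial>subsph (sgn (r *\<^sub>R \<theta>))))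
      * ennreal (r ^ (CARD('n) - 1)) * indicator {0<..} r
      = (ennreal (gw r) * ennreal (r ^ (CARD('n) - 2)) * indicator {0<..} r) * (?C * (\<integral>\<^sup>+\<theta>'. f (\<theta>, \<theta>') \<partial>subsph \<theta>))" for r
    proof (cases "r > 0")
      case True
      have "ennreal (gw r / r) * ennreal (r ^ (CARD('n) - 1)) = ennreal (gw r) * ennreal (r ^ (CARD('n) - 2))"
        using True unfolding e by (simp add: ennreal_mult[symmetric])
      then have "ennreal (gw r / r) * X * ennreal (r ^ (CARD('n) - 1)) = ennreal (gw r) * ennreal (r ^ (CARD('n) - 2)) * X" for X
        by (metis mult.assoc mult.commute)
      then show ?thesis using True t s by (simp add: gw_scale sgn_scaleR)
    qed simp
    then show "(\<integral>\<^sup>+r. ennreal (gw (r *\<^sub>R \<theta>) / norm (r *\<^sub>R \<theta>)) * (?C * (\<integral>\<^sup>+\<theta>'. f (sgn (r *\<^sub>R \<theta>), \<theta>') \<partial>subsph (sgn (r *\<^sub>R \<theta>))))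
      * ennreal (r ^ (CARD('n) - 1)) * indicator {0<..} r \<partial>lborel) = ?C * (?C * (\<integral>\<^sup>+\<theta>'. f (\<theta>, \<theta>') \<partial>subsph \<theta>))"
      by (simp add: nn_integral_multc)
  qed
  also have "\<dots> = ?C * ?C * (\<integral>\<^sup>+\<xi>. (\<integral>\<^sup>+\<theta>. f (\<xi>, \<theta>) \<partial>subsph \<xi>) \<partial>sph)"
    by (simp add: nn_integral_cmult mult.assoc)
  finally show ?thesis .
qed

lemma closed_indicator_limit:
  fixes C :: "'a::metric_space set"
  assumes C: "closed C" "C \<noteq> {}"
  shows "(\<lambda>k. max 0 (1 - real k * infdist x C)) \<longlonglongrightarrow> indicator C x"
proof (cases "x \<in> C")
  case False
  then have pos: "infdist x C > 0" using C by (simp add: infdist_pos_not_in_closed)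
  obtain K where K: "real K * infdist x C > 1" using reals_Archimedean3[OF pos] by blast
  have "eventually (\<lambda>k. max 0 (1 - real k * infdist x C) = 0) sequentially"
    using eventually_ge_at_top[of K]
  proof eventually_elim
    fix k assume "K \<le> k"
    then have "real K * infdist x C \<le> real k * infdist x C" using pos by (intro mult_right_mono) auto
    then show "max 0 (1 - real k * infdist x C) = 0" using K by simp
  qed
  then show ?thesis using False by (simp add: tendsto_eventually)
qed simp

text \<open>Indicators of closed sets are pointwise limits of continuous functions with values in
  [0,1], and the closed sets form an intersection-stable generator of the Borel sets.\<close>

lemma finite_borel_measure_eqI:
  fixes M N :: "'a::metric_space measure"
  assumes M: "sets M = sets borel" "finite_measure M" and N: "sets N = sets borel" "finite_measure N"
    and eq: "\<And>f. continuous_on UNIV f \<Longrightarrow> (\<And>x. 0 \<le> f x) \<Longrightarrow> (\<And>x. f x \<le> 1) \<Longrightarrow>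
       (\<integral>\<^sup>+x. ennreal (f x) \<partial>M) = (\<integral>\<^sup>+x. ennreal (f x) \<partial>N)"
  shows "M = N"
proof -
  interpret M: finite_measure M by fact
  interpret N: finite_measure N by fact
  define g where "g C k x = max 0 (1 - real k * infdist x C)" for C :: "'a set" and k x
  have lim: "(\<lambda>k. \<integral>\<^sup>+x. ennreal (g C k x) \<partial>L) \<longlonglongrightarrow> emeasure L C"
    if C: "closed C" "C \<noteq> {}" and L: "sets L = sets borel" "finite_measure L" for C and L :: "'a measure"
  proof -
    note [measurable_cong] = L(1)
    have CL: "C \<in> sets L" using C L(1) by simp
    interpret L: finite_measure L by fact
    have "(\<lambda>k. \<integral>\<^sup>+x. ennreal (g C k x) \<partial>L) \<longlonglongrightarrow> (\<integral>\<^sup>+x. indicator C x \<partial>L)"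
    proof (rule nn_integral_dominated_convergence[where w = "\<lambda>_. 1"])
      show "(\<lambda>x. ennreal (g C k x)) \<in> borel_measurable L" for k
        unfolding g_def measurable_cong_sets[OF L(1) refl]
        by (intro measurable_compose[OF _ measurable_ennreal] borel_measurable_continuous_onI continuous_intros)
      show "AE x in L. ennreal (g C k x) \<le> 1" for k
        by (auto simp: g_def infdist_nonneg)
      show "(\<integral>\<^sup>+x. 1 \<partial>L) < \<infinity>" using L.emeasure_finite[of "space L"] by (simp add: less_top[symmetric])
      show "AE x in L. (\<lambda>k. ennreal (g C k x)) \<longlonglongrightarrow> indicator C x"
        using closed_indicator_limit[OF C] unfolding g_def ennreal_indicator[symmetric]
        by (intro AE_I2 tendsto_ennrealI)
    qed (use CL in simp_all)
    then show ?thesis using C by (simp add: L(1))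
  qed
  have gc: "continuous_on UNIV (g C k)" and g0: "0 \<le> g C k x" and g1: "g C k x \<le> 1" for C k x
    unfolding g_def by (intro continuous_intros) (auto simp: infdist_nonneg)
  have closed: "emeasure M C = emeasure N C" if "closed C" for C
  proof (cases "C = {}")
    case False
    show ?thesis
      using lim[OF that False M] lim[OF that False N] eq[OF gc g0 g1]
      by (simp add: LIMSEQ_unique)
  qed simp
  show ?thesis
  proof (rule measure_eqI_generator_eq[where E = "Collect closed" and \<Omega> = UNIV and A = "\<lambda>_. UNIV"])
    show "Int_stable (Collect closed :: 'a set set)" by (auto simp: Int_stable_def)
    show "sets M = sigma_sets UNIV (Collect closed)" "sets N = sigma_sets UNIV (Collect closed)"
      by (simp_all add: M(1) N(1) borel_eq_closed)
    show "emeasure M UNIV \<noteq> \<infinity>" for i :: nat by simp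
  qed (auto simp: closed)
qed

lemma borel_measurable_nn_integral_hyperplane [measurable]:
  fixes \<Phi> :: "'a \<times> (real^'n) \<Rightarrow> ennreal"
  assumes [measurable]: "\<Phi> \<in> borel_measurable (M \<Otimes>\<^sub>M borel)" "h \<in> borel_measurable M"
  shows "(\<lambda>z. \<integral>\<^sup>+\<theta>. \<Phi> (z, \<theta>) \<partial>hyperplane_measure (h z)) \<in> borel_measurable M"
proof -
  have "(\<integral>\<^sup>+\<theta>. \<Phi> (z, \<theta>) \<partial>hyperplane_measure (h z)) = (\<integral>\<^sup>+x. \<Phi> (z, proj (h z) x)
        * indicator {x. 0 \<le> x \<bullet> h z \<and> x \<bullet> h z \<le> 1} x \<partial>lborel)" if "z \<in> space M" for z
    using that by (subst nn_integral_hyperplane_measure) simp_all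
  then show ?thesis
    by (simp cong: measurable_cong)
qed

lemma AE_hyperplane_nonzero:
  fixes \<xi> :: "real^'n"
  assumes n: "CARD('n) > 1" and \<xi>: "norm \<xi> = 1"
  shows "AE y in hyperplane_measure \<xi>. y \<noteq> 0"
proof (subst AE_borel_iff_nn_integral)
  have "(\<integral>\<^sup>+y. indicator {0} y \<partial>hyperplane_measure \<xi>)
     = (\<integral>\<^sup>+\<theta>. (\<integral>\<^sup>+r. indicator {0} (r *\<^sub>R \<theta>) * ennreal (r ^ (CARD('n) - 2)) * indicator {0<..} r \<partial>lborel) \<partial>subsph \<xi>)"
    by (rule polar_hyperplane[OF n \<xi>]) simp
  also have "\<dots> = (\<integral>\<^sup>+\<theta>. 0 \<partial>subsph \<xi>)"
  proof (rule nn_integral_cong_AE, use AE_subsph[OF \<xi>] in eventually_elim)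
    fix \<theta> assume "norm \<theta> = 1 \<and> \<theta> \<bullet> \<xi> = 0"
    then have z: "indicator {0} (r *\<^sub>R \<theta>) * ennreal (r ^ (CARD('n) - 2)) * indicator {0<..} r = 0" for r
      by (auto simp: indicator_def)
    show "(\<integral>\<^sup>+r. indicator {0} (r *\<^sub>R \<theta>) * ennreal (r ^ (CARD('n) - 2)) * indicator {0<..} r \<partial>lborel) = 0"
      unfolding z by simp
  qed
  finally show "(\<integral>\<^sup>+y. indicator {x. \<not> x \<noteq> 0} y \<partial>hyperplane_measure \<xi>) = 0" by (simp add: )
qed simp_all

lemma nn_gw_hyperplane_finite:
  fixes \<xi> :: "real^'n"
  assumes n: "CARD('n) > 1" and \<xi>: "norm \<xi> = 1"
  shows "(\<integral>\<^sup>+y. ennreal (gw y) \<partial>hyperplane_measure \<xi>) < \<infinity>"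
proof -
  let ?C = "\<integral>\<^sup>+r. ennreal (gw r) * ennreal (r ^ (CARD('n) - 2)) * indicator {0<..} r \<partial>lborel"
  have "(\<integral>\<^sup>+y. ennreal (gw y) \<partial>hyperplane_measure \<xi>)
     = (\<integral>\<^sup>+\<theta>. (\<integral>\<^sup>+r. ennreal (gw (r *\<^sub>R \<theta>)) * ennreal (r ^ (CARD('n) - 2)) * indicator {0<..} r \<partial>lborel) \<partial>subsph \<xi>)"
    by (rule polar_hyperplane[OF n \<xi>]) simp
  also have "\<dots> = (\<integral>\<^sup>+\<theta>. ?C \<partial>subsph \<xi>)"
    by (rule nn_integral_cong_AE, use AE_subsph[OF \<xi>] in eventually_elim) (simp add: gw_scale)
  also have "\<dots> < \<infinity>"
    using nn_gw_moment_finite[of "CARD('n) - 2"] finite_measure.emeasure_finite[OF finite_subsph[OF \<xi>], of UNIV]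
    by (simp add: ennreal_mult_less_top less_top)
  finally show ?thesis .
qed

section \<open>The thickened incidence relation and its limit\<close>

definition thick :: "real \<Rightarrow> ((real^'n) \<times> (real^'n) \<Rightarrow> real) \<Rightarrow> ennreal" where
  "thick \<epsilon> f = (\<integral>\<^sup>+x. (\<integral>\<^sup>+y. ennreal (gw x) * ennreal (gw y * f (sgn x, sgn y)) * indicator {0..\<epsilon>} (x \<bullet> y) * ennreal (1 / \<epsilon>) \<partial>lborel) \<partial>lborel)"

lemma thick_swap:
  fixes f :: "(real^'n) \<times> (real^'n) \<Rightarrow> real"
  assumes [measurable]: "f \<in> borel_measurable borel" and pos: "\<And>z. f z \<ge> 0"
  shows "thick \<epsilon> (\<lambda>(x, y). f (y, x)) = thick \<epsilon> f"
proof -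
  have [measurable]: "f \<in> borel_measurable (borel \<Otimes>\<^sub>M borel)" by (simp add: borel_prod)
  have "thick \<epsilon> (\<lambda>(x, y). f (y, x)) = (\<integral>\<^sup>+x. (\<integral>\<^sup>+y. ennreal (gw y) * ennreal (gw x * f (sgn y, sgn x)) * indicator {0..\<epsilon>} (y \<bullet> x) * ennreal (1 / \<epsilon>) \<partial>lborel) \<partial>lborel)"
    unfolding thick_def
    by (intro nn_integral_cong) (simp add: inner_commute ennreal_mult' mult_ac)
  also have "\<dots> = thick \<epsilon> f"
    unfolding thick_def by (rule lborel_pair.Fubini') simp
  finally show ?thesis .
qed

text \<open>In the direction of \<open>x\<close> the slab has width
  \<open>\<epsilon> / norm x\<close>. Writing the normal coordinate as that width times u makes the
  range of u the fixed interval [0,1], and \<open>\<epsilon>\<close> survives only inside the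
  continuous integrand, ready for dominated convergence.\<close>

lemma thick_inner:
  fixes f :: "(real^'n) \<times> (real^'n) \<Rightarrow> real"
  assumes [measurable]: "f \<in> borel_measurable borel" and pos: "\<And>z. f z \<ge> 0" and x: "x \<noteq> 0" and \<epsilon>: "\<epsilon> > 0"
  shows "(\<integral>\<^sup>+y. ennreal (gw y * f (sgn x, sgn y)) * indicator {0..\<epsilon>} (x \<bullet> y) * ennreal (1 / \<epsilon>) \<partial>lborel)
    = ennreal (1 / norm x) * (\<integral>\<^sup>+y. (\<integral>\<^sup>+u. ennreal (gw (y + (\<epsilon> * u / norm x) *\<^sub>R sgn x) * f (sgn x, sgn (y + (\<epsilon> * u / norm x) *\<^sub>R sgn x))) * indicator {0..1} u \<partial>lborel)
       \<partial>hyperplane_measure (sgn x))"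
proof -
  have [measurable]: "f \<in> borel_measurable (borel \<Otimes>\<^sub>M borel)" by (simp add: borel_prod)
  let ?e = "sgn x" and ?b = "norm x"
  have e: "norm ?e = 1" using x by (simp add: norm_sgn)
  have b: "?b > 0" using x by simp
  have xe: "x = ?b *\<^sub>R ?e" using x by (simp add: sgn_div_norm)
  let ?G = "\<lambda>y. ennreal (gw y * f (?e, sgn y)) * indicator {0..\<epsilon>} (x \<bullet> y) * ennreal (1 / \<epsilon>)"
  let ?H = "\<lambda>y u. ennreal (gw (y + (\<epsilon> * u / ?b) *\<^sub>R ?e) * f (?e, sgn (y + (\<epsilon> * u / ?b) *\<^sub>R ?e))) * indicator {0..1} u"
  have "(\<integral>\<^sup>+y. ?G y \<partial>lborel) = (\<integral>\<^sup>+y. (\<integral>\<^sup>+s. ?G (y + s *\<^sub>R ?e) \<partial>lborel) \<partial>hyperplane_measure ?e)"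
    by (rule nn_slice[OF e]) measurable
  also have "\<dots> = (\<integral>\<^sup>+y. ennreal (1 / ?b) * (\<integral>\<^sup>+u. ?H y u \<partial>lborel) \<partial>hyperplane_measure ?e)"
  proof (rule nn_integral_cong_AE, use AE_hyperplane_orth[OF e] in eventually_elim)
    fix y assume y: "y \<bullet> ?e = 0"
    have xy: "x \<bullet> (y + s *\<^sub>R ?e) = ?b * s" for s
      using y e by (subst xe) (simp add: inner_simps inner_commute norm_eq_1)
    have "(\<integral>\<^sup>+s. ?G (y + s *\<^sub>R ?e) \<partial>lborel) = ennreal \<bar>\<epsilon> / ?b\<bar> * (\<integral>\<^sup>+u. ?G (y + (0 + \<epsilon> / ?b * u) *\<^sub>R ?e) \<partial>lborel)"
      using b \<epsilon> by (intro nn_integral_real_affine) auto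
    also have "(\<lambda>u. ?G (y + (0 + \<epsilon> / ?b * u) *\<^sub>R ?e)) = (\<lambda>u. ennreal (1 / \<epsilon>) * ?H y u)"
    proof
      fix u
      have "indicator {0..\<epsilon>} (?b * (\<epsilon> / ?b * u)) = (indicator {0..1} u :: ennreal)"
        using b \<epsilon> by (auto simp: indicator_def zero_le_mult_iff)
      then show "?G (y + (0 + \<epsilon> / ?b * u) *\<^sub>R ?e) = ennreal (1 / \<epsilon>) * ?H y u"
        unfolding xy by (simp add: mult_ac)
    qed
    also have "ennreal \<bar>\<epsilon> / ?b\<bar> * (\<integral>\<^sup>+u. ennreal (1 / \<epsilon>) * ?H y u \<partial>lborel) = ennreal \<bar>\<epsilon> / ?b\<bar> * (ennreal (1 / \<epsilon>) * (\<integral>\<^sup>+u. ?H y u \<partial>lborel))"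
      by (subst nn_integral_cmult) simp_all
    also have "\<dots> = ennreal (1 / ?b) * (\<integral>\<^sup>+u. ?H y u \<partial>lborel)"
      using b \<epsilon> by (simp add: mult.assoc[symmetric] ennreal_mult[symmetric])
    finally show "(\<integral>\<^sup>+s. ?G (y + s *\<^sub>R ?e) \<partial>lborel) = ennreal (1 / ?b) * (\<integral>\<^sup>+u. ?H y u \<partial>lborel)" .
  qed
  also have "\<dots> = ennreal (1 / ?b) * (\<integral>\<^sup>+y. (\<integral>\<^sup>+u. ?H y u \<partial>lborel) \<partial>hyperplane_measure ?e)"
    by (rule nn_integral_cmult) measurable
  finally show ?thesis .
qed

text \<open>The bound in the second claim does not depend on \<open>k\<close>; it is the integrable
  majorant for the outer integral in \<open>thick_limit\<close>. It holds because moving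
  \<open>y\<close> off its hyperplane along the normal can only decrease the Gaussian.\<close>

lemma thick_inner_limit:
  fixes f :: "(real^'n) \<times> (real^'n) \<Rightarrow> real"
  assumes n: "CARD('n) > 1" and c: "continuous_on UNIV f" and pos: "\<And>z. f z \<ge> 0" and le: "\<And>z. f z \<le> 1"
    and x: "x \<noteq> 0"
  shows "(\<lambda>k. \<integral>\<^sup>+y. ennreal (gw y * f (sgn x, sgn y)) * indicator {0..1 / Suc k} (x \<bullet> y) * ennreal (1 / (1 / Suc k)) \<partial>lborel)
    \<longlonglongrightarrow> ennreal (1 / norm x) * (\<integral>\<^sup>+y. ennreal (gw y) * ennreal (f (sgn x, sgn y)) \<partial>hyperplane_measure (sgn x))" (is "?A \<longlonglongrightarrow> _")
    and "(\<integral>\<^sup>+y. ennreal (gw y * f (sgn x, sgn y)) * indicator {0..1 / Suc k} (x \<bullet> y) * ennreal (1 / (1 / Suc k)) \<partial>lborel)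
      \<le> ennreal (1 / norm x) * (\<integral>\<^sup>+y. ennreal (gw y) \<partial>hyperplane_measure (sgn x))"
proof -
  have fm[measurable]: "f \<in> borel_measurable borel" by (rule borel_measurable_continuous_onI[OF c])
  have [measurable]: "f \<in> borel_measurable (borel \<Otimes>\<^sub>M borel)" by (simp add: borel_prod)
  let ?e = "sgn x" and ?b = "norm x"
  have e: "norm ?e = 1" using x by (simp add: norm_sgn)
  define H where "H k y u = ennreal (gw (y + (1 / Suc k * u / ?b) *\<^sub>R ?e) * f (?e, sgn (y + (1 / Suc k * u / ?b) *\<^sub>R ?e))) * indicator {0..1} u" for k :: nat and y u
  have Hm[measurable]: "(\<lambda>(y, u). H k y u) \<in> borel_measurable (borel \<Otimes>\<^sub>M borel)" for k
    unfolding H_def by measurable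
  have eq: "?A k = ennreal (1 / ?b) * (\<integral>\<^sup>+y. (\<integral>\<^sup>+u. H k y u \<partial>lborel) \<partial>hyperplane_measure ?e)" for k
    unfolding H_def using pos x by (intro thick_inner) auto
  have Hle: "H k y u \<le> ennreal (gw y) * indicator {0..1} u" if y: "y \<bullet> ?e = 0" for k y u
  proof -
    have "gw (y + (1 / Suc k * u / ?b) *\<^sub>R ?e) = gw y * gw ((1 / Suc k * u / ?b) *\<^sub>R ?e)"
      by (rule gw_add_orth) (use y in simp)
    also have "\<dots> \<le> gw y * 1" by (intro mult_left_mono gw_le) simp
    finally have "gw (y + (1 / Suc k * u / ?b) *\<^sub>R ?e) * f (?e, sgn (y + (1 / Suc k * u / ?b) *\<^sub>R ?e)) \<le> gw y * 1"
      by (intro mult_mono le pos) auto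
    then show ?thesis unfolding H_def by (intro mult_right_mono ennreal_leI) auto
  qed
  have bound: "(\<integral>\<^sup>+u. H k y u \<partial>lborel) \<le> ennreal (gw y)" if y: "y \<bullet> ?e = 0" for k y
  proof -
    have "(\<integral>\<^sup>+u. H k y u \<partial>lborel) \<le> (\<integral>\<^sup>+u. ennreal (gw y) * indicator {0..1} (u::real) \<partial>lborel)"
      by (intro nn_integral_mono Hle y)
    then show ?thesis by (simp add: nn_integral_cmult)
  qed
  have lim_u: "(\<lambda>k. \<integral>\<^sup>+u. H k y u \<partial>lborel) \<longlonglongrightarrow> ennreal (gw y) * ennreal (f (?e, sgn y))"
    if y: "y \<bullet> ?e = 0" "y \<noteq> 0" for y
  proof -
    have "(\<lambda>k. \<integral>\<^sup>+u. H k y u \<partial>lborel) \<longlonglongrightarrow> (\<integral>\<^sup>+u. ennreal (gw y * f (?e, sgn y)) * indicator {0..1} (u::real) \<partial>lborel)"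
    proof (rule nn_integral_dominated_convergence[where w = "\<lambda>u. ennreal (gw y) * indicator {0..1} u"])
      show "(\<integral>\<^sup>+u. ennreal (gw y) * indicator {0..1} (u::real) \<partial>lborel) < \<infinity>"
        by (simp add: nn_integral_cmult)
      show "AE u in lborel. (\<lambda>k. H k y u) \<longlonglongrightarrow> ennreal (gw y * f (?e, sgn y)) * indicator {0..1} u"
      proof (rule AE_I2)
        fix u :: real
        have "(\<lambda>k. 1 / real (Suc k) * u / ?b) \<longlonglongrightarrow> 0 * u / ?b"
          by (intro tendsto_intros LIMSEQ_inverse_real_of_nat[unfolded inverse_eq_divide]) (use x in simp)
        then have l: "(\<lambda>k. y + (1 / Suc k * u / ?b) *\<^sub>R ?e) \<longlonglongrightarrow> y + 0 *\<^sub>R ?e"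
          by (intro tendsto_intros) simp
        have cg: "isCont gw y"
          using continuous_on_gw[OF continuous_on_id, of "UNIV :: (real^'n) set"]
          by (simp add: continuous_on_eq_continuous_at)
        have l1: "(\<lambda>k. gw (y + (1 / Suc k * u / ?b) *\<^sub>R ?e)) \<longlonglongrightarrow> gw y"
          using isCont_tendsto_compose[OF cg l[unfolded scaleR_zero_left add_0_right]] .
        have l2: "(\<lambda>k. (?e, sgn (y + (1 / Suc k * u / ?b) *\<^sub>R ?e))) \<longlonglongrightarrow> (?e, sgn y)"
          using l y by (intro tendsto_intros) auto
        have l3: "(\<lambda>k. f (?e, sgn (y + (1 / Suc k * u / ?b) *\<^sub>R ?e))) \<longlonglongrightarrow> f (?e, sgn y)"
          using isCont_tendsto_compose[of "(?e, sgn y)" f, OF _ l2] c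
          by (simp add: continuous_on_eq_continuous_at)
        have "(\<lambda>k. ennreal (gw (y + (1 / Suc k * u / ?b) *\<^sub>R ?e) * f (?e, sgn (y + (1 / Suc k * u / ?b) *\<^sub>R ?e)))) \<longlonglongrightarrow> ennreal (gw y * f (?e, sgn y))"
          by (intro tendsto_ennrealI tendsto_mult l1 l3)
        then show "(\<lambda>k. H k y u) \<longlonglongrightarrow> ennreal (gw y * f (?e, sgn y)) * indicator {0..1} u"
          unfolding H_def by (cases "u \<in> {0..1}") auto
      qed
    qed (use Hle[OF y(1)] in auto)
    then show ?thesis by (simp add: nn_integral_cmult ennreal_mult' )
  qed
  have "(\<lambda>k. \<integral>\<^sup>+y. (\<integral>\<^sup>+u. H k y u \<partial>lborel) \<partial>hyperplane_measure ?e) \<longlonglongrightarrow> (\<integral>\<^sup>+y. ennreal (gw y) * ennreal (f (?e, sgn y)) \<partial>hyperplane_measure ?e)"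
  proof (rule nn_integral_dominated_convergence[where w = "\<lambda>y. ennreal (gw y)"])
    show "AE y in hyperplane_measure ?e. (\<integral>\<^sup>+u. H k y u \<partial>lborel) \<le> ennreal (gw y)" for k
      using AE_hyperplane_orth[OF e] by eventually_elim (rule bound)
    \<comment> \<open>\<open>sgn\<close> is discontinuous at 0, so convergence is asserted off the
      origin, which is a null set of the hyperplane because n > 1.\<close>
    show "AE y in hyperplane_measure ?e. (\<lambda>k. \<integral>\<^sup>+u. H k y u \<partial>lborel) \<longlonglongrightarrow> ennreal (gw y) * ennreal (f (?e, sgn y))"
      using AE_hyperplane_orth[OF e] AE_hyperplane_nonzero[OF n e] by eventually_elim (rule lim_u)
    show "(\<integral>\<^sup>+y. ennreal (gw y) \<partial>hyperplane_measure ?e) < \<infinity>" by (rule nn_gw_hyperplane_finite[OF n e])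
  qed measurable
  then show "?A \<longlonglongrightarrow> ennreal (1 / ?b) * (\<integral>\<^sup>+y. ennreal (gw y) * ennreal (f (?e, sgn y)) \<partial>hyperplane_measure ?e)"
    unfolding eq by (intro ennreal_tendsto_cmult) auto
  have "(\<integral>\<^sup>+y. (\<integral>\<^sup>+u. H k y u \<partial>lborel) \<partial>hyperplane_measure ?e) \<le> (\<integral>\<^sup>+y. ennreal (gw y) \<partial>hyperplane_measure ?e)"
    by (rule nn_integral_mono_AE) (use AE_hyperplane_orth[OF e] in eventually_elim, rule bound)
  then show "?A k \<le> ennreal (1 / ?b) * (\<integral>\<^sup>+y. ennreal (gw y) \<partial>hyperplane_measure ?e)"
    unfolding eq by (rule mult_left_mono) simp
qed

lemma nn_flag_finite:
  "(\<integral>\<^sup>+\<xi>. emeasure (subsph \<xi>) UNIV \<partial>(sph :: (real^'n) measure)) < \<infinity>"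
proof -
  let ?B = "of_nat (CARD('n) - 1) * emeasure lborel (cball (0::real^'n) 2)"
  have "(\<integral>\<^sup>+\<xi>. emeasure (subsph \<xi>) UNIV \<partial>(sph :: (real^'n) measure)) \<le> (\<integral>\<^sup>+\<xi>. ?B \<partial>(sph :: (real^'n) measure))"
    by (rule nn_integral_mono_AE, use AE_sph_norm in eventually_elim) (rule emeasure_subsph_le)
  also have "\<dots> < \<infinity>"
    using emeasure_lborel_cball_finite[of "0::real^'n" 2] finite_measure.emeasure_finite[OF finite_sph, of "UNIV :: (real^'n) set"]
    by (simp add: ennreal_mult_less_top of_nat_less_top less_top)
  finally show ?thesis .
qed

lemma thick_limit:
  fixes f :: "(real^'n) \<times> (real^'n) \<Rightarrow> real"
  assumes n: "CARD('n) > 1" and c: "continuous_on UNIV f" and pos: "\<And>z. f z \<ge> 0" and le: "\<And>z. f z \<le> 1"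
  defines "C \<equiv> \<integral>\<^sup>+r. ennreal (gw r) * ennreal (r ^ (CARD('n) - 2)) * indicator {0<..} r \<partial>lborel"
  shows "(\<lambda>k. thick (1 / Suc k) f) \<longlonglongrightarrow> C * C * (\<integral>\<^sup>+\<xi>. (\<integral>\<^sup>+\<theta>. ennreal (f (\<xi>, \<theta>)) \<partial>subsph \<xi>) \<partial>sph)"
proof -
  have fm[measurable]: "f \<in> borel_measurable borel" by (rule borel_measurable_continuous_onI[OF c])
  have [measurable]: "f \<in> borel_measurable (borel \<Otimes>\<^sub>M borel)" by (simp add: borel_prod)
  define A where "A k x = (\<integral>\<^sup>+y. ennreal (gw y * f (sgn x, sgn y)) * indicator {0..1 / Suc k} (x \<bullet> y) * ennreal (1 / (1 / Suc k)) \<partial>lborel)" for k :: nat and x :: "real^'n"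
  have [measurable]: "A k \<in> borel_measurable borel" for k unfolding A_def by measurable
  have th: "thick (1 / Suc k) f = (\<integral>\<^sup>+x. ennreal (gw x) * A k x \<partial>lborel)" for k
    unfolding thick_def A_def by (subst nn_integral_cmult[symmetric]) (measurable, simp add: mult.assoc)
  have nz: "AE x in lborel. x \<noteq> (0::real^'n)" by (rule AE_lborel_singleton)
  have fr: "(\<integral>\<^sup>+x. ennreal (gw x / norm x) * (\<integral>\<^sup>+y. ennreal (gw y) * h (sgn x, sgn y) \<partial>hyperplane_measure (sgn x)) \<partial>lborel)
      = C * C * (\<integral>\<^sup>+\<xi>. (\<integral>\<^sup>+\<theta>. h (\<xi>, \<theta>) \<partial>subsph \<xi>) \<partial>sph)" if "h \<in> borel_measurable borel" for h :: "(real^'n) \<times> (real^'n) \<Rightarrow> ennreal"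
    unfolding C_def by (rule frame_weighted[OF n that])
  have hm: "(\<lambda>x. \<integral>\<^sup>+y. ennreal (gw y) * h (sgn x, sgn y) \<partial>hyperplane_measure (sgn x)) \<in> borel_measurable borel"
    if [measurable]: "h \<in> borel_measurable (borel \<Otimes>\<^sub>M borel)" for h :: "(real^'n) \<times> (real^'n) \<Rightarrow> ennreal"
    using borel_measurable_nn_integral_hyperplane[of "\<lambda>(x, y). ennreal (gw y) * h (sgn x, sgn y)" borel sgn] by simp
  have hm1: "(\<lambda>x. \<integral>\<^sup>+y. ennreal (gw y) * 1 \<partial>hyperplane_measure (sgn (x :: real^'n))) \<in> borel_measurable borel"
    by (rule hm[of "\<lambda>_. 1"]) simp
  have hmf: "(\<lambda>x. \<integral>\<^sup>+y. ennreal (gw y) * ennreal (f (sgn x, sgn y)) \<partial>hyperplane_measure (sgn x)) \<in> borel_measurable borel"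
    by (rule hm[of "\<lambda>z. ennreal (f z)"]) simp
  note [measurable] = hm1 hmf
  have sp: "ennreal (gw x) * (ennreal (1 / norm x) * X) = ennreal (gw x / norm x) * X" for x :: "real^'n" and X
    by (simp add: mult.assoc[symmetric] ennreal_mult[symmetric])
  have "(\<lambda>k. thick (1 / Suc k) f) \<longlonglongrightarrow> (\<integral>\<^sup>+x. ennreal (gw x / norm x) * (\<integral>\<^sup>+y. ennreal (gw y) * ennreal (f (sgn x, sgn y)) \<partial>hyperplane_measure (sgn x)) \<partial>lborel)"
    unfolding th
  proof (rule nn_integral_dominated_convergence[where w = "\<lambda>x. ennreal (gw x / norm x) * (\<integral>\<^sup>+y. ennreal (gw y) * 1 \<partial>hyperplane_measure (sgn x))"])
    show "AE x in lborel. ennreal (gw x) * A k x \<le> ennreal (gw x / norm x) * (\<integral>\<^sup>+y. ennreal (gw y) * 1 \<partial>hyperplane_measure (sgn x))" for k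
      using nz
    proof eventually_elim
      fix x :: "real^'n" assume "x \<noteq> 0"
      from thick_inner_limit(2)[OF n c pos le this, of k]
      show "ennreal (gw x) * A k x \<le> ennreal (gw x / norm x) * (\<integral>\<^sup>+y. ennreal (gw y) * 1 \<partial>hyperplane_measure (sgn x))"
        unfolding A_def[symmetric] sp[symmetric] by (intro mult_left_mono) auto
    qed
    show "AE x in lborel. (\<lambda>k. ennreal (gw x) * A k x) \<longlonglongrightarrow> ennreal (gw x / norm x) * (\<integral>\<^sup>+y. ennreal (gw y) * ennreal (f (sgn x, sgn y)) \<partial>hyperplane_measure (sgn x))"
      using nz
    proof eventually_elim
      fix x :: "real^'n" assume "x \<noteq> 0"
      from thick_inner_limit(1)[OF n c pos le this]
      show "(\<lambda>k. ennreal (gw x) * A k x) \<longlonglongrightarrow> ennreal (gw x / norm x) * (\<integral>\<^sup>+y. ennreal (gw y) * ennreal (f (sgn x, sgn y)) \<partial>hyperplane_measure (sgn x))"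
        unfolding A_def[symmetric] sp[symmetric] by (intro ennreal_tendsto_cmult) auto
    qed
    show "(\<integral>\<^sup>+x. ennreal (gw x / norm (x :: real^'n)) * (\<integral>\<^sup>+y. ennreal (gw y) * 1 \<partial>hyperplane_measure (sgn x)) \<partial>lborel) < \<infinity>"
    proof -
      have "(\<integral>\<^sup>+x. ennreal (gw x / norm (x :: real^'n)) * (\<integral>\<^sup>+y. ennreal (gw y) * 1 \<partial>hyperplane_measure (sgn x)) \<partial>lborel)
        = C * C * (\<integral>\<^sup>+\<xi>. (\<integral>\<^sup>+\<theta>. 1 \<partial>subsph \<xi>) \<partial>(sph :: (real^'n) measure))"
        by (rule fr[of "\<lambda>_. 1"]) simp
      also have "\<dots> < \<infinity>"
        using nn_flag_finite[where 'n = 'n] nn_gw_moment_finite[of "CARD('n) - 2"]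
        by (simp add: C_def ennreal_mult_less_top)
      finally show ?thesis .
    qed
  qed measurable
  then show ?thesis by (subst (asm) fr) simp_all
qed

text \<open>Incident pairs of unit vectors, the first chosen by \<open>sph\<close> and the second by
  \<open>subsph\<close> of the first. Written as one image of a density on pairs, it is a single
  Borel measure to which uniqueness by continuous test functions applies.\<close>

definition flag_measure :: "((real^'n) \<times> (real^'n)) measure" where
  "flag_measure = distr (density (lborel \<Otimes>\<^sub>M lborel) (\<lambda>(x, y). of_nat CARD('n) * of_nat (CARD('n) - 1) * indicator (cball 0 1 - {0}) x
     * indicator (cball 0 1 - {0}) (proj (sgn x) y) * indicator {y. 0 \<le> y \<bullet> sgn x \<and> y \<bullet> sgn x \<le> 1} y))
     borel (\<lambda>(x, y). (sgn x, sgn (proj (sgn x) y)))"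

lemma nn_integral_flag:
  fixes \<Phi> :: "(real^'n) \<times> (real^'n) \<Rightarrow> ennreal"
  assumes [measurable]: "\<Phi> \<in> borel_measurable borel"
  shows "(\<integral>\<^sup>+z. \<Phi> z \<partial>flag_measure) = (\<integral>\<^sup>+\<xi>. (\<integral>\<^sup>+\<theta>. \<Phi> (\<xi>, \<theta>) \<partial>subsph \<xi>) \<partial>sph)"
proof -
  have [measurable]: "\<Phi> \<in> borel_measurable (borel \<Otimes>\<^sub>M borel)" by (simp add: borel_prod)
  have [measurable]: "(\<lambda>(x, y). (sgn x, sgn (proj (sgn x) y))) \<in> (borel \<Otimes>\<^sub>M borel) \<rightarrow>\<^sub>M (borel :: ((real^'n) \<times> (real^'n)) measure)"
    unfolding borel_prod[symmetric] by measurable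
  define D :: "real^'n \<Rightarrow> real^'n \<Rightarrow> ennreal" where
    "D x y = of_nat CARD('n) * of_nat (CARD('n) - 1) * indicator (cball 0 1 - {0}) x
     * indicator (cball 0 1 - {0}) (proj (sgn x) y) * indicator {y. 0 \<le> y \<bullet> sgn x \<and> y \<bullet> sgn x \<le> 1} y" for x y
  have [measurable]: "(\<lambda>(x, y). D x y) \<in> borel_measurable (borel \<Otimes>\<^sub>M borel)"
    unfolding D_def by measurable
  have fl: "flag_measure = distr (density (lborel \<Otimes>\<^sub>M lborel) (\<lambda>(x, y). D x y)) borel (\<lambda>(x, y). (sgn x, sgn (proj (sgn x) y)))"
    by (simp add: flag_measure_def D_def)
  have inner: "(\<integral>\<^sup>+y. D x y * \<Phi> (sgn x, sgn (proj (sgn x) y)) \<partial>lborel)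
      = of_nat CARD('n) * ((\<integral>\<^sup>+\<theta>. \<Phi> (sgn x, \<theta>) \<partial>subsph (sgn x)) * indicator (cball 0 1 - {0}) x)" for x
  proof -
    have "(\<integral>\<^sup>+y. D x y * \<Phi> (sgn x, sgn (proj (sgn x) y)) \<partial>lborel)
       = (\<integral>\<^sup>+y. (of_nat CARD('n) * of_nat (CARD('n) - 1) * indicator (cball 0 1 - {0}) x) * (\<Phi> (sgn x, sgn (proj (sgn x) y))
     * indicator (cball 0 1 - {0}) (proj (sgn x) y) * indicator {y. 0 \<le> y \<bullet> sgn x \<and> y \<bullet> sgn x \<le> 1} y) \<partial>lborel)"
      by (intro nn_integral_cong) (simp add: D_def mult_ac)
    also have "\<dots> = (of_nat CARD('n) * of_nat (CARD('n) - 1) * indicator (cball 0 1 - {0}) x) * (\<integral>\<^sup>+y. (\<Phi> (sgn x, sgn (proj (sgn x) y))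
     * indicator (cball 0 1 - {0}) (proj (sgn x) y) * indicator {y. 0 \<le> y \<bullet> sgn x \<and> y \<bullet> sgn x \<le> 1} y) \<partial>lborel)"
      by (rule nn_integral_cmult) measurable
    also have "\<dots> = of_nat CARD('n) * ((\<integral>\<^sup>+\<theta>. \<Phi> (sgn x, \<theta>) \<partial>subsph (sgn x)) * indicator (cball 0 1 - {0}) x)"
      by (subst nn_integral_subsph) (measurable, simp add: mult_ac)
    finally show ?thesis .
  qed
  have "(\<integral>\<^sup>+z. \<Phi> z \<partial>flag_measure) = (\<integral>\<^sup>+z. (case z of (x, y) \<Rightarrow> D x y * \<Phi> (sgn x, sgn (proj (sgn x) y))) \<partial>(lborel \<Otimes>\<^sub>M lborel))"
    unfolding fl by (simp add: nn_integral_distr nn_integral_density split_beta')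
  also have "\<dots> = (\<integral>\<^sup>+x. (\<integral>\<^sup>+y. D x y * \<Phi> (sgn x, sgn (proj (sgn x) y)) \<partial>lborel) \<partial>lborel)"
    by (subst lborel.nn_integral_fst[symmetric]) simp_all
  also have "\<dots> = of_nat CARD('n) * (\<integral>\<^sup>+x. (\<integral>\<^sup>+\<theta>. \<Phi> (sgn x, \<theta>) \<partial>subsph (sgn x)) * indicator (cball 0 1 - {0}) x \<partial>lborel)"
    unfolding inner by (rule nn_integral_cmult) measurable
  also have "\<dots> = (\<integral>\<^sup>+\<xi>. (\<integral>\<^sup>+\<theta>. \<Phi> (\<xi>, \<theta>) \<partial>subsph \<xi>) \<partial>sph)"
    by (subst nn_integral_sph) simp_all
  finally show ?thesis .
qed

text \<open>A continuous function and its transpose have the same thickened integrals, hence limits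
  that agree. This identifies \<open>flag_measure\<close> with its image under swapping, and the
  identity extends from continuous to all nonnegative Borel functions.\<close>

theorem nn_integral_flag_swap:
  fixes \<Phi> :: "(real^'n) \<times> (real^'n) \<Rightarrow> ennreal"
  assumes n: "CARD('n) > 1" and [measurable]: "\<Phi> \<in> borel_measurable borel"
  shows "(\<integral>\<^sup>+\<xi>. (\<integral>\<^sup>+\<theta>. \<Phi> (\<xi>, \<theta>) \<partial>subsph \<xi>) \<partial>sph) = (\<integral>\<^sup>+\<theta>. (\<integral>\<^sup>+\<xi>. \<Phi> (\<xi>, \<theta>) \<partial>subsph \<theta>) \<partial>sph)"
proof -
  have sw: "prod.swap \<in> borel \<rightarrow>\<^sub>M (borel :: ((real^'n) \<times> (real^'n)) measure)"
  proof -
    have sd: "prod.swap = (\<lambda>z :: (real^'n) \<times> (real^'n). (snd z, fst z))" by auto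
    show ?thesis unfolding borel_prod[symmetric] by (subst sd) measurable
  qed
  note [measurable] = sw
  let ?C = "\<integral>\<^sup>+r. ennreal (gw r) * ennreal (r ^ (CARD('n) - 2)) * indicator {0<..} r \<partial>lborel"
  \<comment> \<open>Cancelling in \<open>ennreal\<close> requires the constant to be neither 0 nor
    infinite.\<close>
  have C: "?C * ?C \<noteq> 0" "?C * ?C \<noteq> \<infinity>"
    using nn_gw_moment_finite[of "CARD('n) - 2"] nn_gw_moment_pos[of "CARD('n) - 2"]
    by (auto simp: ennreal_mult_eq_top_iff)
  have fin: "finite_measure (flag_measure :: ((real^'n) \<times> (real^'n)) measure)"
  proof
    have "emeasure flag_measure (UNIV :: ((real^'n) \<times> (real^'n)) set) = (\<integral>\<^sup>+z. 1 \<partial>(flag_measure :: ((real^'n) \<times> (real^'n)) measure))"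
      by (simp add: flag_measure_def)
    also have "\<dots> < \<infinity>" using nn_flag_finite by (subst nn_integral_flag) simp_all
    finally show "emeasure flag_measure (space (flag_measure :: ((real^'n) \<times> (real^'n)) measure)) \<noteq> \<infinity>"
      by (simp add: flag_measure_def less_top)
  qed
  have se[measurable_cong]: "sets (flag_measure :: ((real^'n) \<times> (real^'n)) measure) = sets borel" by (simp add: flag_measure_def)
  have eq: "distr flag_measure borel prod.swap = (flag_measure :: ((real^'n) \<times> (real^'n)) measure)"
  proof (rule finite_borel_measure_eqI)
    show "finite_measure (distr flag_measure borel prod.swap :: ((real^'n) \<times> (real^'n)) measure)"
      by (rule finite_measure.finite_measure_distr[OF fin]) simp
    fix f :: "(real^'n) \<times> (real^'n) \<Rightarrow> real"
    assume f: "continuous_on UNIV f" "\<And>z. 0 \<le> f z" "\<And>z. f z \<le> 1"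
    have fm[measurable]: "f \<in> borel_measurable borel" by (rule borel_measurable_continuous_onI[OF f(1)])
    let ?f' = "\<lambda>(x, y). f (y, x)"
    have f': "continuous_on UNIV ?f'" "\<And>z. 0 \<le> ?f' z" "\<And>z. ?f' z \<le> 1"
      using f by (auto simp: split_beta' intro!: continuous_on_compose2[OF f(1)] continuous_intros)
    have f'm[measurable]: "?f' \<in> borel_measurable borel" by (rule borel_measurable_continuous_onI[OF f'(1)])
    have "?C * ?C * (\<integral>\<^sup>+\<xi>. (\<integral>\<^sup>+\<theta>. ennreal (?f' (\<xi>, \<theta>)) \<partial>subsph \<xi>) \<partial>sph) = ?C * ?C * (\<integral>\<^sup>+\<xi>. (\<integral>\<^sup>+\<theta>. ennreal (f (\<xi>, \<theta>)) \<partial>subsph \<xi>) \<partial>sph)"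
      using LIMSEQ_unique[OF thick_limit[OF n f'] thick_limit[OF n f, folded thick_swap[OF fm f(2)]]] .
    then have "(\<integral>\<^sup>+\<xi>. (\<integral>\<^sup>+\<theta>. ennreal (?f' (\<xi>, \<theta>)) \<partial>subsph \<xi>) \<partial>sph) = (\<integral>\<^sup>+\<xi>. (\<integral>\<^sup>+\<theta>. ennreal (f (\<xi>, \<theta>)) \<partial>subsph \<xi>) \<partial>sph)"
      using C by (simp add: ennreal_mult_cancel_left)
    then have "(\<integral>\<^sup>+z. ennreal (?f' z) \<partial>flag_measure) = (\<integral>\<^sup>+z. ennreal (f z) \<partial>flag_measure)"
      by (subst (1 2) nn_integral_flag) simp_all
    then show "(\<integral>\<^sup>+z. ennreal (f z) \<partial>distr flag_measure borel prod.swap) = (\<integral>\<^sup>+z. ennreal (f z) \<partial>flag_measure)"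
      by (subst nn_integral_distr) (simp_all add: prod.swap_def split_beta')
  qed (use fin in \<open>simp_all add: flag_measure_def\<close>)
  have "(\<integral>\<^sup>+\<xi>. (\<integral>\<^sup>+\<theta>. \<Phi> (\<xi>, \<theta>) \<partial>subsph \<xi>) \<partial>sph) = (\<integral>\<^sup>+z. \<Phi> z \<partial>flag_measure)"
    by (subst nn_integral_flag) simp_all
  also have "\<dots> = (\<integral>\<^sup>+z. \<Phi> (prod.swap z) \<partial>flag_measure)"
    by (subst eq[symmetric], subst nn_integral_distr) simp_all
  also have "\<dots> = (\<integral>\<^sup>+\<theta>. (\<integral>\<^sup>+\<xi>. \<Phi> (\<xi>, \<theta>) \<partial>subsph \<theta>) \<partial>sph)"
    by (subst nn_integral_flag) simp_all
  finally show ?thesis .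
qed

subsection \<open>Gaussian moments and Hermite polynomials\<close>

lemma integral_even:
  fixes f :: "real \<Rightarrow> real"
  assumes "integrable lborel f" "\<And>s. f (- s) = f s"
  shows "(\<integral>s. f s \<partial>lborel) = 2 * (\<integral>s. f s * indicator {0<..} s \<partial>lborel)"
proof -
  have i: "integrable lborel (\<lambda>s. f s * indicator {0<..} s)"
    using integrable_mult_indicator[OF _ assms(1), of "{0<..}"] by (simp add: mult.commute)
  have "(\<integral>s. f s * indicator {0<..} s \<partial>lborel) = (\<integral>s. f (0 + - 1 * s) * indicator {0<..} (0 + - 1 * s) \<partial>lborel)"
    by (subst lborel_integral_real_affine[where c = "-1" and t = 0]) simp_all
  also have "\<dots> = (\<integral>s. f s * indicator {..<0} s \<partial>lborel)"
    by (intro Bochner_Integration.integral_cong) (auto simp: assms(2) indicator_def)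
  finally have eq: "(\<integral>s. f s * indicator {0<..} s \<partial>lborel) = (\<integral>s. f s * indicator {..<0} s \<partial>lborel)" .
  have i2: "integrable lborel (\<lambda>s. f s * indicator {..<0} s)"
    using integrable_mult_indicator[OF _ assms(1), of "{..<0}"] by (simp add: mult.commute)
  have "(\<integral>s. f s \<partial>lborel) = (\<integral>s. f s * indicator {0<..} s + f s * indicator {..<0} s \<partial>lborel)"
  proof (rule integral_cong_AE)
    show "AE s in lborel. f s = f s * indicator {0<..} s + f s * indicator {..<0} s"
      using AE_lborel_singleton[of 0] by eventually_elim (auto simp: indicator_def)
    show "f \<in> borel_measurable lborel" using assms(1) by simp
    then show "(\<lambda>s. f s * indicator {0<..} s + f s * indicator {..<0} s) \<in> borel_measurable lborel" by simp
  qed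
  also have "\<dots> = 2 * (\<integral>s. f s * indicator {0<..} s \<partial>lborel)"
    using i i2 eq by simp
  finally show ?thesis .
qed

definition mom :: "nat \<Rightarrow> real" where "mom i = (\<integral>s. gw s * s ^ i \<partial>lborel)"

definition hmom :: "nat \<Rightarrow> real" where "hmom i = (\<integral>s. gw s * s ^ i * indicator {0<..} s \<partial>lborel)"

lemma integrable_hmom: "integrable lborel (\<lambda>s. gw s * s ^ i * indicator {0<..} s :: real)"
  using integrable_mult_indicator[OF _ integrable_gw_moment[of i], of "{0<..}"] by (simp add: mult.commute)

lemma hmom_abs: "2 * hmom i = (\<integral>s. gw s * \<bar>s\<bar> ^ i \<partial>lborel)"
proof -
  have "(\<integral>s. gw s * \<bar>s\<bar> ^ i \<partial>lborel) = 2 * (\<integral>s. gw s * \<bar>s\<bar> ^ i * indicator {0<..} s \<partial>lborel)"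
    by (rule integral_even[OF integrable_gw_moment_abs]) (simp add: gw_def)
  also have "(\<integral>s. gw s * \<bar>s\<bar> ^ i * indicator {0<..} s \<partial>lborel) = hmom i"
    unfolding hmom_def by (intro Bochner_Integration.integral_cong) (auto simp: indicator_def)
  finally show ?thesis by simp
qed

lemma mom_even: "mom (2 * k) = sqrt (2 * pi) * (fact (2 * k) / (2 ^ k * fact k))"
  using integral_std_normal_moment_even[of k] by (simp add: mom_def gw_real mult.assoc)

lemma mom_odd: "mom (2 * k + 1) = 0"
  using integral_std_normal_moment_odd[of k] by (simp add: mom_def gw_real mult.assoc)

lemma mom_0: "mom 0 = sqrt (2 * pi)"
  using mom_even[of 0] by simp

lemma mom_pos: "mom (2 * k) > 0"
  by (simp add: mom_even)

lemma hmom_even: "hmom (2 * k) = mom (2 * k) / 2"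
  using hmom_abs[of "2 * k"] by (simp add: mom_def power_mult)

lemma hmom_odd: "hmom (2 * k + 1) = 2 ^ k * fact k"
proof -
  have "2 * hmom (2 * k + 1) = sqrt (2 * pi) * (\<integral>s. std_normal_density s * \<bar>s\<bar> ^ (2 * k + 1) \<partial>lborel)"
    unfolding hmom_abs gw_real by (simp add: mult.assoc)
  also have "\<dots> = sqrt (2 * pi) * (sqrt (2 / pi) * 2 ^ k * fact k)"
    by (simp only: integral_std_normal_moment_abs_odd)
  also have "\<dots> = 2 * (2 ^ k * fact k)"
    by (simp add: real_sqrt_mult real_sqrt_divide)
  finally show ?thesis by simp
qed

lemma mom_even_rec: "mom (2 * (k + 1)) = (2 * k + 1) * mom (2 * k)"
proof -
  have 1: "fact (2 * (k + 1)) = (2 * real k + 2) * ((2 * real k + 1) * fact (2 * k))" by (simp add: algebra_simps)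
  have 2: "2 ^ (k + 1) * fact (k + 1) = (2 * real k + 2) * (2 ^ k * fact k)" by (simp add: algebra_simps)
  have 3: "2 * real k + 2 \<noteq> 0" by linarith
  have g: "X * ((a * (b * c)) / (a * d)) = b * (X * (c / d))" if "a \<noteq> 0" for X a b c d :: real
    using that by simp
  show ?thesis unfolding mom_even 1 2 by (rule g[OF 3])
qed

lemma mom_rec: "mom (i + 2) = (i + 1) * mom i"
proof (cases "even i")
  case True
  then obtain k where "i = 2 * k" by (auto elim: evenE)
  then show ?thesis using mom_even_rec[of k] by simp
next
  case False
  then obtain k where "i = 2 * k + 1" by (auto elim: oddE)
  then show ?thesis using mom_odd[of k] mom_odd[of "k + 1"] by simp
qed

lemma hmom_rec: "hmom (i + 2) = (i + 1) * hmom i"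
proof (cases "even i")
  case True
  then obtain k where k: "i = 2 * k" by (auto elim: evenE)
  have "hmom (2 * (k + 1)) = (2 * k + 1) * hmom (2 * k)"
    unfolding hmom_even mom_even_rec by simp
  then show ?thesis using k by simp
next
  case False
  then obtain k where k: "i = 2 * k + 1" by (auto elim: oddE)
  then show ?thesis using hmom_odd[of k] hmom_odd[of "k + 1"] by simp
qed

lemma hmom_1: "hmom 1 = 1"
  using hmom_odd[of 0] by simp

section \<open>Hermite polynomials and their Gaussian integrals\<close>

definition PX :: "real poly" where "PX = [:0, 1:]"

lemma poly_PX [simp]: "poly PX s = s"
  and pderiv_PX [simp]: "pderiv PX = 1"
  and PX_times_monom: "PX * monom 1 i = monom 1 (Suc i)"
  by (simp_all add: PX_def pderiv_pCons monom_Suc)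

lemma poly_eqI2: "(\<And>s. poly p s = poly q s) \<Longrightarrow> p = (q :: real poly)"
  by (simp add: poly_eq_poly_eq_iff[symmetric] fun_eq_iff)

text \<open>The probabilists' Hermite polynomials multiplied by (-1)^j: with this sign the j-th
  derivative of the Gaussian is \<open>herm j\<close> times the Gaussian.\<close>

primrec herm :: "nat \<Rightarrow> real poly" where
  "herm 0 = 1"
| "herm (Suc j) = pderiv (herm j) - PX * herm j"

declare herm.simps(2) [simp del]

lemma pderiv_herm_Suc: "pderiv (herm (Suc j)) = smult (- real (Suc j)) (herm j)"
proof (induction j)
  case 0
  show ?case by (simp add: herm.simps(2) PX_def pderiv_pCons pderiv_minus)
next
  case (Suc j)
  have "pderiv (herm (Suc (Suc j))) = pderiv (pderiv (herm (Suc j))) - (PX * pderiv (herm (Suc j)) + herm (Suc j))"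
    unfolding herm.simps(2)[of "Suc j"] pderiv_diff pderiv_mult by simp
  also have "\<dots> = smult (- real (Suc j)) (pderiv (herm j) - PX * herm j) - herm (Suc j)"
    unfolding Suc.IH pderiv_smult by (rule poly_eqI2) (simp add: algebra_simps)
  also have "\<dots> = smult (- real (Suc (Suc j))) (herm (Suc j))"
    unfolding herm.simps(2)[of j, symmetric]
    by (rule poly_eqI2) (simp add: algebra_simps)
  finally show ?case .
qed

lemma herm_rec: "PX * herm (Suc j) = - herm (Suc (Suc j)) - smult (real (Suc j)) (herm j)"
  unfolding herm.simps(2)[of "Suc j"] pderiv_herm_Suc
  by (rule poly_eqI2) (simp add: algebra_simps)

lemma poly_herm_rec: "poly (herm (Suc (Suc j))) s = - s * poly (herm (Suc j)) s - real (Suc j) * poly (herm j) s"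
  using arg_cong[OF herm_rec[of j], of "\<lambda>p. poly p s"] by (simp add: algebra_simps)

lemma poly_herm_minus: "poly (herm j) (- s) = (- 1) ^ j * poly (herm j) s"
proof (induction j rule: less_induct)
  case (less j)
  consider "j = 0" | "j = 1" | i where "j = Suc (Suc i)" by (metis One_nat_def not0_implies_Suc)
  then show ?case
  proof cases
    case 3
    then show ?thesis using less[of i] less[of "Suc i"] by (simp add: poly_herm_rec algebra_simps)
  qed (simp_all add: herm.simps(2) pderiv_pCons)
qed

lemma herm_zero_even: "sqrt (2 * pi) * poly (herm (2 * j)) 0 = (- 1) ^ j * mom (2 * j)"
proof (induction j)
  case (Suc j)
  have "poly (herm (2 * Suc j)) 0 = - (2 * j + 1) * poly (herm (2 * j)) 0"
    using poly_herm_rec[of "2 * j" 0] by (simp add: algebra_simps)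
  then have "sqrt (2 * pi) * poly (herm (2 * Suc j)) 0 = - (2 * j + 1) * (sqrt (2 * pi) * poly (herm (2 * j)) 0)"
    by simp
  then show ?case unfolding Suc using mom_even_rec[of j] by (simp add: algebra_simps)
qed (simp add: mom_0)

lemma herm_zero_nonzero: "poly (herm (2 * j)) 0 \<noteq> 0"
  using herm_zero_even[of j] mom_pos[of j] by auto

lemma linear_on_monoms:
  fixes A B :: "real poly \<Rightarrow> real"
  assumes A: "\<And>p q. A (p + q) = A p + A q" "\<And>c p. A (smult c p) = c * A p"
    and B: "\<And>p q. B (p + q) = B p + B q" "\<And>c p. B (smult c p) = c * B p"
    and m: "\<And>i. A (monom 1 i) = B (monom 1 i)"
  shows "A p = B p"
proof -
  have s: "L (\<Sum>i\<in>I. f i) = (\<Sum>i\<in>I. L (f i))" if "\<And>p q. L (p + q) = L p + L q" "\<And>c p. L (smult c p) = c * L p" "finite I"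
    for L :: "real poly \<Rightarrow> real" and f and I :: "nat set"
    using that(3) by (induction I rule: finite_induct) (use that(1) that(2)[of 0 0] in auto)
  have p: "p = (\<Sum>i\<le>degree p. smult (coeff p i) (monom 1 i))"
    using poly_as_sum_of_monoms[of p] by (simp add: smult_monom)
  show ?thesis
    by (subst (1 2) p) (simp add: s[OF A] s[OF B] A B m)
qed

definition gint :: "real poly \<Rightarrow> real" where "gint p = (\<integral>s. poly p s * gw s \<partial>lborel)"

definition hint :: "nat \<Rightarrow> real poly \<Rightarrow> real" where
  "hint q p = (\<integral>s. s ^ q * poly p s * gw s * indicator {0<..} s \<partial>lborel)"

lemma integrable_poly_gw: "integrable lborel (\<lambda>s. \<bar>s\<bar> ^ q * poly p s * gw s)"
proof -
  have eq: "(\<lambda>s. \<bar>s\<bar> ^ q * poly p s * gw s) = (\<lambda>s. \<Sum>i\<le>degree p. coeff p i * (\<bar>s\<bar> ^ q * s ^ i * gw s))"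
    by (simp add: poly_altdef sum_distrib_left sum_distrib_right mult_ac)
  have "integrable lborel (\<lambda>s. \<bar>s\<bar> ^ q * s ^ i * gw s)" for i
    by (rule Bochner_Integration.integrable_bound[OF integrable_gw_moment_abs[of "q + i"]])
      (auto simp: power_add abs_mult power_abs)
  then show ?thesis unfolding eq by (intro Bochner_Integration.integrable_sum integrable_mult_right)
qed

lemma integrable_poly_gw': "integrable lborel (\<lambda>s. poly p s * gw s)"
  using integrable_poly_gw[of 0 p] by simp

lemma integrable_poly_gw_half: "integrable lborel (\<lambda>s. s ^ q * poly p s * gw s * indicator {0<..} s)"
proof -
  have "integrable lborel (\<lambda>s. \<bar>s\<bar> ^ q * poly p s * gw s * indicator {0<..} s)"
    using integrable_mult_indicator[OF _ integrable_poly_gw[of q p], of "{0<..}"] by (simp add: mult.commute)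
  also have "(\<lambda>s. \<bar>s\<bar> ^ q * poly p s * gw s * indicator {0<..} s) = (\<lambda>s. s ^ q * poly p s * gw s * indicator {0<..} s)"
    by (auto simp: indicator_def)
  finally show ?thesis .
qed

lemma gint_add: "gint (p + q) = gint p + gint q" and gint_smult: "gint (smult c p) = c * gint p"
  using integrable_poly_gw'[of p] integrable_poly_gw'[of q]
  by (simp_all add: gint_def distrib_right mult.assoc)

lemma hint_add: "hint r (p + q) = hint r p + hint r q" and hint_smult: "hint r (smult c p) = c * hint r p"
proof -
  show "hint r (p + q) = hint r p + hint r q"
    unfolding hint_def using integrable_poly_gw_half[of r p] integrable_poly_gw_half[of r q]
    by (simp add: distrib_right distrib_left)
  have "hint r (smult c p) = (\<integral>s. c * (s ^ r * poly p s * gw s * indicator {0<..} s) \<partial>lborel)"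
    unfolding hint_def by (simp add: mult_ac)
  then show "hint r (smult c p) = c * hint r p" by (simp add: hint_def)
qed

lemma gint_monom: "gint (monom 1 i) = mom i"
  by (simp add: gint_def mom_def poly_monom mult.commute)

lemma hint_monom: "hint q (monom 1 i) = hmom (q + i)"
  by (simp add: hint_def hmom_def poly_monom power_add mult_ac)

lemma gint_times_X: "gint (PX * p) = gint (pderiv p)"
proof (rule linear_on_monoms[where A = "\<lambda>p. gint (PX * p)" and B = "\<lambda>p. gint (pderiv p)"])
  show "gint (PX * monom 1 i) = gint (pderiv (monom 1 i))" for i
  proof (cases i)
    case 0
    then show ?thesis using mom_odd[of 0] gint_monom[of 1]
      by (simp add: PX_times_monom pderiv_monom gint_def poly_monom)
  next
    case (Suc j)
    have "PX * monom 1 i = (monom 1 (Suc (Suc j)) :: real poly)" by (simp add: Suc PX_times_monom)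
    moreover have "pderiv (monom 1 i) = smult (real (Suc j)) (monom 1 j)"
      by (simp add: Suc pderiv_monom smult_monom)
    ultimately show ?thesis using mom_rec[of j] by (simp add: gint_monom gint_smult)
  qed
qed (simp_all add: gint_add gint_smult pderiv_add pderiv_smult distrib_left)

text \<open>Integration by parts on the half-line: \<open>(pderiv p - PX * p)\<close> times the
  Gaussian is the derivative of \<open>p\<close> times the Gaussian, and the power
  \<open>Suc q\<close> of s kills the boundary term at 0. On monomials this is just the recursion
  \<open>hmom_rec\<close>.\<close>

lemma hint_herm_step: "hint (Suc q) (pderiv p - PX * p) = - real (Suc q) * hint q p"
proof (rule linear_on_monoms[where A = "\<lambda>p. hint (Suc q) (pderiv p - PX * p)" and B = "\<lambda>p. - real (Suc q) * hint q p"])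
  have m: "hint r (- p) = - hint r p" for r p using hint_smult[of r "-1" p] by simp
  have d: "hint r (p - p') = hint r p - hint r p'" for r p p' using hint_add[of r p "- p'"] by (simp add: m)
  show "hint (Suc q) (pderiv (monom 1 i) - PX * monom 1 i) = - real (Suc q) * hint q (monom 1 i)" for i
  proof -
    have "PX * monom 1 i = (monom 1 (Suc i) :: real poly)" by (simp add: PX_times_monom)
    moreover have "hint (Suc q) (pderiv (monom 1 i)) = real i * hmom (q + i)"
    proof (cases i)
      case (Suc j)
      then have "pderiv (monom 1 i) = smult (real (Suc j)) (monom 1 j)" by (simp add: pderiv_monom smult_monom)
      then show ?thesis by (simp add: hint_smult hint_monom Suc)
    qed (simp add: pderiv_monom hint_def)
    ultimately show ?thesis using hmom_rec[of "q + i"] by (simp add: d hint_monom algebra_simps)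
  qed
  show "hint (Suc q) (pderiv (p + p') - PX * (p + p')) = hint (Suc q) (pderiv p - PX * p) + hint (Suc q) (pderiv p' - PX * p')" for p p'
    by (simp add: d hint_add pderiv_add distrib_left)
  show "hint (Suc q) (pderiv (smult c p) - PX * smult c p) = c * hint (Suc q) (pderiv p - PX * p)" for c p
    by (simp add: d hint_smult pderiv_smult right_diff_distrib)
qed (simp_all add: hint_add hint_smult distrib_left)

text \<open>The last integration by parts, with no power of s left: only the boundary value at 0
  remains.\<close>

lemma hint_herm_0: "hint 0 (pderiv p - PX * p) = - poly p 0"
proof (rule linear_on_monoms[where A = "\<lambda>p. hint 0 (pderiv p - PX * p)" and B = "\<lambda>p. - poly p 0"])
  have m: "hint r (- p) = - hint r p" for r p using hint_smult[of r "-1" p] by simp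
  have d: "hint r (p - p') = hint r p - hint r p'" for r p p' using hint_add[of r p "- p'"] by (simp add: m)
  show "hint 0 (pderiv (monom 1 i) - PX * monom 1 i) = - poly (monom 1 i) 0" for i
  proof -
    have x: "PX * monom 1 i = (monom 1 (Suc i) :: real poly)" by (simp add: PX_times_monom)
    show ?thesis
    proof (cases i)
      case (Suc j)
      then have "pderiv (monom 1 i) = smult (real (Suc j)) (monom 1 j)" by (simp add: pderiv_monom smult_monom)
      then show ?thesis unfolding x using hmom_rec[of j] by (simp add: d hint_smult hint_monom Suc poly_monom)
    next
      case 0
      then show ?thesis unfolding x using hmom_1 by (simp add: d m hint_monom pderiv_monom poly_monom)
    qed
  qed
  show "hint 0 (pderiv (p + p') - PX * (p + p')) = hint 0 (pderiv p - PX * p) + hint 0 (pderiv p' - PX * p')" for p p'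
    by (simp add: d hint_add pderiv_add distrib_left)
  show "hint 0 (pderiv (smult c p) - PX * smult c p) = c * hint 0 (pderiv p - PX * p)" for c p
    by (simp add: d hint_smult pderiv_smult right_diff_distrib)
qed simp_all

lemma hint_herm: "hint q (herm (j + q + 1)) = (- 1) ^ (q + 1) * fact q * poly (herm j) 0"
proof (induction q)
  case 0
  then show ?case using hint_herm_0[of "herm j"] by (simp add: herm.simps(2))
next
  case (Suc q)
  have "hint (Suc q) (herm (j + Suc q + 1)) = - real (Suc q) * hint q (herm (j + q + 1))"
    using hint_herm_step[of q "herm (j + q + 1)"] by (simp add: herm.simps(2))
  then show ?case unfolding Suc by (simp add: algebra_simps)
qed

text \<open>For odd q the derivative of order q + 1 of |s|^q is 2 q! times the Dirac mass at 0. Here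
  this is tested against \<open>herm j\<close> times the Gaussian, whose derivative of order q + 1
  is \<open>herm (j + q + 1)\<close> times the Gaussian.\<close>

lemma abs_power_herm_integral:
  assumes "odd q" "even j"
  shows "(\<integral>s. \<bar>s\<bar> ^ q * poly (herm (j + q + 1)) s * gw s \<partial>lborel) = 2 * fact q * poly (herm j) 0"
proof -
  have "(\<integral>s. \<bar>s\<bar> ^ q * poly (herm (j + q + 1)) s * gw s \<partial>lborel)
      = 2 * (\<integral>s. \<bar>s\<bar> ^ q * poly (herm (j + q + 1)) s * gw s * indicator {0<..} s \<partial>lborel)"
    using assms by (intro integral_even integrable_poly_gw) (simp add: poly_herm_minus gw_def)
  also have "(\<integral>s. \<bar>s\<bar> ^ q * poly (herm (j + q + 1)) s * gw s * indicator {0<..} s \<partial>lborel) = hint q (herm (j + q + 1))"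
    unfolding hint_def by (intro Bochner_Integration.integral_cong) (auto simp: indicator_def)
  finally show ?thesis unfolding hint_herm using assms by simp
qed

text \<open>The identity \<open>gint_times_X\<close> turns the three-term recursion into a relation
  between orders j and j + 2, each step contributing the factor u^2 - 1. With u the cosine of an
  angle, this factor is what matches the moments of great subspheres in
  \<open>subsph_moment\<close>.\<close>

lemma herm_scaled_integral:
  "(\<integral>r. poly (herm (2 * k)) (r * u) * gw r \<partial>lborel) = (u\<^sup>2 - 1) ^ k * mom (2 * k)"
proof -
  let ?p = "\<lambda>j. pcompose (herm j) [:0, u:]"
  have A: "gint (?p (Suc (Suc j))) = (u\<^sup>2 - 1) * real (Suc j) * gint (?p j)" for j
  proof -
    have m: "gint (- p) = - gint p" for p using gint_smult[of "-1" p] by simp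
    have d: "gint (p - p') = gint p - gint p'" for p p' using gint_add[of p "- p'"] by (simp add: m)
    have "?p (Suc (Suc j)) = smult (- u) (PX * ?p (Suc j)) - smult (real (Suc j)) (?p j)"
      by (intro poly_eqI2) (simp add: poly_pcompose poly_herm_rec)
    then have "gint (?p (Suc (Suc j))) = - u * gint (pderiv (?p (Suc j))) - real (Suc j) * gint (?p j)"
      by (simp only: d gint_smult gint_times_X)
    also have "pderiv (?p (Suc j)) = smult (- u * real (Suc j)) (?p j)"
      by (intro poly_eqI2) (simp add: pderiv_pcompose pderiv_herm_Suc pcompose_smult pderiv_pCons poly_pcompose algebra_simps)
    finally show ?thesis by (simp add: gint_smult algebra_simps power2_eq_square)
  qed
  have "gint (?p (2 * k)) = (u\<^sup>2 - 1) ^ k * mom (2 * k)"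
  proof (induction k)
    case 0
    then show ?case using gint_monom[of 0] by (simp add: gint_def poly_pcompose)
  next
    case (Suc k)
    then show ?case using A[of "2 * k"] mom_even_rec[of k] by simp
  qed
  then show ?thesis by (simp add: gint_def poly_pcompose)
qed

lemma herm_scaled_half_integral:
  "(\<integral>r. poly (herm (2 * k)) (r * u) * gw r * indicator {0<..} r \<partial>lborel) = (u\<^sup>2 - 1) ^ k * mom (2 * k) / 2"
proof -
  have "integrable lborel (\<lambda>r. poly (herm (2 * k)) (r * u) * gw r)"
    using integrable_poly_gw'[of "pcompose (herm (2 * k)) [:0, u:]"] by (simp add: poly_pcompose)
  from integral_even[OF this] have "(u\<^sup>2 - 1) ^ k * mom (2 * k) = 2 * (\<integral>r. poly (herm (2 * k)) (r * u) * gw r * indicator {0<..} r \<partial>lborel)"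
    unfolding herm_scaled_integral by (simp add: poly_herm_minus gw_def)
  then show ?thesis by simp
qed

text \<open>Multiplication by X^2 maps an even Hermite polynomial to a combination of even ones. The
  induction on k therefore runs over products of \<open>monom 1 (2 * k)\<close> with an arbitrary
  even Hermite polynomial, and the last line takes the constant one.\<close>

lemma herm_even_span:
  fixes K :: "real poly \<Rightarrow> real"
  assumes K: "\<And>p q. K (p + q) = K p + K q" "\<And>c p. K (smult c p) = c * K p"
    and h: "\<And>j. K (herm (2 * j)) = 0"
  shows "K (monom 1 (2 * k)) = 0"
proof -
  have m: "K (- p) = - K p" for p using K(2)[of "-1" p] by simp
  have d: "K (p - p') = K p - K p'" for p p' using K(1)[of p "- p'"] by (simp add: m)
  have "K (monom 1 (2 * k) * herm (2 * j)) = 0" for j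
  proof (induction k arbitrary: j)
    case 0
    then show ?case using h[of j] by simp
  next
    case (Suc k)
    have M: "monom 1 (2 * Suc k) = monom 1 (2 * k) * (PX * PX :: real poly)"
      by (intro poly_eqI2) (simp add: poly_monom)
    show ?case
    proof (cases j)
      case 0
      have "PX * PX * herm (2 * j) = herm 2 + herm (2 * 0)"
        by (simp add: 0 numeral_2_eq_2 herm.simps(2) PX_def pderiv_pCons pderiv_minus one_pCons)
      then have "monom 1 (2 * Suc k) * herm (2 * j) = monom 1 (2 * k) * herm (2 * 1) + monom 1 (2 * k) * herm (2 * 0)"
        unfolding M by (simp only: mult.assoc distrib_left mult_1_right)
      then show ?thesis by (simp only: K(1) Suc.IH add_0)
    next
      case (Suc i)
      have "PX * PX * herm (2 * j) = PX * (PX * herm (Suc (2 * i + 1)))"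
        by (simp add: Suc mult.assoc)
      also have "\<dots> = herm (2 * (i + 2)) + smult (real (2 * i + 3)) (herm (2 * (i + 1)))
         + (smult (real (2 * i + 2)) (herm (2 * (i + 1))) + smult (real (2 * i + 2) * real (2 * i + 1)) (herm (2 * i)))"
        by (intro poly_eqI2) (simp add: poly_herm_rec algebra_simps)
      finally have "monom 1 (2 * Suc k) * herm (2 * j) = monom 1 (2 * k) * herm (2 * (i + 2)) + smult (real (2 * i + 3)) (monom 1 (2 * k) * herm (2 * (i + 1)))
         + (smult (real (2 * i + 2)) (monom 1 (2 * k) * herm (2 * (i + 1))) + smult (real (2 * i + 2) * real (2 * i + 1)) (monom 1 (2 * k) * herm (2 * i)))"
        unfolding M by (simp only: mult.assoc distrib_left mult_smult_right)
      then show ?thesis by (simp only: K Suc.IH mult_zero_right add_0)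
    qed
  qed
  from this[of 0] show ?thesis by simp
qed

subsection \<open>Polar coordinates and Gaussian marginals\<close>

definition rmeas :: "nat \<Rightarrow> real measure" where
  "rmeas j = density lborel (\<lambda>r. ennreal (indicator {0<..} r * r ^ j))"

lemma sets_rmeas [simp, measurable_cong]: "sets (rmeas j) = sets borel"
  and space_rmeas [simp]: "space (rmeas j) = UNIV"
  by (simp_all add: rmeas_def)

lemma sigma_finite_rmeas: "sigma_finite_measure (rmeas j)"
  unfolding rmeas_def
  by (subst sigma_finite_measure.sigma_finite_iff_density_finite[OF sigma_finite_lborel]) auto

lemma nn_integral_rmeas:
  assumes [measurable]: "f \<in> borel_measurable borel"
  shows "(\<integral>\<^sup>+r. f r \<partial>rmeas j) = (\<integral>\<^sup>+r. f r * ennreal (r ^ j) * indicator {0<..} r \<partial>lborel)"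
  unfolding rmeas_def by (subst nn_integral_density) (auto intro!: nn_integral_cong simp: indicator_def mult.commute)

lemma rmeas_integrable_iff:
  assumes [measurable]: "f \<in> borel_measurable borel"
  shows "integrable (rmeas j) f \<longleftrightarrow> integrable lborel (\<lambda>r. f r * r ^ j * indicator {0<..} r :: real)"
  unfolding rmeas_def by (subst integrable_density) (auto simp: indicator_def mult_ac)

lemma rmeas_integral:
  assumes [measurable]: "f \<in> borel_measurable borel"
  shows "(\<integral>r. f r \<partial>rmeas j) = (\<integral>r. f r * r ^ j * indicator {0<..} r \<partial>lborel)"
  unfolding rmeas_def by (subst integral_density) (auto simp: indicator_def mult_ac)

lemma lborel_polar:
  "(lborel :: (real^'n) measure) = distr (sph \<Otimes>\<^sub>M rmeas (CARD('n) - 1)) borel (\<lambda>(\<theta>, r). r *\<^sub>R \<theta>)"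
proof (rule measure_eqI)
  interpret R: sigma_finite_measure "rmeas (CARD('n) - 1)" by (rule sigma_finite_rmeas)
  fix A :: "(real^'n) set" assume "A \<in> sets lborel"
  then have [measurable]: "A \<in> sets borel" by simp
  have "emeasure lborel A = (\<integral>\<^sup>+x. indicator A x \<partial>lborel)" by simp
  also have "\<dots> = (\<integral>\<^sup>+\<theta>. (\<integral>\<^sup>+r. indicator A (r *\<^sub>R \<theta>) \<partial>rmeas (CARD('n) - 1)) \<partial>sph)"
    by (subst polar_lborel, simp, subst nn_integral_rmeas) simp_all
  also have "\<dots> = (\<integral>\<^sup>+z. indicator A (case z of (\<theta>, r) \<Rightarrow> r *\<^sub>R \<theta>) \<partial>(sph \<Otimes>\<^sub>M rmeas (CARD('n) - 1)))"
    by (subst R.nn_integral_fst[symmetric]) simp_all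
  also have "\<dots> = (\<integral>\<^sup>+x. indicator A x \<partial>distr (sph \<Otimes>\<^sub>M rmeas (CARD('n) - 1)) borel (\<lambda>(\<theta>, r). r *\<^sub>R \<theta>))"
    by (subst nn_integral_distr) (simp_all add: split_beta')
  finally show "emeasure lborel A = emeasure (distr (sph \<Otimes>\<^sub>M rmeas (CARD('n) - 1)) borel (\<lambda>(\<theta>, r). r *\<^sub>R \<theta>)) A"
    by simp
qed simp

text \<open>A factorisation along rays is enough. This is how homogeneity separates an integral over
  space into a moment on the sphere and a radial integral, for integrands of either sign.\<close>

lemma polar_product:
  fixes F :: "real^'n \<Rightarrow> real"
  assumes [measurable]: "F \<in> borel_measurable borel" "A \<in> borel_measurable borel" "B \<in> borel_measurable borel"
    and A: "integrable sph A" and B: "integrable (rmeas (CARD('n) - 1)) B"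
    and F: "\<And>\<theta> r. norm \<theta> = 1 \<Longrightarrow> r > 0 \<Longrightarrow> F (r *\<^sub>R \<theta>) = A \<theta> * B r"
  shows "integrable lborel F"
    and "(\<integral>x. F x \<partial>lborel) = (\<integral>\<theta>. A \<theta> \<partial>sph) * (\<integral>r. B r \<partial>rmeas (CARD('n) - 1))"
proof -
  let ?R = "rmeas (CARD('n) - 1)"
  interpret S: finite_measure "sph :: (real^'n) measure" by (rule finite_sph)
  interpret R: sigma_finite_measure ?R by (rule sigma_finite_rmeas)
  interpret P: pair_sigma_finite "sph :: (real^'n) measure" ?R ..
  have AB: "integrable (sph \<Otimes>\<^sub>M ?R) (\<lambda>(\<theta>, r). A \<theta> * B r)"
  proof (rule P.Fubini_integrable)
    show "integrable sph (\<lambda>\<theta>. \<integral>r. norm (case (\<theta>, r) of (\<theta>, r) \<Rightarrow> A \<theta> * B r) \<partial>?R)"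
      using A B by (simp add: abs_mult)
  qed (use B in simp_all)
  have pos: "AE r in ?R. r > 0"
    unfolding rmeas_def by (subst AE_density) (auto simp: indicator_def intro!: AE_I2)
  have "AE z in sph \<Otimes>\<^sub>M ?R. norm (fst z :: real^'n) = 1 \<and> snd z > 0"
  proof (rule P.AE_pair_measure)
    show "AE \<theta> in sph. AE r in ?R. norm (fst (\<theta> :: real^'n, r)) = 1 \<and> snd (\<theta>, r) > 0"
      using AE_sph_norm
    proof eventually_elim
      fix \<theta> :: "real^'n" assume t: "norm \<theta> = 1"
      show "AE r in ?R. norm (fst (\<theta> :: real^'n, r)) = 1 \<and> snd (\<theta>, r) > 0"
        using pos by eventually_elim (simp add: t)
    qed
  qed measurable
  then have eq: "AE z in sph \<Otimes>\<^sub>M ?R. F (case z of (\<theta>, r) \<Rightarrow> r *\<^sub>R \<theta>) = (case z of (\<theta>, r) \<Rightarrow> A \<theta> * B r)"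
    by eventually_elim (auto simp: split_beta' F)
  have "integrable (sph \<Otimes>\<^sub>M ?R) (\<lambda>z. F (case z of (\<theta>, r) \<Rightarrow> r *\<^sub>R \<theta>))"
    using AB by (subst integrable_cong_AE[OF _ _ eq]) simp_all
  then show "integrable lborel F"
    by (subst lborel_polar) (simp add: integrable_distr_eq split_beta')
  have "(\<integral>x. F x \<partial>lborel) = (\<integral>z. F (case z of (\<theta>, r) \<Rightarrow> r *\<^sub>R \<theta>) \<partial>(sph \<Otimes>\<^sub>M ?R))"
    by (subst lborel_polar) (simp add: integral_distr split_beta')
  also have "\<dots> = (\<integral>z. (case z of (\<theta>, r) \<Rightarrow> A \<theta> * B r) \<partial>(sph \<Otimes>\<^sub>M ?R))"
    by (rule integral_cong_AE[OF _ _ eq]) simp_all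
  also have "\<dots> = (\<integral>\<theta>. (\<integral>r. A \<theta> * B r \<partial>?R) \<partial>sph)"
    using P.integral_fst'[OF AB] by simp
  also have "\<dots> = (\<integral>\<theta>. A \<theta> \<partial>sph) * (\<integral>r. B r \<partial>?R)" by simp
  finally show "(\<integral>x. F x \<partial>lborel) = (\<integral>\<theta>. A \<theta> \<partial>sph) * (\<integral>r. B r \<partial>?R)" .
qed

section \<open>Gaussian marginals and the moments of great subspheres\<close>

text \<open>The Gaussian mass of any hyperplane through the origin, namely (2 pi)^((n-1)/2). It is
  kept symbolic; its square in \<open>ridge_const\<close> is there to cancel it.\<close>

definition gconst :: "'n::finite itself \<Rightarrow> real" where
  "gconst _ = (\<integral>x. gw (x :: real^'n) \<partial>lborel) / sqrt (2 * pi)"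

lemma nn_gw_real: "(\<integral>\<^sup>+s. ennreal (gw (s::real)) \<partial>lborel) = ennreal (sqrt (2 * pi))"
  using nn_integral_eq_integral[OF integrable_gw_moment[of 0]] mom_0 by (simp add: mom_def)

lemma borel_measurable_nn_integral_subsph_const:
  fixes h :: "real^'n \<Rightarrow> ennreal"
  assumes [measurable]: "h \<in> borel_measurable borel"
  shows "(\<lambda>\<xi>. \<integral>\<^sup>+\<theta>. h \<theta> \<partial>subsph \<xi>) \<in> borel_measurable borel"
proof -
  have "(\<lambda>\<xi>. \<integral>\<^sup>+\<theta>. h \<theta> \<partial>subsph \<xi>) = (\<lambda>\<xi>. of_nat (CARD('n) - 1) * (\<integral>\<^sup>+x. h (sgn (proj \<xi> x)) * indicator (cball 0 1 - {0}) (proj \<xi> x)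
        * indicator {x. 0 \<le> x \<bullet> \<xi> \<and> x \<bullet> \<xi> \<le> 1} x \<partial>lborel))"
    by (rule ext, rule nn_integral_subsph) (rule assms)
  also have "\<dots> \<in> borel_measurable borel" by measurable
  finally show ?thesis .
qed

definition radon :: "(real^'n \<Rightarrow> real) \<Rightarrow> real^'n \<Rightarrow> real" where
  "radon g \<xi> = (\<integral>\<theta>. g \<theta> \<partial>subsph \<xi>)"

context
  fixes dummy :: "'n::finite itself"
  assumes n: "CARD('n) > 1"
begin

lemma nn_gw_slice:
  fixes \<xi> :: "real^'n"
  assumes \<xi>: "norm \<xi> = 1" and [measurable]: "w \<in> borel_measurable borel"
  shows "(\<integral>\<^sup>+x. w (x \<bullet> \<xi>) * ennreal (gw x) \<partial>lborel)
    = (\<integral>\<^sup>+y. ennreal (gw y) \<partial>hyperplane_measure \<xi>) * (\<integral>\<^sup>+s. w s * ennreal (gw s) \<partial>lborel)"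
proof -
  have "(\<integral>\<^sup>+x. w (x \<bullet> \<xi>) * ennreal (gw x) \<partial>lborel)
     = (\<integral>\<^sup>+y. (\<integral>\<^sup>+s. w ((y + s *\<^sub>R \<xi>) \<bullet> \<xi>) * ennreal (gw (y + s *\<^sub>R \<xi>)) \<partial>lborel) \<partial>hyperplane_measure \<xi>)"
    by (rule nn_slice[OF \<xi>]) simp
  also have "\<dots> = (\<integral>\<^sup>+y. ennreal (gw y) * (\<integral>\<^sup>+s. w s * ennreal (gw s) \<partial>lborel) \<partial>hyperplane_measure \<xi>)"
  proof (rule nn_integral_cong_AE, use AE_hyperplane_orth[OF \<xi>] in eventually_elim)
    fix y assume y: "y \<bullet> \<xi> = 0"
    have "w ((y + s *\<^sub>R \<xi>) \<bullet> \<xi>) * ennreal (gw (y + s *\<^sub>R \<xi>)) = ennreal (gw y) * (w s * ennreal (gw s))" for s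
      using y \<xi> by (simp add: gw_add_orth gw_scale inner_simps norm_eq_1 ennreal_mult mult_ac)
    then show "(\<integral>\<^sup>+s. w ((y + s *\<^sub>R \<xi>) \<bullet> \<xi>) * ennreal (gw (y + s *\<^sub>R \<xi>)) \<partial>lborel)
      = ennreal (gw y) * (\<integral>\<^sup>+s. w s * ennreal (gw s) \<partial>lborel)"
      by (simp add: nn_integral_cmult)
  qed
  also have "\<dots> = (\<integral>\<^sup>+y. ennreal (gw y) \<partial>hyperplane_measure \<xi>) * (\<integral>\<^sup>+s. w s * ennreal (gw s) \<partial>lborel)"
    by (rule nn_integral_multc) simp
  finally show ?thesis .
qed

lemma integrable_gw_vec: "integrable lborel (gw :: real^'n \<Rightarrow> real)"
  and nn_gw_hyperplane: "norm (\<xi> :: real^'n) = 1 \<Longrightarrow> (\<integral>\<^sup>+y. ennreal (gw y) \<partial>hyperplane_measure \<xi>) = ennreal (gconst TYPE('n))"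
proof -
  have e: "(\<integral>\<^sup>+x. ennreal (gw (x :: real^'n)) \<partial>lborel) = (\<integral>\<^sup>+y. ennreal (gw y) \<partial>hyperplane_measure \<xi>) * ennreal (sqrt (2 * pi))"
    if "norm \<xi> = 1" for \<xi> :: "real^'n"
    using nn_gw_slice[OF that, of "\<lambda>_. 1"] by (simp add: nn_gw_real)
  have fin: "(\<integral>\<^sup>+x. ennreal (gw (x :: real^'n)) \<partial>lborel) < \<infinity>"
    using e[of "axis undefined 1"] nn_gw_hyperplane_finite[OF n, of "axis undefined 1"]
    by (simp add: ennreal_mult_less_top)
  then show int: "integrable lborel (gw :: real^'n \<Rightarrow> real)"
    by (intro integrableI_bounded) simp_all
  show "(\<integral>\<^sup>+y. ennreal (gw y) \<partial>hyperplane_measure \<xi>) = ennreal (gconst TYPE('n))" if \<xi>: "norm \<xi> = 1" for \<xi> :: "real^'n"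
  proof -
    obtain h where h: "(\<integral>\<^sup>+y. ennreal (gw y) \<partial>hyperplane_measure \<xi>) = ennreal h" "h \<ge> 0"
      using nn_gw_hyperplane_finite[OF n \<xi>] by (cases "\<integral>\<^sup>+y. ennreal (gw y) \<partial>hyperplane_measure \<xi>") auto
    have "ennreal (\<integral>x. gw (x :: real^'n) \<partial>lborel) = ennreal (h * sqrt (2 * pi))"
      using e[OF \<xi>] h nn_integral_eq_integral[OF int] by (simp add: ennreal_mult)
    then have "(\<integral>x. gw (x :: real^'n) \<partial>lborel) = h * sqrt (2 * pi)"
      using h(2) by (subst (asm) ennreal_inj) (simp_all add: integral_nonneg_AE)
    then show ?thesis by (simp add: gconst_def h)
  qed
qed

lemma gconst_pos: "gconst TYPE('n) > 0"
proof -
  have "(\<integral>x. gw (x :: real^'n) \<partial>lborel) \<noteq> 0"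
  proof
    assume "(\<integral>x. gw (x :: real^'n) \<partial>lborel) = 0"
    then have "AE x in lborel. gw (x :: real^'n) = 0"
      using integral_nonneg_eq_0_iff_AE[OF integrable_gw_vec] by simp
    then have "AE x :: real^'n in lborel. False" by eventually_elim (metis gw_pos less_irrefl)
    then have "UNIV \<in> null_sets (lborel :: (real^'n) measure)"
      using AE_iff_null[of "lborel :: (real^'n) measure" "\<lambda>_. False"] by simp
    then show False by (simp add: null_sets_def)
  qed
  moreover have "(\<integral>x. gw (x :: real^'n) \<partial>lborel) \<ge> 0" by (simp add: integral_nonneg_AE)
  ultimately have "(\<integral>x. gw (x :: real^'n) \<partial>lborel) > 0" by linarith
  then show ?thesis unfolding gconst_def by (intro divide_pos_pos) simp_all
qed

lemma gauss_marginal: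
  fixes \<xi> :: "real^'n" and w :: "real \<Rightarrow> real"
  assumes \<xi>: "norm \<xi> = 1" and [measurable]: "w \<in> borel_measurable borel"
    and w: "integrable lborel (\<lambda>s. w s * gw s)"
  shows "integrable lborel (\<lambda>x. w (x \<bullet> \<xi>) * gw x)"
    and "(\<integral>x. w (x \<bullet> \<xi>) * gw x \<partial>lborel) = gconst TYPE('n) * (\<integral>s. w s * gw s \<partial>lborel)"
proof -
  let ?g = "gconst TYPE('n)"
  have g0: "?g \<ge> 0" using gconst_pos by simp
  have meq: "distr (density lborel (\<lambda>x :: real^'n. ennreal (gw x))) borel (\<lambda>x. x \<bullet> \<xi>) = density lborel (\<lambda>s. ennreal (?g * gw s))"
  proof (rule measure_eqI)
    fix A assume "A \<in> sets (distr (density lborel (\<lambda>x :: real^'n. ennreal (gw x))) borel (\<lambda>x. x \<bullet> \<xi>))"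
    then have [measurable]: "A \<in> sets borel" by simp
    have "emeasure (distr (density lborel (\<lambda>x :: real^'n. ennreal (gw x))) borel (\<lambda>x. x \<bullet> \<xi>)) A
       = (\<integral>\<^sup>+s. indicator A s \<partial>distr (density lborel (\<lambda>x :: real^'n. ennreal (gw x))) borel (\<lambda>x. x \<bullet> \<xi>))" by simp
    also have "\<dots> = (\<integral>\<^sup>+x. indicator A (x \<bullet> \<xi>) * ennreal (gw x) \<partial>lborel)"
      by (subst nn_integral_distr, simp, simp, subst nn_integral_density) (simp_all add: mult.commute)
    also have "\<dots> = ennreal ?g * (\<integral>\<^sup>+s. indicator A s * ennreal (gw s) \<partial>lborel)"
      by (subst nn_gw_slice[OF \<xi>]) (simp_all add: nn_gw_hyperplane[OF \<xi>])
    also have "\<dots> = (\<integral>\<^sup>+s. ennreal (?g * gw s) * indicator A s \<partial>lborel)"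
      using g0 by (subst nn_integral_cmult[symmetric]) (auto intro!: nn_integral_cong simp: ennreal_mult mult_ac)
    also have "\<dots> = emeasure (density lborel (\<lambda>s. ennreal (?g * gw s))) A"
      by (subst emeasure_density) simp_all
    finally show "emeasure (distr (density lborel (\<lambda>x :: real^'n. ennreal (gw x))) borel (\<lambda>x. x \<bullet> \<xi>)) A = emeasure (density lborel (\<lambda>s. ennreal (?g * gw s))) A" .
  qed simp
  have "integrable (density lborel (\<lambda>s. ennreal (?g * gw s))) w"
    using integrable_mult_right[OF w, of ?g] g0 by (subst integrable_density) (simp_all add: mult_ac)
  then have "integrable (density lborel (\<lambda>x :: real^'n. ennreal (gw x))) (\<lambda>x. w (x \<bullet> \<xi>))"
    unfolding meq[symmetric] by (subst (asm) integrable_distr_eq) simp_all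
  then show "integrable lborel (\<lambda>x. w (x \<bullet> \<xi>) * gw x)"
    by (subst (asm) integrable_density) (simp_all add: mult.commute)
  have "(\<integral>x. w (x \<bullet> \<xi>) * gw x \<partial>lborel) = (\<integral>x. w (x \<bullet> \<xi>) \<partial>density lborel (\<lambda>x :: real^'n. ennreal (gw x)))"
    by (subst integral_density) (simp_all add: mult.commute)
  also have "\<dots> = (\<integral>s. w s \<partial>density lborel (\<lambda>s. ennreal (?g * gw s)))"
    unfolding meq[symmetric] by (subst integral_distr) simp_all
  also have "\<dots> = ?g * (\<integral>s. w s * gw s \<partial>lborel)"
    using g0 by (subst integral_density) (simp_all add: mult.assoc mult.commute[of "w _" "gw _"])
  finally show "(\<integral>x. w (x \<bullet> \<xi>) * gw x \<partial>lborel) = ?g * (\<integral>s. w s * gw s \<partial>lborel)" .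
qed

text \<open>Let b be the projection of \<open>a\<close> to the hyperplane orthogonal to
  \<open>\<theta>\<close>. The Gaussian integral of (x . b)^(2k) is evaluated twice: as a
  one-dimensional marginal it gives |b|^(2k) with |b|^2 = 1 - (\<theta> . a)^2, and by slicing along
  \<open>\<theta>\<close> followed by polar coordinates in the hyperplane it gives the moment
  sought.\<close>

lemma subsph_moment:
  fixes \<theta> a :: "real^'n"
  assumes \<theta>: "norm \<theta> = 1" and a: "norm a = 1"
  shows "hmom (2 * k + CARD('n) - 2) * sqrt (2 * pi) * (\<integral>\<xi>. (\<xi> \<bullet> a) ^ (2 * k) \<partial>subsph \<theta>)
     = gconst TYPE('n) * mom (2 * k) * (1 - (\<theta> \<bullet> a)\<^sup>2) ^ k"
proof -
  interpret S: finite_measure "subsph \<theta>" by (rule finite_subsph[OF \<theta>])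
  define b where "b = proj \<theta> a"
  have bb: "b \<bullet> b = 1 - (\<theta> \<bullet> a)\<^sup>2"
    using \<theta> a by (simp add: b_def inner_simps norm_eq_1 inner_commute power2_eq_square)
  have pow: "(x::real) ^ (2 * k) \<ge> 0" for x by (simp add: power_mult)
  have i: "integrable (subsph \<theta>) (\<lambda>\<xi>. (\<xi> \<bullet> a) ^ (2 * k))"
  proof (rule S.integrable_const_bound[of _ 1])
    show "AE \<xi> in subsph \<theta>. norm ((\<xi> \<bullet> a) ^ (2 * k)) \<le> 1"
      using AE_subsph[OF \<theta>]
    proof eventually_elim
      fix \<xi> assume "norm \<xi> = 1 \<and> \<xi> \<bullet> \<theta> = 0"
      then have "\<bar>\<xi> \<bullet> a\<bar> \<le> 1" using Cauchy_Schwarz_ineq2[of \<xi> a] a by simp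
      then show "norm ((\<xi> \<bullet> a) ^ (2 * k)) \<le> 1" by (simp add: power_abs power_le_one)
    qed
  qed simp
  have hm: "(\<integral>\<^sup>+r. ennreal (gw r) * ennreal (r ^ j) * indicator {0<..} r \<partial>lborel) = ennreal (hmom j)" for j
  proof -
    have "(\<integral>\<^sup>+r. ennreal (gw r) * ennreal (r ^ j) * indicator {0<..} r \<partial>lborel) = (\<integral>\<^sup>+r. ennreal (gw r * r ^ j * indicator {0<..} r) \<partial>lborel)"
      by (intro nn_integral_cong) (auto simp: indicator_def ennreal_mult)
    also have "\<dots> = ennreal (hmom j)"
      unfolding hmom_def by (rule nn_integral_eq_integral[OF integrable_hmom]) (auto simp: indicator_def)
    finally show ?thesis .
  qed
  have e: "2 * k + CARD('n) - 2 = 2 * k + (CARD('n) - 2)" using n by simp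
  have p1: "(\<integral>\<^sup>+y. ennreal ((y \<bullet> a) ^ (2 * k) * gw y) \<partial>hyperplane_measure \<theta>)
     = (\<integral>\<^sup>+\<xi>. ennreal ((\<xi> \<bullet> a) ^ (2 * k)) \<partial>subsph \<theta>) * ennreal (hmom (2 * k + CARD('n) - 2))"
  proof -
    have "(\<integral>\<^sup>+y. ennreal ((y \<bullet> a) ^ (2 * k) * gw y) \<partial>hyperplane_measure \<theta>)
      = (\<integral>\<^sup>+\<xi>. (\<integral>\<^sup>+r. ennreal ((r *\<^sub>R \<xi> \<bullet> a) ^ (2 * k) * gw (r *\<^sub>R \<xi>)) * ennreal (r ^ (CARD('n) - 2)) * indicator {0<..} r \<partial>lborel) \<partial>subsph \<theta>)"
      by (rule polar_hyperplane[OF n \<theta>]) simp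
    also have "\<dots> = (\<integral>\<^sup>+\<xi>. ennreal ((\<xi> \<bullet> a) ^ (2 * k)) * ennreal (hmom (2 * k + CARD('n) - 2)) \<partial>subsph \<theta>)"
    proof (rule nn_integral_cong_AE, use AE_subsph[OF \<theta>] in eventually_elim)
      fix \<xi> assume \<xi>: "norm \<xi> = 1 \<and> \<xi> \<bullet> \<theta> = 0"
      have "ennreal ((r *\<^sub>R \<xi> \<bullet> a) ^ (2 * k) * gw (r *\<^sub>R \<xi>)) * ennreal (r ^ (CARD('n) - 2)) * indicator {0<..} r
        = ennreal ((\<xi> \<bullet> a) ^ (2 * k)) * (ennreal (gw r) * ennreal (r ^ (2 * k + CARD('n) - 2)) * indicator {0<..} r)" for r
      proof (cases "r > 0")
        case True
        have "((r *\<^sub>R \<xi> \<bullet> a) ^ (2 * k) * gw (r *\<^sub>R \<xi>)) * r ^ (CARD('n) - 2) = (\<xi> \<bullet> a) ^ (2 * k) * (gw r * r ^ (2 * k + CARD('n) - 2))"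
          using \<xi> unfolding e power_add by (simp add: gw_scale power_mult_distrib)
        then show ?thesis using True by (simp add: ennreal_mult[symmetric] pow)
      qed simp
      then show "(\<integral>\<^sup>+r. ennreal ((r *\<^sub>R \<xi> \<bullet> a) ^ (2 * k) * gw (r *\<^sub>R \<xi>)) * ennreal (r ^ (CARD('n) - 2)) * indicator {0<..} r \<partial>lborel)
         = ennreal ((\<xi> \<bullet> a) ^ (2 * k)) * ennreal (hmom (2 * k + CARD('n) - 2))"
        by (simp add: nn_integral_cmult hm)
    qed
    also have "\<dots> = (\<integral>\<^sup>+\<xi>. ennreal ((\<xi> \<bullet> a) ^ (2 * k)) \<partial>subsph \<theta>) * ennreal (hmom (2 * k + CARD('n) - 2))"
      by (rule nn_integral_multc) simp
    finally show ?thesis .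
  qed
  have p2: "(\<integral>\<^sup>+x. ennreal ((x \<bullet> b) ^ (2 * k) * gw x) \<partial>lborel) = (\<integral>\<^sup>+y. ennreal ((y \<bullet> a) ^ (2 * k) * gw y) \<partial>hyperplane_measure \<theta>) * ennreal (sqrt (2 * pi))"
  proof -
    have "(\<integral>\<^sup>+x. ennreal ((x \<bullet> b) ^ (2 * k) * gw x) \<partial>lborel)
      = (\<integral>\<^sup>+y. (\<integral>\<^sup>+s. ennreal (((y + s *\<^sub>R \<theta>) \<bullet> b) ^ (2 * k) * gw (y + s *\<^sub>R \<theta>)) \<partial>lborel) \<partial>hyperplane_measure \<theta>)"
      by (rule nn_slice[OF \<theta>]) simp
    also have "\<dots> = (\<integral>\<^sup>+y. ennreal ((y \<bullet> a) ^ (2 * k) * gw y) * ennreal (sqrt (2 * pi)) \<partial>hyperplane_measure \<theta>)"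
    proof (rule nn_integral_cong_AE, use AE_hyperplane_orth[OF \<theta>] in eventually_elim)
      fix y assume y: "y \<bullet> \<theta> = 0"
      have yb: "(y + s *\<^sub>R \<theta>) \<bullet> b = y \<bullet> a" for s
        using y \<theta> by (simp add: b_def inner_simps norm_eq_1 inner_commute)
      have "ennreal (((y + s *\<^sub>R \<theta>) \<bullet> b) ^ (2 * k) * gw (y + s *\<^sub>R \<theta>)) = ennreal ((y \<bullet> a) ^ (2 * k) * gw y) * ennreal (gw s)" for s
        unfolding yb using y \<theta> by (simp add: gw_add_orth gw_scale ennreal_mult[symmetric] pow mult.assoc)
      then show "(\<integral>\<^sup>+s. ennreal (((y + s *\<^sub>R \<theta>) \<bullet> b) ^ (2 * k) * gw (y + s *\<^sub>R \<theta>)) \<partial>lborel) = ennreal ((y \<bullet> a) ^ (2 * k) * gw y) * ennreal (sqrt (2 * pi))"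
        by (simp add: nn_integral_cmult nn_gw_real)
    qed
    also have "\<dots> = (\<integral>\<^sup>+y. ennreal ((y \<bullet> a) ^ (2 * k) * gw y) \<partial>hyperplane_measure \<theta>) * ennreal (sqrt (2 * pi))"
      by (rule nn_integral_multc) simp
    finally show ?thesis .
  qed
  have p3: "(\<integral>\<^sup>+x. ennreal ((x \<bullet> b) ^ (2 * k) * gw x) \<partial>lborel) = ennreal (gconst TYPE('n) * mom (2 * k) * (1 - (\<theta> \<bullet> a)\<^sup>2) ^ k)"
  proof -
    obtain e where e: "norm e = 1" "b = norm b *\<^sub>R e"
      using a by (cases "b = 0") (auto intro: that[of "sgn b"] that[of a] simp: norm_sgn sgn_div_norm)
    have m: "(x \<bullet> b) ^ (2 * k) * gw x = ((b \<bullet> b) ^ k * (x \<bullet> e) ^ (2 * k)) * gw x" for x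
      by (subst e(2)) (simp add: power_mult_distrib power_mult power2_norm_eq_inner)
    have I: "integrable lborel (\<lambda>s. ((b \<bullet> b) ^ k * s ^ (2 * k)) * gw s)"
      using integrable_mult_right[OF integrable_gw_moment[of "2 * k"], of "(b \<bullet> b) ^ k"] by (simp add: mult_ac)
    have v: "(\<integral>s. ((b \<bullet> b) ^ k * s ^ (2 * k)) * gw s \<partial>lborel) = (b \<bullet> b) ^ k * mom (2 * k)"
      by (simp add: mom_def mult.assoc mult.commute[of "gw _" "_ ^ _"])
    have "(\<integral>\<^sup>+x. ennreal ((x \<bullet> b) ^ (2 * k) * gw x) \<partial>lborel) = ennreal (\<integral>x. ((b \<bullet> b) ^ k * (x \<bullet> e) ^ (2 * k)) * gw x \<partial>lborel)"
      unfolding m using gauss_marginal(1)[OF e(1) _ I] by (intro nn_integral_eq_integral) (auto simp: pow)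
    also have "\<dots> = ennreal (gconst TYPE('n) * ((b \<bullet> b) ^ k * mom (2 * k)))"
      using gauss_marginal(2)[OF e(1) _ I] v by simp
    finally show ?thesis by (simp add: bb mult_ac)
  qed
  have "ennreal ((\<integral>\<xi>. (\<xi> \<bullet> a) ^ (2 * k) \<partial>subsph \<theta>) * hmom (2 * k + CARD('n) - 2) * sqrt (2 * pi)) = ennreal (gconst TYPE('n) * mom (2 * k) * (1 - (\<theta> \<bullet> a)\<^sup>2) ^ k)"
  proof -
    have "hmom j \<ge> 0" for j unfolding hmom_def by (intro integral_nonneg_AE) (auto simp: indicator_def)
    then show ?thesis
      using p3[unfolded p2 p1] nn_integral_eq_integral[OF i] by (simp add: pow ennreal_mult integral_nonneg_AE)
  qed
  moreover have "(\<integral>\<xi>. (\<xi> \<bullet> a) ^ (2 * k) \<partial>subsph \<theta>) * hmom (2 * k + CARD('n) - 2) * sqrt (2 * pi) \<ge> 0"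
    unfolding hmom_def by (intro mult_nonneg_nonneg integral_nonneg_AE) (auto simp: indicator_def pow)
  moreover have "gconst TYPE('n) * mom (2 * k) * (1 - (\<theta> \<bullet> a)\<^sup>2) ^ k \<ge> 0"
    using gconst_pos mom_pos[of k] bb[symmetric] by simp
  ultimately show ?thesis by (simp add: mult_ac)
qed

subsection \<open>The spherical Radon transform\<close>

text \<open>By symmetry, the average over \<open>\<xi>\<close> of the mass of E on its great
  subsphere equals the integral over E of the total masses of the great subspheres, which is 0.
  Hence functions that agree almost everywhere on the sphere agree almost everywhere on almost every
  great subsphere.\<close>

lemma radon_null:
  fixes E :: "(real^'n) set"
  assumes [measurable]: "E \<in> sets borel" and "emeasure sph E = 0"
  shows "AE \<xi> in sph. emeasure (subsph \<xi>) E = 0"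
proof -
  have Em: "(\<lambda>z :: (real^'n) \<times> (real^'n). indicator E (snd z) :: ennreal) \<in> borel_measurable borel"
    unfolding borel_prod[symmetric] by measurable
  have "(\<integral>\<^sup>+\<xi>. emeasure (subsph \<xi>) E \<partial>sph) = (\<integral>\<^sup>+\<xi>. (\<integral>\<^sup>+\<theta>. indicator E (snd (\<xi>, \<theta>)) \<partial>subsph \<xi>) \<partial>sph)"
    by simp
  also have "\<dots> = (\<integral>\<^sup>+\<theta>. (\<integral>\<^sup>+\<xi>. indicator E (snd (\<xi>, \<theta>)) \<partial>subsph \<theta>) \<partial>sph)"
    by (rule nn_integral_flag_swap[OF n Em])
  also have "\<dots> = (\<integral>\<^sup>+\<theta>. indicator E \<theta> * emeasure (subsph \<theta>) UNIV \<partial>sph)"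
    by simp
  also have "\<dots> = (\<integral>\<^sup>+\<theta>. 0 \<partial>(sph :: (real^'n) measure))"
  proof (rule nn_integral_cong_AE)
    have "AE \<theta> in sph. \<theta> \<notin> E" using assms by (intro AE_not_in) (simp add: null_sets_def)
    then show "AE \<theta> in sph. indicator E \<theta> * emeasure (subsph \<theta>) UNIV = 0" by eventually_elim simp
  qed
  finally have z: "(\<integral>\<^sup>+\<xi>. emeasure (subsph \<xi>) E \<partial>sph) = 0" by simp
  have "(\<lambda>\<xi>. \<integral>\<^sup>+\<theta>. indicator E \<theta> \<partial>subsph \<xi>) \<in> borel_measurable borel"
    by (rule borel_measurable_nn_integral_subsph_const) measurable
  then show ?thesis using z by (subst (asm) nn_integral_0_iff_AE) simp_all
qed

text \<open>The symmetry gives the identity in \<open>ennreal\<close>. Passing to real integrals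
  needs finiteness, which comes from \<open>k \<le> 1\<close> on the sphere and one bound
  \<open>?B\<close> for the total mass of all great subspheres.\<close>

lemma radon_nonneg:
  fixes g k :: "real^'n \<Rightarrow> real"
  assumes gm[measurable]: "g \<in> borel_measurable borel" and km[measurable]: "k \<in> borel_measurable borel"
    and g: "integrable sph g" "\<And>x. g x \<ge> 0" and k: "\<And>x. k x \<ge> 0" "\<And>x. norm x = 1 \<Longrightarrow> k x \<le> 1"
  shows "AE \<xi> in sph. integrable (subsph \<xi>) g"
    and "integrable sph (radon g)"
    and "(\<integral>\<xi>. radon g \<xi> * k \<xi> \<partial>sph) = (\<integral>\<theta>. g \<theta> * (\<integral>\<xi>. k \<xi> \<partial>subsph \<theta>) \<partial>sph)"
    and "integrable sph (\<lambda>\<theta>. g \<theta> * (\<integral>\<xi>. k \<xi> \<partial>subsph \<theta>))"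
proof -
  let ?B = "of_nat (CARD('n) - 1) * emeasure lborel (cball (0::real^'n) 2)"
  have B: "?B < \<infinity>"
    using emeasure_lborel_cball_finite[of "0::real^'n" 2] by (simp add: ennreal_mult_less_top of_nat_less_top)
  define P where "P \<xi> = (\<integral>\<^sup>+\<theta>. ennreal (g \<theta>) \<partial>subsph \<xi>)" for \<xi>
  have Pm[measurable]: "P \<in> borel_measurable borel"
    unfolding P_def by (rule borel_measurable_nn_integral_subsph_const) measurable
  define Q where "Q h \<theta> = (\<integral>\<^sup>+\<xi>. ennreal (h \<xi>) \<partial>subsph \<theta>)" for \<theta> and h :: "real^'n \<Rightarrow> real"
  have Qm[measurable]: "Q h \<in> borel_measurable borel" if [measurable]: "h \<in> borel_measurable borel" for h
    unfolding Q_def by (rule borel_measurable_nn_integral_subsph_const) measurable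
  have sw: "(\<integral>\<^sup>+\<xi>. P \<xi> * ennreal (h \<xi>) \<partial>sph) = (\<integral>\<^sup>+\<theta>. ennreal (g \<theta>) * Q h \<theta> \<partial>sph)"
    if [measurable]: "h \<in> borel_measurable borel" for h
  proof -
    have Fm: "(\<lambda>z :: (real^'n) \<times> (real^'n). ennreal (g (snd z)) * ennreal (h (fst z))) \<in> borel_measurable borel"
      unfolding borel_prod[symmetric] by measurable
    have "(\<integral>\<^sup>+\<xi>. P \<xi> * ennreal (h \<xi>) \<partial>sph) = (\<integral>\<^sup>+\<xi>. (\<integral>\<^sup>+\<theta>. ennreal (g (snd (\<xi>, \<theta>))) * ennreal (h (fst (\<xi>, \<theta>))) \<partial>subsph \<xi>) \<partial>sph)"
      by (simp add: P_def nn_integral_multc)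
    also have "\<dots> = (\<integral>\<^sup>+\<theta>. (\<integral>\<^sup>+\<xi>. ennreal (g (snd (\<xi>, \<theta>))) * ennreal (h (fst (\<xi>, \<theta>))) \<partial>subsph \<theta>) \<partial>sph)"
      by (rule nn_integral_flag_swap[OF n Fm])
    also have "\<dots> = (\<integral>\<^sup>+\<theta>. ennreal (g \<theta>) * Q h \<theta> \<partial>sph)"
      by (simp add: Q_def nn_integral_cmult)
    finally show ?thesis .
  qed
  have fin: "(\<integral>\<^sup>+\<xi>. P \<xi> \<partial>sph) < \<infinity>"
  proof -
    have "(\<integral>\<^sup>+\<xi>. P \<xi> \<partial>sph) = (\<integral>\<^sup>+\<theta>. ennreal (g \<theta>) * emeasure (subsph \<theta>) UNIV \<partial>sph)"
      using sw[of "\<lambda>_. 1"] by (simp add: Q_def)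
    also have "\<dots> \<le> (\<integral>\<^sup>+\<theta>. ennreal (g \<theta>) * ?B \<partial>sph)"
      by (rule nn_integral_mono_AE, use AE_sph_norm in eventually_elim) (intro mult_left_mono emeasure_subsph_le, auto)
    also have "\<dots> = (\<integral>\<^sup>+\<theta>. ennreal (g \<theta>) \<partial>sph) * ?B" by (rule nn_integral_multc) simp
    also have "\<dots> < \<infinity>" using B g by (simp add: ennreal_mult_less_top integrable_iff_bounded)
    finally show ?thesis .
  qed
  then have Pfin: "AE \<xi> in sph. P \<xi> \<noteq> \<infinity>" by (intro nn_integral_noteq_infinite) auto
  show "AE \<xi> in sph. integrable (subsph \<xi>) g"
    using Pfin by eventually_elim (auto simp: integrable_iff_bounded P_def g(2) less_top)
  have rP: "radon g \<xi> = enn2real (P \<xi>)" for \<xi>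
    unfolding radon_def P_def by (rule integral_eq_nn_integral) (use g in auto)
  have [measurable]: "radon g \<in> borel_measurable borel" unfolding rP[abs_def] by measurable
  have Pr: "AE \<xi> in sph. ennreal (radon g \<xi>) = P \<xi>"
    using Pfin by eventually_elim (simp add: rP less_top)
  show "integrable sph (radon g)"
  proof (rule integrableI_nonneg)
    have "(\<integral>\<^sup>+\<xi>. ennreal (radon g \<xi>) \<partial>sph) = (\<integral>\<^sup>+\<xi>. P \<xi> \<partial>sph)" by (rule nn_integral_cong_AE[OF Pr])
    then show "(\<integral>\<^sup>+\<xi>. ennreal (radon g \<xi>) \<partial>sph) < \<infinity>" using fin by simp
  qed (simp_all add: rP)
  have kQ: "Q k \<theta> \<le> ?B" if "norm \<theta> = 1" for \<theta>
  proof -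
    have "Q k \<theta> \<le> (\<integral>\<^sup>+\<xi>. 1 \<partial>subsph \<theta>)" unfolding Q_def
      by (rule nn_integral_mono_AE, use AE_subsph[OF that] in eventually_elim) (use k(2) in auto)
    also have "\<dots> \<le> ?B" using emeasure_subsph_le[OF that] by simp
    finally show ?thesis .
  qed
  have kr: "(\<integral>\<xi>. k \<xi> \<partial>subsph \<theta>) = enn2real (Q k \<theta>)" for \<theta>
    unfolding Q_def by (rule integral_eq_nn_integral) (use k in auto)
  have [measurable]: "(\<lambda>\<theta>. \<integral>\<xi>. k \<xi> \<partial>subsph \<theta>) \<in> borel_measurable borel"
    unfolding kr by measurable
  have gk: "(\<integral>\<^sup>+\<theta>. ennreal (g \<theta> * (\<integral>\<xi>. k \<xi> \<partial>subsph \<theta>)) \<partial>sph) = (\<integral>\<^sup>+\<theta>. ennreal (g \<theta>) * Q k \<theta> \<partial>sph)"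
  proof (rule nn_integral_cong_AE, use AE_sph_norm in eventually_elim)
    fix \<theta> :: "real^'n" assume "norm \<theta> = 1"
    then have "Q k \<theta> < \<infinity>" using kQ B by (metis order.strict_trans1)
    then show "ennreal (g \<theta> * (\<integral>\<xi>. k \<xi> \<partial>subsph \<theta>)) = ennreal (g \<theta>) * Q k \<theta>"
      by (simp add: kr ennreal_mult g)
  qed
  have rk: "(\<integral>\<^sup>+\<xi>. ennreal (radon g \<xi> * k \<xi>) \<partial>sph) = (\<integral>\<^sup>+\<xi>. P \<xi> * ennreal (k \<xi>) \<partial>sph)"
    by (rule nn_integral_cong_AE, use Pr in eventually_elim) (simp add: ennreal_mult' k mult.commute flip: ennreal_mult'')
  have rg0: "radon g \<xi> \<ge> 0" for \<xi> by (simp add: rP)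
  have kk0: "(\<integral>\<xi>. k \<xi> \<partial>subsph \<theta>) \<ge> 0" for \<theta> by (simp add: kr)
  have "(\<integral>\<xi>. radon g \<xi> * k \<xi> \<partial>sph) = enn2real (\<integral>\<^sup>+\<xi>. ennreal (radon g \<xi> * k \<xi>) \<partial>sph)"
    by (rule integral_eq_nn_integral) (auto simp: rg0 k)
  also have "\<dots> = enn2real (\<integral>\<^sup>+\<theta>. ennreal (g \<theta> * (\<integral>\<xi>. k \<xi> \<partial>subsph \<theta>)) \<partial>sph)"
    unfolding rk gk by (simp add: sw)
  also have "\<dots> = (\<integral>\<theta>. g \<theta> * (\<integral>\<xi>. k \<xi> \<partial>subsph \<theta>) \<partial>sph)"
    by (rule integral_eq_nn_integral[symmetric]) (auto simp: g kk0)
  finally show "(\<integral>\<xi>. radon g \<xi> * k \<xi> \<partial>sph) = (\<integral>\<theta>. g \<theta> * (\<integral>\<xi>. k \<xi> \<partial>subsph \<theta>) \<partial>sph)" .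
  show "integrable sph (\<lambda>\<theta>. g \<theta> * (\<integral>\<xi>. k \<xi> \<partial>subsph \<theta>))"
  proof (rule integrableI_nonneg)
    have "(\<integral>\<^sup>+\<theta>. ennreal (g \<theta>) * Q k \<theta> \<partial>sph) \<le> (\<integral>\<^sup>+\<theta>. ennreal (g \<theta>) * ?B \<partial>sph)"
      by (rule nn_integral_mono_AE, use AE_sph_norm in eventually_elim) (intro mult_left_mono kQ, auto)
    also have "\<dots> = (\<integral>\<^sup>+\<theta>. ennreal (g \<theta>) \<partial>sph) * ?B" by (rule nn_integral_multc) simp
    also have "\<dots> < \<infinity>" using B g by (simp add: ennreal_mult_less_top integrable_iff_bounded)
    finally show "(\<integral>\<^sup>+\<theta>. ennreal (g \<theta> * (\<integral>\<xi>. k \<xi> \<partial>subsph \<theta>)) \<partial>sph) < \<infinity>" unfolding gk .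
  qed (auto simp: g kk0)
qed

lemma radon_props:
  fixes g :: "real^'n \<Rightarrow> real"
  assumes gm[measurable]: "g \<in> borel_measurable borel" and g: "integrable sph g"
  shows "AE \<xi> in sph. integrable (subsph \<xi>) g"
    and "integrable sph (radon g)"
    and "\<And>k. k \<in> borel_measurable borel \<Longrightarrow> (\<And>x. k x \<ge> 0) \<Longrightarrow> (\<And>x. norm x = 1 \<Longrightarrow> k x \<le> 1) \<Longrightarrow>
      (\<integral>\<xi>. radon g \<xi> * k \<xi> \<partial>sph) = (\<integral>\<theta>. g \<theta> * (\<integral>\<xi>. k \<xi> \<partial>subsph \<theta>) \<partial>sph)"
proof -
  define p where "p x = max 0 (g x)" for x
  define m where "m x = max 0 (- g x)" for x
  have g_eq: "g = (\<lambda>x. p x - m x)" by (auto simp: p_def m_def fun_eq_iff)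
  have [measurable]: "p \<in> borel_measurable borel" "m \<in> borel_measurable borel"
    unfolding p_def m_def by measurable
  have p: "integrable sph p" "\<And>x. p x \<ge> 0" and m: "integrable sph m" "\<And>x. m x \<ge> 0"
    using g by (auto simp: p_def[abs_def] m_def[abs_def])
  note P = radon_nonneg[OF _ _ p, of "\<lambda>_. 1", simplified] and M = radon_nonneg[OF _ _ m, of "\<lambda>_. 1", simplified]
  show "AE \<xi> in sph. integrable (subsph \<xi>) g"
    using P(1) M(1) by eventually_elim (simp add: g_eq)
  have rd: "AE \<xi> in sph. radon g \<xi> = radon p \<xi> - radon m \<xi>"
    using P(1) M(1) by eventually_elim (simp add: radon_def g_eq)
  \<comment> \<open>Where \<open>h\<close> is not integrable the Bochner integral is 0 by
    convention, so \<open>radon h\<close> is a measurable case distinction on the finiteness of the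
    integrals of both parts.\<close>
  have meas: "radon h \<in> borel_measurable borel" if [measurable]: "h \<in> borel_measurable borel" for h :: "real^'n \<Rightarrow> real"
  proof -
    let ?S = "\<lambda>h \<xi>. \<integral>\<^sup>+\<theta>. ennreal (h \<theta>) \<partial>subsph (\<xi> :: real^'n)"
    have S: "?S h \<in> borel_measurable borel" if [measurable]: "h \<in> borel_measurable borel" for h
      by (rule borel_measurable_nn_integral_subsph_const) measurable
    have [measurable]: "?S h \<in> borel_measurable borel" "?S (\<lambda>x. - h x) \<in> borel_measurable borel" by (rule S, simp)+
    have "radon h = (\<lambda>\<xi>. if ?S h \<xi> < \<infinity> \<and> ?S (\<lambda>x. - h x) \<xi> < \<infinity> then enn2real (?S h \<xi>) - enn2real (?S (\<lambda>x. - h x) \<xi>) else 0)"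
    proof
      fix \<xi>
      show "radon h \<xi> = (if ?S h \<xi> < \<infinity> \<and> ?S (\<lambda>x. - h x) \<xi> < \<infinity> then enn2real (?S h \<xi>) - enn2real (?S (\<lambda>x. - h x) \<xi>) else 0)"
      proof (cases "integrable (subsph \<xi>) h")
        case True
        then show ?thesis by (simp add: radon_def real_lebesgue_integral_def real_integrable_def less_top)
      next
        case False
        then have "\<not> (?S h \<xi> < \<infinity> \<and> ?S (\<lambda>x. - h x) \<xi> < \<infinity>)" by (simp add: real_integrable_def less_top)
        then show ?thesis using False by (auto simp: radon_def not_integrable_integral_eq)
      qed
    qed
    then show ?thesis by simp
  qed
  have [measurable]: "radon g \<in> borel_measurable borel" "radon p \<in> borel_measurable borel" "radon m \<in> borel_measurable borel"
    by (intro meas; simp)+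
  show "integrable sph (radon g)"
    using P(2) M(2) by (subst integrable_cong_AE[OF _ _ rd]) simp_all
  fix k :: "real^'n \<Rightarrow> real"
  assume km[measurable]: "k \<in> borel_measurable borel" and k: "\<And>x. k x \<ge> 0" "\<And>x. norm x = 1 \<Longrightarrow> k x \<le> 1"
  note P' = radon_nonneg[OF _ km p k] and M' = radon_nonneg[OF _ km m k]
  have ki: "integrable sph (\<lambda>\<xi>. radon h \<xi> * k \<xi>)" if "integrable sph (radon h)" and [measurable]: "h \<in> borel_measurable borel" for h :: "real^'n \<Rightarrow> real"
  proof (rule Bochner_Integration.integrable_bound[OF that(1)])
    have [measurable]: "radon h \<in> borel_measurable borel" by (rule meas) simp
    show "(\<lambda>\<xi>. radon h \<xi> * k \<xi>) \<in> borel_measurable sph" by simp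
    show "AE \<xi> in sph. norm (radon h \<xi> * k \<xi>) \<le> norm (radon h \<xi>)"
      using AE_sph_norm by eventually_elim (use k in \<open>auto simp: abs_mult mult_left_le\<close>)
  qed
  have "(\<integral>\<xi>. radon g \<xi> * k \<xi> \<partial>sph) = (\<integral>\<xi>. radon p \<xi> * k \<xi> - radon m \<xi> * k \<xi> \<partial>sph)"
    by (rule integral_cong_AE, simp, simp, use rd in eventually_elim) (simp add: left_diff_distrib)
  also have "\<dots> = (\<integral>\<theta>. p \<theta> * (\<integral>\<xi>. k \<xi> \<partial>subsph \<theta>) \<partial>sph) - (\<integral>\<theta>. m \<theta> * (\<integral>\<xi>. k \<xi> \<partial>subsph \<theta>) \<partial>sph)"
    using P'(3) M'(3) ki[OF P(2)] ki[OF M(2)] by simp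
  also have "\<dots> = (\<integral>\<theta>. p \<theta> * (\<integral>\<xi>. k \<xi> \<partial>subsph \<theta>) - m \<theta> * (\<integral>\<xi>. k \<xi> \<partial>subsph \<theta>) \<partial>sph)"
    using P'(4) M'(4) by simp
  also have "\<dots> = (\<integral>\<theta>. g \<theta> * (\<integral>\<xi>. k \<xi> \<partial>subsph \<theta>) \<partial>sph)"
    by (simp add: g_eq left_diff_distrib)
  finally show "(\<integral>\<xi>. radon g \<xi> * k \<xi> \<partial>sph) = (\<integral>\<theta>. g \<theta> * (\<integral>\<xi>. k \<xi> \<partial>subsph \<theta>) \<partial>sph)" .
qed

end

subsection \<open>Polynomials times the Gaussian\<close>

text \<open>Directional derivatives in arbitrary directions, since ridge functions single out
  \<open>\<xi>\<close> and the Hermite functions single out \<open>a\<close>.\<close>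

definition dd :: "'a::real_normed_vector \<Rightarrow> ('a \<Rightarrow> real) \<Rightarrow> 'a \<Rightarrow> real" where
  "dd v f x = frechet_derivative f (at x) v"

lemma partial_deriv_dd: "partial_deriv i f = dd (axis i 1) f"
  by (simp add: partial_deriv_def dd_def fun_eq_iff)

lemma dd_eqI: "(\<And>x. (f has_derivative D x) (at x)) \<Longrightarrow> dd v f = (\<lambda>x. D x v)"
  unfolding dd_def fun_eq_iff by (metis frechet_derivative_at)

text \<open>Polynomials times the Gaussian. The class is closed under differentiation and decays
  rapidly, so smoothness, the symmetry of second derivatives and integrability against homogeneous
  functions all follow by induction over it.\<close>

inductive pg :: "('a::euclidean_space \<Rightarrow> real) \<Rightarrow> bool" where
  base: "pg gw"
| mult: "pg f \<Longrightarrow> pg (\<lambda>x. (x \<bullet> w) * f x)"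
| add: "pg f \<Longrightarrow> pg g \<Longrightarrow> pg (\<lambda>x. f x + g x)"
| scale: "pg f \<Longrightarrow> pg (\<lambda>x. c * f x)"

lemma gw_has_derivative: "(gw has_derivative (\<lambda>v. - (x \<bullet> v) * gw x)) (at x)"
  unfolding gw_def
  by (auto intro!: derivative_eq_intros simp: inner_commute algebra_simps)

lemma pg_uminus: "pg f \<Longrightarrow> pg (\<lambda>x. - f x)"
  using pg.scale[of f "-1"] by simp

lemma pg_differentiable: "pg f \<Longrightarrow> f differentiable (at x)"
proof (induction rule: pg.induct)
  case base
  then show ?case using gw_has_derivative differentiable_def by blast
qed (auto intro!: derivative_intros differentiable_mult differentiable_inner)

lemma pg_has_derivative: "pg f \<Longrightarrow> (f has_derivative (\<lambda>v. dd v f x)) (at x)"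
  unfolding dd_def using pg_differentiable[of f x] by (simp add: frechet_derivative_works)

lemma dd_uminus: "pg f \<Longrightarrow> dd v (\<lambda>x. - f x) = (\<lambda>x. - dd v f x)"
  by (rule dd_eqI) (auto intro!: derivative_eq_intros pg_has_derivative)

lemma dd_gw: "dd v gw = (\<lambda>x. - ((x \<bullet> v) * gw x))"
  by (rule trans[OF dd_eqI[OF gw_has_derivative]]) simp

lemma dd_mult: "pg f \<Longrightarrow> dd v (\<lambda>x. (x \<bullet> w) * f x) = (\<lambda>x. (v \<bullet> w) * f x + (x \<bullet> w) * dd v f x)"
  by (rule dd_eqI) (auto intro!: derivative_eq_intros pg_has_derivative)

lemma dd_add: "pg f \<Longrightarrow> pg g \<Longrightarrow> dd v (\<lambda>x. f x + g x) = (\<lambda>x. dd v f x + dd v g x)"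
  by (rule dd_eqI) (auto intro!: derivative_eq_intros pg_has_derivative)

lemma dd_scale: "pg f \<Longrightarrow> dd v (\<lambda>x. c * f x) = (\<lambda>x. c * dd v f x)"
  by (rule dd_eqI) (auto intro!: derivative_eq_intros pg_has_derivative)

lemma pg_dd: "pg f \<Longrightarrow> pg (dd v f)"
  by (induction rule: pg.induct) (simp_all add: dd_gw dd_mult dd_add dd_scale pg_uminus pg.intros)

lemma pg_dd_iter: "pg f \<Longrightarrow> pg ((dd v ^^ j) f)"
  by (induction j) (simp_all add: pg_dd)

lemma dd_commute: "pg f \<Longrightarrow> dd u (dd v f) = dd v (dd u f)"
proof (induction rule: pg.induct)
  case base
  show ?case by (simp add: dd_gw dd_uminus dd_mult pg.intros inner_commute) (simp add: algebra_simps)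
next
  case (mult f w)
  then show ?case by (simp add: dd_mult dd_add dd_scale pg.intros pg_dd add.left_commute)
qed (simp_all add: dd_add dd_scale pg.intros pg_dd)

lemma dd_linear:
  assumes "pg f"
  shows "dd (u + v) f x = dd u f x + dd v f x" "dd (c *\<^sub>R v) f x = c * dd v f x"
proof -
  interpret bounded_linear "\<lambda>v. dd v f x" by (rule has_derivative_bounded_linear[OF pg_has_derivative[OF assms]])
  show "dd (u + v) f x = dd u f x + dd v f x" "dd (c *\<^sub>R v) f x = c * dd v f x"
    by (simp_all add: add scaleR)
qed

lemma pg_continuous: "pg f \<Longrightarrow> continuous_on S f"
  by (meson continuous_at_imp_continuous_on differentiable_imp_continuous_within pg_differentiable)

lemma pg_measurable: "pg f \<Longrightarrow> f \<in> borel_measurable borel"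
  by (intro borel_measurable_continuous_onI pg_continuous)

lemma pg_sum: "finite I \<Longrightarrow> (\<And>i. i \<in> I \<Longrightarrow> pg (f i)) \<Longrightarrow> pg (\<lambda>x. \<Sum>i\<in>I. f i x)"
proof (induction I rule: finite_induct)
  case empty
  show ?case using pg.scale[OF pg.base, of 0] by simp
qed (auto intro: pg.add)

lemma dd_sum: "finite I \<Longrightarrow> (\<And>i. i \<in> I \<Longrightarrow> pg (f i)) \<Longrightarrow> dd v (\<lambda>x. \<Sum>i\<in>I. f i x) = (\<lambda>x. \<Sum>i\<in>I. dd v (f i) x)"
proof (induction I rule: finite_induct)
  case empty
  have "dd v (\<lambda>x. 0) = (\<lambda>x. 0)" by (rule dd_eqI) (rule has_derivative_const)
  then show ?case by simp
qed (simp add: dd_add pg_sum)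

lemma laplacian_dd: "laplacian f = (\<lambda>x. \<Sum>i\<in>UNIV. dd (axis i 1) (dd (axis i 1) f) x)"
  by (simp add: laplacian_def partial_deriv_dd fun_eq_iff)

lemma pg_laplacian: "pg f \<Longrightarrow> pg (laplacian f)"
  unfolding laplacian_dd by (intro pg_sum pg_dd) simp_all

lemma pg_laplacian_iter: "pg f \<Longrightarrow> pg ((laplacian ^^ m) f)"
  by (induction m) (simp_all add: pg_laplacian)

lemma dd_laplacian: "pg f \<Longrightarrow> dd v (laplacian f) = laplacian (dd v f)"
  unfolding laplacian_dd by (simp add: dd_sum pg_dd dd_commute[of _ v])

lemma dd_laplacian_iter: "pg f \<Longrightarrow> dd v ((laplacian ^^ m) f) = (laplacian ^^ m) (dd v f)"
  by (induction m) (simp_all add: dd_laplacian pg_laplacian_iter)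

lemma dd_dd_iter: "pg f \<Longrightarrow> dd u ((dd v ^^ j) f) = (dd v ^^ j) (dd u f)"
  by (induction j) (simp_all add: dd_commute[of _ u v] pg_dd_iter)

lemma laplacian_add: "pg f \<Longrightarrow> pg g \<Longrightarrow> laplacian (\<lambda>x. f x + g x) = (\<lambda>x. laplacian f x + laplacian g x)"
  unfolding laplacian_dd by (simp add: dd_add pg_dd sum.distrib)

lemma laplacian_scale: "pg f \<Longrightarrow> laplacian (\<lambda>x. c * f x) = (\<lambda>x. c * laplacian f x)"
  unfolding laplacian_dd by (simp add: dd_scale pg_dd sum_distrib_left)

lemma laplacian_iter_add: "pg f \<Longrightarrow> pg g \<Longrightarrow> (laplacian ^^ m) (\<lambda>x. f x + g x) = (\<lambda>x. (laplacian ^^ m) f x + (laplacian ^^ m) g x)"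
  by (induction m) (simp_all add: laplacian_add pg_laplacian_iter)

lemma laplacian_iter_scale: "pg f \<Longrightarrow> (laplacian ^^ m) (\<lambda>x. c * f x) = (\<lambda>x. c * (laplacian ^^ m) f x)"
  by (induction m) (simp_all add: laplacian_scale pg_laplacian_iter)

lemma power_le_one_plus:
  assumes "(t::real) \<ge> 0" "i \<le> j" shows "t ^ i \<le> 1 + t ^ j"
proof (cases "t \<le> 1")
  case True
  then have "t ^ i \<le> 1" using assms by (simp add: power_le_one)
  then show ?thesis using assms by (simp add: add_increasing2)
next
  case False
  then have "t ^ i \<le> t ^ j" using assms by (intro power_increasing) auto
  then show ?thesis by simp
qed

lemma one_plus_power_mono:
  assumes "(t::real) \<ge> 0" "i \<le> j" shows "1 + t ^ i \<le> 2 * (1 + t ^ j)"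
  using power_le_one_plus[OF assms] zero_le_power[OF assms(1), of j] by (simp add: distrib_left)

lemma pg_bound: "pg f \<Longrightarrow> \<exists>C M. C \<ge> 0 \<and> (\<forall>x. \<bar>f x\<bar> \<le> C * (1 + norm x ^ M) * gw x)"
proof (induction rule: pg.induct)
  case base
  show ?case by (intro exI[of _ 1] exI[of _ 0]) (simp add: )
next
  case (mult f w)
  then obtain C M where C: "C \<ge> 0" "\<And>x. \<bar>f x\<bar> \<le> C * (1 + norm x ^ M) * gw x" by blast
  have "\<bar>(x \<bullet> w) * f x\<bar> \<le> (norm w * C * 2) * (1 + norm x ^ Suc M) * gw x" for x
  proof -
    have "norm x * (1 + norm x ^ M) \<le> 2 * (1 + norm x ^ Suc M)"
      using power_le_one_plus[of "norm x" 1 "Suc M"] by (simp add: distrib_left)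
    then have 1: "norm w * C * (norm x * (1 + norm x ^ M)) * gw x \<le> norm w * C * (2 * (1 + norm x ^ Suc M)) * gw x"
      using C by (intro mult_right_mono mult_left_mono) auto
    have "\<bar>(x \<bullet> w) * f x\<bar> \<le> (norm x * norm w) * (C * (1 + norm x ^ M) * gw x)"
      unfolding abs_mult using C(2)[of x] by (intro mult_mono Cauchy_Schwarz_ineq2) auto
    also have "\<dots> = norm w * C * (norm x * (1 + norm x ^ M)) * gw x" by (simp add: mult_ac)
    finally show ?thesis using 1 by (simp add: mult_ac)
  qed
  then show ?case using C by (intro exI[of _ "norm w * C * 2"] exI[of _ "Suc M"]) auto
next
  case (add f g)
  then obtain C M D L where C: "C \<ge> 0" "\<And>x. \<bar>f x\<bar> \<le> C * (1 + norm x ^ M) * gw x"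
    and D: "D \<ge> 0" "\<And>x. \<bar>g x\<bar> \<le> D * (1 + norm x ^ L) * gw x" by blast
  have "\<bar>f x + g x\<bar> \<le> (2 * C + 2 * D) * (1 + norm x ^ max M L) * gw x" for x
  proof -
    have "C * (1 + norm x ^ M) * gw x \<le> C * (2 * (1 + norm x ^ max M L)) * gw x"
      using C by (intro mult_right_mono mult_left_mono one_plus_power_mono) auto
    moreover have "D * (1 + norm x ^ L) * gw x \<le> D * (2 * (1 + norm x ^ max M L)) * gw x"
      using D by (intro mult_right_mono mult_left_mono one_plus_power_mono) auto
    ultimately show ?thesis using C(2)[of x] D(2)[of x] by (simp add: algebra_simps)
  qed
  then show ?case using C D by (intro exI[of _ "2 * C + 2 * D"] exI[of _ "max M L"]) auto
next
  case (scale f c)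
  then obtain C M where C: "C \<ge> 0" "\<And>x. \<bar>f x\<bar> \<le> C * (1 + norm x ^ M) * gw x" by blast
  have "\<bar>c * f x\<bar> \<le> (\<bar>c\<bar> * C) * (1 + norm x ^ M) * gw x" for x
    using mult_left_mono[OF C(2)[of x], of "\<bar>c\<bar>"] by (simp add: abs_mult mult_ac)
  then show ?case using C by (intro exI[of _ "\<bar>c\<bar> * C"] exI[of _ M]) auto
qed

lemma integrable_norm_power_gw:
  "integrable lborel (\<lambda>x :: real^'n. norm x ^ j * gw x)"
proof (rule polar_product(1)[where A = "\<lambda>_. 1" and B = "\<lambda>r. r ^ j * gw r"])
  show "integrable (rmeas (CARD('n) - 1)) (\<lambda>r. r ^ j * gw r)"
    using integrable_hmom[of "j + (CARD('n) - 1)", unfolded power_add] by (subst rmeas_integrable_iff) (simp_all add: mult_ac)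
  show "integrable sph (\<lambda>_ :: real^'n. 1 :: real)" by (rule finite_measure.integrable_const[OF finite_sph])
qed (simp_all add: gw_scale)

lemma pg_integrable:
  fixes f :: "real^'n \<Rightarrow> real"
  assumes f: "pg f" and [measurable]: "F \<in> borel_measurable borel" and F: "\<And>x. \<bar>F x\<bar> \<le> B * norm x ^ q"
  shows "integrable lborel (\<lambda>x. F x * f x)"
proof -
  note [measurable] = pg_measurable[OF f]
  obtain C M where C: "C \<ge> 0" "\<And>x. \<bar>f x\<bar> \<le> C * (1 + norm x ^ M) * gw x" using pg_bound[OF f] by blast
  show ?thesis
  proof (rule Bochner_Integration.integrable_bound)
    show "integrable lborel (\<lambda>x :: real^'n. (\<bar>B\<bar> * C) * (norm x ^ q * gw x + norm x ^ (q + M) * gw x))"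
      by (intro integrable_mult_right Bochner_Integration.integrable_add integrable_norm_power_gw)
    have "\<bar>F x * f x\<bar> \<le> (\<bar>B\<bar> * C) * (norm x ^ q * gw x + norm x ^ (q + M) * gw x)" for x
    proof -
      have "\<bar>F x\<bar> \<le> \<bar>B\<bar> * norm x ^ q" using F[of x] by (rule order_trans) (intro mult_right_mono, auto)
      then have "\<bar>F x * f x\<bar> \<le> (\<bar>B\<bar> * norm x ^ q) * (C * (1 + norm x ^ M) * gw x)"
        unfolding abs_mult using C by (intro mult_mono) auto
      then show ?thesis by (simp add: algebra_simps power_add)
    qed
    then show "AE x in lborel. norm (F x * f x) \<le> norm ((\<bar>B\<bar> * C) * (norm x ^ q * gw x + norm x ^ (q + M) * gw x))"
      by (intro AE_I2) (metis abs_ge_self order_trans real_norm_def)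
  qed simp
qed

lemma lborel_translate_integral:
  fixes f :: "'a::euclidean_space \<Rightarrow> real"
  assumes [measurable]: "f \<in> borel_measurable borel"
  shows "(\<integral>x. f (t + x) \<partial>lborel) = (\<integral>x. f x \<partial>lborel)"
    and "integrable lborel (\<lambda>x. f (t + x)) \<longleftrightarrow> integrable lborel f"
   by (subst (2) lborel_distr_plus[of t, symmetric], simp add: integral_distr)
      (subst (2) lborel_distr_plus[of t, symmetric], simp add: integrable_distr_eq)

section \<open>Ridge functions integrated against derivatives\<close>

text \<open>The weight is invariant under translation by multiples of \<open>\<tau>\<close>.
  Averaging the integrand over the translations by \<open>u *\<^sub>R \<tau>\<close> with u in [0,1]
  turns the derivative into a difference of two translates of one integrable function, and these
  have equal integrals. No limit at infinity has to be taken.\<close>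

lemma ridge_integral_tangential:
  fixes f :: "real^'n \<Rightarrow> real"
  assumes f: "pg f" and t: "\<tau> \<bullet> \<xi> = 0"
  shows "(\<integral>x. \<bar>x \<bullet> \<xi>\<bar> ^ q * dd \<tau> f x \<partial>lborel) = 0"
proof -
  note [measurable] = pg_measurable[OF f] pg_measurable[OF pg_dd[OF f]]
  let ?w = "\<lambda>x. \<bar>x \<bullet> \<xi>\<bar> ^ q"
  have wb: "\<bar>?w x\<bar> \<le> norm \<xi> ^ q * norm x ^ q" for x
    using power_mono[OF Cauchy_Schwarz_ineq2[of x \<xi>], of q] by (simp add: power_mult_distrib mult.commute)
  define W where "W x = ?w x * dd \<tau> f x" for x
  have Wi: "integrable lborel W" unfolding W_def by (rule pg_integrable[OF pg_dd[OF f] _ wb]) simp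
  have wfi: "integrable lborel (\<lambda>x. ?w x * f x)" by (rule pg_integrable[OF f _ wb]) simp
  have [measurable]: "W \<in> borel_measurable borel" using Wi by simp
  have wt: "?w (u *\<^sub>R \<tau> + x) = ?w x" for u x using t by (simp add: inner_simps)
  define V where "V x u = indicator {0..1} u * W (u *\<^sub>R \<tau> + x)" for x u
  have Vm: "(\<lambda>(u, x). V x u) \<in> borel_measurable (lborel \<Otimes>\<^sub>M lborel)"
    unfolding V_def by measurable
  have Vi: "integrable (lborel \<Otimes>\<^sub>M lborel) (\<lambda>(u, x). V x u)"
  proof (rule lborel_pair.Fubini_integrable[OF Vm])
    have "(\<lambda>u. \<integral>x. norm (V x u) \<partial>lborel) = (\<lambda>u. indicator {0..1} u * (\<integral>x. \<bar>W x\<bar> \<partial>lborel))"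
      by (simp add: V_def abs_mult lborel_translate_integral(1)[of "\<lambda>x. \<bar>W x\<bar>"] fun_eq_iff)
    then show "integrable lborel (\<lambda>u. \<integral>x. norm (case (u, x) of (u, x) \<Rightarrow> V x u) \<partial>lborel)"
      by simp
    show "AE u in lborel. integrable lborel (\<lambda>x. case (u, x) of (u, x) \<Rightarrow> V x u)"
      using Wi by (simp add: V_def lborel_translate_integral(2)[of W])
  qed
  have ftc: "(\<integral>u. V x u \<partial>lborel) = ?w x * f (\<tau> + x) - ?w x * f x" for x
  proof -
    have "(\<integral>u. dd \<tau> f (u *\<^sub>R \<tau> + x) * indicator {0..1} u \<partial>lborel) = f (1 *\<^sub>R \<tau> + x) - f (0 *\<^sub>R \<tau> + x)"
    proof (rule integral_FTC_Icc_real)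
      fix u :: real
      have "((\<lambda>u. f (u *\<^sub>R \<tau> + x)) has_derivative (\<lambda>h. dd (h *\<^sub>R \<tau>) f (u *\<^sub>R \<tau> + x))) (at u)"
        by (rule has_derivative_compose[OF _ pg_has_derivative[OF f]]) (auto intro!: derivative_eq_intros)
      then show "((\<lambda>u. f (u *\<^sub>R \<tau> + x)) has_real_derivative dd \<tau> f (u *\<^sub>R \<tau> + x)) (at u)"
        by (simp add: has_field_derivative_def dd_linear[OF f] mult.commute[of _ "dd _ _ _"] mult_commute_abs)
      have "continuous_on UNIV (\<lambda>u. dd \<tau> f (u *\<^sub>R \<tau> + x))"
        by (rule continuous_on_compose2[OF pg_continuous[OF pg_dd[OF f], of UNIV]]) (auto intro!: continuous_intros)
      then show "isCont (\<lambda>u. dd \<tau> f (u *\<^sub>R \<tau> + x)) u" by (simp add: continuous_on_eq_continuous_at)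
    qed simp
    moreover have "V x u = ?w x * (dd \<tau> f (u *\<^sub>R \<tau> + x) * indicator {0..1} u)" for u
      unfolding V_def W_def wt by simp
    ultimately show ?thesis by (simp add: right_diff_distrib)
  qed
  have "(\<integral>x. W x \<partial>lborel) = (\<integral>u. indicator {0..1} u * (\<integral>x. W x \<partial>lborel) \<partial>(lborel :: real measure))"
    by simp
  also have "\<dots> = (\<integral>u. (\<integral>x. V x u \<partial>lborel) \<partial>lborel)"
    unfolding V_def by (simp add: lborel_translate_integral(1)[of W])
  also have "\<dots> = (\<integral>x. (\<integral>u. V x u \<partial>lborel) \<partial>lborel)"
    using lborel_pair.Fubini_integral[OF Vi] by simp
  also have "\<dots> = (\<integral>x. ?w x * f (\<tau> + x) - ?w x * f x \<partial>lborel)" unfolding ftc ..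
  also have "\<dots> = (\<integral>x. ?w (1 *\<^sub>R \<tau> + x) * f (\<tau> + x) - ?w x * f x \<partial>lborel)" unfolding wt ..
  also have "\<dots> = (\<integral>x. ?w (\<tau> + x) * f (\<tau> + x) \<partial>lborel) - (\<integral>x. ?w x * f x \<partial>lborel)"
    using wfi lborel_translate_integral(2)[of "\<lambda>x. ?w x * f x" \<tau>] by simp
  also have "\<dots> = 0" using lborel_translate_integral(1)[of "\<lambda>x. ?w x * f x" \<tau>] by simp
  finally show ?thesis by (simp add: W_def)
qed

text \<open>Split \<open>v\<close> into its multiple of \<open>\<xi>\<close> and a tangential part;
  the latter contributes nothing.\<close>

lemma ridge_integral_dd:
  fixes f :: "real^'n \<Rightarrow> real"
  assumes f: "pg f" and \<xi>: "norm \<xi> = 1"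
  shows "(\<integral>x. \<bar>x \<bullet> \<xi>\<bar> ^ q * dd v f x \<partial>lborel) = (v \<bullet> \<xi>) * (\<integral>x. \<bar>x \<bullet> \<xi>\<bar> ^ q * dd \<xi> f x \<partial>lborel)"
proof -
  have wb: "\<bar>\<bar>x \<bullet> \<xi>\<bar> ^ q\<bar> \<le> 1 * norm x ^ q" for x
    using power_mono[OF Cauchy_Schwarz_ineq2[of x \<xi>], of q] \<xi> by simp
  have I: "integrable lborel (\<lambda>x. \<bar>x \<bullet> \<xi>\<bar> ^ q * dd u f x)" for u
    by (rule pg_integrable[OF pg_dd[OF f] _ wb]) simp
  have "dd v f x = dd (proj \<xi> v) f x + (v \<bullet> \<xi>) * dd \<xi> f x" for x
    using dd_linear(1)[OF f, of "proj \<xi> v" "(v \<bullet> \<xi>) *\<^sub>R \<xi>"] by (simp add: dd_linear(2)[OF f])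
  then have e: "\<bar>x \<bullet> \<xi>\<bar> ^ q * dd v f x = \<bar>x \<bullet> \<xi>\<bar> ^ q * dd (proj \<xi> v) f x + (v \<bullet> \<xi>) * (\<bar>x \<bullet> \<xi>\<bar> ^ q * dd \<xi> f x)" for x
    by (metis distrib_left mult.left_commute)
  have "(\<integral>x. \<bar>x \<bullet> \<xi>\<bar> ^ q * dd v f x \<partial>lborel) = (\<integral>x. \<bar>x \<bullet> \<xi>\<bar> ^ q * dd (proj \<xi> v) f x + (v \<bullet> \<xi>) * (\<bar>x \<bullet> \<xi>\<bar> ^ q * dd \<xi> f x) \<partial>lborel)"
    unfolding e ..
  also have "\<dots> = (\<integral>x. \<bar>x \<bullet> \<xi>\<bar> ^ q * dd (proj \<xi> v) f x \<partial>lborel) + (v \<bullet> \<xi>) * (\<integral>x. \<bar>x \<bullet> \<xi>\<bar> ^ q * dd \<xi> f x \<partial>lborel)"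
    by (subst Bochner_Integration.integral_add[OF I integrable_mult_right[OF I]]) simp
  also have "(\<integral>x. \<bar>x \<bullet> \<xi>\<bar> ^ q * dd (proj \<xi> v) f x \<partial>lborel) = 0"
    by (rule ridge_integral_tangential[OF f proj_orth[OF \<xi>]])
  finally show ?thesis by simp
qed

text \<open>Each second coordinate derivative counts with the square of the matching coordinate of
  \<open>\<xi>\<close>, and these squares add up to 1.\<close>

lemma ridge_integral_laplacian:
  fixes f :: "real^'n \<Rightarrow> real"
  assumes f: "pg f" and \<xi>: "norm \<xi> = 1"
  shows "(\<integral>x. \<bar>x \<bullet> \<xi>\<bar> ^ q * laplacian f x \<partial>lborel) = (\<integral>x. \<bar>x \<bullet> \<xi>\<bar> ^ q * dd \<xi> (dd \<xi> f) x \<partial>lborel)"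
proof -
  have wb: "\<bar>\<bar>x \<bullet> \<xi>\<bar> ^ q\<bar> \<le> 1 * norm x ^ q" for x
    using power_mono[OF Cauchy_Schwarz_ineq2[of x \<xi>], of q] \<xi> by simp
  let ?I = "\<integral>x. \<bar>x \<bullet> \<xi>\<bar> ^ q * dd \<xi> (dd \<xi> f) x \<partial>lborel"
  have 1: "(\<integral>x. \<bar>x \<bullet> \<xi>\<bar> ^ q * dd v (dd v f) x \<partial>lborel) = (v \<bullet> \<xi>)\<^sup>2 * ?I" for v
  proof -
    have "(\<integral>x. \<bar>x \<bullet> \<xi>\<bar> ^ q * dd v (dd v f) x \<partial>lborel) = (v \<bullet> \<xi>) * (\<integral>x. \<bar>x \<bullet> \<xi>\<bar> ^ q * dd v (dd \<xi> f) x \<partial>lborel)"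
      by (simp add: ridge_integral_dd[OF pg_dd[OF f] \<xi>, of q v v] dd_commute[OF f, of \<xi> v])
    then show ?thesis by (simp add: ridge_integral_dd[OF pg_dd[OF f] \<xi>, of q v \<xi>] power2_eq_square)
  qed
  have "(\<integral>x. \<bar>x \<bullet> \<xi>\<bar> ^ q * laplacian f x \<partial>lborel) = (\<Sum>i\<in>UNIV. (\<integral>x. \<bar>x \<bullet> \<xi>\<bar> ^ q * dd (axis i 1) (dd (axis i 1) f) x \<partial>lborel))"
    unfolding laplacian_dd sum_distrib_left
    by (rule Bochner_Integration.integral_sum) (intro pg_integrable[OF pg_dd[OF pg_dd[OF f]] _ wb], simp)
  also have "\<dots> = (\<Sum>i\<in>UNIV. (axis i 1 \<bullet> \<xi>)\<^sup>2) * ?I"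
    unfolding sum_distrib_right by (rule sum.cong[OF refl 1])
  also have "(\<Sum>i\<in>UNIV. (axis i 1 \<bullet> \<xi>)\<^sup>2) = \<xi> \<bullet> \<xi>"
    by (simp add: inner_vec_def[of \<xi>] inner_axis' power2_eq_square)
  finally show ?thesis using \<xi> by (simp add: norm_eq_1)
qed

lemma ridge_integral_laplacian_iter:
  fixes f :: "real^'n \<Rightarrow> real"
  assumes f: "pg f" and \<xi>: "norm \<xi> = 1"
  shows "(\<integral>x. \<bar>x \<bullet> \<xi>\<bar> ^ q * (laplacian ^^ m) f x \<partial>lborel) = (\<integral>x. \<bar>x \<bullet> \<xi>\<bar> ^ q * (dd \<xi> ^^ (2 * m)) f x \<partial>lborel)"
  using f
proof (induction m arbitrary: f)
  case (Suc m)
  have "(\<integral>x. \<bar>x \<bullet> \<xi>\<bar> ^ q * (laplacian ^^ Suc m) f x \<partial>lborel) = (\<integral>x. \<bar>x \<bullet> \<xi>\<bar> ^ q * dd \<xi> (dd \<xi> ((laplacian ^^ m) f)) x \<partial>lborel)"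
    by (simp add: ridge_integral_laplacian pg_laplacian_iter Suc.prems \<xi>)
  also have "dd \<xi> (dd \<xi> ((laplacian ^^ m) f)) = (laplacian ^^ m) (dd \<xi> (dd \<xi> f))"
    by (simp add: dd_laplacian_iter Suc.prems pg_dd)
  also have "(\<integral>x. \<bar>x \<bullet> \<xi>\<bar> ^ q * (laplacian ^^ m) (dd \<xi> (dd \<xi> f)) x \<partial>lborel) = (\<integral>x. \<bar>x \<bullet> \<xi>\<bar> ^ q * (dd \<xi> ^^ (2 * m)) (dd \<xi> (dd \<xi> f)) x \<partial>lborel)"
    by (rule Suc.IH) (simp add: Suc.prems pg_dd)
  also have "(dd \<xi> ^^ (2 * m)) (dd \<xi> (dd \<xi> f)) = (dd \<xi> ^^ (2 * Suc m)) f"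
    by (simp add: funpow_swap1)
  finally show ?case .
qed simp

lemma ridge_integral_dd_iter:
  fixes f :: "real^'n \<Rightarrow> real"
  assumes f: "pg f" and \<xi>: "norm \<xi> = 1"
  shows "(\<integral>x. \<bar>x \<bullet> \<xi>\<bar> ^ q * (dd \<xi> ^^ j) ((dd a ^^ i) f) x \<partial>lborel) = (a \<bullet> \<xi>) ^ i * (\<integral>x. \<bar>x \<bullet> \<xi>\<bar> ^ q * (dd \<xi> ^^ (i + j)) f x \<partial>lborel)"
  using f
proof (induction i arbitrary: f)
  case (Suc i)
  have "(dd \<xi> ^^ j) ((dd a ^^ Suc i) f) = dd a ((dd \<xi> ^^ j) ((dd a ^^ i) f))"
    by (simp add: dd_dd_iter Suc.prems pg_dd_iter)
  then have "(\<integral>x. \<bar>x \<bullet> \<xi>\<bar> ^ q * (dd \<xi> ^^ j) ((dd a ^^ Suc i) f) x \<partial>lborel) = (a \<bullet> \<xi>) * (\<integral>x. \<bar>x \<bullet> \<xi>\<bar> ^ q * dd \<xi> ((dd \<xi> ^^ j) ((dd a ^^ i) f)) x \<partial>lborel)"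
    by (simp only: ridge_integral_dd[OF pg_dd_iter[OF pg_dd_iter[OF Suc.prems]] \<xi>, of q a])
  also have "dd \<xi> ((dd \<xi> ^^ j) ((dd a ^^ i) f)) = (dd \<xi> ^^ j) ((dd a ^^ i) (dd \<xi> f))"
    by (simp add: dd_dd_iter Suc.prems pg_dd_iter)
  also have "(\<integral>x. \<bar>x \<bullet> \<xi>\<bar> ^ q * (dd \<xi> ^^ j) ((dd a ^^ i) (dd \<xi> f)) x \<partial>lborel) = (a \<bullet> \<xi>) ^ i * (\<integral>x. \<bar>x \<bullet> \<xi>\<bar> ^ q * (dd \<xi> ^^ (i + j)) (dd \<xi> f) x \<partial>lborel)"
    by (rule Suc.IH) (simp add: Suc.prems pg_dd)
  also have "(dd \<xi> ^^ (i + j)) (dd \<xi> f) = (dd \<xi> ^^ (Suc i + j)) f"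
    by (simp add: funpow_swap1)
  finally show ?case by simp
qed simp

definition pgp :: "'a::euclidean_space \<Rightarrow> real poly \<Rightarrow> 'a \<Rightarrow> real" where
  "pgp a p x = poly p (x \<bullet> a) * gw x"

lemma pg_pgp: "pg (pgp a p)"
proof (induction p)
  case 0
  show ?case using pg.scale[OF pg.base, of 0] by (simp add: pgp_def[abs_def])
next
  case (pCons c p)
  have "pgp a (pCons c p) = (\<lambda>x. c * gw x + (x \<bullet> a) * pgp a p x)"
    by (simp add: pgp_def fun_eq_iff algebra_simps)
  then show ?case using pCons.IH by (simp add: pg.intros)
qed

lemma pgp_add: "pgp a (p + q) = (\<lambda>x. pgp a p x + pgp a q x)"
  and pgp_smult: "pgp a (smult c p) = (\<lambda>x. c * pgp a p x)"
  by (simp_all add: pgp_def fun_eq_iff algebra_simps)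

lemma dd_iter_gw: "norm a = 1 \<Longrightarrow> (dd a ^^ j) gw = pgp a (herm j)"
proof (induction j)
  case 0
  show ?case by (simp add: pgp_def fun_eq_iff)
next
  case (Suc j)
  have "((pgp a (herm j)) has_derivative (\<lambda>v. poly (pderiv (herm j)) (x \<bullet> a) * (v \<bullet> a) * gw x + poly (herm j) (x \<bullet> a) * (- (x \<bullet> v) * gw x))) (at x)" for x
  proof -
    have "(poly (herm j) has_derivative (*) (poly (pderiv (herm j)) (x \<bullet> a))) (at (x \<bullet> a))"
      using poly_DERIV[of "herm j" "x \<bullet> a"] by (simp add: has_field_derivative_def)
    then have d: "((\<lambda>x. poly (herm j) (x \<bullet> a)) has_derivative (\<lambda>v. poly (pderiv (herm j)) (x \<bullet> a) * (v \<bullet> a))) (at x)"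
      by (rule has_derivative_compose[rotated]) (auto intro!: derivative_eq_intros)
    show ?thesis
      unfolding pgp_def[abs_def] using has_derivative_mult[OF d gw_has_derivative[of x]] by (simp add: add.commute)
  qed
  then have "dd a (pgp a (herm j)) = (\<lambda>x. poly (pderiv (herm j)) (x \<bullet> a) * (a \<bullet> a) * gw x + poly (herm j) (x \<bullet> a) * (- (x \<bullet> a) * gw x))"
    by (rule dd_eqI)
  also have "\<dots> = pgp a (herm (Suc j))"
    using Suc.prems by (simp add: pgp_def fun_eq_iff herm.simps(2) norm_eq_1 algebra_simps)
  finally show ?case using Suc by simp
qed

text \<open>All derivatives are converted into derivatives along \<open>\<xi>\<close>: the 2k along
  \<open>a\<close> each leave a factor a . \<xi>, the Laplacians leave none. Of the resulting 2k +
  2m = (2k + n - 2) + (q + 1) derivatives, q + 1 reduce |s|^q to a Dirac mass, and the others show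
  up as a Hermite polynomial at 0, of even order because n is even.\<close>

lemma ridge_integral_herm:
  fixes a \<xi> :: "real^'n"
  assumes n: "CARD('n) > 1" "even CARD('n)" and q: "odd q" and m: "2 * m = CARD('n) + q - 1"
    and a: "norm a = 1" and \<xi>: "norm \<xi> = 1"
  shows "(\<integral>x. \<bar>x \<bullet> \<xi>\<bar> ^ q * (laplacian ^^ m) (pgp a (herm (2 * k))) x \<partial>lborel)
    = gconst TYPE('n) * 2 * fact q * poly (herm (2 * k + CARD('n) - 2)) 0 * (a \<bullet> \<xi>) ^ (2 * k)"
proof -
  have e: "2 * k + 2 * m = (2 * k + CARD('n) - 2) + q + 1" using n m by simp
  have ev: "even (2 * k + CARD('n) - 2)" using n by simp
  have "(\<integral>x. \<bar>x \<bullet> \<xi>\<bar> ^ q * (laplacian ^^ m) (pgp a (herm (2 * k))) x \<partial>lborel)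
     = (\<integral>x. \<bar>x \<bullet> \<xi>\<bar> ^ q * (dd \<xi> ^^ (2 * m)) ((dd a ^^ (2 * k)) gw) x \<partial>lborel)"
    unfolding dd_iter_gw[OF a] by (rule ridge_integral_laplacian_iter[OF pg_pgp \<xi>])
  also have "\<dots> = (a \<bullet> \<xi>) ^ (2 * k) * (\<integral>x. \<bar>x \<bullet> \<xi>\<bar> ^ q * (dd \<xi> ^^ (2 * k + 2 * m)) gw x \<partial>lborel)"
    by (rule ridge_integral_dd_iter[OF pg.base \<xi>])
  also have "(\<integral>x. \<bar>x \<bullet> \<xi>\<bar> ^ q * (dd \<xi> ^^ (2 * k + 2 * m)) gw x \<partial>lborel)
     = (\<integral>x. (\<bar>x \<bullet> \<xi>\<bar> ^ q * poly (herm (2 * k + 2 * m)) (x \<bullet> \<xi>)) * gw x \<partial>lborel)"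
    unfolding dd_iter_gw[OF \<xi>] pgp_def by (simp add: mult_ac)
  also have "\<dots> = gconst TYPE('n) * (\<integral>s. (\<bar>s\<bar> ^ q * poly (herm (2 * k + 2 * m)) s) * gw s \<partial>lborel)"
    by (rule gauss_marginal(2)[OF n(1) \<xi> _ integrable_poly_gw])
      (intro borel_measurable_continuous_onI continuous_intros)
  also have "(\<integral>s. (\<bar>s\<bar> ^ q * poly (herm (2 * k + 2 * m)) s) * gw s \<partial>lborel) = 2 * fact q * poly (herm (2 * k + CARD('n) - 2)) 0"
    unfolding e by (rule abs_power_herm_integral[OF q ev])
  finally show ?thesis by (simp add: mult_ac)
qed

subsection \<open>Radial functions times even powers of a linear form\<close>

definition deriv_seq :: "(nat \<Rightarrow> real \<Rightarrow> real) \<Rightarrow> bool" where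
  "deriv_seq D \<longleftrightarrow> (\<forall>j y. (D j has_real_derivative D (Suc j) y) (at y))"

text \<open>A class of smooth functions containing every radial profile times powers of a linear
  form and closed under differentiation. It covers the compactly supported test functions, which
  \<open>pg\<close> does not.\<close>

inductive sm :: "('a::euclidean_space \<Rightarrow> real) \<Rightarrow> bool" where
  radial: "deriv_seq D \<Longrightarrow> sm (\<lambda>x. D j (x \<bullet> x))"
| const: "sm (\<lambda>x. c)"
| inner: "sm (\<lambda>x. x \<bullet> v)"
| add: "sm f \<Longrightarrow> sm g \<Longrightarrow> sm (\<lambda>x. f x + g x)"
| mult: "sm f \<Longrightarrow> sm g \<Longrightarrow> sm (\<lambda>x. f x * g x)"

lemma radial_has_derivative:
  assumes "deriv_seq D"
  shows "((\<lambda>x. D j (x \<bullet> x)) has_derivative (\<lambda>v. 2 * (x \<bullet> v) * D (Suc j) (x \<bullet> x))) (at x)"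
proof -
  have d: "(D j has_derivative (*) (D (Suc j) (x \<bullet> x))) (at (x \<bullet> x))"
    using assms by (simp add: deriv_seq_def has_field_derivative_def)
  have "((\<lambda>x. x \<bullet> x) has_derivative (\<lambda>v. 2 * (x \<bullet> v))) (at x)"
    by (auto intro!: derivative_eq_intros simp: inner_commute)
  from has_derivative_compose[OF this d] show ?thesis by (simp add: mult_ac)
qed

lemma sm_differentiable: "sm f \<Longrightarrow> f differentiable (at x)"
proof (induction rule: sm.induct)
  case (radial D j)
  then show ?case using radial_has_derivative differentiable_def by blast
qed (auto intro!: derivative_intros differentiable_mult differentiable_inner)

lemma sm_has_derivative: "sm f \<Longrightarrow> (f has_derivative (\<lambda>v. dd v f x)) (at x)"
  unfolding dd_def using sm_differentiable[of f x] by (simp add: frechet_derivative_works)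

lemma sm_dd_add: "sm f \<Longrightarrow> sm g \<Longrightarrow> dd v (\<lambda>x. f x + g x) = (\<lambda>x. dd v f x + dd v g x)"
  by (rule dd_eqI) (auto intro!: derivative_eq_intros sm_has_derivative)

lemma sm_dd_mult: "sm f \<Longrightarrow> sm g \<Longrightarrow> dd v (\<lambda>x. f x * g x) = (\<lambda>x. f x * dd v g x + dd v f x * g x)"
  by (rule dd_eqI) (auto intro!: derivative_eq_intros sm_has_derivative)

lemma dd_const: "dd v (\<lambda>x. c) = (\<lambda>x. 0)"
  by (rule dd_eqI) (rule has_derivative_const)

lemma dd_inner: "dd v (\<lambda>x. x \<bullet> w) = (\<lambda>x. v \<bullet> w)"
  by (rule dd_eqI) (auto intro!: derivative_eq_intros)

lemma dd_radial: "deriv_seq D \<Longrightarrow> dd v (\<lambda>x. D j (x \<bullet> x)) = (\<lambda>x. 2 * (x \<bullet> v) * D (Suc j) (x \<bullet> x))"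
  by (rule dd_eqI) (rule radial_has_derivative)

lemma sm_dd: "sm f \<Longrightarrow> sm (dd v f)"
  by (induction rule: sm.induct)
    (auto simp: dd_radial dd_const dd_inner sm_dd_add sm_dd_mult intro!: sm.intros)

lemma sm_power: "sm f \<Longrightarrow> sm (\<lambda>x. f x ^ d)"
  by (induction d) (auto intro: sm.intros)

lemma sm_C_k: "sm f \<Longrightarrow> C_k k (f :: real^'n \<Rightarrow> real)"
proof (induction k arbitrary: f)
  case 0
  then show ?case
    by (auto intro!: continuous_at_imp_continuous_on differentiable_imp_continuous_within sm_differentiable)
qed (auto simp: partial_deriv_dd sm_dd sm_differentiable)

lemma sm_sum: "finite I \<Longrightarrow> (\<And>i. i \<in> I \<Longrightarrow> sm (f i)) \<Longrightarrow> sm (\<lambda>x. \<Sum>i\<in>I. f i x)"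
  by (induction I rule: finite_induct) (auto intro: sm.intros)

lemma sm_laplacian: "sm f \<Longrightarrow> sm (laplacian f)"
  unfolding laplacian_dd by (intro sm_sum sm_dd) simp_all

lemma sm_laplacian_iter: "sm f \<Longrightarrow> sm ((laplacian ^^ m) f)"
  by (induction m) (simp_all add: sm_laplacian)

lemma sm_laplacian_add: "sm f \<Longrightarrow> sm g \<Longrightarrow> laplacian (\<lambda>x. f x + g x) = (\<lambda>x. laplacian f x + laplacian g x)"
  unfolding laplacian_dd by (simp add: sm_dd_add sm_dd sum.distrib)

lemma sm_laplacian_scale: "sm f \<Longrightarrow> laplacian (\<lambda>x. c * f x) = (\<lambda>x. c * laplacian f x)"
  unfolding laplacian_dd by (simp add: sm_dd_mult dd_const sm_dd sm.const sum_distrib_left)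

lemma sm_laplacian_iter_add: "sm f \<Longrightarrow> sm g \<Longrightarrow> (laplacian ^^ m) (\<lambda>x. f x + g x) = (\<lambda>x. (laplacian ^^ m) f x + (laplacian ^^ m) g x)"
  by (induction m) (simp_all add: sm_laplacian_add sm_laplacian_iter)

lemma sm_laplacian_iter_scale: "sm f \<Longrightarrow> (laplacian ^^ m) (\<lambda>x. c * f x) = (\<lambda>x. c * (laplacian ^^ m) f x)"
  by (induction m) (simp_all add: sm_laplacian_scale sm_laplacian_iter)

lemma dd_inner_power: "dd v (\<lambda>x. (x \<bullet> a) ^ d) = (\<lambda>x. real d * (v \<bullet> a) * (x \<bullet> a) ^ (d - 1))"
  by (rule dd_eqI) (auto intro!: derivative_eq_intros)

text \<open>The operator \<open>4 y D'' + (2 n + 4 d) D'\<close> is the radial part of the Laplacian in the variable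
  \<open>y = x \<bullet> x\<close>; the remainder has lower degree in \<open>x \<bullet> a\<close>, hence the systems below are triangular.\<close>

lemma laplacian_radial_power:
  fixes a :: "real^'n" and D :: "nat \<Rightarrow> real \<Rightarrow> real"
  assumes D: "deriv_seq D" and a: "norm a = 1"
  shows "laplacian (\<lambda>x. D j (x \<bullet> x) * (x \<bullet> a) ^ d)
    = (\<lambda>x. (4 * (x \<bullet> x) * D (j + 2) (x \<bullet> x) + (2 * CARD('n) + 4 * d) * D (j + 1) (x \<bullet> x)) * (x \<bullet> a) ^ d
        + (real d * real (d - 1)) * (D j (x \<bullet> x) * (x \<bullet> a) ^ (d - 2)))"
proof
  fix x :: "real^'n"
  let ?y = "x \<bullet> x" and ?s = "x \<bullet> a"
  have 1: "dd v (\<lambda>x. D j (x \<bullet> x) * (x \<bullet> a) ^ d) = (\<lambda>x. D j (x \<bullet> x) * (real d * (v \<bullet> a) * (x \<bullet> a) ^ (d - 1)) + (2 * (x \<bullet> v) * D (Suc j) (x \<bullet> x)) * (x \<bullet> a) ^ d)" for v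
    using D by (subst sm_dd_mult) (auto intro!: sm.intros sm_power simp: dd_inner_power dd_radial)
  have 2: "dd v (dd v (\<lambda>x. D j (x \<bullet> x) * (x \<bullet> a) ^ d)) x
     = D j ?y * (real d * real (d - 1) * (v \<bullet> a)\<^sup>2 * ?s ^ (d - 2)) + 4 * (x \<bullet> v) * (v \<bullet> a) * D (Suc j) ?y * (real d * ?s ^ (d - 1))
       + (2 * (v \<bullet> v) * D (Suc j) ?y + 4 * (x \<bullet> v)\<^sup>2 * D (Suc (Suc j)) ?y) * ?s ^ d" for v
    unfolding 1 using D
    by (simp add: sm_dd_add sm_dd_mult sm.intros sm_power dd_inner_power dd_radial dd_const dd_inner numeral_2_eq_2 algebra_simps)
  have s1: "(\<Sum>i\<in>UNIV. (axis i 1 \<bullet> a)\<^sup>2) = 1"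
    using a by (simp add: norm_eq_1 inner_vec_def[of a] inner_axis' power2_eq_square)
  have s2: "(\<Sum>i\<in>UNIV. (x \<bullet> axis i 1) * (axis i 1 \<bullet> a)) = ?s"
    by (simp add: inner_vec_def[of x a] inner_axis' inner_axis)
  have s3: "(\<Sum>i\<in>UNIV. (x \<bullet> axis i 1)\<^sup>2) = ?y"
    by (simp add: inner_vec_def[of x x] inner_axis power2_eq_square)
  have s4: "(\<Sum>i\<in>UNIV. (axis i 1 :: real^'n) \<bullet> axis i 1) = CARD('n)"
    by (simp add: inner_axis_axis)
  have ds: "real d * (?s * ?s ^ (d - 1)) = real d * ?s ^ d" by (cases d) auto
  have "laplacian (\<lambda>x. D j (x \<bullet> x) * (x \<bullet> a) ^ d) x
     = (\<Sum>i\<in>UNIV. (D j ?y * (real d * real (d - 1)) * ?s ^ (d - 2)) * (axis i 1 \<bullet> a)\<^sup>2)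
      + (\<Sum>i\<in>UNIV. (4 * D (Suc j) ?y * (real d * ?s ^ (d - 1))) * ((x \<bullet> axis i 1) * (axis i 1 \<bullet> a)))
      + (\<Sum>i\<in>UNIV. (2 * D (Suc j) ?y * ?s ^ d) * ((axis i 1 :: real^'n) \<bullet> axis i 1))
      + (\<Sum>i\<in>UNIV. (4 * D (Suc (Suc j)) ?y * ?s ^ d) * (x \<bullet> axis i 1)\<^sup>2)"
    unfolding laplacian_dd 2 sum.distrib[symmetric]
    by (intro sum.cong refl) (simp add: algebra_simps)
  also have "\<dots> = D j ?y * (real d * real (d - 1)) * ?s ^ (d - 2) + 4 * D (Suc j) ?y * (real d * (?s * ?s ^ (d - 1)))
      + 2 * D (Suc j) ?y * ?s ^ d * CARD('n) + 4 * D (Suc (Suc j)) ?y * ?s ^ d * ?y"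
    unfolding sum_distrib_left[symmetric] s1 s2 s3 s4 by (simp add: mult_ac)
  also have "\<dots> = (4 * ?y * D (j + 2) ?y + (2 * CARD('n) + 4 * d) * D (j + 1) ?y) * ?s ^ d
        + (real d * real (d - 1)) * (D j ?y * ?s ^ (d - 2))"
    unfolding ds by (simp add: algebra_simps)
  finally show "laplacian (\<lambda>x. D j (x \<bullet> x) * (x \<bullet> a) ^ d) x = (4 * ?y * D (j + 2) ?y + (2 * CARD('n) + 4 * d) * D (j + 1) ?y) * ?s ^ d
        + (real d * real (d - 1)) * (D j ?y * ?s ^ (d - 2))" .
qed

section \<open>Radial integrals and the triangular moment system\<close>

text \<open>Profiles are functions of y = r^2 given with all their derivatives. The integrals and
  limits demanded are the ones that integration by parts on the half-line consumes; the annular bump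
  and the Gaussian both qualify.\<close>

definition rad :: "(nat \<Rightarrow> real \<Rightarrow> real) \<Rightarrow> bool" where
  "rad D \<longleftrightarrow> deriv_seq D \<and>
     (\<forall>j e. integrable lborel (\<lambda>r. D j (r\<^sup>2) * r ^ e * indicator {0<..} r) \<and> ((\<lambda>r. D j (r\<^sup>2) * r ^ e) \<longlongrightarrow> 0) at_top)"

definition rint :: "(nat \<Rightarrow> real \<Rightarrow> real) \<Rightarrow> nat \<Rightarrow> nat \<Rightarrow> real" where
  "rint D j e = (\<integral>r. D j (r\<^sup>2) * r ^ e * indicator {0<..} r \<partial>lborel)"

text \<open>Integrate the derivative of \<open>D j (r\<^sup>2) * r ^ (e + 1)\<close>; the exponent
  is at least 1, so the boundary value at 0 vanishes.\<close>

lemma rint_ibp: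
  assumes D: "rad D"
  shows "2 * rint D (Suc j) (e + 2) = - (real e + 1) * rint D j e"
proof -
  have dD: "(D j has_real_derivative D (Suc j) y) (at y)" for j y using D by (simp add: rad_def deriv_seq_def)
  have i: "integrable lborel (\<lambda>r. D j (r\<^sup>2) * r ^ e * indicator {0<..} r)" for j e using D by (simp add: rad_def)
  have lim: "((\<lambda>r. D j (r\<^sup>2) * r ^ e) \<longlongrightarrow> 0) at_top" for j e using D by (simp add: rad_def)
  define f where "f r = 2 * (D (Suc j) (r\<^sup>2) * r ^ (e + 2)) + (real e + 1) * (D j (r\<^sup>2) * r ^ e)" for r
  have cD: "continuous_on UNIV (D j)" for j
    by (intro continuous_at_imp_continuous_on ballI DERIV_isCont[OF dD])
  have fc: "continuous_on UNIV f"
    unfolding f_def by (intro continuous_intros continuous_on_compose2[OF cD]) auto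
  have eq: "f r * indicator {0<..} r = 2 * (D (Suc j) (r\<^sup>2) * r ^ (e + 2) * indicator {0<..} r) + (real e + 1) * (D j (r\<^sup>2) * r ^ e * indicator {0<..} r)" for r
    by (simp add: f_def algebra_simps)
  have fi: "integrable lborel (\<lambda>r. f r * indicator {0<..} r)"
    unfolding eq by (intro Bochner_Integration.integrable_add integrable_mult_right i)
  have "(LBINT r=0..\<infinity>. f r) = 0 - 0"
  proof (rule interval_integral_FTC_integrable[where F = "\<lambda>r. D j (r\<^sup>2) * r ^ (e + 1)"])
    fix r :: real
    have "((\<lambda>r. D j (r\<^sup>2)) has_real_derivative D (Suc j) (r\<^sup>2) * (2 * r)) (at r)"
      by (rule DERIV_chain2[OF dD]) (auto intro!: derivative_eq_intros)
    moreover have "((\<lambda>r. r ^ (e + 1)) has_real_derivative (real e + 1) * r ^ e) (at r)"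
      using DERIV_pow[of "e + 1" r UNIV] by (simp add: add.commute)
    ultimately have "((\<lambda>r. D j (r\<^sup>2) * r ^ (e + 1)) has_real_derivative f r) (at r)"
      by (rule DERIV_cong[OF DERIV_mult]) (simp add: f_def algebra_simps power2_eq_square)
    then show "((\<lambda>r. D j (r\<^sup>2) * r ^ (e + 1)) has_vector_derivative f r) (at r)"
      by (simp add: has_real_derivative_iff_has_vector_derivative)
    show "isCont f r" using fc by (simp add: continuous_on_eq_continuous_at)
  next
    show "set_integrable lborel (einterval 0 \<infinity>) f"
      using fi by (simp add: set_integrable_def zero_ereal_def mult.commute)
    have "((\<lambda>r. D j (r\<^sup>2) * r ^ (e + 1)) \<longlongrightarrow> D j (0\<^sup>2) * 0 ^ (e + 1)) (at_right 0)"
      by (intro tendsto_intros isCont_tendsto_compose[OF DERIV_isCont[OF dD]])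
    then show "(((\<lambda>r. D j (r\<^sup>2) * r ^ (e + 1)) \<circ> real_of_ereal) \<longlongrightarrow> 0) (at_right 0)"
      by (simp add: ereal_tendsto_simps1 zero_ereal_def)
    show "(((\<lambda>r. D j (r\<^sup>2) * r ^ (e + 1)) \<circ> real_of_ereal) \<longlongrightarrow> 0) (at_left \<infinity>)"
      using lim[of j "e + 1"] by (simp add: ereal_tendsto_simps1)
  qed simp
  then have "(\<integral>r. f r * indicator {0<..} r \<partial>lborel) = 0"
    by (simp add: interval_lebesgue_integral_0_infty set_lebesgue_integral_def mult.commute)
  then have "2 * rint D (Suc j) (e + 2) + (real e + 1) * rint D j e = 0"
    unfolding eq rint_def
    by (subst (asm) Bochner_Integration.integral_add[OF integrable_mult_right[OF i] integrable_mult_right[OF i]])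
      (simp only: integral_mult_right_zero)
  then show ?thesis by (simp add: algebra_simps)
qed

text \<open>By Leibniz, the j-th derivative of 4 y D'' + c D', the term with factor j coming from
  the coefficient y. With c = 2n + 4d this is the radial part of the Laplacian on a profile times (x
  . a)^d.\<close>

definition radop :: "nat \<Rightarrow> (nat \<Rightarrow> real \<Rightarrow> real) \<Rightarrow> nat \<Rightarrow> real \<Rightarrow> real" where
  "radop c D j y = 4 * (y * D (j + 2) y + real j * D (j + 1) y) + real c * D (j + 1) y"

lemma rad_radop:
  assumes D: "rad D" shows "rad (radop c D)"
proof -
  have i: "integrable lborel (\<lambda>r. D j (r\<^sup>2) * r ^ e * indicator {0<..} r)" for j e using D by (simp add: rad_def)
  have lim: "((\<lambda>r. D j (r\<^sup>2) * r ^ e) \<longlongrightarrow> 0) at_top" for j e using D by (simp add: rad_def)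
  have dD: "(D j has_real_derivative D (Suc j) y) (at y)" for j y using D by (simp add: rad_def deriv_seq_def)
  have eq: "radop c D j (r\<^sup>2) * r ^ e = 4 * (D (j + 2) (r\<^sup>2) * r ^ (e + 2)) + (4 * real j + real c) * (D (j + 1) (r\<^sup>2) * r ^ e)" for j r e
    by (simp add: radop_def algebra_simps power2_eq_square)
  have "deriv_seq (radop c D)"
    unfolding deriv_seq_def radop_def
    by (auto intro!: derivative_eq_intros dD simp: algebra_simps)
  moreover have "integrable lborel (\<lambda>r. radop c D j (r\<^sup>2) * r ^ e * indicator {0<..} r)" for j e
  proof -
    have "integrable lborel (\<lambda>r. 4 * (D (j + 2) (r\<^sup>2) * r ^ (e + 2) * indicator {0<..} r) + (4 * real j + real c) * (D (j + 1) (r\<^sup>2) * r ^ e * indicator {0<..} r))"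
      by (intro Bochner_Integration.integrable_add integrable_mult_right i)
    then show ?thesis unfolding eq by (simp add: algebra_simps)
  qed
  moreover have "((\<lambda>r. radop c D j (r\<^sup>2) * r ^ e) \<longlongrightarrow> 0) at_top" for j e
    unfolding eq by (rule tendsto_eq_rhs[OF tendsto_add[OF tendsto_mult_right_zero[OF lim] tendsto_mult_right_zero[OF lim]]]) simp
  ultimately show ?thesis by (simp add: rad_def)
qed

lemma rint_radop:
  assumes D: "rad D"
  shows "rint (radop c D) 0 (e + 2) = ((real e + 3) * (real e + 1) - real c * (real e + 1) / 2) * rint D 0 e"
proof -
  have i: "integrable lborel (\<lambda>r. D j (r\<^sup>2) * r ^ e * indicator {0<..} r)" for j e using D by (simp add: rad_def)
  have eq: "radop c D 0 (r\<^sup>2) * r ^ (e + 2) * indicator {0<..} r = 4 * (D (Suc 1) (r\<^sup>2) * r ^ (e + 2 + 2) * indicator {0<..} r) + real c * (D (Suc 0) (r\<^sup>2) * r ^ (e + 2) * indicator {0<..} r)" for r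
    by (simp add: radop_def power_add power2_eq_square algebra_simps)
  have "rint (radop c D) 0 (e + 2) = 4 * rint D (Suc 1) (e + 2 + 2) + real c * rint D (Suc 0) (e + 2)"
    unfolding rint_def eq
    by (subst Bochner_Integration.integral_add[OF integrable_mult_right[OF i] integrable_mult_right[OF i]])
      (simp only: integral_mult_right_zero)
  also have "\<dots> = ((real e + 3) * (real e + 1) - real c * (real e + 1) / 2) * rint D 0 e"
  proof -
    have a: "rint D (Suc 1) (e + 2 + 2) = - (real e + 3) / 2 * rint D (Suc 0) (e + 2)"
    proof -
      have "2 * rint D (Suc 1) (e + 2 + 2) = - (real e + 3) * rint D (Suc 0) (e + 2)"
        using rint_ibp[OF D, of 1 "e + 2"] by (simp add: algebra_simps)
      then show ?thesis by linarith
    qed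
    have b: "rint D (Suc 0) (e + 2) = - (real e + 1) / 2 * rint D 0 e"
      using rint_ibp[OF D, of 0 e] by simp
    show ?thesis unfolding a b by (simp add: field_simps)
  qed
  finally show ?thesis .
qed

text \<open>Row k and column j of the system after m Laplacians. The first coefficient is that of
  \<open>rint_radop\<close> with c = 2n + 8k, factored, where \<open>e\<close> here exceeds the
  exponent there by 2. The second comes from both derivatives hitting (x . a)^(2k); at k = 0 it is
  0, so the truncated \<open>k - 1\<close> is harmless.\<close>

primrec kap :: "nat \<Rightarrow> nat \<Rightarrow> nat \<Rightarrow> nat \<Rightarrow> nat \<Rightarrow> real" where
  "kap n q 0 k j = (if j = k then 1 else 0)"
| "kap n q (Suc m) k j =
     (let e = real (q + n - 1 + 2 * k) - 2 * real m in (e - 1) * (e + 1 - real n - 4 * real k)) * kap n q m k j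
     + real (2 * k) * real (2 * k - 1) * kap n q m (k - 1) j"

lemma kap_zero: "j > k \<Longrightarrow> kap n q m k j = 0"
  by (induction m arbitrary: k) auto

text \<open>On the diagonal only the first coefficient survives. Since q + n - 1 is even and q is
  odd, both of its factors are odd integers, hence nonzero whatever m and k are.\<close>

lemma kap_diag:
  assumes "even n" "odd q" "n \<ge> 1"
  shows "kap n q m k k \<noteq> 0"
proof (induction m)
  case (Suc m)
  let ?e = "real (q + n - 1 + 2 * k) - 2 * real m"
  have e: "?e = of_int (int q + int n - 1 + 2 * int k - 2 * int m)"
    using assms by (simp add: of_nat_diff)
  have "?e - 1 = of_int (int q + int n - 2 + 2 * int k - 2 * int m)" unfolding e by simp
  moreover have "odd (int q + int n - 2 + 2 * int k - 2 * int m)" using assms by simp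
  ultimately have 1: "?e - 1 \<noteq> 0" by (metis even_zero of_int_eq_0_iff)
  have "?e + 1 - real n - 4 * real k = of_int (int q - 2 * int k - 2 * int m)" unfolding e by simp
  moreover have "odd (int q - 2 * int k - 2 * int m)" using assms by simp
  ultimately have 2: "?e + 1 - real n - 4 * real k \<noteq> 0" by (metis even_zero of_int_eq_0_iff)
  have 3: "real (2 * k) * real (2 * k - 1) * kap n q m (k - 1) k = 0"
    by (cases k) (simp_all add: kap_zero)
  show ?case
    using no_zero_divisors[OF no_zero_divisors[OF 1 2] Suc.IH]
    unfolding kap.simps(2) Let_def 3 add_0_right .
qed simp

definition smom :: "(real^'n \<Rightarrow> real) \<Rightarrow> real^'n \<Rightarrow> nat \<Rightarrow> real" where
  "smom F a k = (\<integral>\<theta>. F \<theta> * (\<theta> \<bullet> a) ^ (2 * k) \<partial>sph)"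

lemma smom_integrable:
  assumes F: "integrable sph F" and [measurable]: "F \<in> borel_measurable borel" and a: "norm a = 1"
  shows "integrable sph (\<lambda>\<theta>. F \<theta> * (\<theta> \<bullet> a) ^ d)"
proof (rule Bochner_Integration.integrable_bound[OF F])
  show "AE \<theta> in sph. norm (F \<theta> * (\<theta> \<bullet> a) ^ d) \<le> norm (F \<theta>)"
    using AE_sph_norm
  proof eventually_elim
    fix \<theta> :: "real^'a" assume "norm \<theta> = 1"
    then have "\<bar>\<theta> \<bullet> a\<bar> \<le> 1" using Cauchy_Schwarz_ineq2[of \<theta> a] a by simp
    then have "\<bar>\<theta> \<bullet> a\<bar> ^ d \<le> 1" by (simp add: power_le_one)
    then show "norm (F \<theta> * (\<theta> \<bullet> a) ^ d) \<le> norm (F \<theta>)"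
      by (simp add: abs_mult power_abs mult_left_le)
  qed
qed simp

text \<open>The innermost Laplacian is split off. It turns a profile times (x . a)^(2k) into another
  profile of the same kind plus a multiple of the term with k - 1, so the induction is over all
  \<open>D\<close> and \<open>k\<close>. The bound on 2m keeps the subtraction in the exponent
  exact.\<close>

lemma laplacian_iter_moment:
  fixes F :: "real^'n \<Rightarrow> real"
  assumes Fm[measurable]: "F \<in> borel_measurable borel" and F: "integrable sph F" and a: "norm a = 1"
    and hom: "\<And>r \<theta>. r > 0 \<Longrightarrow> F (r *\<^sub>R \<theta>) = r ^ q * F \<theta>"
  shows "2 * m \<le> q + CARD('n) - 1 \<Longrightarrow> rad D \<Longrightarrow>
      integrable lborel (\<lambda>x. F x * (laplacian ^^ m) (\<lambda>x. D 0 (x \<bullet> x) * (x \<bullet> a) ^ (2 * k)) x) \<and>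
      (\<integral>x. F x * (laplacian ^^ m) (\<lambda>x. D 0 (x \<bullet> x) * (x \<bullet> a) ^ (2 * k)) x \<partial>lborel)
      = (\<Sum>j\<le>k. kap CARD('n) q m k j * smom F a j) * rint D 0 (q + CARD('n) - 1 + 2 * k - 2 * m)"
proof (induction m arbitrary: D k)
  case 0
  have c: "(\<lambda>y. D 0 y) \<in> borel_measurable borel"
    using 0(2) by (intro borel_measurable_continuous_onI continuous_at_imp_continuous_on ballI)
      (auto simp: rad_def deriv_seq_def intro: DERIV_isCont)
  note [measurable] = c
  have i: "integrable lborel (\<lambda>r. D j (r\<^sup>2) * r ^ e * indicator {0<..} r)" for j e using 0(2) by (simp add: rad_def)
  have ex: "r ^ q * r ^ (2 * k) * r ^ (CARD('n) - 1) = r ^ (q + CARD('n) - 1 + 2 * k)" for r :: real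
  proof -
    have "q + 2 * k + (CARD('n) - 1) = q + CARD('n) - 1 + 2 * k" using zero_less_card_finite[where 'a = 'n] by linarith
    then show ?thesis by (metis power_add)
  qed
  have ex': "D 0 (r\<^sup>2) * r ^ q * r ^ (2 * k) * r ^ (CARD('n) - 1) * indicator {0<..} r = D 0 (r\<^sup>2) * r ^ (q + CARD('n) - 1 + 2 * k) * indicator {0<..} r" for r
    unfolding ex[symmetric] by simp
  have p: "F (r *\<^sub>R \<theta>) * (D 0 (r *\<^sub>R \<theta> \<bullet> r *\<^sub>R \<theta>) * (r *\<^sub>R \<theta> \<bullet> a) ^ (2 * k)) = (F \<theta> * (\<theta> \<bullet> a) ^ (2 * k)) * (D 0 (r\<^sup>2) * r ^ q * r ^ (2 * k))"
    if "norm \<theta> = 1" "r > 0" for \<theta> r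
    using that by (simp add: hom norm_eq_1 power_mult_distrib power2_eq_square)
  have im: "integrable (rmeas (CARD('n) - 1)) (\<lambda>r. D 0 (r\<^sup>2) * r ^ q * r ^ (2 * k))"
    using i[of 0 "q + CARD('n) - 1 + 2 * k"] by (subst rmeas_integrable_iff, simp, subst ex') simp
  have B: "(\<integral>r. D 0 (r\<^sup>2) * r ^ q * r ^ (2 * k) \<partial>rmeas (CARD('n) - 1)) = rint D 0 (q + CARD('n) - 1 + 2 * k)"
    by (subst rmeas_integral, simp, subst ex') (simp add: rint_def)
  have S: "(\<Sum>j\<le>k. kap CARD('n) q 0 k j * smom F a j) = smom F a k"
    by (simp add: if_distrib[of "\<lambda>x. x * _"] sum.delta cong: if_cong)
  show ?case
    using polar_product[OF _ _ _ smom_integrable[OF F Fm a, of "2 * k"] im p] B S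
    by (simp add: smom_def)
next
  case (Suc m)
  define e where "e = q + CARD('n) - 1 + 2 * k - 2 * Suc m"
  have e2: "q + CARD('n) - 1 + 2 * k - 2 * m = e + 2" and er: "real e = real (q + CARD('n) - 1 + 2 * k) - 2 * real m - 2"
    using Suc.prems(1) by (auto simp: e_def of_nat_diff)
  have ds: "deriv_seq D" using Suc.prems(2) by (simp add: rad_def)
  have ds': "deriv_seq (radop c D)" for c using rad_radop[OF Suc.prems(2)] by (simp add: rad_def)
  let ?c = "2 * CARD('n) + 4 * (2 * k)"
  let ?f = "\<lambda>x. radop ?c D 0 (x \<bullet> x) * (x \<bullet> a) ^ (2 * k)"
  let ?g = "\<lambda>x. D 0 (x \<bullet> x) * (x \<bullet> a) ^ (2 * (k - 1))"
  let ?d = "real (2 * k) * real (2 * k - 1)"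
  have smf: "sm ?f" and smg: "sm ?g" by (intro sm.mult sm.radial sm_power sm.inner ds ds')+
  have "laplacian (\<lambda>x. D 0 (x \<bullet> x) * (x \<bullet> a) ^ (2 * k)) = (\<lambda>x. ?f x + ?d * ?g x)"
    unfolding laplacian_radial_power[OF ds a] by (simp add: radop_def diff_mult_distrib2 fun_eq_iff)
  then have L: "(laplacian ^^ Suc m) (\<lambda>x. D 0 (x \<bullet> x) * (x \<bullet> a) ^ (2 * k)) = (\<lambda>x. (laplacian ^^ m) ?f x + ?d * (laplacian ^^ m) ?g x)"
    using smf smg by (simp add: funpow_Suc_right sm_laplacian_iter_add sm_laplacian_iter_scale sm.mult[OF sm.const] del: funpow.simps)
  have m: "2 * m \<le> q + CARD('n) - 1" using Suc.prems(1) by simp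
  note f = Suc.IH[OF m rad_radop[OF Suc.prems(2)], of ?c k]
  note g = Suc.IH[OF m Suc.prems(2), of "k - 1"]
  have eq: "F x * (laplacian ^^ Suc m) (\<lambda>x. D 0 (x \<bullet> x) * (x \<bullet> a) ^ (2 * k)) x = F x * (laplacian ^^ m) ?f x + ?d * (F x * (laplacian ^^ m) ?g x)" for x
    unfolding L by (simp add: algebra_simps)
  have I: "integrable lborel (\<lambda>x. F x * (laplacian ^^ Suc m) (\<lambda>x. D 0 (x \<bullet> x) * (x \<bullet> a) ^ (2 * k)) x)"
    unfolding eq using f g by (intro Bochner_Integration.integrable_add integrable_mult_right) auto
  \<comment> \<open>For k > 0 the exponents agree, as lowering k by one equals one more Laplacian;
    for k = 0 the coefficient is 0.\<close>
  have kg: "?d * rint D 0 (q + CARD('n) - 1 + 2 * (k - 1) - 2 * m) = ?d * rint D 0 e"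
    by (cases k) (simp_all add: e_def)
  have ks: "?d * (\<Sum>j\<le>k-1. kap CARD('n) q m (k-1) j * smom F a j) = ?d * (\<Sum>j\<le>k. kap CARD('n) q m (k-1) j * smom F a j)"
    by (cases k) (simp_all add: kap_zero)
  let ?M = "(real e + 3) * (real e + 1) - real ?c * (real e + 1) / 2"
  have "(\<integral>x. F x * (laplacian ^^ Suc m) (\<lambda>x. D 0 (x \<bullet> x) * (x \<bullet> a) ^ (2 * k)) x \<partial>lborel)
     = (\<integral>x. F x * (laplacian ^^ m) ?f x \<partial>lborel) + ?d * (\<integral>x. F x * (laplacian ^^ m) ?g x \<partial>lborel)"
    unfolding eq using f g by (subst Bochner_Integration.integral_add) auto
  also have "\<dots> = (\<Sum>j\<le>k. kap CARD('n) q m k j * smom F a j) * (?M * rint D 0 e)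
      + (?d * (\<Sum>j\<le>k-1. kap CARD('n) q m (k-1) j * smom F a j)) * rint D 0 (q + CARD('n) - 1 + 2 * (k - 1) - 2 * m)"
    using f g by (simp only: e2 rint_radop[OF Suc.prems(2)] mult.assoc)
  also have "\<dots> = (\<Sum>j\<le>k. kap CARD('n) q m k j * smom F a j) * (?M * rint D 0 e)
      + (?d * (\<Sum>j\<le>k. kap CARD('n) q m (k-1) j * smom F a j)) * rint D 0 e"
  proof -
    have "(?d * S) * rint D 0 (q + CARD('n) - 1 + 2 * (k - 1) - 2 * m) = (?d * S) * rint D 0 e" for S
      using arg_cong[OF kg, of "\<lambda>t. S * t"] by (simp only: mult.assoc mult.left_commute[of S])
    then show ?thesis unfolding ks[symmetric] by (simp only:)
  qed
  also have "\<dots> = (\<Sum>j\<le>k. (?M * kap CARD('n) q m k j + ?d * kap CARD('n) q m (k-1) j) * smom F a j) * rint D 0 e"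
  proof -
    have "(\<Sum>j\<le>k. u j * s j) * (M * R) + (d * (\<Sum>j\<le>k. v j * s j)) * R = (\<Sum>j\<le>k. (M * u j + d * v j) * s j) * R"
      for M d R :: real and u v s :: "nat \<Rightarrow> real"
      by (simp add: sum_distrib_left sum_distrib_right sum.distrib[symmetric] algebra_simps)
    then show ?thesis .
  qed
  also have "(\<Sum>j\<le>k. (?M * kap CARD('n) q m k j + ?d * kap CARD('n) q m (k-1) j) * smom F a j) = (\<Sum>j\<le>k. kap CARD('n) q (Suc m) k j * smom F a j)"
  proof (rule sum.cong[OF refl])
    fix j
    have "?M = (let e = real (q + CARD('n) - 1 + 2 * k) - 2 * real m in (e - 1) * (e + 1 - real CARD('n) - 4 * real k))"
      unfolding er Let_def by (simp add: field_simps)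
    then show "(?M * kap CARD('n) q m k j + ?d * kap CARD('n) q m (k-1) j) * smom F a j = kap CARD('n) q (Suc m) k j * smom F a j"
      by (simp only: kap.simps)
  qed
  finally show ?case using I by (simp only: e_def)
qed

lemma kap_injective:
  assumes "even n" "odd q" "n \<ge> 1"
    and eq: "\<And>k. (\<Sum>j\<le>k. kap n q m k j * A j) = (\<Sum>j\<le>k. kap n q m k j * B j)"
  shows "A k = B k"
proof (induction k rule: less_induct)
  case (less k)
  have s: "(\<Sum>j\<le>k. kap n q m k j * X j) = (\<Sum>j<k. kap n q m k j * X j) + kap n q m k k * X k" for X
    by (simp add: lessThan_Suc_atMost[symmetric])
  have "(\<Sum>j<k. kap n q m k j * A j) = (\<Sum>j<k. kap n q m k j * B j)"
    using less by (intro sum.cong) auto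
  then have "kap n q m k k * A k = kap n q m k k * B k" using eq[of k] unfolding s by simp
  then show ?case using kap_diag[OF assms(1-3)] by simp
qed

subsection \<open>A bump function and the Gaussian as radial profiles\<close>

text \<open>The classical function exp(-1/u), flat at 0, divided by powers of u so that derivatives
  stay in the family.\<close>

definition flat :: "nat \<Rightarrow> real \<Rightarrow> real" where
  "flat i u = (if u > 0 then exp (- 1 / u) / u ^ i else 0)"

text \<open>A single term of the series of exp(1/u) already dominates. The quadratic bound makes
  every member differentiable at 0 with derivative 0.\<close>

lemma flat_le: "\<bar>flat i u\<bar> \<le> fact (i + 2) * u\<^sup>2"
proof (cases "u > 0")
  case True
  have "(1 / u) ^ (i + 2) / fact (i + 2) \<le> exp (1 / u)"
  proof -
    have "(\<Sum>n\<in>{i + 2}. (1 / u) ^ n /\<^sub>R fact n) \<le> (\<Sum>n. (1 / u) ^ n /\<^sub>R fact n)"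
      using True by (intro sum_le_suminf summable_exp_generic) auto
    then show ?thesis by (simp add: exp_def divide_inverse mult.commute)
  qed
  then have "1 / (fact (i + 2) * u ^ (i + 2)) \<le> exp (1 / u)"
    by (simp add: power_divide mult.commute del: fact_Suc power_Suc add_2_eq_Suc')
  moreover have "0 < fact (i + 2) * u ^ (i + 2)" using True by simp
  ultimately have "1 \<le> exp (1 / u) * (fact (i + 2) * u ^ (i + 2))"
    by (simp add: pos_divide_le_eq del: fact_Suc power_Suc add_2_eq_Suc')
  then have "exp (- 1 / u) \<le> fact (i + 2) * u ^ (i + 2)"
    by (simp add: exp_minus inverse_eq_divide divide_le_eq mult.commute del: fact_Suc power_Suc add_2_eq_Suc')
  then have "exp (- 1 / u) / u ^ i \<le> fact (i + 2) * u\<^sup>2"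
    using True by (simp add: divide_le_eq power_add mult_ac del: fact_Suc add_2_eq_Suc')
  then show ?thesis using True by (simp add: flat_def del: fact_Suc add_2_eq_Suc')
qed (simp add: flat_def)

lemma flat_derivative: "(flat i has_real_derivative flat (i + 2) u - real i * flat (i + 1) u) (at u)"
proof (cases u "0::real" rule: linorder_cases)
  case greater
  have "((\<lambda>u. exp (- 1 / u) / u ^ i) has_real_derivative flat (i + 2) u - real i * flat (i + 1) u) (at u)"
  proof -
    have d1: "((\<lambda>u. exp (- 1 / u)) has_real_derivative exp (- 1 / u) * (1 / u\<^sup>2)) (at u)"
      using greater by (auto intro!: derivative_eq_intros simp: power2_eq_square)
    have d2: "((\<lambda>u. u ^ i) has_real_derivative real i * u ^ (i - 1)) (at u)"
      by (auto intro!: derivative_eq_intros)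
    have ii: "real i * u ^ (i - 1) * u = real i * u ^ i" by (cases i) auto
    show ?thesis
    proof (rule DERIV_cong[OF DERIV_divide[OF d1 d2]])
      have "real i * u ^ (i - 1) = real i * u ^ i / u" using ii greater by (simp add: field_simps)
      then show "(exp (- 1 / u) * (1 / u\<^sup>2) * u ^ i - exp (- 1 / u) * (real i * u ^ (i - 1))) / (u ^ i * u ^ i) = flat (i + 2) u - real i * flat (i + 1) u"
        using greater by (cases i) (simp_all add: flat_def field_simps power2_eq_square)
    qed (use greater in simp)
  qed
  then show ?thesis
    by (rule has_field_derivative_transform_within_open[of _ _ _ "{0<..}"]) (use greater in \<open>auto simp: flat_def\<close>)
next
  case less
  have "((\<lambda>u. 0) has_real_derivative flat (i + 2) u - real i * flat (i + 1) u) (at u)"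
    using less by (simp add: flat_def)
  then show ?thesis
    by (rule has_field_derivative_transform_within_open[of _ _ _ "{..<0}"]) (use less in \<open>auto simp: flat_def\<close>)
next
  case equal
  have "(\<lambda>h. flat i h / h) \<midarrow>0\<rightarrow> 0"
  proof (rule Lim_null_comparison)
    show "\<forall>\<^sub>F h in at 0. norm (flat i h / h) \<le> fact (i + 2) * \<bar>h\<bar>"
    proof (rule always_eventually, rule allI)
      fix h :: real
      show "norm (flat i h / h) \<le> fact (i + 2) * \<bar>h\<bar>"
        using flat_le[of i h] by (cases "h = 0") (auto simp: abs_divide divide_le_eq power2_eq_square abs_mult[symmetric] mult.assoc)
    qed
    show "(\<lambda>h. fact (i + 2) * \<bar>h :: real\<bar>) \<midarrow>0\<rightarrow> 0" by (auto intro!: tendsto_eq_intros)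
  qed
  then show ?thesis by (simp add: equal has_field_derivative_iff flat_def)
qed

text \<open>Sums of products of flat functions at the two ends of [1,4]. With y = x . x the support
  lies in the annulus of radii 1 and 2, away from the origin.\<close>

inductive bumpy :: "(real \<Rightarrow> real) \<Rightarrow> bool" where
  base: "bumpy (\<lambda>y. c * (flat i (y - 1) * flat j (4 - y)))"
| add: "bumpy f \<Longrightarrow> bumpy g \<Longrightarrow> bumpy (\<lambda>y. f y + g y)"

lemma bumpy_derivative: "bumpy f \<Longrightarrow> \<exists>f'. bumpy f' \<and> (\<forall>y. (f has_real_derivative f' y) (at y))"
proof (induction rule: bumpy.induct)
  case (base c i j)
  let ?f' = "\<lambda>y. (c * (flat (i + 2) (y - 1) * flat j (4 - y)) + (- c * real i) * (flat (i + 1) (y - 1) * flat j (4 - y)))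
     + ((- c) * (flat i (y - 1) * flat (j + 2) (4 - y)) + (c * real j) * (flat i (y - 1) * flat (j + 1) (4 - y)))"
  have "((\<lambda>y. c * (flat i (y - 1) * flat j (4 - y))) has_real_derivative ?f' y) (at y)" for y
  proof -
    have d1: "((\<lambda>y. flat i (y - 1)) has_real_derivative (flat (i + 2) (y - 1) - real i * flat (i + 1) (y - 1)) * 1) (at y)"
      by (rule DERIV_chain2[OF flat_derivative]) (auto intro!: derivative_eq_intros)
    have d2: "((\<lambda>y. flat j (4 - y)) has_real_derivative (flat (j + 2) (4 - y) - real j * flat (j + 1) (4 - y)) * (- 1)) (at y)"
      by (rule DERIV_chain2[OF flat_derivative]) (auto intro!: derivative_eq_intros)
    show ?thesis
      by (rule DERIV_cong[OF DERIV_cmult[OF DERIV_mult[OF d1 d2]]]) (simp add: algebra_simps)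
  qed
  moreover have "bumpy ?f'" by (intro bumpy.intros)
  ultimately show ?case by blast
next
  case (add f g)
  then show ?case by (blast intro: bumpy.add DERIV_add)
qed

lemma bumpy_support: "bumpy f \<Longrightarrow> \<not> (1 < y \<and> y < 4) \<Longrightarrow> f y = 0"
  by (induction rule: bumpy.induct) (auto simp: flat_def)

definition bumps :: "nat \<Rightarrow> real \<Rightarrow> real" where
  "bumps j = (deriv ^^ j) (\<lambda>y. 1 * (flat 0 (y - 1) * flat 0 (4 - y)))"

lemma bumpy_bumps: "bumpy (bumps j)"
  and bumps_deriv_seq: "deriv_seq bumps"
proof -
  have d: "bumpy (deriv f) \<and> (f has_real_derivative deriv f y) (at y)" if "bumpy f" for f y
    using bumpy_derivative[OF that] by (metis DERIV_imp_deriv ext)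
  show b: "bumpy (bumps j)" for j
    using bumpy.base[of 1 0 0] by (induction j) (simp_all add: bumps_def d)
  show "deriv_seq bumps"
    unfolding deriv_seq_def using d[OF b] by (simp add: bumps_def)
qed

lemma rad_bumps: "rad bumps"
proof -
  have "integrable lborel (\<lambda>r. bumps j (r\<^sup>2) * r ^ e * indicator {0<..} r)" for j e
  proof -
    have c: "continuous_on UNIV (\<lambda>r. bumps j (r\<^sup>2) * r ^ e)"
    proof -
      have "continuous_on UNIV (bumps j)"
        using bumps_deriv_seq by (intro continuous_at_imp_continuous_on ballI) (auto simp: deriv_seq_def intro: DERIV_isCont)
      then have "continuous_on UNIV (\<lambda>r :: real. bumps j (r\<^sup>2))"
        by (rule continuous_on_compose2) (auto intro!: continuous_intros)
      then show ?thesis by (intro continuous_intros)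
    qed
    have "integrable lborel (\<lambda>r. indicator {0..2} r *\<^sub>R (bumps j (r\<^sup>2) * r ^ e))"
      by (rule borel_integrable_compact) (auto intro: continuous_on_subset[OF c])
    also have "(\<lambda>r. indicator {0..2} r *\<^sub>R (bumps j (r\<^sup>2) * r ^ e)) = (\<lambda>r. bumps j (r\<^sup>2) * r ^ e * indicator {0<..} r)"
    proof
      fix r :: real
      show "indicator {0..2} r *\<^sub>R (bumps j (r\<^sup>2) * r ^ e) = bumps j (r\<^sup>2) * r ^ e * indicator {0<..} r"
      proof (cases "0 < r \<and> r \<le> 2")
        case False
        have "bumps j (r\<^sup>2) = 0" if "r > 2"
          using that power_strict_mono[of 2 r 2] by (intro bumpy_support[OF bumpy_bumps]) auto
        moreover have "bumps j 0 = 0" by (rule bumpy_support[OF bumpy_bumps]) auto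
        ultimately show ?thesis using False by (cases "r = 0") (auto simp: indicator_def)
      qed auto
    qed
    finally show ?thesis .
  qed
  moreover have "((\<lambda>r. bumps j (r\<^sup>2) * r ^ e) \<longlongrightarrow> 0) at_top" for j e
  proof (rule tendsto_eventually)
    show "\<forall>\<^sub>F r in at_top. bumps j (r\<^sup>2) * r ^ e = 0"
      using eventually_ge_at_top[of "2::real"]
    proof eventually_elim
      fix r :: real assume "r \<ge> 2"
      then have "r\<^sup>2 \<ge> 2\<^sup>2" by (intro power_mono) auto
      then show "bumps j (r\<^sup>2) * r ^ e = 0" using bumpy_support[OF bumpy_bumps, of "r\<^sup>2" j] by simp
    qed
  qed
  ultimately show ?thesis using bumps_deriv_seq by (simp add: rad_def)
qed

lemma rint_bumps_pos: "rint bumps 0 e > 0"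
proof -
  have nn: "bumps 0 (r\<^sup>2) * r ^ e * indicator {0<..} r \<ge> 0" for r
    by (auto simp: bumps_def flat_def indicator_def)
  have i: "integrable lborel (\<lambda>r. bumps 0 (r\<^sup>2) * r ^ e * indicator {0<..} r)" using rad_bumps by (simp add: rad_def)
  have "rint bumps 0 e \<noteq> 0"
  proof
    assume "rint bumps 0 e = 0"
    then have "AE r in lborel. bumps 0 (r\<^sup>2) * r ^ e * indicator {0<..} r = 0"
      using integral_nonneg_eq_0_iff_AE[OF i] nn by (simp add: rint_def)
    then have "AE r in lborel. r \<notin> {1<..<2 :: real}"
    proof eventually_elim
      fix r :: real assume z: "bumps 0 (r\<^sup>2) * r ^ e * indicator {0<..} r = 0"
      show "r \<notin> {1<..<2}"
      proof
        assume r: "r \<in> {1<..<2}"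
        then have "1 < r\<^sup>2" "r\<^sup>2 < 4" using power_strict_mono[of 1 r 2] power_strict_mono[of r 2 2] by auto
        then show False using z r by (simp add: bumps_def flat_def)
      qed
    qed
    then have "{1<..<2 :: real} \<in> null_sets lborel" by (subst (asm) AE_iff_null) (auto simp: greaterThanLessThan_def greaterThan_def lessThan_def Int_def)
    then show False by (simp add: null_sets_def)
  qed
  moreover have "rint bumps 0 e \<ge> 0" unfolding rint_def using nn by (intro integral_nonneg_AE) auto
  ultimately show ?thesis by simp
qed

definition gseq :: "nat \<Rightarrow> real \<Rightarrow> real" where "gseq j y = (- 1 / 2) ^ j * exp (- y / 2)"

lemma rad_gseq: "rad gseq"
proof -
  have g: "gseq j (r\<^sup>2) = (- 1 / 2) ^ j * gw r" for j r by (simp add: gseq_def gw_def power2_eq_square)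
  have "deriv_seq gseq" unfolding deriv_seq_def gseq_def by (auto intro!: derivative_eq_intros)
  moreover have "integrable lborel (\<lambda>r. gseq j (r\<^sup>2) * r ^ e * indicator {0<..} r)" for j e
    unfolding g using integrable_mult_right[OF integrable_hmom[of e], of "(- 1 / 2) ^ j"] by (simp add: mult.assoc)
  moreover have "((\<lambda>r. gseq j (r\<^sup>2) * r ^ e) \<longlongrightarrow> 0) at_top" for j e
  proof -
    have "((\<lambda>r. gw r * r ^ e) \<longlongrightarrow> 0) at_top"
    proof (rule tendsto_sandwich[OF _ _ tendsto_const tendsto_power_div_exp_0[of e]])
      show "\<forall>\<^sub>F r in at_top. (0::real) \<le> gw r * r ^ e"
        using eventually_ge_at_top[of 0] by eventually_elim simp
      show "\<forall>\<^sub>F r in at_top. gw r * r ^ e \<le> r ^ e / exp r"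
        using eventually_ge_at_top[of "2::real"]
      proof eventually_elim
        fix r :: real assume r: "r \<ge> 2"
        have "2 * r \<le> r * r" using r by (intro mult_right_mono) auto
        then have "gw r \<le> exp (- r)" by (simp add: gw_def)
        then have "gw r * r ^ e \<le> exp (- r) * r ^ e" using r by (intro mult_right_mono) auto
        then show "gw r * r ^ e \<le> r ^ e / exp r" by (simp add: exp_minus divide_inverse mult.commute)
      qed
    qed
    from tendsto_mult_right_zero[OF this, of "(- 1 / 2) ^ j"] show ?thesis
      unfolding g by (simp add: mult.assoc)
  qed
  ultimately show ?thesis by (simp add: rad_def)
qed

lemma rint_gseq: "rint gseq 0 e = hmom e"
  unfolding rint_def hmom_def by (simp add: gseq_def gw_def power2_eq_square)

lemma gseq_pgp: "(\<lambda>x. gseq 0 (x \<bullet> x) * (x \<bullet> a) ^ d) = pgp a (monom 1 d)"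
  by (simp add: gseq_def pgp_def gw_def fun_eq_iff poly_monom)

lemma bump_test_function:
  fixes a :: "real^'n"
  shows "(\<lambda>x. bumps 0 (x \<bullet> x) * (x \<bullet> a) ^ d) \<in> test_functions (UNIV - {0})" (is "?\<phi> \<in> _")
proof -
  have sub: "{x. ?\<phi> x \<noteq> 0} \<subseteq> cball 0 2 - ball 0 1"
  proof
    fix x assume "x \<in> {x. ?\<phi> x \<noteq> 0}"
    then have "1 < x \<bullet> x \<and> x \<bullet> x < 4" using bumpy_support[OF bumpy_bumps, of "x \<bullet> x" 0] by auto
    then have b: "1\<^sup>2 < (norm x)\<^sup>2" "(norm x)\<^sup>2 < 2\<^sup>2" by (simp_all add: power2_norm_eq_inner)
    have "1 < norm x" by (rule power2_less_imp_less[OF b(1)]) simp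
    moreover have "norm x < 2" by (rule power2_less_imp_less[OF b(2)]) simp
    ultimately
    show "x \<in> cball 0 2 - ball 0 1" by simp
  qed
  then have cl: "closure {x. ?\<phi> x \<noteq> 0} \<subseteq> cball 0 2 - ball 0 1"
    by (rule closure_minimal) (simp add: closed_Diff)
  have "bounded {x. ?\<phi> x \<noteq> 0}" using sub by (intro bounded_subset[OF bounded_cball[of 0 2]]) blast
  then have "compact (closure {x. ?\<phi> x \<noteq> 0})"
    by (rule compact_closure[THEN iffD2])
  moreover have "C_k k ?\<phi>" for k by (intro sm_C_k sm.mult sm.radial sm_power sm.inner bumps_deriv_seq)
  moreover have "closure {x. ?\<phi> x \<noteq> 0} \<subseteq> UNIV - {0}" using cl by force
  ultimately show ?thesis by (simp add: test_functions_def)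
qed

text \<open>Degree 1 - n cancels the Jacobian r^(n-1), leaving the radial exponent d. For d = 2k
  this is the exponent q + n - 1 + 2k - 2m that \<open>laplacian_iter_moment\<close> yields.\<close>

lemma homogeneous_moment:
  fixes g :: "real^'n \<Rightarrow> real"
  assumes gm[measurable]: "g \<in> borel_measurable borel" and g: "integrable sph g" and a: "norm a = 1" and D: "rad D"
    and hom: "\<And>r \<theta>. r > 0 \<Longrightarrow> g (r *\<^sub>R \<theta>) = g \<theta> / r ^ (CARD('n) - 1)"
  shows "integrable lborel (\<lambda>x. g x * (D 0 (x \<bullet> x) * (x \<bullet> a) ^ d))"
    and "(\<integral>x. g x * (D 0 (x \<bullet> x) * (x \<bullet> a) ^ d) \<partial>lborel) = (\<integral>\<theta>. g \<theta> * (\<theta> \<bullet> a) ^ d \<partial>sph) * rint D 0 d"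
proof -
  have c: "(\<lambda>y. D 0 y) \<in> borel_measurable borel"
    using D by (intro borel_measurable_continuous_onI continuous_at_imp_continuous_on ballI)
      (auto simp: rad_def deriv_seq_def intro: DERIV_isCont)
  note [measurable] = c
  let ?B = "\<lambda>r. D 0 (r\<^sup>2) * r ^ d / r ^ (CARD('n) - 1)"
  have B: "?B r * r ^ (CARD('n) - 1) * indicator {0<..} r = D 0 (r\<^sup>2) * r ^ d * indicator {0<..} r" for r
    by (cases "r > 0") auto
  have p: "g (r *\<^sub>R \<theta>) * (D 0 (r *\<^sub>R \<theta> \<bullet> r *\<^sub>R \<theta>) * (r *\<^sub>R \<theta> \<bullet> a) ^ d) = (g \<theta> * (\<theta> \<bullet> a) ^ d) * ?B r"
    if "norm \<theta> = 1" "r > 0" for \<theta> r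
    using that by (simp add: hom norm_eq_1 power_mult_distrib power2_eq_square)
  have i: "integrable (rmeas (CARD('n) - 1)) ?B"
    using D by (subst rmeas_integrable_iff, simp, subst B) (simp add: rad_def)
  have v: "(\<integral>r. ?B r \<partial>rmeas (CARD('n) - 1)) = rint D 0 d"
    by (subst rmeas_integral, simp, subst B) (simp add: rint_def)
  have m: "(\<lambda>x. g x * (D 0 (x \<bullet> x) * (x \<bullet> a) ^ d)) \<in> borel_measurable borel" "(\<lambda>\<theta>. g \<theta> * (\<theta> \<bullet> a) ^ d) \<in> borel_measurable borel" "?B \<in> borel_measurable borel"
    by measurable
  show "integrable lborel (\<lambda>x. g x * (D 0 (x \<bullet> x) * (x \<bullet> a) ^ d))"
    by (rule polar_product(1)[OF m smom_integrable[OF g gm a] i p])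
  show "(\<integral>x. g x * (D 0 (x \<bullet> x) * (x \<bullet> a) ^ d) \<partial>lborel) = (\<integral>\<theta>. g \<theta> * (\<theta> \<bullet> a) ^ d \<partial>sph) * rint D 0 d"
    using polar_product(2)[OF m smom_integrable[OF g gm a] i p] by (simp only: v)
qed

subsection \<open>Even functions on the sphere are determined by their even moments\<close>

inductive trig :: "(real^'n \<Rightarrow> real) \<Rightarrow> bool" where
  base: "trig (\<lambda>x. c * cos (x \<bullet> a) + d * sin (x \<bullet> a))"
| add: "trig f \<Longrightarrow> trig g \<Longrightarrow> trig (\<lambda>x. f x + g x)"

lemma trig_mult_base: "trig f \<Longrightarrow> trig (\<lambda>x. (c * cos (x \<bullet> a) + d * sin (x \<bullet> a)) * f x)"
proof (induction rule: trig.induct)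
  case (base c' b d')
  have "(\<lambda>x. (c * cos (x \<bullet> a) + d * sin (x \<bullet> a)) * (c' * cos (x \<bullet> b) + d' * sin (x \<bullet> b)))
    = (\<lambda>x. ((c * c' + d * d') / 2 * cos (x \<bullet> (a - b)) + (d * c' - c * d') / 2 * sin (x \<bullet> (a - b)))
         + ((c * c' - d * d') / 2 * cos (x \<bullet> (a + b)) + (d * c' + c * d') / 2 * sin (x \<bullet> (a + b))))"
    by (simp add: fun_eq_iff inner_diff_right inner_add_right cos_diff cos_add sin_diff sin_add field_simps)
  then show ?case by (simp only:) (intro trig.intros)
next
  case (add f g)
  then show ?case by (simp add: distrib_left trig.add)
qed

lemma trig_mult: "trig f \<Longrightarrow> trig g \<Longrightarrow> trig (\<lambda>x. f x * g x)"
  by (induction rule: trig.induct) (rule trig_mult_base, assumption, simp add: distrib_right trig.add)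

lemma trig_continuous: "trig f \<Longrightarrow> continuous_on S f"
  by (induction rule: trig.induct) (auto intro!: continuous_intros)

lemma trig_separates:
  fixes x y :: "real^'n"
  assumes "x \<noteq> y" shows "\<exists>f. trig f \<and> f x \<noteq> f y"
proof (rule ccontr)
  assume n: "\<not> ?thesis"
  \<comment> \<open>The scaling makes the two phases differ by exactly 1; equal cosines and sines
    would then force cos 1 = 1, hence sin 1 = 0.\<close>
  define a where "a = (1 / ((x - y) \<bullet> (x - y))) *\<^sub>R (x - y)"
  have "x \<bullet> a - y \<bullet> a = (x - y) \<bullet> a" by (simp add: inner_diff_left)
  also have "\<dots> = 1" using assms by (simp add: a_def)
  finally have 1: "x \<bullet> a - y \<bullet> a = 1" .
  have "trig (\<lambda>x. cos (x \<bullet> a))" "trig (\<lambda>x. sin (x \<bullet> a))"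
    using trig.base[of 1 a 0] trig.base[of 0 a 1] by simp_all
  then have "cos (x \<bullet> a) = cos (y \<bullet> a)" "sin (x \<bullet> a) = sin (y \<bullet> a)" using n by blast+
  then have "cos (x \<bullet> a - y \<bullet> a) = 1" by (simp add: cos_diff sin_cos_squared_add3)
  then have "sin (1::real) = 0" unfolding 1 using sin_cos_squared_add[of "1::real"] by simp
  then show False using sin_gt_zero_02[of 1] by simp
qed

text \<open>Trigonometric sums are used as the Stone-Weierstrass algebra because they need only
  powers of single linear forms: \<open>\<Lambda>\<close> of a cosine is the limit of its Taylor
  sums, hence of even moments, and sines are odd. The addition formulas make the sums an algebra
  without mixed products of linear forms.\<close>

lemma even_moments_determine:
  fixes \<Lambda> :: "(real^'n \<Rightarrow> real) \<Rightarrow> real"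
  assumes add: "\<And>f g. continuous_on UNIV f \<Longrightarrow> continuous_on UNIV g \<Longrightarrow> \<Lambda> (\<lambda>x. f x + g x) = \<Lambda> f + \<Lambda> g"
    and scale: "\<And>f c. continuous_on UNIV f \<Longrightarrow> \<Lambda> (\<lambda>x. c * f x) = c * \<Lambda> f"
    and bd: "\<And>f e. continuous_on UNIV f \<Longrightarrow> (\<And>x. norm x = 1 \<Longrightarrow> \<bar>f x\<bar> \<le> e) \<Longrightarrow> \<bar>\<Lambda> f\<bar> \<le> C * e"
    and ev: "\<And>f. continuous_on UNIV f \<Longrightarrow> \<Lambda> (\<lambda>x. f (- x)) = \<Lambda> f"
    and mom: "\<And>a k. norm a = 1 \<Longrightarrow> \<Lambda> (\<lambda>x. (x \<bullet> a) ^ (2 * k)) = 0"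
    and f: "continuous_on UNIV f"
  shows "\<Lambda> f = 0"
proof -
  have mom': "\<Lambda> (\<lambda>x. (x \<bullet> a) ^ (2 * k)) = 0" for a k
  proof -
    obtain e where e: "norm e = 1" "a = norm a *\<^sub>R e"
    proof (cases "a = 0")
      case True
      then show ?thesis using that[of "axis undefined 1"] by simp
    next
      case False
      then show ?thesis using that[of "sgn a"] by (simp add: norm_sgn sgn_div_norm)
    qed
    have "(\<lambda>x. (x \<bullet> a) ^ (2 * k)) = (\<lambda>x. norm a ^ (2 * k) * (x \<bullet> e) ^ (2 * k))"
      by (subst e(2)) (simp add: power_mult_distrib)
    then show ?thesis using mom[OF e(1), of k] by (simp add: scale continuous_intros)
  qed
  have odd: "\<Lambda> f = 0" if "continuous_on UNIV f" "\<And>x. f (- x) = - f x" for f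
    using ev[OF that(1)] scale[OF that(1), of "-1"] that(2) by simp
  have sum0: "\<Lambda> (\<lambda>x. \<Sum>i<(m::nat). cos_coeff i * (x \<bullet> a) ^ i) = 0" for m a
  proof (induction m)
    case 0
    show ?case using scale[of "\<lambda>x. 0" 0] by simp
  next
    case (Suc m)
    have "\<Lambda> (\<lambda>x. cos_coeff m * (x \<bullet> a) ^ m) = cos_coeff m * \<Lambda> (\<lambda>x. (x \<bullet> a) ^ m)"
      by (rule scale) (intro continuous_intros)
    moreover have "cos_coeff m * \<Lambda> (\<lambda>x. (x \<bullet> a) ^ m) = 0"
    proof (cases "even m")
      case True
      then obtain k where "m = 2 * k" by (auto elim: evenE)
      then show ?thesis using mom' by simp
    qed (simp add: cos_coeff_def)
    ultimately show ?case using Suc by (simp add: add continuous_intros)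
  qed
  have cos0: "\<Lambda> (\<lambda>x. cos (x \<bullet> a)) = 0" for a
  proof -
    have "\<bar>\<Lambda> (\<lambda>x. cos (x \<bullet> a))\<bar> \<le> C * (norm a ^ m / fact m)" for m
    proof -
      let ?T = "\<lambda>x. \<Sum>i<m. cos_coeff i * (x \<bullet> a) ^ i"
      have "\<bar>\<Lambda> (\<lambda>x. cos (x \<bullet> a) + (- 1) * ?T x)\<bar> \<le> C * (norm a ^ m / fact m)"
      proof (rule bd)
        fix x :: "real^'n" assume x: "norm x = 1"
        obtain t where "cos (x \<bullet> a) = ?T x + cos (t + 1/2 * real m * pi) / fact m * (x \<bullet> a) ^ m"
          using Maclaurin_cos_expansion[of "x \<bullet> a" m] by blast
        then have "\<bar>cos (x \<bullet> a) + (- 1) * ?T x\<bar> = \<bar>cos (t + 1/2 * real m * pi)\<bar> * \<bar>x \<bullet> a\<bar> ^ m / fact m"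
          by (simp add: abs_mult power_abs)
        also have "\<dots> \<le> 1 * norm a ^ m / fact m"
          using Cauchy_Schwarz_ineq2[of x a] x by (intro divide_right_mono mult_mono power_mono) auto
        finally show "\<bar>cos (x \<bullet> a) + (- 1) * ?T x\<bar> \<le> norm a ^ m / fact m" by simp
      qed (intro continuous_intros)
      moreover have "\<Lambda> (\<lambda>x. cos (x \<bullet> a) + (- 1) * ?T x) = \<Lambda> (\<lambda>x. cos (x \<bullet> a)) + (- 1) * \<Lambda> ?T"
        by (subst add) (intro continuous_intros, intro continuous_intros, subst scale, intro continuous_intros, simp)
      ultimately show ?thesis unfolding sum0 by simp
    qed
    moreover have "(\<lambda>m. C * (norm a ^ m / fact m)) \<longlonglongrightarrow> C * 0"
      using summable_LIMSEQ_zero[OF summable_exp_generic[of "norm a"]]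
      by (intro tendsto_intros) (simp add: divide_inverse mult.commute)
    ultimately have "\<bar>\<Lambda> (\<lambda>x. cos (x \<bullet> a))\<bar> \<le> C * 0" by (intro LIMSEQ_le_const) auto
    then show ?thesis by simp
  qed
  have sin0: "\<Lambda> (\<lambda>x. sin (x \<bullet> a)) = 0" for a by (rule odd) (auto intro!: continuous_intros)
  have tr: "\<Lambda> g = 0" if "trig g" for g
    using that
  proof (induction rule: trig.induct)
    case (base c a d)
    have "\<Lambda> (\<lambda>x. c * cos (x \<bullet> a) + d * sin (x \<bullet> a)) = \<Lambda> (\<lambda>x. c * cos (x \<bullet> a)) + \<Lambda> (\<lambda>x. d * sin (x \<bullet> a))"
      by (rule add) (intro continuous_intros)+
    also have "\<dots> = c * \<Lambda> (\<lambda>x. cos (x \<bullet> a)) + d * \<Lambda> (\<lambda>x. sin (x \<bullet> a))"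
      by (subst (1 2) scale) (intro continuous_intros refl)+
    finally show ?case by (simp add: cos0 sin0)
  next
    case (add f g)
    then show ?case using assms(1)[of f g] by (simp add: trig_continuous)
  qed
  have C0: "C \<ge> 0" using bd[of "\<lambda>x. 0" 1] by simp
  have "\<bar>\<Lambda> f\<bar> \<le> C * e" if e: "e > 0" for e
  proof -
    have "\<exists>g. trig g \<and> (\<forall>x\<in>sphere 0 1. \<bar>f x - g x\<bar> < e)"
    proof (rule Stone_Weierstrass_HOL)
      show "trig (\<lambda>x. c)" for c using trig.base[of c 0 0] by simp
    qed (use e in \<open>auto intro: trig_continuous trig_mult trig.add trig_separates continuous_on_subset[OF f]\<close>)
    then obtain g where g: "trig g" "\<And>x. norm x = 1 \<Longrightarrow> \<bar>f x - g x\<bar> < e" by auto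
    have gc: "continuous_on UNIV g" using g(1) by (rule trig_continuous)
    have "\<bar>\<Lambda> (\<lambda>x. f x + (- 1) * g x)\<bar> \<le> C * e"
      by (rule bd) (use g(2) in \<open>auto intro!: continuous_intros f gc less_imp_le\<close>)
    also have "\<Lambda> (\<lambda>x. f x + (- 1) * g x) = \<Lambda> f + (- 1) * \<Lambda> g"
      by (subst add[OF f], intro continuous_intros gc, subst scale[OF gc]) simp
    finally show ?thesis using tr[OF g(1)] by simp
  qed
  then have "\<bar>\<Lambda> f\<bar> \<le> 0 + e" if "e > 0" for e
    using that C0 by (cases "C = 0") (auto dest: spec[of _ "e / C"] simp: field_simps dest!: meta_spec[of _ "e / C"])
  then have "\<bar>\<Lambda> f\<bar> \<le> 0" by (rule field_le_epsilon)
  then show ?thesis by simp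
qed

section \<open>Reflection invariance and a test for almost everywhere nonnegativity\<close>

lemma sph_reflect:
  fixes f :: "real^'n \<Rightarrow> real"
  assumes [measurable]: "f \<in> borel_measurable borel"
  shows "(\<integral>\<theta>. f (- \<theta>) \<partial>sph) = (\<integral>\<theta>. f \<theta> \<partial>sph)"
proof -
  have nn: "(\<integral>\<^sup>+\<theta>. h (- \<theta>) \<partial>sph) = (\<integral>\<^sup>+\<theta>. h \<theta> \<partial>sph)" if [measurable]: "h \<in> borel_measurable borel" for h :: "real^'n \<Rightarrow> ennreal"
  proof -
    have "(\<integral>\<^sup>+x. k (- x) \<partial>lborel) = (\<integral>\<^sup>+x. k x \<partial>lborel)" if [measurable]: "k \<in> borel_measurable borel" for k :: "real^'n \<Rightarrow> ennreal"
      by (subst (2) lborel_affine[of "-1" 0]) (simp_all add: nn_integral_density nn_integral_distr)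
    from this[of "\<lambda>x. h (sgn x) * indicator (cball 0 1 - {0}) x"] show ?thesis
      by (simp add: nn_integral_sph sgn_minus indicator_def)
  qed
  have "distr sph borel uminus = (sph :: (real^'n) measure)"
  proof (rule measure_eqI)
    fix A assume "A \<in> sets (distr sph borel (uminus :: real^'n \<Rightarrow> _))"
    then have [measurable]: "A \<in> sets borel" by simp
    show "emeasure (distr sph borel uminus) A = emeasure sph A"
      using nn[of "indicator A"] by (subst (1 2) nn_integral_indicator[symmetric]) (simp_all add: nn_integral_distr del: nn_integral_indicator)
  qed simp
  then show ?thesis
    using integral_distr[of uminus "sph :: (real^'n) measure" borel f] by simp
qed

text \<open>The slab belonging to \<open>- \<xi>\<close> is a translate along \<open>\<xi>\<close>
  of the slab belonging to \<open>\<xi>\<close>, and the projection ignores such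
  translations.\<close>

lemma subsph_minus:
  fixes \<xi> :: "real^'n"
  assumes \<xi>: "norm \<xi> = 1" shows "subsph (- \<xi>) = subsph \<xi>"
proof (rule measure_eqI)
  fix A assume "A \<in> sets (subsph (- \<xi>))"
  then have [measurable]: "A \<in> sets borel" by simp
  let ?F = "\<lambda>x. indicator A (sgn (proj \<xi> x)) * indicator (cball 0 1 - {0}) (proj \<xi> x) :: ennreal"
  have pr: "proj \<xi> (- \<xi> + x) = proj \<xi> x" for x using \<xi> by (simp add: inner_simps norm_eq_1 algebra_simps)
  have "(\<integral>\<^sup>+x. ?F x * indicator {x. 0 \<le> x \<bullet> - \<xi> \<and> x \<bullet> - \<xi> \<le> 1} x \<partial>lborel)
     = (\<integral>\<^sup>+x. ?F (- \<xi> + x) * indicator {x. 0 \<le> x \<bullet> - \<xi> \<and> x \<bullet> - \<xi> \<le> 1} (- \<xi> + x) \<partial>lborel)"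
    by (rule nn_integral_lborel_translate[symmetric]) measurable
  also have "\<dots> = (\<integral>\<^sup>+x. ?F x * indicator {x. 0 \<le> x \<bullet> \<xi> \<and> x \<bullet> \<xi> \<le> 1} x \<partial>lborel)"
    unfolding pr using \<xi> by (intro nn_integral_cong) (auto simp: indicator_def inner_simps norm_eq_1)
  finally have eq: "(\<integral>\<^sup>+x. ?F x * indicator {x. 0 \<le> x \<bullet> - \<xi> \<and> x \<bullet> - \<xi> \<le> 1} x \<partial>lborel)
     = (\<integral>\<^sup>+x. ?F x * indicator {x. 0 \<le> x \<bullet> \<xi> \<and> x \<bullet> \<xi> \<le> 1} x \<partial>lborel)" .
  show "emeasure (subsph (- \<xi>)) A = emeasure (subsph \<xi>) A"
    using nn_integral_subsph[of "indicator A" "- \<xi>"] nn_integral_subsph[of "indicator A" \<xi>] eq by simp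
qed simp

lemma radon_minus: "norm \<xi> = 1 \<Longrightarrow> radon g (- \<xi>) = radon g \<xi>"
  by (simp add: radon_def subsph_minus)

text \<open>Approximating indicators of closed sets extends the test to them. A compact subset of
  \<open>{x. h x < 0}\<close> then has no mass for the density |h|, and inner regularity passes this
  on to the whole set.\<close>

lemma AE_nonneg_by_continuous:
  fixes h :: "real^'n \<Rightarrow> real"
  assumes hm[measurable]: "h \<in> borel_measurable borel" and h: "integrable sph h"
    and test: "\<And>f. continuous_on UNIV f \<Longrightarrow> (\<And>x. 0 \<le> f x) \<Longrightarrow> (\<And>x. f x \<le> 1) \<Longrightarrow> (\<integral>x. h x * f x \<partial>sph) \<ge> 0"
  shows "AE x in sph. h x \<ge> 0"
proof -
  have cl: "(\<integral>x. h x * indicator K x \<partial>sph) \<ge> 0" if K: "closed K" for K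
  proof (cases "K = {}")
    case False
    define g where "g k x = max 0 (1 - real k * infdist x K)" for k :: nat and x
    have gc: "continuous_on UNIV (g k)" and g0: "0 \<le> g k x" and g1: "g k x \<le> 1" for k x
      unfolding g_def by (intro continuous_intros) (auto simp: infdist_nonneg)
    have [measurable]: "g k \<in> borel_measurable borel" for k by (rule borel_measurable_continuous_onI[OF gc])
    have [measurable]: "K \<in> sets borel" using K by simp
    have "(\<lambda>k. \<integral>x. h x * g k x \<partial>sph) \<longlonglongrightarrow> (\<integral>x. h x * indicator K x \<partial>sph)"
    proof (rule integral_dominated_convergence[where w = "\<lambda>x. \<bar>h x\<bar>"])
      show "AE x in sph. (\<lambda>k. h x * g k x) \<longlonglongrightarrow> h x * indicator K x"
        using closed_indicator_limit[OF K False] unfolding g_def by (intro AE_I2 tendsto_mult tendsto_const)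
      show "AE x in sph. norm (h x * g k x) \<le> \<bar>h x\<bar>" for k
        using g0 g1 by (intro AE_I2) (simp add: abs_mult mult_left_le)
    qed (use h in simp_all)
    then show ?thesis by (rule LIMSEQ_le_const) (use test[OF gc g0 g1] in auto)
  qed simp
  define M where "M = density sph (\<lambda>x. ennreal \<bar>h x\<bar>)"
  have sM: "sets M = sets borel" by (simp add: M_def)
  have fM: "emeasure M (space M) \<noteq> \<infinity>"
    using h by (simp add: M_def emeasure_density integrable_iff_bounded)
  define B where "B = {x. h x < 0}"
  have [measurable]: "B \<in> sets borel" unfolding B_def by measurable
  have K0: "emeasure M K = 0" if "K \<subseteq> B" "compact K" for K
  proof -
    have [measurable]: "K \<in> sets borel" using that(2) by (simp add: borel_compact)
    have i: "integrable sph (\<lambda>x. - (h x * indicator K x))"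
      using integrable_mult_indicator[OF _ h, of K] by (simp add: mult.commute)
    have nn: "- (h x * indicator K x) \<ge> 0" for x using that(1) by (auto simp: indicator_def B_def)
    have "(\<integral>x. - (h x * indicator K x) \<partial>sph) = 0"
    proof (rule antisym)
      show "(\<integral>x. - (h x * indicator K x) \<partial>sph) \<ge> 0" by (rule integral_nonneg_AE) (use nn in auto)
      show "(\<integral>x. - (h x * indicator K x) \<partial>sph) \<le> 0" using cl[of K] that(2) by (simp add: compact_imp_closed)
    qed
    then have "AE x in sph. - (h x * indicator K x) = 0"
      using integral_nonneg_eq_0_iff_AE[OF i] nn by simp
    then have "AE x in sph. ennreal \<bar>h x\<bar> * indicator K x = 0" by eventually_elim (auto simp: indicator_def)
    then show ?thesis unfolding M_def by (subst emeasure_density) (simp_all add: nn_integral_0_iff_AE)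
  qed
  have "emeasure M B = (SUP K \<in> {K. K \<subseteq> B \<and> compact K}. emeasure M K)"
    by (rule inner_regular[OF sM fM]) simp
  also have "\<dots> = (SUP K \<in> {K. K \<subseteq> B \<and> compact K}. 0)" by (rule SUP_cong) (use K0 in auto)
  also have "\<dots> \<le> 0" by (rule SUP_least) simp
  finally have "(\<integral>\<^sup>+x. ennreal \<bar>h x\<bar> * indicator B x \<partial>sph) = 0"
    unfolding M_def by (subst (asm) emeasure_density) simp_all
  then have "AE x in sph. ennreal \<bar>h x\<bar> * indicator B x = 0" by (simp add: nn_integral_0_iff_AE)
  then show ?thesis by eventually_elim (auto simp: B_def indicator_def split: if_splits)
qed

subsection \<open>Every distribution on the sphere is an image of the unit interval\<close>

text \<open>Digits 0 and 1 in base 3: all later digits together contribute at most 1/2, so the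
  leading digit, of weight 1, can be read off by comparing with 1. Base 2 would leave ambiguous
  expansions.\<close>

definition code_sum :: "(nat \<Rightarrow> bool) \<Rightarrow> real" where
  "code_sum b = (\<Sum>i. of_bool (b i) * (1/3) ^ i)"

definition code_step :: "real \<Rightarrow> real" where "code_step y = 3 * (y - of_bool (y \<ge> 1))"

lemma code_summable: "summable (\<lambda>i. of_bool (b i) * (1/3::real) ^ i)"
  by (rule summable_comparison_test'[OF summable_geometric[of "1/3 :: real"], of 0]) (auto simp: of_bool_def)

lemma code_sum_bounds: "0 \<le> code_sum b" "code_sum b \<le> 3/2"
proof -
  show "0 \<le> code_sum b" unfolding code_sum_def by (intro suminf_nonneg code_summable) auto
  have "code_sum b \<le> (\<Sum>i. (1/3::real) ^ i)"
    unfolding code_sum_def by (intro suminf_le code_summable) (auto simp: of_bool_def)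
  then show "code_sum b \<le> 3/2" using suminf_geometric[of "1/3::real"] by simp
qed

lemma code_sum_rec: "code_sum b = of_bool (b 0) + code_sum (\<lambda>i. b (Suc i)) / 3"
  unfolding code_sum_def
  using suminf_split_head[OF code_summable[of b]] suminf_mult[OF code_summable[of "\<lambda>i. b (Suc i)"], of "1/3"]
  by (simp add: mult_ac)

lemma code_step_sum: "code_step (code_sum b) = code_sum (\<lambda>i. b (Suc i))"
  and code_head: "code_sum b \<ge> 1 \<longleftrightarrow> b 0"
  using code_sum_bounds[of "\<lambda>i. b (Suc i)"] unfolding code_step_def code_sum_rec[of b]
  by (auto simp: of_bool_def)

lemma code_digit: "(code_step ^^ i) (code_sum b) \<ge> 1 \<longleftrightarrow> b i"
proof -
  have "(code_step ^^ i) (code_sum b) = code_sum (\<lambda>k. b (k + i))"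
    by (induction i) (simp_all add: code_step_sum)
  then show ?thesis by (simp add: code_head)
qed

lemma SUP_rat_below: "(SUP r::rat. if of_rat r < x then ereal (of_rat r) else - \<infinity>) = ereal x" (is "?S = _")
proof (rule antisym)
  show "?S \<le> ereal x" by (rule SUP_least) auto
  show "ereal x \<le> ?S"
  proof (rule ccontr)
    assume "\<not> ?thesis"
    then have "?S < ereal x" by (simp only: not_le)
    then obtain z where z': "?S < ereal z" "ereal z < ereal x" using ereal_dense2 by blast
    then have z: "?S < ereal z" "z < x" by (simp_all only: less_ereal.simps)
    obtain r where r: "z < of_rat r" "of_rat r < x" using of_rat_dense[OF z(2)] by blast
    have "ereal (of_rat r) \<le> ?S" by (rule SUP_upper2[of r]) (use r in auto)
    then show False using z r by (metis ereal_less(3) less_ereal.simps(1) order.strict_trans1 order.asym)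
  qed
qed

text \<open>A vector is encoded by the truth values of all its rational cuts
  \<open>of_rat r < x $ c\<close>, and each coordinate is recovered as a supremum of rationals. An
  injection with a Borel left inverse reduces laws on \<open>real^'n\<close> to laws on the line,
  where the quantile function is available.\<close>

lemma ex_real_coding:
  "\<exists>(j :: real^'n \<Rightarrow> real) \<psi>. j \<in> borel_measurable borel \<and> \<psi> \<in> borel_measurable borel \<and> (\<forall>x. \<psi> (j x) = x)"
proof -
  define b where "b x i = (case from_nat i :: 'n \<times> rat of (c, r) \<Rightarrow> of_rat r < x $ c)" for x :: "real^'n" and i
  define j where "j x = code_sum (b x)" for x
  define f where "f c y = real_of_ereal (SUP r::rat. if (code_step ^^ to_nat (c :: 'n, r)) y \<ge> 1 then ereal (of_rat r) else - \<infinity>)" for c y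
  define \<psi> where "\<psi> y = (\<Sum>c\<in>UNIV. f c y *\<^sub>R axis c 1 :: real^'n)" for y
  have "j \<in> borel_measurable borel"
    unfolding j_def code_sum_def b_def split_beta' by measurable
  moreover have [measurable]: "code_step \<in> borel_measurable borel" unfolding code_step_def by measurable
  have [measurable]: "(code_step ^^ i) \<in> borel_measurable borel" for i
    by (induction i) (auto intro: measurable_comp simp: comp_def)
  have "\<psi> \<in> borel_measurable borel" unfolding \<psi>_def f_def by measurable
  moreover have "\<psi> (j x) = x" for x
  proof -
    have "f c (j x) = x $ c" for c
    proof -
      have bb: "b x (to_nat (c, r)) \<longleftrightarrow> of_rat r < x $ c" for r by (simp add: b_def)
      show ?thesis unfolding f_def j_def code_digit bb SUP_rat_below by simp
    qed
    then show ?thesis by (simp add: \<psi>_def vec_eq_iff axis_def if_distrib[of "\<lambda>t. _ * t"] sum.delta cong: if_cong)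
  qed
  ultimately show ?thesis by blast
qed

section \<open>From a nonnegative density to an embedding into \<open>L_q\<close>\<close>

text \<open>After division by its total mass W the density is a probability law, realised as the law
  of \<open>Z\<close> on the unit interval. The map T x t = W^(1/q) (x . Z t) is linear at every t,
  and W > 0 because N does not vanish identically.\<close>

lemma superposition_embeds:
  fixes N w :: "real^'n \<Rightarrow> real"
  assumes q: "q > 0" and N0: "\<And>x. N x \<ge> 0" and N1: "\<And>x. N x = 0 \<longleftrightarrow> x = 0"
    and wm[measurable]: "w \<in> borel_measurable borel" and w: "integrable sph w" and w0: "AE \<xi> in sph. w \<xi> \<ge> 0"
    and rep: "\<And>x. N x ^ q = (\<integral>\<xi>. \<bar>x \<bullet> \<xi>\<bar> ^ q * w \<xi> \<partial>sph)"
  shows "isometric_to_subspace_of_Lq (real q) N"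
proof -
  define W where "W = (\<integral>\<xi>. w \<xi> \<partial>sph)"
  have "W \<noteq> 0"
  proof
    assume "W = 0"
    then have "AE \<xi> in sph. w \<xi> = 0" using integral_nonneg_eq_0_iff_AE[OF w w0] by (simp add: W_def)
    then have "(\<integral>\<xi>. \<bar>axis undefined 1 \<bullet> \<xi>\<bar> ^ q * w \<xi> \<partial>sph) = (\<integral>\<xi>. 0 \<partial>(sph :: (real^'n) measure))"
      by (intro integral_cong_AE) auto
    then have "N (axis undefined 1) ^ q = 0" using rep[of "axis undefined 1"] by simp
    then show False using N1[of "axis undefined 1"] by (simp add: axis_eq_0_iff)
  qed
  moreover have "W \<ge> 0" unfolding W_def by (rule integral_nonneg_AE[OF w0])
  ultimately have W: "W > 0" by simp
  define P where "P = density sph (\<lambda>\<xi>. ennreal (w \<xi> / W))"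
  have sP[measurable_cong]: "sets P = sets borel" by (simp add: P_def)
  interpret P: prob_space P
  proof
    have "emeasure P (space P) = (\<integral>\<^sup>+\<xi>. ennreal (w \<xi> / W) \<partial>sph)" by (simp add: P_def emeasure_density)
    also have "\<dots> = ennreal (\<integral>\<xi>. w \<xi> / W \<partial>sph)"
      using w w0 W by (intro nn_integral_eq_integral) auto
    also have "(\<integral>\<xi>. w \<xi> / W \<partial>sph) = 1" using W by (simp add: W_def)
    finally show "emeasure P (space P) = 1" by simp
  qed
  obtain j :: "real^'n \<Rightarrow> real" and \<psi> where j[measurable]: "j \<in> borel_measurable borel" and \<psi>[measurable]: "\<psi> \<in> borel_measurable borel"
    and j\<psi>: "\<And>x :: real^'n. \<psi> (j x) = x" using ex_real_coding[where 'n = 'n] by auto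
  define M where "M = distr P borel j"
  interpret M: cdf_distribution M
    unfolding cdf_distribution_def M_def by (rule P.real_distribution_distr) simp
  let ?\<Omega> = "restrict_space lborel {0<..<1::real}"
  have Im: "M.I \<in> borel_measurable ?\<Omega>" by (simp cong: measurable_cong_sets sets_restrict_space_cong)
  \<comment> \<open>\<open>M.I\<close> is the quantile function of the coded law, considered on the
    open interval; at the endpoints \<open>Z\<close> is 0, so
    \<open>\<bar>x \<bullet> Z t\<bar> ^ q\<close> vanishes there as q > 0.\<close>
  define Z where "Z t = (if t \<in> {0<..<1} then \<psi> (M.I t) else 0)" for t
  have Zm[measurable]: "Z \<in> borel_measurable borel"
  proof -
    have "(\<lambda>t. \<psi> (M.I t)) \<in> borel_measurable (restrict_space borel {0<..<1})"
      by (rule measurable_compose[OF M.measurable_CI \<psi>])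
    moreover have "{0<..<1::real} = {x. 0 < x \<and> x < 1}" by auto
    ultimately show ?thesis unfolding Z_def by (subst measurable_If_restrict_space_iff) auto
  qed
  have law: "distr ?\<Omega> borel (\<lambda>t. \<psi> (M.I t)) = P"
  proof -
    have "distr ?\<Omega> borel (\<lambda>t. \<psi> (M.I t)) = distr (distr ?\<Omega> borel M.I) borel \<psi>"
      by (subst distr_distr[OF \<psi> Im]) (simp add: comp_def)
    also have "\<dots> = distr M borel \<psi>" by (simp only: M.distr_I_eq_M)
    also have "\<dots> = distr P borel (\<psi> \<circ> j)" unfolding M_def by (subst distr_distr) simp_all
    also have "\<dots> = P" using j\<psi> by (simp add: comp_def distr_id2[OF sP[symmetric]])
    finally show ?thesis .
  qed
  have qI: "integrable sph (\<lambda>\<xi>. \<bar>x \<bullet> \<xi>\<bar> ^ q * w \<xi>)" for x :: "real^'n"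
  proof (rule Bochner_Integration.integrable_bound[OF integrable_mult_right[OF w, of "norm x ^ q"]])
    show "AE \<xi> in sph. norm (\<bar>x \<bullet> \<xi>\<bar> ^ q * w \<xi>) \<le> norm (norm x ^ q * w \<xi>)"
      using AE_sph_norm
    proof eventually_elim
      fix \<xi> :: "real^'n" assume "norm \<xi> = 1"
      then have "\<bar>x \<bullet> \<xi>\<bar> ^ q \<le> norm x ^ q" using Cauchy_Schwarz_ineq2[of x \<xi>] by (intro power_mono) auto
      then show "norm (\<bar>x \<bullet> \<xi>\<bar> ^ q * w \<xi>) \<le> norm (norm x ^ q * w \<xi>)" by (simp add: abs_mult mult_right_mono)
    qed
  qed simp
  have key: "integrable lborel (\<lambda>t. indicator {0..1} t * \<bar>x \<bullet> Z t\<bar> ^ q)" "(\<integral>t. indicator {0..1} t * \<bar>x \<bullet> Z t\<bar> ^ q \<partial>lborel) = N x ^ q / W" for x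
  proof -
    have eq: "indicator {0..1} t * \<bar>x \<bullet> Z t\<bar> ^ q = indicator {0<..<1} t *\<^sub>R \<bar>x \<bullet> \<psi> (M.I t)\<bar> ^ q" for t
      using q by (auto simp: Z_def indicator_def)
    have Ym: "(\<lambda>t. \<psi> (M.I t)) \<in> borel_measurable ?\<Omega>" using measurable_compose[OF Im \<psi>] .
    have iP: "integrable P (\<lambda>\<xi>. \<bar>x \<bullet> \<xi>\<bar> ^ q)"
      using integrable_mult_right[OF qI[of x], of "1 / W"] w0 W
      unfolding P_def by (subst integrable_density) (auto simp: mult_ac)
    then have "integrable ?\<Omega> (\<lambda>t. \<bar>x \<bullet> \<psi> (M.I t)\<bar> ^ q)"
      unfolding law[symmetric] by (subst (asm) integrable_distr_eq[OF Ym]) simp_all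
    then show "integrable lborel (\<lambda>t. indicator {0..1} t * \<bar>x \<bullet> Z t\<bar> ^ q)"
      unfolding eq by (subst (asm) integrable_restrict_space) simp_all
    have "(\<integral>t. indicator {0..1} t * \<bar>x \<bullet> Z t\<bar> ^ q \<partial>lborel) = (\<integral>t. \<bar>x \<bullet> \<psi> (M.I t)\<bar> ^ q \<partial>?\<Omega>)"
      unfolding eq by (subst integral_restrict_space) simp_all
    also have "\<dots> = (\<integral>\<xi>. \<bar>x \<bullet> \<xi>\<bar> ^ q \<partial>P)"
      by (subst law[symmetric], subst integral_distr[OF Ym]) simp_all
    also have "\<dots> = (\<integral>\<xi>. \<bar>x \<bullet> \<xi>\<bar> ^ q * w \<xi> / W \<partial>sph)"
      using w0 W unfolding P_def by (subst integral_density) (auto simp: mult_ac)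
    also have "\<dots> = N x ^ q / W" by (simp add: rep)
    finally show "(\<integral>t. indicator {0..1} t * \<bar>x \<bullet> Z t\<bar> ^ q \<partial>lborel) = N x ^ q / W" .
  qed
  define c where "c = W powr (1 / q)"
  have c: "c > 0" "c ^ q = W" using W q by (simp_all add: c_def powr_realpow[symmetric] powr_powr)
  define T where "T x t = c * (x \<bullet> Z t)" for x t
  have pw: "\<bar>T x t\<bar> powr real q = W * \<bar>x \<bullet> Z t\<bar> ^ q" for x t
  proof -
    have "\<bar>T x t\<bar> powr real q = \<bar>T x t\<bar> ^ q" using q by (cases "T x t = 0") (simp_all add: powr_realpow)
    then show ?thesis using c by (simp add: T_def abs_mult power_mult_distrib)
  qed
  have bm: "f \<in> borel_measurable lebesgue" if "f \<in> borel_measurable borel" for f :: "real \<Rightarrow> real"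
    using that by (simp add: measurable_completion)
  have iL: "integrable (lebesgue_on {0..1}) (\<lambda>t. \<bar>T x t\<bar> powr real q)"
    and vL: "(\<integral>t. \<bar>T x t\<bar> powr real q \<partial>lebesgue_on {0..1}) = N x ^ q" for x
  proof -
    have "integrable lebesgue (\<lambda>t. indicator {0..1} t * \<bar>x \<bullet> Z t\<bar> ^ q)"
      using key(1)[of x] by (subst integrable_completion) simp_all
    then have "integrable (lebesgue_on {0..1}) (\<lambda>t. \<bar>x \<bullet> Z t\<bar> ^ q)"
      by (subst integrable_restrict_space) simp_all
    then show "integrable (lebesgue_on {0..1}) (\<lambda>t. \<bar>T x t\<bar> powr real q)" unfolding pw by simp
    have "(\<integral>t. \<bar>x \<bullet> Z t\<bar> ^ q \<partial>lebesgue_on {0..1}) = (\<integral>t. indicator {0..1} t * \<bar>x \<bullet> Z t\<bar> ^ q \<partial>lebesgue)"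
      by (subst integral_restrict_space) simp_all
    also have "\<dots> = N x ^ q / W" using key(2)[of x] by (subst integral_completion) simp_all
    finally show "(\<integral>t. \<bar>T x t\<bar> powr real q \<partial>lebesgue_on {0..1}) = N x ^ q" unfolding pw using W by simp
  qed
  show ?thesis
    unfolding isometric_to_subspace_of_Lq_def
  proof (intro exI[of _ T] conjI allI)
    show "T x \<in> Lq_functions (real q)" for x
      using iL[of x] unfolding Lq_functions_def
      by (auto simp: T_def[abs_def] intro!: measurable_restrict_space1 bm)
    show "Lq_norm (real q) (T x) = N x" for x
    proof (cases "x = 0")
      case True
      then show ?thesis using q N1[of 0] by (simp add: Lq_norm_def vL)
    next
      case False
      then have "N x > 0" using N0[of x] N1[of x] by simp
      then show ?thesis using q by (simp add: Lq_norm_def vL powr_realpow[symmetric] powr_powr)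
    qed
  qed (simp_all add: T_def inner_simps algebra_simps)
qed

subsection \<open>Superpositions of ridge functions\<close>

lemma abs_inner_power_le:
  fixes x \<xi> :: "'a::real_inner"
  shows "norm \<xi> = 1 \<Longrightarrow> \<bar>x \<bullet> \<xi>\<bar> ^ q \<le> norm x ^ q"
  using power_mono[OF Cauchy_Schwarz_ineq2[of x \<xi>], of q] by simp

text \<open>Stated for a general finite measure and a map into the sphere because it has two uses:
  the sphere itself with the Radon density, and the unit interval with the directions and weights of
  an embedding.\<close>

lemma ridge_superposition:
  fixes v :: "'z \<Rightarrow> real^'n" and b :: "'z \<Rightarrow> real"
  assumes n: "CARD('n) > 1" "even CARD('n)" and q: "odd q" and m: "2 * m = CARD('n) + q - 1"
    and M: "finite_measure M" and vm[measurable]: "v \<in> borel_measurable M" and b: "integrable M b"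
    and v1: "AE z in M. norm (v z) = 1" and a: "norm a = 1"
  shows "(\<integral>x. (\<integral>z. \<bar>x \<bullet> v z\<bar> ^ q * b z \<partial>M) * (laplacian ^^ m) (pgp a (herm (2 * k))) x \<partial>lborel)
    = gconst TYPE('n) * 2 * fact q * poly (herm (2 * k + CARD('n) - 2)) 0 * (\<integral>z. b z * (v z \<bullet> a) ^ (2 * k) \<partial>M)"
proof -
  interpret M: finite_measure M by fact
  interpret P: pair_sigma_finite M "lborel :: (real^'n) measure" ..
  let ?\<psi> = "(laplacian ^^ m) (pgp a (herm (2 * k)))"
  let ?\<tau> = "gconst TYPE('n) * 2 * fact q * poly (herm (2 * k + CARD('n) - 2)) 0"
  have pg: "pg ?\<psi>" by (rule pg_laplacian_iter[OF pg_pgp])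
  have [measurable]: "?\<psi> \<in> borel_measurable borel" by (rule pg_measurable[OF pg])
  have bm[measurable]: "b \<in> borel_measurable M" using b by simp
  let ?K = "\<integral>x. norm x ^ q * \<bar>?\<psi> x\<bar> \<partial>lborel"
  have Ki: "integrable lborel (\<lambda>x. norm x ^ q * \<bar>?\<psi> x\<bar>)"
    using integrable_norm[OF pg_integrable[OF pg, of "\<lambda>x. norm x ^ q" 1 q]] by (simp add: abs_mult)
  have Ii: "integrable lborel (\<lambda>x. \<bar>x \<bullet> \<xi>\<bar> ^ q * ?\<psi> x)" if "norm \<xi> = 1" for \<xi>
    by (rule pg_integrable[OF pg, of _ 1 q]) (use abs_inner_power_le[OF that] in auto)
  have I: "integrable (M \<Otimes>\<^sub>M lborel) (\<lambda>(z, x). (\<bar>x \<bullet> v z\<bar> ^ q * b z) * ?\<psi> x)"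
  proof (rule P.Fubini_integrable)
    show "AE z in M. integrable lborel (\<lambda>x. case (z, x) of (z, x) \<Rightarrow> (\<bar>x \<bullet> v z\<bar> ^ q * b z) * ?\<psi> x)"
      using v1
    proof eventually_elim
      fix z assume "norm (v z) = 1"
      from integrable_mult_right[OF Ii[OF this], of "b z"]
      show "integrable lborel (\<lambda>x. case (z, x) of (z, x) \<Rightarrow> (\<bar>x \<bullet> v z\<bar> ^ q * b z) * ?\<psi> x)" by (simp add: mult_ac)
    qed
    show "integrable M (\<lambda>z. \<integral>x. norm (case (z, x) of (z, x) \<Rightarrow> (\<bar>x \<bullet> v z\<bar> ^ q * b z) * ?\<psi> x) \<partial>lborel)"
    proof (rule Bochner_Integration.integrable_bound[OF integrable_mult_left[OF b, of ?K]])
      show "AE z in M. norm (\<integral>x. norm (case (z, x) of (z, x) \<Rightarrow> (\<bar>x \<bullet> v z\<bar> ^ q * b z) * ?\<psi> x) \<partial>lborel) \<le> norm (b z * ?K)"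
        using v1
      proof eventually_elim
        fix z assume z: "norm (v z) = 1"
        have "(\<integral>x. norm ((\<bar>x \<bullet> v z\<bar> ^ q * b z) * ?\<psi> x) \<partial>lborel) = \<bar>b z\<bar> * (\<integral>x. \<bar>x \<bullet> v z\<bar> ^ q * \<bar>?\<psi> x\<bar> \<partial>lborel)"
          by (subst integral_mult_right_zero[symmetric]) (simp add: abs_mult mult_ac)
        also have "\<dots> \<le> \<bar>b z\<bar> * ?K"
          using integrable_norm[OF Ii[OF z]] Ki abs_inner_power_le[OF z]
          by (intro mult_left_mono integral_mono) (auto simp: abs_mult intro: mult_right_mono)
        finally show "norm (\<integral>x. norm (case (z, x) of (z, x) \<Rightarrow> (\<bar>x \<bullet> v z\<bar> ^ q * b z) * ?\<psi> x) \<partial>lborel) \<le> norm (b z * ?K)"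
          by (simp add: abs_mult)
      qed
    qed simp
  qed simp
  have "(\<integral>x. (\<integral>z. \<bar>x \<bullet> v z\<bar> ^ q * b z \<partial>M) * ?\<psi> x \<partial>lborel) = (\<integral>x. (\<integral>z. (\<bar>x \<bullet> v z\<bar> ^ q * b z) * ?\<psi> x \<partial>M) \<partial>lborel)"
    by simp
  also have "\<dots> = (\<integral>z. (\<integral>x. (\<bar>x \<bullet> v z\<bar> ^ q * b z) * ?\<psi> x \<partial>lborel) \<partial>M)"
    by (rule P.Fubini_integral) (use I in simp)
  also have "\<dots> = (\<integral>z. ?\<tau> * (b z * (v z \<bullet> a) ^ (2 * k)) \<partial>M)"
  proof (rule integral_cong_AE)
    show "AE z in M. (\<integral>x. (\<bar>x \<bullet> v z\<bar> ^ q * b z) * ?\<psi> x \<partial>lborel) = ?\<tau> * (b z * (v z \<bullet> a) ^ (2 * k))"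
      using v1
    proof eventually_elim
      fix z assume z: "norm (v z) = 1"
      have "(\<integral>x. (\<bar>x \<bullet> v z\<bar> ^ q * b z) * ?\<psi> x \<partial>lborel) = b z * (\<integral>x. \<bar>x \<bullet> v z\<bar> ^ q * ?\<psi> x \<partial>lborel)"
        by (subst integral_mult_right_zero[symmetric]) (simp add: mult_ac)
      then show "(\<integral>x. (\<bar>x \<bullet> v z\<bar> ^ q * b z) * ?\<psi> x \<partial>lborel) = ?\<tau> * (b z * (v z \<bullet> a) ^ (2 * k))"
        unfolding ridge_integral_herm[OF n q m a z] by (simp add: inner_commute)
    qed
  qed simp_all
  also have "\<dots> = ?\<tau> * (\<integral>z. b z * (v z \<bullet> a) ^ (2 * k) \<partial>M)" by (rule integral_mult_right_zero)
  finally show ?thesis .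
qed

lemma ridge_superposition_continuous:
  fixes b :: "real^'n \<Rightarrow> real"
  assumes b: "integrable sph b"
  shows "continuous_on UNIV (\<lambda>x. \<integral>\<xi>. \<bar>x \<bullet> \<xi>\<bar> ^ q * b \<xi> \<partial>sph)"
  unfolding continuous_on_eq_continuous_at[OF open_UNIV] continuous_at_sequentially comp_def
proof (intro ballI allI impI)
  fix x :: "real^'n" and X assume X: "X \<longlonglongrightarrow> x"
  have [measurable]: "b \<in> borel_measurable borel" using b by simp
  obtain B where B: "\<And>n. norm (X n) \<le> B" using convergent_imp_bounded[OF X] by (auto simp: bounded_iff)
  show "(\<lambda>n. \<integral>\<xi>. \<bar>X n \<bullet> \<xi>\<bar> ^ q * b \<xi> \<partial>sph) \<longlonglongrightarrow> (\<integral>\<xi>. \<bar>x \<bullet> \<xi>\<bar> ^ q * b \<xi> \<partial>sph)"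
  proof (rule integral_dominated_convergence[where w = "\<lambda>\<xi>. B ^ q * \<bar>b \<xi>\<bar>"])
    show "AE \<xi> in sph. (\<lambda>n. \<bar>X n \<bullet> \<xi>\<bar> ^ q * b \<xi>) \<longlonglongrightarrow> \<bar>x \<bullet> \<xi>\<bar> ^ q * b \<xi>"
      by (intro AE_I2 tendsto_intros X)
    show "AE \<xi> in sph. norm (\<bar>X n \<bullet> \<xi>\<bar> ^ q * b \<xi>) \<le> B ^ q * \<bar>b \<xi>\<bar>" for n
      using AE_sph_norm
    proof eventually_elim
      fix \<xi> :: "real^'n" assume "norm \<xi> = 1"
      from order_trans[OF abs_inner_power_le[OF this] power_mono[OF B[of n] norm_ge_zero]]
      show "norm (\<bar>X n \<bullet> \<xi>\<bar> ^ q * b \<xi>) \<le> B ^ q * \<bar>b \<xi>\<bar>"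
        by (simp add: abs_mult mult_right_mono)
    qed
  qed (use b in simp_all)
qed

section \<open>The constant of the representation and the Hermite moments\<close>

text \<open>The value forced by \<open>herm_moment_identity\<close>. Evaluating the ridge integrals
  gives 2 q! \<open>gconst\<close> times a Hermite value at 0, whose sign beyond (-1)^k is the power
  of -1 here; the subsphere moments give the other \<open>gconst\<close>, the half-line integrals a
  factor 2, and the product of two factors sqrt(2 pi) brings in pi.\<close>

definition ridge_const :: "'n::finite itself \<Rightarrow> nat \<Rightarrow> real" where
  "ridge_const t q = (- 1) ^ ((CARD('n) - 2) div 2) * pi / (4 * fact q * (gconst t)\<^sup>2)"

lemma pgp_sum: "pgp a P x = (\<Sum>i\<le>degree P. coeff P i * pgp a (monom 1 i) x)"
  unfolding pgp_def poly_monom poly_altdef[of P] by (simp add: sum_distrib_right mult.assoc)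

text \<open>Both sides are \<open>g\<close> integrated against a multiple of (1 - (\<theta> .
  a)^2)^k: the left one by moving the Radon transform onto (\<xi> . a)^(2k) and evaluating by
  \<open>subsph_moment\<close>, the right one by integrating the Hermite polynomial along
  rays.\<close>

lemma herm_moment_identity:
  fixes g :: "real^'n \<Rightarrow> real"
  assumes n: "CARD('n) > 1" "even CARD('n)" and q: "odd q" and m: "2 * m = CARD('n) + q - 1"
    and gm[measurable]: "g \<in> borel_measurable borel" and g: "integrable sph g"
    and hom: "\<And>r \<theta>. r > 0 \<Longrightarrow> g (r *\<^sub>R \<theta>) = g \<theta> / r ^ (CARD('n) - 1)"
    and a: "norm a = 1"
  shows "(\<integral>x. (\<integral>\<xi>. \<bar>x \<bullet> \<xi>\<bar> ^ q * (ridge_const TYPE('n) q * radon g \<xi>) \<partial>sph) * (laplacian ^^ m) (pgp a (herm (2 * k))) x \<partial>lborel)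
    = (\<integral>x. g x * pgp a (herm (2 * k)) x \<partial>lborel)"
proof -
  let ?c = "ridge_const TYPE('n) q" and ?G = "gconst TYPE('n)"
  obtain p where p: "CARD('n) = 2 * p + 2" using n by (metis add_2_eq_Suc' evenE gr0_implies_Suc mult_Suc_right n(1) nat_mult_eq_1_iff not_less_eq One_nat_def add.commute less_irrefl mult_0_right not_less_zero old.nat.exhaust)
  have e: "2 * k + CARD('n) - 2 = 2 * (k + p)" by (simp add: p)
  have G: "?G > 0" by (rule gconst_pos[OF n(1)])
  have ri: "integrable sph (radon g)" by (rule radon_props(2)[OF n(1) gm g])
  have S: "(\<integral>\<xi>. (?c * radon g \<xi>) * (\<xi> \<bullet> a) ^ (2 * k) \<partial>sph) = ?c * (\<integral>\<theta>. g \<theta> * (\<integral>\<xi>. (\<xi> \<bullet> a) ^ (2 * k) \<partial>subsph \<theta>) \<partial>sph)"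
  proof -
    have "(\<integral>\<xi>. radon g \<xi> * (\<xi> \<bullet> a) ^ (2 * k) \<partial>sph) = (\<integral>\<theta>. g \<theta> * (\<integral>\<xi>. (\<xi> \<bullet> a) ^ (2 * k) \<partial>subsph \<theta>) \<partial>sph)"
    proof (rule radon_props(3)[OF n(1) gm g])
      show "(x \<bullet> a) ^ (2 * k) \<le> 1" if "norm x = 1" for x
        using power_le_one[of "\<bar>x \<bullet> a\<bar>" "2 * k"] Cauchy_Schwarz_ineq2[of x a] that a by (simp add: power_mult)
    qed (simp_all add: power_mult)
    then show ?thesis by (simp add: mult.assoc)
  qed
  \<comment> \<open>As n is even, the half-line moment has even order and is half of a full Gaussian
    moment, the same number that gives the Hermite value at 0 up to sign.\<close>
  have sub: "(\<integral>\<xi>. (\<xi> \<bullet> a) ^ (2 * k) \<partial>subsph \<theta>) = ?G * mom (2 * k) / (mom (2 * (k + p)) / 2 * sqrt (2 * pi)) * (1 - (\<theta> \<bullet> a)\<^sup>2) ^ k"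
    if "norm \<theta> = 1" for \<theta>
    using subsph_moment[OF n(1) that a, of k] mom_pos[of "k + p"] unfolding e hmom_even by (simp add: field_simps)
  \<comment> \<open>Integration along rays for a general polynomial. Both sides are linear in
    \<open>P\<close>, so monomials suffice, and there homogeneity separates the radius.\<close>
  have L: "(\<integral>x. g x * pgp a P x \<partial>lborel) = (\<integral>\<theta>. g \<theta> * (\<integral>r. poly P (r * (\<theta> \<bullet> a)) * gw r * indicator {0<..} r \<partial>lborel) \<partial>sph)" for P
  proof -
    have gi: "integrable lborel (\<lambda>x. g x * pgp a (monom 1 d) x)" and gv: "(\<integral>x. g x * pgp a (monom 1 d) x \<partial>lborel) = (\<integral>\<theta>. g \<theta> * (\<theta> \<bullet> a) ^ d \<partial>sph) * hmom d" for d
      using homogeneous_moment[OF gm g a rad_gseq hom, of d] unfolding rint_gseq by (simp_all add: gseq_pgp[symmetric])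
    have pi: "integrable lborel (\<lambda>x. g x * pgp a P x)" for P
    proof -
      have "(\<lambda>x. g x * pgp a P x) = (\<lambda>x. \<Sum>i\<le>degree P. coeff P i * (g x * pgp a (monom 1 i) x))"
        unfolding pgp_sum[of a P] by (simp add: sum_distrib_left mult.left_commute)
      then show ?thesis using gi by simp
    qed
    define J where "J P \<theta> = (\<integral>r. poly P (r * (\<theta> \<bullet> a)) * gw r * indicator {0<..} r \<partial>lborel)" for P \<theta>
    have hi: "integrable lborel (\<lambda>r. poly P (r * u) * gw r * indicator {0<..} r)" for P u
      using integrable_poly_gw_half[of 0 "pcompose P [:0, u:]"] by (simp add: poly_pcompose)
    have Jadd: "J (P + Q) \<theta> = J P \<theta> + J Q \<theta>" for P Q \<theta>
      unfolding J_def poly_add distrib_right by (rule Bochner_Integration.integral_add[OF hi hi])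
    have Jsm: "J (smult c P) \<theta> = c * J P \<theta>" for c P \<theta> by (simp add: J_def mult.assoc)
    have Jm: "J (monom 1 d) \<theta> = (\<theta> \<bullet> a) ^ d * hmom d" for d \<theta>
      by (simp add: J_def hmom_def poly_monom power_mult_distrib mult_ac integral_mult_right_zero[symmetric] del: integral_mult_right_zero)
    have Jmc: "J (monom c d) \<theta> = c * ((\<theta> \<bullet> a) ^ d * hmom d)" for c d \<theta>
      using Jsm[of c "monom 1 d"] by (simp add: smult_monom Jm)
    have Ji: "integrable sph (\<lambda>\<theta>. g \<theta> * J P \<theta>)" for P
    proof -
      have J0: "J 0 \<theta> = 0" for \<theta> by (simp add: J_def)
      have Js: "J (\<Sum>i\<in>I. f i) \<theta> = (\<Sum>i\<in>I. J (f i) \<theta>)" if "finite I" for I :: "nat set" and f \<theta>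
        using that by (induction I rule: finite_induct) (simp_all add: J0 Jadd)
      have "J P \<theta> = (\<Sum>i\<le>degree P. coeff P i * ((\<theta> \<bullet> a) ^ i * hmom i))" for \<theta>
        by (subst poly_as_sum_of_monoms[of P, symmetric], subst Js) (simp_all add: Jmc)
      then have "(\<lambda>\<theta>. g \<theta> * J P \<theta>) = (\<lambda>\<theta>. \<Sum>i\<le>degree P. (coeff P i * hmom i) * (g \<theta> * (\<theta> \<bullet> a) ^ i))"
        by (simp add: sum_distrib_left mult_ac)
      then show ?thesis using smom_integrable[OF g gm a] by simp
    qed
    have "(\<integral>x. g x * pgp a P x \<partial>lborel) = (\<integral>\<theta>. g \<theta> * J P \<theta> \<partial>sph)"
    proof (rule linear_on_monoms[where A = "\<lambda>P. \<integral>x. g x * pgp a P x \<partial>lborel" and B = "\<lambda>P. \<integral>\<theta>. g \<theta> * J P \<theta> \<partial>sph"])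
      show "(\<integral>x. g x * pgp a (P + Q) x \<partial>lborel) = (\<integral>x. g x * pgp a P x \<partial>lborel) + (\<integral>x. g x * pgp a Q x \<partial>lborel)" for P Q
        unfolding pgp_add distrib_left by (rule Bochner_Integration.integral_add[OF pi pi])
      show "(\<integral>x. g x * pgp a (smult c P) x \<partial>lborel) = c * (\<integral>x. g x * pgp a P x \<partial>lborel)" for c P
        unfolding pgp_smult by (simp add: mult.left_commute)
      show "(\<integral>\<theta>. g \<theta> * J (P + Q) \<theta> \<partial>sph) = (\<integral>\<theta>. g \<theta> * J P \<theta> \<partial>sph) + (\<integral>\<theta>. g \<theta> * J Q \<theta> \<partial>sph)" for P Q
        unfolding Jadd distrib_left by (rule Bochner_Integration.integral_add[OF Ji Ji])
      show "(\<integral>\<theta>. g \<theta> * J (smult c P) \<theta> \<partial>sph) = c * (\<integral>\<theta>. g \<theta> * J P \<theta> \<partial>sph)" for c P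
        unfolding Jsm by (simp add: mult.left_commute)
      show "(\<integral>x. g x * pgp a (monom 1 i) x \<partial>lborel) = (\<integral>\<theta>. g \<theta> * J (monom 1 i) \<theta> \<partial>sph)" for i
        unfolding gv Jm by (simp add: mult.assoc[symmetric])
    qed
    then show ?thesis by (simp add: J_def)
  qed
  have R: "(\<integral>x. g x * pgp a (herm (2 * k)) x \<partial>lborel) = (\<integral>\<theta>. g \<theta> * (((\<theta> \<bullet> a)\<^sup>2 - 1) ^ k * mom (2 * k) / 2) \<partial>sph)"
    unfolding L herm_scaled_half_integral ..
  \<comment> \<open>Here the moment of order 2(k + p) cancels and the sign (-1)^(k + p) (-1)^p
    reduces to (-1)^k, which turns 1 - u^2 into u^2 - 1.\<close>
  have cc: "?G * 2 * fact q * poly (herm (2 * (k + p))) 0 * (?c * (?G * mom (2 * k) / (mom (2 * (k + p)) / 2 * sqrt (2 * pi)) * (1 - u\<^sup>2) ^ k))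
     = (u\<^sup>2 - 1) ^ k * mom (2 * k) / 2" for u :: real
  proof -
    have h: "poly (herm (2 * (k + p))) 0 = (- 1) ^ (k + p) * mom (2 * (k + p)) / sqrt (2 * pi)"
      using herm_zero_even[of "k + p"] by (simp add: field_simps)
    have pp: "(CARD('n) - 2) div 2 = p" by (simp add: p)
    have s: "(u\<^sup>2 - 1) ^ k = (- 1) ^ k * (1 - u\<^sup>2) ^ k"
      by (simp add: power_mult_distrib[symmetric])
    have s2: "(- 1 :: real) ^ (k + p) * (- 1) ^ p = (- 1) ^ k"
      by (simp add: power_add mult.assoc power_mult_distrib[symmetric])
    have sp: "sqrt (2 * pi) * sqrt (2 * pi) = 2 * pi" by simp
    let ?M = "mom (2 * (k + p))" and ?S = "sqrt (2 * pi)"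
    have "?G * 2 * fact q * ((- 1) ^ (k + p) * ?M / ?S) * (((- 1) ^ p * pi / (4 * fact q * ?G\<^sup>2)) * (?G * mom (2 * k) / (?M / 2 * ?S) * (1 - u\<^sup>2) ^ k))
      = ((- 1) ^ (k + p) * (- 1) ^ p) * (pi / (?S * ?S)) * mom (2 * k) * (1 - u\<^sup>2) ^ k"
      using G mom_pos[of "k + p"] by (simp add: field_simps power2_eq_square)
    also have "\<dots> = (u\<^sup>2 - 1) ^ k * mom (2 * k) / 2"
      unfolding s2 sp s by simp
    finally show ?thesis unfolding h ridge_const_def pp .
  qed
  have "(\<integral>x. (\<integral>\<xi>. \<bar>x \<bullet> \<xi>\<bar> ^ q * (?c * radon g \<xi>) \<partial>sph) * (laplacian ^^ m) (pgp a (herm (2 * k))) x \<partial>lborel)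
     = ?G * 2 * fact q * poly (herm (2 * (k + p))) 0 * (\<integral>\<xi>. (?c * radon g \<xi>) * (\<xi> \<bullet> a) ^ (2 * k) \<partial>sph)"
    unfolding e[symmetric]
    by (rule ridge_superposition[OF n q m finite_sph _ _ AE_sph_norm a]) (use ri in simp_all)
  also have "\<dots> = (\<integral>\<theta>. (?G * 2 * fact q * poly (herm (2 * (k + p))) 0 * ?c) * (g \<theta> * (\<integral>\<xi>. (\<xi> \<bullet> a) ^ (2 * k) \<partial>subsph \<theta>)) \<partial>sph)"
    unfolding S by (simp only: integral_mult_right_zero mult.assoc)
  also have "\<dots> = (\<integral>\<theta>. g \<theta> * (((\<theta> \<bullet> a)\<^sup>2 - 1) ^ k * mom (2 * k) / 2) \<partial>sph)"
  proof (rule Bochner_Integration.integral_cong_AE)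
    show "AE \<theta> in sph. (?G * 2 * fact q * poly (herm (2 * (k + p))) 0 * ?c) * (g \<theta> * (\<integral>\<xi>. (\<xi> \<bullet> a) ^ (2 * k) \<partial>subsph \<theta>)) = g \<theta> * (((\<theta> \<bullet> a)\<^sup>2 - 1) ^ k * mom (2 * k) / 2)"
      using AE_sph_norm
    proof eventually_elim
      fix \<theta> :: "real^'n" assume t: "norm \<theta> = 1"
      show "(?G * 2 * fact q * poly (herm (2 * (k + p))) 0 * ?c) * (g \<theta> * (\<integral>\<xi>. (\<xi> \<bullet> a) ^ (2 * k) \<partial>subsph \<theta>)) = g \<theta> * (((\<theta> \<bullet> a)\<^sup>2 - 1) ^ k * mom (2 * k) / 2)"
        unfolding sub[OF t] cc[symmetric] by (simp only: mult_ac)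
    qed
    have "(\<lambda>\<theta>. \<integral>\<xi>. (\<xi> \<bullet> a) ^ (2 * k) \<partial>subsph \<theta>) \<in> borel_measurable borel"
    proof -
      have "(\<integral>\<xi>. (\<xi> \<bullet> a) ^ (2 * k) \<partial>subsph \<theta>) = enn2real (\<integral>\<^sup>+\<xi>. ennreal ((\<xi> \<bullet> a) ^ (2 * k)) \<partial>subsph \<theta>)" for \<theta>
        by (rule integral_eq_nn_integral) (auto simp: power_mult)
      moreover have "(\<lambda>\<theta>. \<integral>\<^sup>+\<xi>. ennreal ((\<xi> \<bullet> a) ^ (2 * k)) \<partial>subsph \<theta>) \<in> borel_measurable borel"
        by (rule borel_measurable_nn_integral_subsph_const) measurable
      ultimately show ?thesis by simp
    qed
    then show "(\<lambda>\<theta>. (?G * 2 * fact q * poly (herm (2 * (k + p))) 0 * ?c) * (g \<theta> * (\<integral>\<xi>. (\<xi> \<bullet> a) ^ (2 * k) \<partial>subsph \<theta>))) \<in> borel_measurable sph" by simp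
  qed simp
  finally show ?thesis unfolding R .
qed

lemma sph_integral_bounded_linear:
  fixes b :: "real^'n \<Rightarrow> real"
  assumes b: "integrable sph b"
  shows "continuous_on UNIV f \<Longrightarrow> integrable sph (\<lambda>\<theta>. b \<theta> * f \<theta>)"
    and "continuous_on UNIV f \<Longrightarrow> (\<And>x. norm x = 1 \<Longrightarrow> \<bar>f x\<bar> \<le> e) \<Longrightarrow> \<bar>\<integral>\<theta>. b \<theta> * f \<theta> \<partial>sph\<bar> \<le> (\<integral>\<theta>. \<bar>b \<theta>\<bar> \<partial>sph) * e"
proof -
  have [measurable]: "b \<in> borel_measurable borel" using b by simp
  have i: "integrable sph (\<lambda>\<theta>. b \<theta> * f \<theta>)" if f: "continuous_on UNIV f" and fe: "\<And>x. norm x = 1 \<Longrightarrow> \<bar>f x\<bar> \<le> e" for f e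
  proof (rule Bochner_Integration.integrable_bound[OF integrable_mult_left[OF b, of e]])
    have [measurable]: "f \<in> borel_measurable borel" by (rule borel_measurable_continuous_onI[OF f])
    show "(\<lambda>\<theta>. b \<theta> * f \<theta>) \<in> borel_measurable sph" by simp
    show "AE \<theta> in sph. norm (b \<theta> * f \<theta>) \<le> norm (b \<theta> * e)"
      using AE_sph_norm
    proof eventually_elim
      fix \<theta> :: "real^'n" assume "norm \<theta> = 1"
      then show "norm (b \<theta> * f \<theta>) \<le> norm (b \<theta> * e)" using fe[of \<theta>] by (auto simp: abs_mult intro!: mult_left_mono)
    qed
  qed
  show "integrable sph (\<lambda>\<theta>. b \<theta> * f \<theta>)" if f: "continuous_on UNIV f"
  proof -
    have "bounded (f ` sphere 0 1)" by (intro compact_imp_bounded compact_continuous_image continuous_on_subset[OF f]) auto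
    then obtain e where e: "\<forall>x\<in>sphere 0 1. \<bar>f x\<bar> \<le> e" by (auto simp: bounded_iff)
    show ?thesis by (rule i[OF f, of e]) (use e in auto)
  qed
  show "\<bar>\<integral>\<theta>. b \<theta> * f \<theta> \<partial>sph\<bar> \<le> (\<integral>\<theta>. \<bar>b \<theta>\<bar> \<partial>sph) * e" if f: "continuous_on UNIV f" and fe: "\<And>x. norm x = 1 \<Longrightarrow> \<bar>f x\<bar> \<le> e"
  proof -
    have "\<bar>\<integral>\<theta>. b \<theta> * f \<theta> \<partial>sph\<bar> \<le> (\<integral>\<theta>. \<bar>b \<theta> * f \<theta>\<bar> \<partial>sph)" by (rule integral_abs_bound)
    also have "\<dots> \<le> (\<integral>\<theta>. \<bar>b \<theta>\<bar> * e \<partial>sph)"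
    proof (rule integral_mono_AE)
      show "AE \<theta> in sph. \<bar>b \<theta> * f \<theta>\<bar> \<le> \<bar>b \<theta>\<bar> * e"
        using AE_sph_norm by eventually_elim (use fe in \<open>auto simp: abs_mult intro!: mult_left_mono\<close>)
    qed (use i[OF f fe] b in auto)
    finally show ?thesis by simp
  qed
qed

lemma AE_lborel_sgn:
  fixes E :: "(real^'n) set"
  assumes [measurable]: "E \<in> sets borel" and E: "AE \<theta> in sph. \<theta> \<notin> E"
  shows "AE x in lborel. sgn x \<notin> E"
proof (subst AE_borel_iff_nn_integral)
  have "(\<integral>\<^sup>+x. indicator {x. sgn x \<in> E} x \<partial>lborel)
     = (\<integral>\<^sup>+\<theta>. (\<integral>\<^sup>+r. indicator {x. sgn x \<in> E} (r *\<^sub>R \<theta>) * ennreal (r ^ (CARD('n) - 1)) * indicator {0<..} r \<partial>lborel) \<partial>sph)"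
    by (rule polar_lborel) measurable
  also have "\<dots> = (\<integral>\<^sup>+\<theta>. 0 \<partial>(sph :: (real^'n) measure))"
  proof (rule nn_integral_cong_AE, use E AE_sph_norm in eventually_elim)
    fix \<theta> :: "real^'n" assume "\<theta> \<notin> E" "norm \<theta> = 1"
    then have z: "indicator {x. sgn x \<in> E} (r *\<^sub>R \<theta>) * ennreal (r ^ (CARD('n) - 1)) * indicator {0<..} r = 0" for r
      by (cases "r > 0") (auto simp: sgn_scaleR sgn_div_norm)
    show "(\<integral>\<^sup>+r. indicator {x. sgn x \<in> E} (r *\<^sub>R \<theta>) * ennreal (r ^ (CARD('n) - 1)) * indicator {0<..} r \<partial>lborel) = 0"
      unfolding z by simp
  qed
  finally show "(\<integral>\<^sup>+x. indicator {x. \<not> sgn x \<notin> E} x \<partial>lborel) = 0" by simp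
qed simp_all

text \<open>\<open>D\<close> may serve as its own test function, so the integral of its square over
  the sphere is 0. Homogeneity carries the vanishing from almost every direction to almost every
  point, and a closed set of full Lebesgue measure is everything.\<close>

lemma vanishing_even_moments:
  fixes D :: "real^'n \<Rightarrow> real"
  assumes c: "continuous_on UNIV D" and ev: "\<And>x. D (- x) = D x"
    and hom: "\<And>r \<theta>. r > 0 \<Longrightarrow> D (r *\<^sub>R \<theta>) = r ^ q * D \<theta>"
    and mom: "\<And>a k. norm a = 1 \<Longrightarrow> smom D a k = 0"
  shows "D x = 0"
proof -
  have [measurable]: "D \<in> borel_measurable borel" by (rule borel_measurable_continuous_onI[OF c])
  have one: "integrable sph (\<lambda>_ :: real^'n. 1 :: real)" by (rule finite_measure.integrable_const[OF finite_sph])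
  have Di: "integrable sph D" using sph_integral_bounded_linear(1)[OF one c] by simp
  note L = sph_integral_bounded_linear[OF Di]
  have "(\<integral>\<theta>. D \<theta> * D \<theta> \<partial>sph) = 0"
  proof (rule even_moments_determine[where \<Lambda> = "\<lambda>f. \<integral>\<theta>. D \<theta> * f \<theta> \<partial>sph" and C = "\<integral>\<theta>. \<bar>D \<theta>\<bar> \<partial>sph"])
    show "(\<integral>\<theta>. D \<theta> * (f \<theta> + g \<theta>) \<partial>sph) = (\<integral>\<theta>. D \<theta> * f \<theta> \<partial>sph) + (\<integral>\<theta>. D \<theta> * g \<theta> \<partial>sph)"
      if "continuous_on UNIV f" "continuous_on UNIV g" for f g
      unfolding distrib_left by (rule Bochner_Integration.integral_add[OF L(1)[OF that(1)] L(1)[OF that(2)]])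
    show "(\<integral>\<theta>. D \<theta> * (k * f \<theta>) \<partial>sph) = k * (\<integral>\<theta>. D \<theta> * f \<theta> \<partial>sph)" for f k by (simp add: mult.left_commute)
    show "(\<integral>\<theta>. D \<theta> * f (- \<theta>) \<partial>sph) = (\<integral>\<theta>. D \<theta> * f \<theta> \<partial>sph)" if "continuous_on UNIV f" for f
      using sph_reflect[of "\<lambda>\<theta>. D \<theta> * f \<theta>"] borel_measurable_continuous_onI[OF that] by (simp add: ev)
    show "(\<integral>\<theta>. D \<theta> * (\<theta> \<bullet> a) ^ (2 * k) \<partial>sph) = 0" if "norm a = 1" for a k
      using mom[OF that, of k] by (simp add: smom_def)
  qed (use L(2) c in auto)
  then have "AE \<theta> in sph. D \<theta> * D \<theta> = 0"
    using integral_nonneg_eq_0_iff_AE[OF L(1)[OF c]] by simp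
  then have "AE \<theta> in sph. \<theta> \<notin> {\<theta>. D \<theta> \<noteq> 0}" by eventually_elim simp
  then have "AE x in lborel. sgn x \<notin> {\<theta>. D \<theta> \<noteq> 0}" by (intro AE_lborel_sgn) simp_all
  then have "AE x in lborel. x \<in> {x. D x = 0}"
    using AE_lborel_singleton[of 0]
  proof eventually_elim
    fix x assume x: "sgn x \<notin> {\<theta>. D \<theta> \<noteq> 0}" "x \<noteq> 0"
    then have "D (norm x *\<^sub>R sgn x) = 0" by (subst hom) auto
    then show "x \<in> {x. D x = 0}" using x by (simp add: sgn_div_norm)
  qed
  then have "AE x in lebesgue. x \<in> {x. D x = 0}" by (rule AE_completion)
  moreover have "closed {x. D x = 0}" using c by (intro closed_Collect_eq continuous_on_const) auto
  ultimately show ?thesis using mem_closed_if_AE_lebesgue by blast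
qed

section \<open>The representation of \<open>N ^ q\<close> by ridge functions\<close>

theorem ridge_representation:
  fixes N g :: "real^'n \<Rightarrow> real"
  assumes n: "CARD('n) > 1" "even CARD('n)" and q: "odd q" and m: "2 * m = CARD('n) + q - 1"
    and N: "continuous_on UNIV N" "\<And>c x. N (c *\<^sub>R x) = \<bar>c\<bar> * N x"
    and gm[measurable]: "g \<in> borel_measurable borel" and g: "integrable sph g"
    and hom: "\<And>r \<theta>. r > 0 \<Longrightarrow> g (r *\<^sub>R \<theta>) = g \<theta> / r ^ (CARD('n) - 1)"
    and dist: "\<And>a k. norm a = 1 \<Longrightarrow> (\<integral>x. N x ^ q * (laplacian ^^ m) (\<lambda>x. bumps 0 (x \<bullet> x) * (x \<bullet> a) ^ (2 * k)) x \<partial>lborel)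
       = (\<integral>x. g x * (bumps 0 (x \<bullet> x) * (x \<bullet> a) ^ (2 * k)) \<partial>lborel)"
  shows "N x ^ q = (\<integral>\<xi>. \<bar>x \<bullet> \<xi>\<bar> ^ q * (ridge_const TYPE('n) q * radon g \<xi>) \<partial>sph)"
proof -
  let ?b = "\<lambda>\<xi>. ridge_const TYPE('n) q * radon g \<xi>"
  define H where "H x = (\<integral>\<xi>. \<bar>x \<bullet> \<xi>\<bar> ^ q * ?b \<xi> \<partial>sph)" for x
  have bi: "integrable sph ?b" using radon_props(2)[OF n(1) gm g] by simp
  have one: "integrable sph (\<lambda>_ :: real^'n. 1 :: real)" by (rule finite_measure.integrable_const[OF finite_sph])
  have Hc: "continuous_on UNIV H" unfolding H_def by (rule ridge_superposition_continuous[OF bi])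
  have Nc: "continuous_on UNIV (\<lambda>x. N x ^ q)" by (intro continuous_intros N)
  have Hhom: "H (r *\<^sub>R \<theta>) = \<bar>r\<bar> ^ q * H \<theta>" for r \<theta>
    by (simp add: H_def abs_mult power_mult_distrib mult.assoc)
  have Nhom: "N (r *\<^sub>R \<theta>) ^ q = \<bar>r\<bar> ^ q * N \<theta> ^ q" for r \<theta> by (simp add: N power_mult_distrib)
  have mm: "2 * m \<le> q + CARD('n) - 1" and ee: "q + CARD('n) - 1 + 2 * k - 2 * m = 2 * k" for k using m by auto
  have X: "(\<integral>x. F x * (laplacian ^^ m) (\<lambda>x. D 0 (x \<bullet> x) * (x \<bullet> a) ^ (2 * k)) x \<partial>lborel)
      = (\<Sum>j\<le>k. kap CARD('n) q m k j * smom F a j) * rint D 0 (2 * k)"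
    if "continuous_on UNIV F" "\<And>r \<theta>. F (r *\<^sub>R \<theta>) = \<bar>r\<bar> ^ q * F \<theta>" "rad D" "norm a = 1" for F :: "real^'n \<Rightarrow> real" and D a k
    using laplacian_iter_moment[OF borel_measurable_continuous_onI[OF that(1)] _ that(4) _ mm that(3), of k, unfolded ee]
      sph_integral_bounded_linear(1)[OF one that(1)] that(2) by simp
  \<comment> \<open>The hypothesis is available only for bumps; the radial scalar
    \<open>rint bumps 0 (2 * k)\<close> is positive and drops out of both sides.\<close>
  have kN: "(\<Sum>j\<le>k. kap CARD('n) q m k j * smom (\<lambda>x. N x ^ q) a j) = smom g a k" if a: "norm a = 1" for a k
    using X[OF Nc Nhom rad_bumps a, of k] dist[OF a, of k] homogeneous_moment(2)[OF gm g a rad_bumps hom, of "2 * k"] rint_bumps_pos[of "2 * k"]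
    by (simp add: smom_def)
  have kH: "(\<Sum>j\<le>k. kap CARD('n) q m k j * smom H a j) = smom g a k" if a: "norm a = 1" for a k
  proof -
    \<comment> \<open>The defect of the expected identity, as a linear functional of the polynomial.
      It vanishes on even Hermite polynomials, hence on even powers, and an even power times the
      Gaussian is again a radial profile times a power of x . a.\<close>
    define K where "K p = (\<integral>x. H x * (laplacian ^^ m) (pgp a p) x \<partial>lborel) - (\<integral>x. g x * pgp a p x \<partial>lborel)" for p
    have Hb: "\<bar>H x\<bar> \<le> (\<integral>\<xi>. \<bar>?b \<xi>\<bar> \<partial>sph) * norm x ^ q" for x
    proof -
      have "\<bar>\<integral>\<xi>. ?b \<xi> * \<bar>x \<bullet> \<xi>\<bar> ^ q \<partial>sph\<bar> \<le> (\<integral>\<xi>. \<bar>?b \<xi>\<bar> \<partial>sph) * norm x ^ q"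
        by (rule sph_integral_bounded_linear(2)[OF bi]) (use abs_inner_power_le in \<open>auto intro!: continuous_intros\<close>)
      then show ?thesis by (simp add: H_def mult.commute)
    qed
    have Hi: "integrable lborel (\<lambda>x. H x * (laplacian ^^ m) (pgp a p) x)" for p
      by (rule pg_integrable[OF pg_laplacian_iter[OF pg_pgp] borel_measurable_continuous_onI[OF Hc] Hb])
    have gi: "integrable lborel (\<lambda>x. g x * pgp a p x)" for p
    proof -
      have "integrable lborel (\<lambda>x. g x * pgp a (monom 1 i) x)" for i
        using homogeneous_moment(1)[OF gm g a rad_gseq hom, of i] by (simp add: gseq_pgp[symmetric])
      moreover have "(\<lambda>x. g x * pgp a p x) = (\<lambda>x. \<Sum>i\<le>degree p. coeff p i * (g x * pgp a (monom 1 i) x))"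
        unfolding pgp_sum[of a p] by (simp add: sum_distrib_left mult.left_commute)
      ultimately show ?thesis by simp
    qed
    have "K (monom 1 (2 * k)) = 0"
    proof (rule herm_even_span)
      show "K (p + r) = K p + K r" for p r
        unfolding K_def pgp_add laplacian_iter_add[OF pg_pgp pg_pgp] distrib_left using Hi gi by simp
      show "K (smult c p) = c * K p" for c p
        unfolding K_def pgp_smult laplacian_iter_scale[OF pg_pgp] by (simp add: mult.left_commute right_diff_distrib)
      show "K (herm (2 * j)) = 0" for j
        using herm_moment_identity[OF n q m gm g hom a, of j] by (simp add: K_def H_def)
    qed
    then show ?thesis
      using X[OF Hc Hhom rad_gseq a, of k] homogeneous_moment(2)[OF gm g a rad_gseq hom, of "2 * k"] mom_pos[of k]
      unfolding K_def rint_gseq hmom_even fun_cong[OF gseq_pgp] by (simp add: smom_def)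
  qed
  have "smom (\<lambda>x. N x ^ q) a k = smom H a k" if "norm a = 1" for a k
    by (rule kap_injective[OF n(2) q, where m = m]) (use n kN[OF that] kH[OF that] in auto)
  then have z: "smom (\<lambda>x. N x ^ q - H x) a k = 0" if "norm a = 1" for a k
  proof -
    have "integrable sph (\<lambda>\<theta>. F \<theta> * (\<theta> \<bullet> a) ^ (2 * k))" if "continuous_on UNIV F" for F
      using sph_integral_bounded_linear(1)[OF one, of "\<lambda>\<theta>. F \<theta> * (\<theta> \<bullet> a) ^ (2 * k)"] that by (simp add: continuous_intros)
    from this[OF Nc] this[OF Hc] show ?thesis
      using \<open>\<And>k a. norm a = 1 \<Longrightarrow> smom (\<lambda>x. N x ^ q) a k = smom H a k\<close>[OF that, of k] by (simp add: smom_def left_diff_distrib)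
  qed
  have "N x ^ q - H x = 0"
  proof (rule vanishing_even_moments[where q = q])
    show "continuous_on UNIV (\<lambda>x. N x ^ q - H x)" by (intro continuous_intros Nc Hc N)
    show "N (- x) ^ q - H (- x) = N x ^ q - H x" for x using Nhom[of "-1" x] Hhom[of "-1" x] by simp
    show "N (r *\<^sub>R \<theta>) ^ q - H (r *\<^sub>R \<theta>) = r ^ q * (N \<theta> ^ q - H \<theta>)" if "r > 0" for r \<theta>
      using that by (simp add: Nhom Hhom right_diff_distrib)
  qed (use z in auto)
  then show ?thesis by (simp add: H_def)
qed

subsection \<open>Isometric embeddings and nonnegative densities\<close>

text \<open>\<open>g\<close> is measurable only for completed measures. This exchanges it for a
  Borel representative in measurability, integrability and integrals at once.\<close>

lemma completion_AE_cong:
  fixes f f' :: "'a \<Rightarrow> real"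
  assumes f': "f' \<in> borel_measurable M" and ae: "AE x in M. f x = f' x"
  shows "f \<in> borel_measurable (completion M)"
    and "(\<integral>x. f x \<partial>completion M) = (\<integral>x. f' x \<partial>M)"
    and "integrable (completion M) f \<longleftrightarrow> integrable M f'"
proof -
  obtain E where E: "{x \<in> space M. \<not> f x = f' x} \<subseteq> E" "E \<in> null_sets M"
    using ae unfolding eventually_ae_filter by blast
  show m: "f \<in> borel_measurable (completion M)"
  proof (rule measurableI)
    fix A :: "real set" assume A: "A \<in> sets borel"
    have "f -` A \<inter> space M = (f' -` A \<inter> space M - E) \<union> (f -` A \<inter> space M \<inter> E)" using E(1) by auto
    moreover have "f' -` A \<inter> space M - E \<in> sets (completion M)"
      using measurable_sets[OF f' A] E(2) by (intro sets_completionI_sets sets.Diff) auto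
    moreover have "f -` A \<inter> space M \<inter> E \<in> sets (completion M)" by (rule null_sets_completion[OF E(2)]) auto
    ultimately have "f -` A \<inter> space M \<in> sets (completion M)" by (metis sets.Un)
    then show "f -` A \<inter> space (completion M) \<in> sets (completion M)" by simp
  qed simp
  have m': "f' \<in> borel_measurable (completion M)" by (rule measurable_completion[OF f'])
  have ae': "AE x in completion M. f x = f' x" by (rule AE_completion[OF ae])
  show "(\<integral>x. f x \<partial>completion M) = (\<integral>x. f' x \<partial>M)"
    by (simp add: integral_cong_AE[OF m m' ae'] integral_completion[OF f'])
  show "integrable (completion M) f \<longleftrightarrow> integrable M f'"
    by (simp add: integrable_cong_AE[OF m m' ae'] integrable_completion[OF f'])
qed

lemma distr_laplacian_iter: "(distr_laplacian ^^ m) F \<phi> = F ((laplacian ^^ m) \<phi>)"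
proof (induction m arbitrary: \<phi>)
  case (Suc m)
  have "(distr_laplacian ^^ Suc m) F \<phi> = (distr_laplacian ^^ m) F (laplacian \<phi>)"
    by (simp add: distr_laplacian_def)
  then show ?case unfolding Suc.IH by (simp add: funpow_swap1)
qed simp

section \<open>Comparison of signs and necessity of nonnegativity\<close>

text \<open>The functional equation Gamma (z + 1) = z Gamma z at the half-integers z = -1/2, -3/2,
  ... flips the sign at every step, starting from Gamma (1/2) > 0.\<close>

lemma Gamma_half_sign: "(- 1) ^ j * Gamma (1 / 2 - real j) > 0"
proof (induction j)
  case (Suc j)
  let ?z = "1 / 2 - real (Suc j)"
  have "?z \<notin> \<int>\<^sub>\<le>\<^sub>0"
  proof
    assume "?z \<in> \<int>\<^sub>\<le>\<^sub>0"
    then have "?z + real (Suc j) \<in> \<int>" by (intro Ints_add nonpos_Ints_Int Ints_of_nat)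
    then obtain i where "1 / 2 = real_of_int i" by (auto elim: Ints_cases)
    then have "real_of_int (2 * i) = real_of_int 1" by simp
    then have "2 * i = 1" by (simp only: of_int_eq_iff)
    then show False by presburger
  qed
  then have "Gamma (?z + 1) = ?z * Gamma ?z" by (rule Gamma_plus1)
  then have G: "Gamma (1 / 2 - real j) = ?z * Gamma ?z" by simp
  have "(- 1) ^ j * (?z * c) = ((- 1) ^ Suc j * c) * (real (Suc j) - 1 / 2)" for c :: real by (simp add: algebra_simps)
  then have "((- 1) ^ Suc j * Gamma ?z) * (real (Suc j) - 1 / 2) > 0" using Suc unfolding G by (simp only:)
  moreover have "real (Suc j) - 1 / 2 > 0" by simp
  ultimately show ?case by (rule zero_less_mult_pos2)
qed (simp add: Gamma_one_half_real)

text \<open>With q = 2i + 1 and n = 2l one has m = l + i, while \<open>C_const\<close> has the sign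
  of (-1)^(i+1) and \<open>ridge_const\<close> that of (-1)^(l-1); the three signs multiply to
  1.\<close>

lemma const_sign:
  assumes n: "CARD('n::finite) > 1" "even CARD('n)" and q: "odd q" and m: "2 * m = CARD('n) + q - 1"
  shows "(- 1) ^ m / C_const (real q) * ridge_const TYPE('n) q > 0"
proof -
  obtain i where i: "q = 2 * i + 1" using q by (auto elim: oddE)
  obtain l where l: "CARD('n) = 2 * l" using n by (auto elim: evenE)
  have l0: "l \<ge> 1" using n l by simp
  have ml: "m = l + i" using m i l by simp
  have p: "(CARD('n) - 2) div 2 = l - 1" using l by simp
  have "(- 1) ^ (i + 1) * Gamma (- real q / 2) > 0"
  proof -
    have "- real q / 2 = 1 / 2 - real (i + 1)" by (simp add: i field_simps)
    then show ?thesis using Gamma_half_sign[of "i + 1"] by (simp only:)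
  qed
  moreover have "2 powr (real q + 1) * sqrt pi * Gamma ((real q + 1) / 2) > 0" by (intro mult_pos_pos Gamma_real_pos) auto
  ultimately have C: "(- 1) ^ (i + 1) * C_const (real q) > 0"
    unfolding C_const_def by (cases "even i") (auto simp: divide_pos_neg zero_less_divide_iff mult_less_0_iff zero_less_mult_iff divide_less_0_iff)
  have G: "gconst TYPE('n) > 0" by (rule gconst_pos[OF n(1)])
  have R: "(- 1) ^ (l - 1) * ridge_const TYPE('n) q > 0"
    using G by (simp add: ridge_const_def p mult.assoc[symmetric] power_mult_distrib[symmetric] del: mult_minus1)
  have s: "(- 1 :: real) ^ m = (- 1) ^ (i + 1) * (- 1) ^ (l - 1)"
    using l0 unfolding ml by (cases l) (simp_all add: power_add)
  have "(- 1) ^ m / C_const (real q) * ridge_const TYPE('n) q = ((- 1) ^ (i + 1) / C_const (real q)) * ((- 1) ^ (l - 1) * ridge_const TYPE('n) q)"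
    unfolding s by simp
  moreover have "(- 1) ^ (i + 1) / C_const (real q) > 0" using C unfolding zero_less_divide_iff zero_less_mult_iff .
  ultimately show ?thesis using mult_pos_pos[OF _ R] by (simp only:)
qed

text \<open>Almost everywhere linearity gives T x t = x . h t with one vector function h. Splitting
  h into length and direction represents \<open>N ^ q\<close> by the weight |h|^q at the directions
  \<open>v\<close>, and both representations have equal even moments because the factor in
  \<open>ridge_superposition\<close> is nonzero. The measure from the embedding need not be even, so
  it is symmetrised before it is compared with the Radon density, which is even.\<close>

lemma isometric_nonneg:
  fixes N g :: "real^'n \<Rightarrow> real"
  assumes n: "CARD('n) > 1" "even CARD('n)" and q: "odd q" and m: "2 * m = CARD('n) + q - 1"
    and N0: "\<And>x. N x \<ge> 0"
    and gm[measurable]: "g \<in> borel_measurable borel" and g: "integrable sph g"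
    and rep: "\<And>x. N x ^ q = (\<integral>\<xi>. \<bar>x \<bullet> \<xi>\<bar> ^ q * (ridge_const TYPE('n) q * radon g \<xi>) \<partial>sph)"
    and iso: "isometric_to_subspace_of_Lq (real q) N"
  shows "AE \<xi> in sph. ridge_const TYPE('n) q * radon g \<xi> \<ge> 0"
proof -
  let ?L = "lebesgue_on {0..1::real}" and ?b = "\<lambda>\<xi>. ridge_const TYPE('n) q * radon g \<xi>"
  have q0: "q > 0" using q by (cases q) auto
  have fL: "finite_measure ?L" by (rule finite_measure_lebesgue_on) simp
  have bi: "integrable sph ?b" using radon_props(2)[OF n(1) gm g] by simp
  have bm: "?b \<in> borel_measurable borel"
    using borel_measurable_integrable[OF bi] unfolding measurable_cong_sets[OF sets_sph refl] .
  obtain T :: "real^'n \<Rightarrow> real \<Rightarrow> real" where T: "\<And>x. T x \<in> Lq_functions (real q)"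
    and Tadd: "\<And>x y. AE t in ?L. T (x + y) t = T x t + T y t"
    and Tsc: "\<And>c x. AE t in ?L. T (c *\<^sub>R x) t = c * T x t"
    and TN: "\<And>x. Lq_norm (real q) (T x) = N x"
    using iso unfolding isometric_to_subspace_of_Lq_def by blast
  have pw: "\<bar>y\<bar> powr real q = \<bar>y\<bar> ^ q" for y :: real using q0 by (cases "y = 0") (simp_all add: powr_realpow)
  have Tm[measurable]: "T x \<in> borel_measurable ?L" and Ti: "integrable ?L (\<lambda>t. \<bar>T x t\<bar> ^ q)" for x
    using T[of x] by (simp_all add: Lq_functions_def pw)
  have TNq: "N x ^ q = (\<integral>t. \<bar>T x t\<bar> ^ q \<partial>?L)" for x
  proof -
    have "0 \<le> (\<integral>t. \<bar>T x t\<bar> ^ q \<partial>?L)" by (rule integral_nonneg_AE) auto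
    moreover have "N x = (\<integral>t. \<bar>T x t\<bar> ^ q \<partial>?L) powr (1 / real q)" using TN[of x] by (simp add: Lq_norm_def pw)
    ultimately show ?thesis using q0
      by (cases "(\<integral>t. \<bar>T x t\<bar> ^ q \<partial>?L) = 0") (simp_all add: powr_realpow[symmetric] powr_powr)
  qed
  define h where "h t = (\<chi> i. T (axis i 1) t)" for t
  have hm[measurable]: "h \<in> borel_measurable ?L"
  proof -
    have "h = (\<lambda>t. \<Sum>i\<in>UNIV. T (axis i 1) t *\<^sub>R axis i 1)"
      by (simp add: h_def fun_eq_iff vec_eq_iff axis_def if_distrib[of "\<lambda>u. _ * u"] sum.delta cong: if_cong)
    then show ?thesis by simp
  qed
  \<comment> \<open>The exceptional set may depend on \<open>x\<close>. That suffices, since the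
    relation is integrated for one \<open>x\<close> at a time.\<close>
  have Th: "AE t in ?L. T x t = x \<bullet> h t" for x
  proof -
    have "AE t in ?L. T (\<Sum>i\<in>I. x $ i *\<^sub>R axis i 1) t = (\<Sum>i\<in>I. x $ i * T (axis i 1) t)" if "finite I" for I
      using that
    proof (induction I rule: finite_induct)
      case empty
      show ?case using Tsc[of 0 0] by simp
    next
      case (insert i I)
      show ?case
        using Tadd[of "x $ i *\<^sub>R axis i 1" "\<Sum>i\<in>I. x $ i *\<^sub>R axis i 1"] Tsc[of "x $ i" "axis i 1"] insert.IH
        by eventually_elim (simp add: insert.hyps)
    qed
    from this[of UNIV] have "AE t in ?L. T (\<Sum>i\<in>UNIV. x $ i *\<^sub>R axis i 1) t = (\<Sum>i\<in>UNIV. x $ i * T (axis i 1) t)" by simp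
    moreover have "(\<Sum>i\<in>UNIV. x $ i *\<^sub>R axis i 1) = x"
      by (simp add: vec_eq_iff axis_def if_distrib[of "\<lambda>u. _ * u"] sum.delta cong: if_cong)
    ultimately show ?thesis by (simp add: inner_vec_def h_def)
  qed
  \<comment> \<open>Any unit vector will do as the direction where \<open>h\<close> vanishes: the
    weight \<open>b\<close> is 0 there because q > 0.\<close>
  define u where "u = (axis undefined 1 :: real^'n)"
  define v where "v t = (if h t = 0 then u else sgn (h t))" for t
  define b where "b t = norm (h t) ^ q" for t
  have vm[measurable]: "v \<in> borel_measurable ?L" unfolding v_def by measurable
  have v1: "norm (v t) = 1" for t by (simp add: v_def u_def norm_sgn)
  have bvm[measurable]: "b \<in> borel_measurable ?L" unfolding b_def by measurable
  have hv: "\<bar>x \<bullet> h t\<bar> ^ q = \<bar>x \<bullet> v t\<bar> ^ q * b t" for x t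
  proof (cases "h t = 0")
    case False
    then have "h t = norm (h t) *\<^sub>R v t" by (simp add: v_def sgn_div_norm)
    then have "\<bar>x \<bullet> h t\<bar> = \<bar>x \<bullet> v t\<bar> * norm (h t)" by (metis abs_mult abs_norm_cancel inner_scaleR_right mult.commute)
    then show ?thesis by (simp add: b_def power_mult_distrib)
  qed (use q0 in \<open>simp add: b_def\<close>)
  have b_int: "integrable ?L b"
  proof (rule Bochner_Integration.integrable_bound)
    show "integrable ?L (\<lambda>t. real CARD('n) ^ q * (\<Sum>i\<in>UNIV. \<bar>T (axis i 1 :: real^'n) t\<bar> ^ q))" using Ti by simp
    show "AE t in ?L. norm (b t) \<le> norm (real CARD('n) ^ q * (\<Sum>i\<in>UNIV. \<bar>T (axis i 1 :: real^'n) t\<bar> ^ q))"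
    proof (rule AE_I2)
      fix t
      \<comment> \<open>The largest coordinate controls the norm, so the weight is bounded by a
        fixed multiple of the integrable sum of the |T (axis i 1) t|^q.\<close>
      obtain i where i: "\<And>j. \<bar>h t $ j\<bar> \<le> \<bar>h t $ i\<bar>"
        using Max_in[of "range (\<lambda>j. \<bar>h t $ j\<bar>)"] Max_ge[of "range (\<lambda>j. \<bar>h t $ j\<bar>)"] by (metis (mono_tags, lifting) UNIV_not_empty empty_is_image finite finite_imageI image_iff rangeI)
      have "norm (h t) \<le> (\<Sum>j\<in>UNIV. \<bar>h t $ j\<bar>)" by (rule norm_le_l1_cart)
      also have "\<dots> \<le> (\<Sum>j\<in>(UNIV::'n set). \<bar>h t $ i\<bar>)" by (rule sum_mono) (rule i)
      also have "\<dots> = real CARD('n) * \<bar>h t $ i\<bar>" by simp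
      finally have "norm (h t) ^ q \<le> (real CARD('n) * \<bar>h t $ i\<bar>) ^ q" by (intro power_mono) auto
      also have "\<dots> = real CARD('n) ^ q * \<bar>T (axis i 1) t\<bar> ^ q" by (simp add: power_mult_distrib h_def)
      also have "\<dots> \<le> real CARD('n) ^ q * (\<Sum>i\<in>UNIV. \<bar>T (axis i 1 :: real^'n) t\<bar> ^ q)"
        by (intro mult_left_mono member_le_sum) auto
      finally show "norm (b t) \<le> norm (real CARD('n) ^ q * (\<Sum>i\<in>UNIV. \<bar>T (axis i 1 :: real^'n) t\<bar> ^ q))"
        by (simp add: b_def sum_nonneg)
    qed
  qed simp
  have b0: "b t \<ge> 0" for t by (simp add: b_def)
  have repL: "N x ^ q = (\<integral>t. \<bar>x \<bullet> v t\<bar> ^ q * b t \<partial>?L)" for x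
    unfolding TNq by (rule integral_cong_AE, simp, simp, use Th[of x] in eventually_elim) (simp add: hv)
  have moments: "(\<integral>t. b t * (v t \<bullet> a) ^ (2 * k) \<partial>?L) = (\<integral>\<xi>. ?b \<xi> * (\<xi> \<bullet> a) ^ (2 * k) \<partial>sph)" if a: "norm a = 1" for a k
  proof -
    have e: "2 * k + CARD('n) - 2 = 2 * (k + (CARD('n) - 2) div 2)" using n by (auto elim!: evenE)
    have nz: "gconst TYPE('n) * 2 * fact q * poly (herm (2 * k + CARD('n) - 2)) 0 \<noteq> 0"
      unfolding e mult_eq_0_iff using gconst_pos[OF n(1)] herm_zero_nonzero[of "k + (CARD('n) - 2) div 2"] fact_nonzero[of q, where 'a = real] by (auto simp del: mult_eq_0_iff distrib_left_numeral)
    have "gconst TYPE('n) * 2 * fact q * poly (herm (2 * k + CARD('n) - 2)) 0 * (\<integral>t. b t * (v t \<bullet> a) ^ (2 * k) \<partial>?L)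
        = gconst TYPE('n) * 2 * fact q * poly (herm (2 * k + CARD('n) - 2)) 0 * (\<integral>\<xi>. ?b \<xi> * (\<xi> \<bullet> a) ^ (2 * k) \<partial>sph)"
      using ridge_superposition[OF n q m fL vm b_int AE_I2[OF v1] a, of k]
        ridge_superposition[OF n q m finite_sph measurable_ident_sets[OF sets_sph] bi AE_sph_norm a, of k]
      unfolding repL[symmetric] rep[symmetric] by (rule trans[OF sym])
    then show ?thesis by (rule mult_left_cancel[OF nz, THEN iffD1])
  qed
  have bvi: "integrable ?L (\<lambda>t. b t * f (v t))" if f: "continuous_on UNIV f" for f :: "real^'n \<Rightarrow> real"
  proof -
    have [measurable]: "f \<in> borel_measurable borel" by (rule borel_measurable_continuous_onI[OF f])
    have "bounded (f ` sphere 0 1)" by (intro compact_imp_bounded compact_continuous_image continuous_on_subset[OF f]) auto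
    then obtain e where e: "\<forall>x\<in>sphere 0 1. \<bar>f x\<bar> \<le> e" by (auto simp: bounded_iff)
    show ?thesis
    proof (rule Bochner_Integration.integrable_bound[OF integrable_mult_left[OF b_int, of e]])
      show "AE t in ?L. norm (b t * f (v t)) \<le> norm (b t * e)"
        using e v1 b0 by (intro AE_I2) (simp add: abs_mult, intro mult_left_mono order_trans[OF _ abs_ge_self], auto)
    qed simp
  qed
  have bd: "\<bar>\<integral>t. b t * f (v t) \<partial>?L\<bar> \<le> (\<integral>t. b t \<partial>?L) * e" if f: "continuous_on UNIV f" and fe: "\<And>x. norm x = 1 \<Longrightarrow> \<bar>f x\<bar> \<le> e" for f :: "real^'n \<Rightarrow> real" and e
  proof -
    have "\<bar>\<integral>t. b t * f (v t) \<partial>?L\<bar> \<le> (\<integral>t. \<bar>b t * f (v t)\<bar> \<partial>?L)" by (rule integral_abs_bound)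
    also have "\<dots> \<le> (\<integral>t. b t * e \<partial>?L)"
      by (rule integral_mono[OF integrable_abs[OF bvi[OF f]]])
        (use b_int b0 fe v1 in \<open>auto simp: abs_mult intro!: mult_left_mono\<close>)
    finally show ?thesis by simp
  qed
  have cm: "continuous_on UNIV (\<lambda>x. f (- x))" if "continuous_on UNIV f" for f :: "real^'n \<Rightarrow> real"
    by (rule continuous_on_compose2[OF that]) (auto intro!: continuous_intros)
  note L = sph_integral_bounded_linear[OF bi]
  let ?P = "\<lambda>f. \<integral>t. b t * f (v t) \<partial>?L"
  let ?S = "\<lambda>f. \<integral>\<xi>. ?b \<xi> * f \<xi> \<partial>sph"
  have Padd: "?P (\<lambda>x. f x + k x) = ?P f + ?P k" if "continuous_on UNIV f" "continuous_on UNIV k" for f k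
    unfolding distrib_left by (rule Bochner_Integration.integral_add[OF bvi[OF that(1)] bvi[OF that(2)]])
  have Sadd: "?S (\<lambda>x. f x + k x) = ?S f + ?S k" if "continuous_on UNIV f" "continuous_on UNIV k" for f k
    unfolding distrib_left by (rule Bochner_Integration.integral_add[OF L(1)[OF that(1)] L(1)[OF that(2)]])
  have Pscale: "?P (\<lambda>x. c * f x) = c * ?P f" for c f by (simp add: mult.left_commute)
  have Sscale: "?S (\<lambda>x. c * f x) = c * ?S f" for c f
    by (subst integral_mult_right_zero[symmetric]) (simp only: mult_ac)
  have Sev: "?S (\<lambda>x. f (- x)) = ?S f" if f: "continuous_on UNIV f" for f
  proof -
    have fm[measurable]: "f \<in> borel_measurable borel" by (rule borel_measurable_continuous_onI[OF f])
    have "?S f = (\<integral>\<xi>. ?b (- \<xi>) * f (- \<xi>) \<partial>sph)"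
      using sph_reflect[of "\<lambda>\<xi>. ?b \<xi> * f \<xi>"] bm by simp
    also have "\<dots> = ?S (\<lambda>x. f (- x))"
    proof (rule integral_cong_AE)
      show "AE \<xi> in sph. ?b (- \<xi>) * f (- \<xi>) = ?b \<xi> * f (- \<xi>)"
        using AE_sph_norm by eventually_elim (simp add: radon_minus)
    qed (use bm in \<open>auto intro!: borel_measurable_times measurable_compose[OF _ bm] measurable_compose[OF _ fm]\<close>)
    finally show ?thesis ..
  qed
  \<comment> \<open>The functional takes the average of \<open>f\<close> and its reflection under
    \<open>?P\<close>, which makes it even; \<open>?S\<close> is even already by
    \<open>Sev\<close>.\<close>
  have eqPS: "1 / 2 * (?P f + ?P (\<lambda>x. f (- x))) - ?S f = 0" if f: "continuous_on UNIV f" for f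
  proof (rule even_moments_determine[where \<Lambda> = "\<lambda>f. 1 / 2 * (?P f + ?P (\<lambda>x. f (- x))) - ?S f" and C = "(\<integral>t. b t \<partial>?L) + (\<integral>\<xi>. \<bar>?b \<xi>\<bar> \<partial>sph)"])
    fix f k :: "real^'n \<Rightarrow> real" assume fk: "continuous_on UNIV f" "continuous_on UNIV k"
    show "1 / 2 * (?P (\<lambda>x. f x + k x) + ?P (\<lambda>x. f (- x) + k (- x))) - ?S (\<lambda>x. f x + k x)
      = 1 / 2 * (?P f + ?P (\<lambda>x. f (- x))) - ?S f + (1 / 2 * (?P k + ?P (\<lambda>x. k (- x))) - ?S k)"
      unfolding Padd[OF fk] Sadd[OF fk] Padd[OF cm[OF fk(1)] cm[OF fk(2)]] by (simp add: algebra_simps)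
  next
    fix f :: "real^'n \<Rightarrow> real" and c :: real
    show "1 / 2 * (?P (\<lambda>x. c * f x) + ?P (\<lambda>x. c * f (- x))) - ?S (\<lambda>x. c * f x) = c * (1 / 2 * (?P f + ?P (\<lambda>x. f (- x))) - ?S f)"
      unfolding Pscale Sscale by (simp add: algebra_simps)
  next
    fix f :: "real^'n \<Rightarrow> real" and e :: real assume f: "continuous_on UNIV f" and fe: "\<And>x. norm x = 1 \<Longrightarrow> \<bar>f x\<bar> \<le> e"
    have half: "\<bar>x\<bar> \<le> u \<Longrightarrow> \<bar>y\<bar> \<le> u \<Longrightarrow> \<bar>z\<bar> \<le> w \<Longrightarrow> \<bar>1 / 2 * (x + y) - z\<bar> \<le> u + w" for x y z u w :: real
      unfolding abs_le_iff by argo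
    have "\<bar>?P f\<bar> \<le> (\<integral>t. b t \<partial>?L) * e" "\<bar>?P (\<lambda>x. f (- x))\<bar> \<le> (\<integral>t. b t \<partial>?L) * e" "\<bar>?S f\<bar> \<le> (\<integral>\<xi>. \<bar>?b \<xi>\<bar> \<partial>sph) * e"
      using bd[OF f fe] bd[OF cm[OF f], of e] fe L(2)[OF f fe] by auto
    then show "\<bar>1 / 2 * (?P f + ?P (\<lambda>x. f (- x))) - ?S f\<bar> \<le> ((\<integral>t. b t \<partial>?L) + (\<integral>\<xi>. \<bar>?b \<xi>\<bar> \<partial>sph)) * e"
      unfolding distrib_right by (rule half)
  next
    fix f :: "real^'n \<Rightarrow> real" assume f: "continuous_on UNIV f"
    show "1 / 2 * (?P (\<lambda>x. f (- x)) + ?P (\<lambda>x. f (- (- x)))) - ?S (\<lambda>x. f (- x)) = 1 / 2 * (?P f + ?P (\<lambda>x. f (- x))) - ?S f"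
      unfolding Sev[OF f] by (simp add: add.commute)
  next
    fix a :: "real^'n" and k assume a: "norm a = 1"
    show "1 / 2 * (?P (\<lambda>x. (x \<bullet> a) ^ (2 * k)) + ?P (\<lambda>x. (- x \<bullet> a) ^ (2 * k))) - ?S (\<lambda>x. (x \<bullet> a) ^ (2 * k)) = 0"
      using moments[OF a, of k] by simp
  qed (rule f)
  show ?thesis
  proof (rule AE_nonneg_by_continuous[OF bm bi])
    fix f :: "real^'n \<Rightarrow> real" assume f: "continuous_on UNIV f" "\<And>x. 0 \<le> f x"
    have "?P f \<ge> 0" "?P (\<lambda>x. f (- x)) \<ge> 0" by (intro integral_nonneg_AE AE_I2 mult_nonneg_nonneg b0 f)+
    then have "1 / 2 * (?P f + ?P (\<lambda>x. f (- x))) \<ge> 0" by simp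
    then show "?S f \<ge> 0" unfolding eqPS[OF f(1), unfolded right_minus_eq] .
  qed
qed

theorem mainTheorem6:
  fixes N :: "real^'n \<Rightarrow> real" and g :: "real^'n \<Rightarrow> real" and q m :: nat
  assumes "CARD('n) > 1" and "even CARD('n)" and "odd q"
    and m: "m = (CARD('n) + q - 1) div 2"
    and "continuous_quasi_norm N"
    and "is_function_on ((distr_laplacian ^^ m) (regular_distribution (\<lambda>x. N x ^ q))) (UNIV - {0}) g"
    \<comment> \<open>the distribution is homogeneous of degree \<open>1 - n\<close>; \<open>g\<close> is a homogeneous representative,
      which is what gives its restriction to the sphere a meaning\<close>
    and "\<forall>t x. t > 0 \<and> x \<noteq> 0 \<longrightarrow> g (t *\<^sub>R x) = t powr (1 - real CARD('n)) * g x"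
    and "integrable sphere_measure g"
  shows "(isometric_to_subspace_of_Lq (real q) N \<longleftrightarrow>
            (AE \<xi> in sphere_measure.
               0 \<le> (- 1) ^ m / C_const (real q) * (\<integral>\<theta>. g \<theta> \<partial>great_subsphere_measure \<xi>)))
       \<and> ((AE \<xi> in sphere_measure. 0 \<le> (- 1) ^ m / C_const (real q) * g \<xi>)
            \<longrightarrow> isometric_to_subspace_of_Lq (real q) N)"
proof -
  note n = assms(1,2) and q = assms(3)
  have m2: "2 * m = CARD('n) + q - 1" using assms(1-4) by (auto elim!: evenE oddE)
  have q0: "q > 0" using q by (cases q) auto
  let ?c = "ridge_const TYPE('n) q" and ?s = "(- 1) ^ m / C_const (real q)"
  have sc: "?s * ?c > 0" by (rule const_sign[OF n q m2])
  have N: "continuous_on UNIV N" "\<And>x. 0 \<le> N x" "\<And>x. N x = 0 \<longleftrightarrow> x = 0" "\<And>c x. N (c *\<^sub>R x) = \<bar>c\<bar> * N x"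
    using assms(5) by (auto simp: continuous_quasi_norm_def)
  have "g \<in> borel_measurable (completion sph)"
    using borel_measurable_integrable[OF assms(8)] by (simp only: sphere_measure_eq)
  then obtain g' where g's: "g' \<in> borel_measurable sph" and gg': "AE \<theta> in sph. g \<theta> = g' \<theta>"
    using completion_ex_borel_measurable_real by blast
  have g'm[measurable]: "g' \<in> borel_measurable borel"
    using g's unfolding measurable_cong_sets[OF sets_sph refl] .
  \<comment> \<open>A Borel function extending the sphere representative homogeneously. At the
    origin division by 0 gives the value 0, so the homogeneity \<open>g0hom\<close> holds for every
    vector.\<close>
  define g0 where "g0 x = g' (sgn x) / norm x ^ (CARD('n) - 1)" for x
  have g0m[measurable]: "g0 \<in> borel_measurable borel" unfolding g0_def by measurable
  have g0_sph: "g0 \<theta> = g' \<theta>" if "norm \<theta> = 1" for \<theta> using that by (simp add: g0_def sgn_div_norm)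
  have ae: "AE \<theta> in sph. g \<theta> = g0 \<theta>" using gg' AE_sph_norm by eventually_elim (simp add: g0_sph)
  have g0i: "integrable sph g0" using completion_AE_cong(3)[OF _ ae] assms(8) by (simp add: sphere_measure_eq)
  have g0hom: "g0 (r *\<^sub>R \<theta>) = g0 \<theta> / r ^ (CARD('n) - 1)" if "r > 0" for r \<theta>
    using that by (simp add: g0_def sgn_scaleR power_mult_distrib)
  obtain E where E: "{\<theta>. g \<theta> \<noteq> g0 \<theta>} \<subseteq> E" and En: "E \<in> null_sets sph"
    using ae unfolding eventually_ae_filter by auto
  have Em[measurable]: "E \<in> sets borel" and E0: "emeasure sph E = 0" using En by (auto simp: null_sets_def)
  \<comment> \<open>The exceptional set on the sphere sweeps out a cone of Lebesgue measure zero;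
    off it, both functions are determined along rays by the same degree 1 - n.\<close>
  have aeL: "AE x in lborel. g x = g0 x"
    using AE_lborel_sgn[OF Em AE_not_in[OF En]] AE_lborel_singleton[of 0]
  proof eventually_elim
    fix x assume x: "sgn x \<notin> E" "x \<noteq> 0"
    have "g x = g (norm x *\<^sub>R sgn x)" using x by (simp add: sgn_div_norm)
    also have "\<dots> = norm x powr (1 - real CARD('n)) * g (sgn x)" using assms(7) x by (simp add: sgn_zero_iff)
    also have "g (sgn x) = g0 (sgn x)" using E x(1) by blast
    also have "\<dots> = g' (sgn x)" using x(2) by (intro g0_sph) (simp add: norm_sgn)
    also have "norm x powr (1 - real CARD('n)) = 1 / norm x ^ (CARD('n) - 1)"
    proof -
      have "1 - real CARD('n) = - real (CARD('n) - 1)" using n(1) by simp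
      moreover have "norm x powr real (CARD('n) - 1) = norm x ^ (CARD('n) - 1)" using x by (intro powr_realpow) simp
      ultimately show ?thesis by (simp only: powr_minus divide_inverse mult_1)
    qed
    finally show "g x = g0 x" by (simp add: g0_def)
  qed
  have dist: "(\<integral>x. N x ^ q * (laplacian ^^ m) (\<lambda>x. bumps 0 (x \<bullet> x) * (x \<bullet> a) ^ (2 * k)) x \<partial>lborel)
       = (\<integral>x. g0 x * (bumps 0 (x \<bullet> x) * (x \<bullet> a) ^ (2 * k)) \<partial>lborel)" for a k
  proof -
    let ?\<phi> = "\<lambda>x :: real^'n. bumps 0 (x \<bullet> x) * (x \<bullet> a) ^ (2 * k)"
    have sm: "sm ?\<phi>" by (intro sm.mult sm.radial sm_power sm.inner bumps_deriv_seq)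
    have smm: "f \<in> borel_measurable borel" if "sm f" for f :: "real^'n \<Rightarrow> real"
      using sm_C_k[OF that, of 0] by (simp add: borel_measurable_continuous_onI)
    have [measurable]: "?\<phi> \<in> borel_measurable borel" "(laplacian ^^ m) ?\<phi> \<in> borel_measurable borel"
      by (intro smm sm sm_laplacian_iter)+
    have [measurable]: "(\<lambda>x. N x ^ q) \<in> borel_measurable borel"
      by (intro borel_measurable_continuous_onI continuous_intros N)
    have "(distr_laplacian ^^ m) (regular_distribution (\<lambda>x. N x ^ q)) ?\<phi> = regular_distribution g ?\<phi>"
      using assms(6) bump_test_function[of a "2 * k"] unfolding is_function_on_def by blast
    then have "(\<integral>x. N x ^ q * (laplacian ^^ m) ?\<phi> x \<partial>lebesgue) = (\<integral>x. g x * ?\<phi> x \<partial>lebesgue)"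
      unfolding distr_laplacian_iter regular_distribution_def .
    also have "\<dots> = (\<integral>x. g0 x * ?\<phi> x \<partial>lborel)"
    proof (rule completion_AE_cong(2))
      show "AE x in lborel. g x * ?\<phi> x = g0 x * ?\<phi> x" using aeL by eventually_elim simp
    qed measurable
    also have "(\<integral>x. N x ^ q * (laplacian ^^ m) ?\<phi> x \<partial>lebesgue) = (\<integral>x. N x ^ q * (laplacian ^^ m) ?\<phi> x \<partial>lborel)"
      by (rule integral_completion) measurable
    finally show ?thesis .
  qed
  have rep: "N x ^ q = (\<integral>\<xi>. \<bar>x \<bullet> \<xi>\<bar> ^ q * (?c * radon g0 \<xi>) \<partial>sph)" for x
    by (rule ridge_representation[OF n q m2 N(1,4) g0m g0i g0hom dist])
  have ri: "integrable sph (\<lambda>\<xi>. ?c * radon g0 \<xi>)" using radon_props(2)[OF n(1) g0m g0i] by simp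
  have suff: "isometric_to_subspace_of_Lq (real q) N" if "AE \<xi> in sph. 0 \<le> ?c * radon g0 \<xi>"
    by (rule superposition_embeds[OF q0 N(2,3) _ ri that rep])
      (rule borel_measurable_integrable[OF ri, unfolded measurable_cong_sets[OF sets_sph refl]])
  have iff: "isometric_to_subspace_of_Lq (real q) N \<longleftrightarrow> (AE \<xi> in sph. 0 \<le> ?c * radon g0 \<xi>)"
    using suff isometric_nonneg[OF n q m2 N(2) g0m g0i rep] by blast
  have sign: "0 \<le> ?s * y \<longleftrightarrow> 0 \<le> ?c * y" for y :: real
    using sc unfolding zero_less_mult_iff zero_le_mult_iff by argo
  \<comment> \<open>Almost every great subsphere misses the exceptional set \<open>E\<close> up to a
    null set, so the integral of \<open>g\<close> in the completed measure is the Radon transform of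
    \<open>g0\<close>.\<close>
  have R: "AE \<xi> in sph. (\<integral>\<theta>. g \<theta> \<partial>great_subsphere_measure \<xi>) = radon g0 \<xi>"
    using radon_null[OF n(1) Em E0]
  proof eventually_elim
    fix \<xi> :: "real^'n" assume "emeasure (subsph \<xi>) E = 0"
    then have "AE \<theta> in subsph \<xi>. \<theta> \<notin> E" by (intro AE_not_in) (simp add: null_sets_def)
    then have "AE \<theta> in subsph \<xi>. g \<theta> = g0 \<theta>" by eventually_elim (use E in auto)
    then show "(\<integral>\<theta>. g \<theta> \<partial>great_subsphere_measure \<xi>) = radon g0 \<xi>"
      unfolding great_subsphere_measure_eq radon_def by (intro completion_AE_cong(2)) simp_all
  qed
  have A: "(AE \<xi> in sphere_measure. 0 \<le> ?s * (\<integral>\<theta>. g \<theta> \<partial>great_subsphere_measure \<xi>)) \<longleftrightarrow> (AE \<xi> in sph. 0 \<le> ?c * radon g0 \<xi>)"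
    unfolding sphere_measure_eq AE_completion_iff sign using R by (intro eventually_subst) (auto elim: eventually_mono)
  have "isometric_to_subspace_of_Lq (real q) N" if pos: "AE \<xi> in sphere_measure. 0 \<le> ?s * g \<xi>"
  proof (rule suff)
    \<comment> \<open>The set where \<open>?c * g0\<close> is negative is null on the sphere, hence
      null on almost every great subsphere, so the Radon transform inherits the sign and the
      criterion of (i) applies.\<close>
    have "AE \<xi> in sph. \<xi> \<notin> {\<xi>. \<not> 0 \<le> ?c * g0 \<xi>}"
      using pos ae unfolding sphere_measure_eq AE_completion_iff sign by eventually_elim simp
    then have "emeasure sph {\<xi>. \<not> 0 \<le> ?c * g0 \<xi>} = 0"
      by (subst (asm) AE_iff_measurable[OF _ refl]) simp_all
    then have "AE \<xi> in sph. emeasure (subsph \<xi>) {\<xi>. \<not> 0 \<le> ?c * g0 \<xi>} = 0"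
      by (intro radon_null[OF n(1)]) simp_all
    then show "AE \<xi> in sph. 0 \<le> ?c * radon g0 \<xi>"
    proof eventually_elim
      fix \<xi> :: "real^'n" assume "emeasure (subsph \<xi>) {\<xi>. \<not> 0 \<le> ?c * g0 \<xi>} = 0"
      then have "AE \<theta> in subsph \<xi>. \<theta> \<notin> {\<xi>. \<not> 0 \<le> ?c * g0 \<xi>}" by (intro AE_not_in) (simp add: null_sets_def)
      then have "(\<integral>\<theta>. ?c * g0 \<theta> \<partial>subsph \<xi>) \<ge> 0" by (intro integral_nonneg_AE) simp
      then show "0 \<le> ?c * radon g0 \<xi>" by (simp add: radon_def)
    qed
  qed
  then show ?thesis using iff A by blast
qed


end
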